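(* Let $v:\mathbb{R}\times\Omega\to\mathbb{R}$ be a stationary ergodic random field with $v(\cdot,\omega)\in C^\infty(\mathbb{R})$ for each $\omega$, and with $v,v'\in L^\infty(\mathbb{R}\times\Omega)$ (where $v'=\partial_y v$). Consider the two-dimensional random shear flow $V(x,y,\omega)=(v(y,\omega),0)$ and the associated G-equation with strain term and Markstein constant $c$. Then: (1) The G-equation with strain term can be homogenized: for every $c\ge 0$ there is a deterministic continuous function $\overline H(\cdot,c):\mathbb{R}^2\to\mathbb{R}$ (the effective Hamiltonian) such that for almost every $\omega\in\Omega$ and every uniformly continuous $G_0:\mathbb{R}^2\to\mathbb{R}$, the solutions $G^\epsilon$ of $$G^\epsilon_t+V\left(\tfrac{z}{\epsilon},\omega\right)\cdot DG^\epsilon+|DG^\epsilon|+c\,\frac{DG^\epsilon}{|DG^\epsilon|}\cdot S\left(\tfrac{z}{\epsilon},\omega\right)\cdot DG^\epsilon=0 \ \text{ in } \mathbb{R}^2\times(0,\infty),\qquad G^\epsilon(\cdot,0)=G_0,$$ converge, as $\epsilon\to0$, locally uniformly to the solution $\overline G$ of $\overline G_t+\overline H(D\overline G,c)=0$ in $\mathbb{R}^2\times(0,\infty)$, $\overline G(\cdot,0)=G_0$. Write $\overline H(p)=\overline H(m,n)$ for the effective Hamiltonian with $c=0$ (no strain), and $\overline H(p,c)=\overline H(m,n,c)$ for the one with constant $c$, where $p=(m,n)$. (2) For every unit vector $p=(m,n)\in\mathbb{R}^2$ and every $c>0$, $$\overline H(p)\ \ge\ \overline H(p,c)\ \ge\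 |m|+\sup_{(y,\omega)\in\mathbb{R}\times\Omega} m\,v(y,\omega).$$ (3) Let $p=(m,n)$ be a unit vector and $c>0$. If $\overline H(p)>|m|+\sup_{(y,\omega)\in\mathbb{R}\times\Omega}m\,v(y,\omega)$ and $\mathbf{E}[v]=0$, then $\overline H(p)=\overline H(p,c)$ if and only if $mv\equiv0$.
   Context: Points of $\mathbb{R}^2$ are written $z=(x,y)$. $(\Omega,\mathcal F,\mathbf P)$ is a probability space with expectation $\mathbf E$, and $\{\tau_a\}_{a\in\mathbb{R}}$ is a group of $\mathcal F$-measurable, measure-preserving transformations $\tau_a:\Omega\to\Omega$ ($\tau_{a+b}=\tau_a\circ\tau_b$, $\mathbf P[\tau_a(A)]=\mathbf P[A]$) which is ergodic: if $A\in\mathcal F$ and $\tau_a(A)=A$ for all $a\in\mathbb{R}$, then $\mathbf P[A]\in\{0,1\}$. The field $v$ is stationary: $v(y,\tau_a\omega)=v(y+a,\omega)$. By stationarity $\mathbf E[v]:=\mathbf E[v(y,\cdot)]$ does not depend on $y$. $L^\infty$, suprema over $\mathbb{R}\times\Omega$ and the identity $mv\equiv 0$ are understood up to a $\mathbf P$-null set of $\omega$. The strain tensor is $S=\frac{DV+(DV)^\top}{2}$, where $DV$ is the Jacobian matrix of $V$. The laminar speed is normalized to $s_L=1$. For $V=(v(y,\omega),0)$ the Hamiltonian of the G-equation with strain at $(p,z)$, with $p=(m,n)$, is $$|p|+v(y,\omega)\,m+c\,\frac{m\,n\,v'(y,\omega)}{|p|},$$ the last term being set to $0$ at $p=0$.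 All solutions of PDEs are viscosity solutions. The effective Hamiltonian is uniquely determined by the homogenization property (take linear initial data $G_0(z)=p\cdot z$). *)

theory Defs
  imports "HOL-Probability.Probability"
begin

section \<open>Stationary ergodic random fields on the line\<close>

definition measure_preserving_group :: "'w measure \<Rightarrow> (real \<Rightarrow> 'w \<Rightarrow> 'w) \<Rightarrow> bool" where
  "measure_preserving_group M \<tau> \<longleftrightarrow>
     (\<forall>a. \<tau> a \<in> measurable M M) \<and>
     (\<forall>\<omega>\<in>space M. \<tau> 0 \<omega> = \<omega>) \<and>
     (\<forall>a b. \<forall>\<omega>\<in>space M. \<tau> (a + b) \<omega> = \<tau> a (\<tau> b \<omega>)) \<and>
     (\<forall>a. \<forall>A\<in>sets M. measure M (\<tau> a ` A) = measure M A)"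

definition ergodic_group :: "'w measure \<Rightarrow> (real \<Rightarrow> 'w \<Rightarrow> 'w) \<Rightarrow> bool" where
  "ergodic_group M \<tau> \<longleftrightarrow>
     measure_preserving_group M \<tau> \<and>
     (\<forall>A\<in>sets M. (\<forall>a. \<tau> a ` A = A) \<longrightarrow> measure M A \<in> {0, 1})"

definition stationary_field ::
    "'w measure \<Rightarrow> (real \<Rightarrow> 'w \<Rightarrow> 'w) \<Rightarrow> (real \<Rightarrow> 'w \<Rightarrow> real) \<Rightarrow> bool" where
  "stationary_field M \<tau> v \<longleftrightarrow>
     (\<forall>y. v y \<in> borel_measurable M) \<and>
     (\<forall>a y. \<forall>\<omega>\<in>space M. v y (\<tau> a \<omega>) = v (y + a) \<omega>)"

definition C_infinity :: "(real \<Rightarrow> real) \<Rightarrow> bool" where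
  "C_infinity f \<longleftrightarrow> (\<forall>n x. ((deriv ^^ n) f) field_differentiable (at x))"

(* Exceptional sets are null sets of \<omega> alone; every y is kept. *)
definition Linfty_field :: "'w measure \<Rightarrow> (real \<Rightarrow> 'w \<Rightarrow> real) \<Rightarrow> bool" where
  "Linfty_field M u \<longleftrightarrow> (\<exists>C. AE \<omega> in M. \<forall>y. \<bar>u y \<omega>\<bar> \<le> C)"

(* Extended-real valued because esssup requires a complete order. The library's esssup is
   the top element for non-measurable functions; lemma SUP_field_measurable excludes this
   for measurable fields with continuous paths. *)
definition sup_field :: "'w measure \<Rightarrow> (real \<Rightarrow> 'w \<Rightarrow> real) \<Rightarrow> ereal" where
  "sup_field M u = esssup M (\<lambda>\<omega>. SUP y. ereal (u y \<omega>))"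

lemma SUP_field_measurable:
  fixes u :: "real \<Rightarrow> 'w \<Rightarrow> real"
  assumes "\<And>y. u y \<in> borel_measurable M"
    and "\<And>\<omega>. \<omega> \<in> space M \<Longrightarrow> continuous_on UNIV (\<lambda>y. u y \<omega>)"
  shows "(\<lambda>\<omega>. SUP y. ereal (u y \<omega>)) \<in> borel_measurable M"
proof -
  have "(SUP y. ereal (u y \<omega>)) = (SUP y\<in>\<rat>. ereal (u y \<omega>))" if w: "\<omega> \<in> space M" for \<omega>
  proof (rule antisym)
    show "(SUP y. ereal (u y \<omega>)) \<le> (SUP y\<in>\<rat>. ereal (u y \<omega>))"
    proof (rule SUP_least)
      fix y
      let ?s = "SUP y\<in>\<rat>. ereal (u y \<omega>)"
      have "continuous_on UNIV (\<lambda>y. ereal (u y \<omega>))"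
        using assms(2)[OF w] by (intro continuous_on_ereal)
      then have "closed ((\<lambda>y. ereal (u y \<omega>)) -` {..?s})"
        by (intro closed_vimage) auto
      moreover have "\<rat> \<subseteq> (\<lambda>y. ereal (u y \<omega>)) -` {..?s}"
        by (auto intro: SUP_upper)
      ultimately have "closure \<rat> \<subseteq> (\<lambda>y. ereal (u y \<omega>)) -` {..?s}"
        by (rule closure_minimal[rotated])
      then show "ereal (u y \<omega>) \<le> ?s"
        using Rats_closure_real by auto
    qed
  qed (auto intro: SUP_subset_mono)
  moreover have "(\<lambda>\<omega>. SUP y\<in>\<rat>. ereal (u y \<omega>)) \<in> borel_measurable M"
    using assms(1) by (intro borel_measurable_SUP countable_rat) auto
  ultimately show ?thesis
    by (simp cong: measurable_cong)
qed

section \<open>Viscosity solutions of the Cauchy problem\<close>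

text \<open>The equation is \<open>u\<^sub>t + H(z, Du) = 0\<close> in the open half space \<open>t > 0\<close>; functions of space
  and time are defined on pairs \<open>(z, t)\<close> and only their values for \<open>t \<ge> 0\<close> matter.\<close>

definition C1_test_function ::
    "('a::euclidean_space \<times> real \<Rightarrow> real) \<Rightarrow> ('a \<times> real \<Rightarrow> 'a) \<Rightarrow> ('a \<times> real \<Rightarrow> real) \<Rightarrow> bool" where
  "C1_test_function \<phi> D\<phi> \<phi>t \<longleftrightarrow>
     continuous_on (UNIV \<times> {0<..}) D\<phi> \<and> continuous_on (UNIV \<times> {0<..}) \<phi>t \<and>
     (\<forall>q\<in>UNIV \<times> {0<..}. (\<phi> has_derivative (\<lambda>(h, s). D\<phi> q \<bullet> h + \<phi>t q * s)) (at q))"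

definition viscosity_subsolution ::
    "('a::euclidean_space \<Rightarrow> 'a \<Rightarrow> real) \<Rightarrow> ('a \<times> real \<Rightarrow> real) \<Rightarrow> bool" where
  "viscosity_subsolution H u \<longleftrightarrow>
     (\<forall>\<phi> D\<phi> \<phi>t z t. C1_test_function \<phi> D\<phi> \<phi>t \<longrightarrow> 0 < t \<longrightarrow>
        (\<forall>\<^sub>F q in nhds (z, t). u q - \<phi> q \<le> u (z, t) - \<phi> (z, t)) \<longrightarrow>
        \<phi>t (z, t) + H z (D\<phi> (z, t)) \<le> 0)"

definition viscosity_supersolution ::
    "('a::euclidean_space \<Rightarrow> 'a \<Rightarrow> real) \<Rightarrow> ('a \<times> real \<Rightarrow> real) \<Rightarrow> bool" where
  "viscosity_supersolution H u \<longleftrightarrow>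
     (\<forall>\<phi> D\<phi> \<phi>t z t. C1_test_function \<phi> D\<phi> \<phi>t \<longrightarrow> 0 < t \<longrightarrow>
        (\<forall>\<^sub>F q in nhds (z, t). u q - \<phi> q \<ge> u (z, t) - \<phi> (z, t)) \<longrightarrow>
        \<phi>t (z, t) + H z (D\<phi> (z, t)) \<ge> 0)"

definition viscosity_solution ::
    "('a::euclidean_space \<Rightarrow> 'a \<Rightarrow> real) \<Rightarrow> ('a \<Rightarrow> real) \<Rightarrow> ('a \<times> real \<Rightarrow> real) \<Rightarrow> bool" where
  "viscosity_solution H g u \<longleftrightarrow>
     continuous_on (UNIV \<times> {0..}) u \<and> (\<forall>z. u (z, 0) = g z) \<and>
     viscosity_subsolution H u \<and> viscosity_supersolution H u"

section \<open>The G-equation with strain\<close>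

definition strain_tensor :: "(real^'n \<Rightarrow> real^'n) \<Rightarrow> real^'n \<Rightarrow> real^'n^'n" where
  "strain_tensor V z = (1 / 2) *\<^sub>R (jacobian V (at z) + transpose (jacobian V (at z)))"

(* At p = 0 the strain term vanishes, since 0 /\<^sub>R 0 = 0. *)
definition G_hamiltonian :: "(real^'n \<Rightarrow> real^'n) \<Rightarrow> real \<Rightarrow> real^'n \<Rightarrow> real^'n \<Rightarrow> real" where
  "G_hamiltonian V c z p =
     V z \<bullet> p + norm p + c * ((p /\<^sub>R norm p) \<bullet> (strain_tensor V z *v p))"

definition shear_flow :: "(real \<Rightarrow> 'w \<Rightarrow> real) \<Rightarrow> 'w \<Rightarrow> real^2 \<Rightarrow> real^2" where
  "shear_flow v \<omega> z = vector [v (z $ 2) \<omega>, 0]"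

lemma G_hamiltonian_shear_flow:
  assumes "(\<lambda>y. v y \<omega>) field_differentiable at (z $ 2)"
  shows "G_hamiltonian (shear_flow v \<omega>) c z p =
    norm p + v (z $ 2) \<omega> * p $ 1 +
    (if p = 0 then 0 else c * (p $ 1 * p $ 2 * deriv (\<lambda>y. v y \<omega>) (z $ 2) / norm p))"
proof -
  let ?d = "deriv (\<lambda>y. v y \<omega>) (z $ 2)"
  have d: "((\<lambda>y. v y \<omega>) has_derivative (\<lambda>h. ?d * h)) (at (z $ 2))"
    using assms by (simp add: field_differentiable_derivI has_field_derivative_imp_has_derivative)
  have c: "((\<lambda>z::real^2. v (z $ 2) \<omega>) has_derivative (\<lambda>h. ?d * h $ 2)) (at z)"
    by (rule has_derivative_compose[where f="\<lambda>z. z $ 2" and g="\<lambda>y. v y \<omega>", OF _ d])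
       (rule bounded_linear_imp_has_derivative[OF bounded_linear_vec_nth])
  have s: "shear_flow v \<omega> = (\<lambda>z. v (z $ 2) \<omega> *\<^sub>R axis 1 1)"
    by (auto simp: shear_flow_def vec_eq_iff forall_2 axis_def)
  have "(shear_flow v \<omega> has_derivative (\<lambda>h. (?d * h $ 2) *\<^sub>R axis 1 1)) (at z)"
    unfolding s using c by (rule has_derivative_scaleR_left)
  then have "frechet_derivative (shear_flow v \<omega>) (at z) = (\<lambda>h. (?d * h $ 2) *\<^sub>R axis 1 1)"
    by (metis frechet_derivative_at)
  then have j: "jacobian (shear_flow v \<omega>) (at z) = vector [vector [0, ?d], vector [0, 0]]"
    by (simp add: jacobian_def matrix_def vec_eq_iff forall_2 axis_def)
  have st: "strain_tensor (shear_flow v \<omega>) z *v p = vector [?d * p $ 2 / 2, ?d * p $ 1 / 2]"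
    unfolding strain_tensor_def j
    by (simp add: vec_eq_iff forall_2 sum_2 matrix_vector_mult_def transpose_def)
  have sf: "shear_flow v \<omega> z \<bullet> p = v (z $ 2) \<omega> * p $ 1"
    by (simp add: inner_vec_def sum_2 shear_flow_def)
  have pp: "p \<bullet> vector [?d * p $ 2 / 2, ?d * p $ 1 / 2] = p $ 1 * p $ 2 * ?d"
    by (simp add: inner_vec_def sum_2)
  show ?thesis
    unfolding G_hamiltonian_def st sf inner_scaleR_left pp
    by (simp add: divide_inverse)
qed

section \<open>Homogenization\<close>

text \<open>All solutions, understood as continuous functions on the closed half space, are required
  to exist and to converge. Local uniform convergence is uniform convergence on compact subsets
  of the closed half space \<open>t \<ge> 0\<close>.\<close>

definition effective_hamiltonian ::
    "'w measure \<Rightarrow> (real \<Rightarrow> 'w \<Rightarrow> real) \<Rightarrow> real \<Rightarrow> (real^2 \<Rightarrow> real) \<Rightarrow> bool" where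
  "effective_hamiltonian M v c Hbar \<longleftrightarrow>
     continuous_on UNIV Hbar \<and>
     (AE \<omega> in M. \<forall>G0. uniformly_continuous_on UNIV G0 \<longrightarrow>
        (let H\<epsilon> = (\<lambda>\<epsilon> z p. G_hamiltonian (shear_flow v \<omega>) c (z /\<^sub>R \<epsilon>) p) in
          (\<forall>\<epsilon>>0. \<exists>G. viscosity_solution (H\<epsilon> \<epsilon>) G0 G) \<and>
          (\<exists>G. viscosity_solution (\<lambda>z p. Hbar p) G0 G) \<and>
          (\<forall>G Gbar.
             (\<forall>\<epsilon>>0. viscosity_solution (H\<epsilon> \<epsilon>) G0 (G \<epsilon>)) \<longrightarrow>
             viscosity_solution (\<lambda>z p. Hbar p) G0 Gbar \<longrightarrow>
             (\<forall>K. compact K \<longrightarrow> K \<subseteq> UNIV \<times> {0..} \<longrightarrow>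
                uniform_limit K G Gbar (at_right 0)))))"

end

theory Submission
  imports Defs
begin

text \<open>The corrector depends on \<open>y\<close> only, and its slope \<open>q\<close> solves the scalar equation
  \<open>sqrt (m\<^sup>2 + q\<^sup>2) + c m v' q / sqrt (m\<^sup>2 + q\<^sup>2) = \<lambda> - m v\<close>. Above the level \<open>|m| + sup m v\<close>
  this equation has exactly one root of each sign; both roots are stationary fields, so they have
  path means by the ergodic theorem, and these means invert the effective Hamiltonian outside its
  flat part. On the flat part, correctors switch between the two roots at kinks.
  The correctors give barriers for affine initial data. Homogenization for general data follows
  from a comparison principle for families of approximate sub- and supersolutions, in which the
  functions are touched by paraboloids only.
  If \<open>q\<^sub>0\<close> and \<open>q\<^sub>c\<close> are the positive roots without and with strain, convexity of
  \<open>q \<mapsto> sqrt (m\<^sup>2 + q\<^sup>2)\<close> gives \<open>q\<^sub>c - q\<^sub>0 + c m v' \<ge> 0\<close>, with equality only where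
  \<open>c m v' = 0\<close>. As \<open>v'\<close> has mean zero, strain increases the mean root, that is, it decreases the
  effective Hamiltonian, strictly unless \<open>m v\<close> is constant.\<close>

section \<open>Comparison for approximate solutions\<close>

text \<open>The obstacle is that only the Lipschitz constant \<open>A\<close> in the gradient, the
  speed of propagation, is common to all \<epsilon>; the oscillation in z grows with 1/\<epsilon>,
  and the cell Hamiltonian need not be convex, so no variational formula is at hand. For fixed
  \<epsilon> a solution is compared with a barrier on a short domain of dependence. This makes the
  whole family of solutions satisfy the effective equation up to small errors, and doubling of
  variables is then run for the effective Hamiltonian, which does not depend on z. The effective
  value at (m, n) is the infimum \<open>hb\<close> of the levels above \<open>lam\<close> for which
  n lies between the means of the two roots. Levels above the infimum carry a subsolution with a
  concave corner; below it a shifted root, or on the flat part a convex corner, gives a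
  supersolution. The bound |m| + sup m v survives strain because v' is small at suitable almost
  maxima of m v. Almost sure statements are proved for one slope and one level at a time; sequences
  of levels, rational slopes and a Lipschitz bound then yield one null set.\<close>

definition touches_above :: "('b::euclidean_space \<Rightarrow> real) \<Rightarrow> 'b \<Rightarrow> 'b \<Rightarrow> real \<Rightarrow> real \<Rightarrow> bool" where
  "touches_above u q1 P C r \<longleftrightarrow>
     (\<forall>q\<in>cball q1 r. u q \<le> u q1 + P \<bullet> (q - q1) + C * (norm (q - q1))\<^sup>2)"

text \<open>One constant \<open>C\<close> caps position, slope and opening, and one constant \<eta>
  serves for time, radius and error. The index is chosen before the touching point, so the
  inequality is uniform over all paraboloids within these bounds; families with a vanishing
  consistency error qualify.\<close>

definition approx_subsolution ::
    "('a::euclidean_space \<Rightarrow> 'a \<Rightarrow> real) \<Rightarrow> 'i filter \<Rightarrow> ('i \<Rightarrow> 'a \<times> real \<Rightarrow> real) \<Rightarrow> bool" where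
  "approx_subsolution H F u \<longleftrightarrow>
     (\<forall>C>0. \<forall>\<eta>>0. \<forall>\<^sub>F k in F. \<forall>q P. norm q \<le> C \<longrightarrow> \<eta> \<le> snd q \<longrightarrow> norm P \<le> C \<longrightarrow>
        touches_above (u k) q P C \<eta> \<longrightarrow> snd P + H (fst q) (fst P) \<le> \<eta>)"

text \<open>If u is a supersolution for H, then -u is a subsolution for this Hamiltonian. One-sided
  results are proved for subsolutions and transferred.\<close>

definition dual_hamiltonian :: "('a::euclidean_space \<Rightarrow> 'a \<Rightarrow> real) \<Rightarrow> 'a \<Rightarrow> 'a \<Rightarrow> real" where
  "dual_hamiltonian H z p = - H z (- p)"

definition approx_supersolution ::
    "('a::euclidean_space \<Rightarrow> 'a \<Rightarrow> real) \<Rightarrow> 'i filter \<Rightarrow> ('i \<Rightarrow> 'a \<times> real \<Rightarrow> real) \<Rightarrow> bool" where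
  "approx_supersolution H F w \<longleftrightarrow> approx_subsolution (dual_hamiltonian H) F (\<lambda>k q. - w k q)"

text \<open>\<open>A\<close> bounds the speed of propagation and is the quantity kept uniform over
  families. The constant in z is local and existential, since it blows up under the scaling
  z/\<epsilon>. The value 0 at p = 0 makes constants solutions and gives the bound
  \<open>A * norm p\<close>.\<close>

definition regular_hamiltonian :: "real \<Rightarrow> ('a::euclidean_space \<Rightarrow> 'a \<Rightarrow> real) \<Rightarrow> bool" where
  "regular_hamiltonian A H \<longleftrightarrow> A > 0 \<and> (\<forall>z. H z 0 = 0) \<and>
     (\<forall>z p q. \<bar>H z p - H z q\<bar> \<le> A * norm (p - q)) \<and>
     (\<forall>R. \<exists>B. \<forall>z z' p. norm z \<le> R \<longrightarrow> norm z' \<le> R \<longrightarrow>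
        \<bar>H z p - H z' p\<bar> \<le> B * norm (z - z') * (1 + norm p))"

lemma dual_dual_hamiltonian [simp]: "dual_hamiltonian (dual_hamiltonian H) = H"
  by (simp add: dual_hamiltonian_def fun_eq_iff)

lemma regular_dual_hamiltonian:
  assumes "regular_hamiltonian A H"
  shows "regular_hamiltonian A (dual_hamiltonian H)"
proof -
  have "\<bar>- H z (- p) + H z (- q)\<bar> \<le> A * norm (p - q)" for z p q
  proof -
    have "\<bar>H z (- p) - H z (- q)\<bar> \<le> A * norm (- p - - q)"
      using assms unfolding regular_hamiltonian_def by blast
    then show ?thesis by (simp add: norm_minus_commute abs_minus_commute)
  qed
  moreover have "\<exists>B. \<forall>z z' p. norm z \<le> R \<longrightarrow> norm z' \<le> R \<longrightarrow>
      \<bar>- H z (- p) + H z' (- p)\<bar> \<le> B * norm (z - z') * (1 + norm p)" for R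
  proof -
    obtain B where "\<forall>z z' p. norm z \<le> R \<longrightarrow> norm z' \<le> R \<longrightarrow>
        \<bar>H z p - H z' p\<bar> \<le> B * norm (z - z') * (1 + norm p)"
      using assms unfolding regular_hamiltonian_def by meson
    then have "\<bar>H z (-p) - H z' (-p)\<bar> \<le> B * norm (z - z') * (1 + norm p)"
      if "norm z \<le> R" "norm z' \<le> R" for z z' p
      using that by (metis norm_minus_cancel)
    then show ?thesis by (auto simp: abs_minus_commute intro!: exI[of _ B])
  qed
  ultimately show ?thesis
    using assms unfolding regular_hamiltonian_def dual_hamiltonian_def by simp
qed

lemma regular_hamiltonian_bound:
  assumes "regular_hamiltonian A H"
  shows "\<bar>H z p\<bar> \<le> A * norm p"
proof -
  have "\<bar>H z p - H z 0\<bar> \<le> A * norm (p - 0)"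
    using assms unfolding regular_hamiltonian_def by blast
  then show ?thesis using assms by (simp add: regular_hamiltonian_def)
qed

lemma approx_subsolutionD:
  assumes "approx_subsolution H F u" "C > 0" "\<eta> > 0"
  shows "\<forall>\<^sub>F k in F. \<forall>q P. norm q \<le> C \<longrightarrow> \<eta> \<le> snd q \<longrightarrow> norm P \<le> C \<longrightarrow>
        touches_above (u k) q P C \<eta> \<longrightarrow> snd P + H (fst q) (fst P) \<le> \<eta>"
  using assms unfolding approx_subsolution_def by blast

lemma approx_supersolutionD:
  assumes "approx_supersolution H F w" "C > 0" "\<eta> > 0"
  shows "\<forall>\<^sub>F k in F. \<forall>q P. norm q \<le> C \<longrightarrow> \<eta> \<le> snd q \<longrightarrow> norm P \<le> C \<longrightarrow>
        touches_above (\<lambda>q. - w k q) q (- P) C \<eta> \<longrightarrow> snd P + H (fst q) (fst P) \<ge> - \<eta>"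
proof -
  have "\<forall>\<^sub>F k in F. \<forall>q P. norm q \<le> C \<longrightarrow> \<eta> \<le> snd q \<longrightarrow> norm P \<le> C \<longrightarrow>
        touches_above (\<lambda>q. - w k q) q P C \<eta> \<longrightarrow> snd P + dual_hamiltonian H (fst q) (fst P) \<le> \<eta>"
    using assms approx_subsolutionD unfolding approx_supersolution_def by blast
  then show ?thesis
  proof eventually_elim
    case (elim k)
    show ?case
    proof (intro allI impI)
      fix q P
      assume *: "norm q \<le> C" "\<eta> \<le> snd q" "norm P \<le> C" "touches_above (\<lambda>q. - w k q) q (- P) C \<eta>"
      then have "snd (- P) + dual_hamiltonian H (fst q) (fst (- P)) \<le> \<eta>"
        using elim by (metis norm_minus_cancel)
      then show "snd P + H (fst q) (fst P) \<ge> - \<eta>"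
        by (simp add: dual_hamiltonian_def)
    qed
  qed
qed

text \<open>Along a geometric sequence of penalty weights the maxima decrease, so some weight among
  the first \<open>J\<close> leaves a penalty of order \<open>1 / J\<close>. This replaces the usual limit argument
  and needs no modulus of continuity, hence is uniform over families of functions.\<close>

lemma penalized_maximum:
  fixes f D :: "'b::metric_space \<Rightarrow> real"
  assumes X: "compact X" "x0 \<in> X" and f: "continuous_on X f" and D: "continuous_on X D"
    and D0: "\<And>x. x \<in> X \<Longrightarrow> 0 \<le> D x" "D x0 = 0"
    and M: "\<And>x. x \<in> X \<Longrightarrow> f x \<le> M" and f0: "0 \<le> f x0" and a0: "0 < a0" and J: "0 < J"
  shows "\<exists>j\<le>J. \<exists>x\<in>X. (\<forall>y\<in>X. f y - a0 * 2 ^ j * D y \<le> f x - a0 * 2 ^ j * D x) \<and>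
           f x0 \<le> f x - a0 * 2 ^ j * D x \<and> a0 * 2 ^ j * D x \<le> 2 * M / J"
proof -
  define a where "a j = a0 * 2 ^ j" for j
  have "\<exists>x\<in>X. \<forall>y\<in>X. f y - a j * D y \<le> f x - a j * D x" for j
    using X by (intro continuous_attains_sup continuous_intros f D) auto
  then obtain X' where X': "\<And>j. X' j \<in> X"
      "\<And>j y. y \<in> X \<Longrightarrow> f y - a j * D y \<le> f (X' j) - a j * D (X' j)"
    by metis
  define m where "m j = f (X' j) - a j * D (X' j)" for j
  have apos: "a j > 0" for j using a0 by (simp add: a_def)
  have m0: "m j \<ge> f x0" for j
    using X'(2)[OF X(2), of j] D0(2) by (simp add: m_def)
  have mM: "m j \<le> M" for j
  proof -
    have "0 \<le> a j * D (X' j)" using D0(1)[OF X'(1), of j] apos[of j] by simp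
    then show ?thesis using M[OF X'(1), of j] by (simp add: m_def)
  qed
  \<comment> \<open>The maximum at weight \<open>a j\<close> is tested at the next maximizer:
    doubling the weight makes the old penalty half of the new one, so the drop of the maxima
    controls the new penalty.\<close>
  have step: "a (Suc j) * D (X' (Suc j)) \<le> 2 * (m j - m (Suc j))" for j
    using X'(2)[of "X' (Suc j)" j, OF X'(1)] by (simp add: m_def a_def algebra_simps)
  \<comment> \<open>Pigeonhole: the J drops telescope to at most M, because all maxima lie between
    \<open>f x0\<close>, which is nonnegative, and M.\<close>
  have "\<exists>j<J. m j - m (Suc j) \<le> M / J"
  proof (rule ccontr)
    assume "\<not> ?thesis"
    then have gt: "m j - m (Suc j) > M / J" if "j < J" for j using that by force
    have "(\<Sum>j<J. m j - m (Suc j)) > (\<Sum>j<J. M / J)"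
      using J by (intro sum_strict_mono gt) auto
    moreover have "(\<Sum>j<J. m j - m (Suc j)) = m 0 - m J"
      by (induction J) auto
    ultimately have "m 0 - m J > M" using J by simp
    then show False using mM[of 0] m0[of J] f0 by linarith
  qed
  then obtain j where j: "j < J" "m j - m (Suc j) \<le> M / J" by blast
  show ?thesis
  proof (intro exI[of _ "Suc j"] conjI bexI[of _ "X' (Suc j)"])
    show "Suc j \<le> J" using j by simp
    show "a0 * 2 ^ Suc j * D (X' (Suc j)) \<le> 2 * M / J"
      using step[of j] j(2) unfolding a_def by simp
    show "f x0 \<le> f (X' (Suc j)) - a0 * 2 ^ Suc j * D (X' (Suc j))"
      using m0[of "Suc j"] by (simp add: m_def a_def)
    show "\<forall>y\<in>X. f y - a0 * 2 ^ Suc j * D y \<le> f (X' (Suc j)) - a0 * 2 ^ Suc j * D (X' (Suc j))"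
      using X'(2)[of _ "Suc j"] unfolding a_def by blast
  qed (use X' in auto)
qed

text \<open>The squared positive part has derivative \<open>2 * max 0 s\<close>, which is Lipschitz
  with constant 2; hence it lies below a parabola touching it at any given point. This keeps the
  localized doubling function within the class of paraboloid tests.\<close>

lemma max_0_square_le:
  fixes s s' :: real
  shows "(max 0 s')\<^sup>2 \<le> (max 0 s)\<^sup>2 + 2 * max 0 s * (s' - s) + (s' - s)\<^sup>2"
proof (cases "s \<ge> 0")
  case True
  then have "(max 0 s)\<^sup>2 + 2 * max 0 s * (s' - s) + (s' - s)\<^sup>2 = s'\<^sup>2"
    by (simp add: power2_eq_square algebra_simps)
  then show ?thesis by (simp add: max_def)
next
  case False
  then have "max 0 s' \<le> \<bar>s' - s\<bar>" by auto
  then have "(max 0 s')\<^sup>2 \<le> \<bar>s' - s\<bar>\<^sup>2" by (intro power_mono) auto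
  then show ?thesis using False by simp
qed

text \<open>The penalty \<open>(max 0 \<sigma>)\<^sup>2\<close> with \<open>\<sigma> = |z - z0|\<^sup>2 + 2 A R t - \<rho>\<^sup>2\<close> is a supersolution of
  \<open>\<pi>\<^sub>t = A |D\<pi>|\<close> on \<open>|z - z0| \<le> R\<close>, which localizes the comparison argument.\<close>

lemma cone_penalty_le:
  fixes z z1 z0 :: "'a::euclidean_space"
  assumes "norm (z - z1) \<le> R" "norm (z1 - z0) \<le> R" "0 \<le> A"
    and s: "s = (norm (z1 - z0))\<^sup>2 + 2 * A * R * t1 - \<rho>\<^sup>2" "s \<le> d" "0 \<le> d"
  shows "(max 0 ((norm (z - z0))\<^sup>2 + 2 * A * R * t - \<rho>\<^sup>2))\<^sup>2 \<le> (max 0 s)\<^sup>2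
     + (4 * max 0 s) * ((z1 - z0) \<bullet> (z - z1)) + (4 * max 0 s * A * R) * (t - t1)
     + (2 * d + 18 * R\<^sup>2 + 8 * A\<^sup>2 * R\<^sup>2) * ((norm (z - z1))\<^sup>2 + (t - t1)\<^sup>2)"
proof -
  define s' where "s' = (norm (z - z0))\<^sup>2 + 2 * A * R * t - \<rho>\<^sup>2"
  have eq: "(norm (z - z0))\<^sup>2 = (norm (z1 - z0))\<^sup>2 + 2 * ((z1 - z0) \<bullet> (z - z1)) + (norm (z - z1))\<^sup>2"
  proof -
    have "z - z0 = (z1 - z0) + (z - z1)" by simp
    then show ?thesis by (simp only: power2_norm_eq_inner inner_add_left inner_add_right)
        (simp add: inner_commute)
  qed
  have d1: "s' - s = 2 * ((z1 - z0) \<bullet> (z - z1)) + (norm (z - z1))\<^sup>2 + 2 * A * R * (t - t1)"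
    unfolding s'_def s(1) eq by (simp add: algebra_simps)
  have R0: "0 \<le> R" using assms(1) norm_ge_zero order_trans by blast
  let ?n = "norm (z - z1)" and ?t = "\<bar>t - t1\<bar>"
  have h: "\<bar>2 * x + w + y\<bar> \<le> 3 * c + e"
    if "\<bar>x\<bar> \<le> c" "w \<le> c" "\<bar>y\<bar> = e" "0 \<le> w" for x w y c e :: real using that by linarith
  have "\<bar>(z1 - z0) \<bullet> (z - z1)\<bar> \<le> R * ?n"
    using Cauchy_Schwarz_ineq2[of "z1 - z0" "z - z1"] assms(2)
    by (meson mult_right_mono norm_ge_zero order_trans)
  moreover have "?n\<^sup>2 \<le> R * ?n" using assms(1) by (simp add: power2_eq_square mult_right_mono)
  moreover have "\<bar>2 * A * R * (t - t1)\<bar> = 2 * A * R * ?t" using R0 assms(3) by (simp add: abs_mult)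
  \<comment> \<open>A linear bound on the increment of \<sigma>; its square is then absorbed in the
    quadratic term of the paraboloid.\<close>
  ultimately have "\<bar>s' - s\<bar> \<le> 3 * (R * ?n) + 2 * A * R * ?t"
    unfolding d1 by (rule h) simp
  then have "\<bar>s' - s\<bar> \<le> 3 * R * ?n + 2 * A * R * ?t" by (simp add: mult.assoc)
  then have "\<bar>s' - s\<bar>\<^sup>2 \<le> (3 * R * ?n + 2 * A * R * ?t)\<^sup>2" by (intro power_mono) auto
  also have "\<dots> \<le> 2 * (3 * R * ?n)\<^sup>2 + 2 * (2 * A * R * ?t)\<^sup>2"
    using sum_squares_bound[of "3 * R * ?n" "2 * A * R * ?t"] by (simp add: power2_sum)
  also have "\<dots> = 18 * R\<^sup>2 * ?n\<^sup>2 + 8 * A\<^sup>2 * R\<^sup>2 * (t - t1)\<^sup>2"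
    by (simp add: power_mult_distrib)
  also have "\<dots> \<le> (18 * R\<^sup>2 + 8 * A\<^sup>2 * R\<^sup>2) * (?n\<^sup>2 + (t - t1)\<^sup>2)"
    by (simp add: algebra_simps)
  finally have sq: "(s' - s)\<^sup>2 \<le> (18 * R\<^sup>2 + 8 * A\<^sup>2 * R\<^sup>2) * (?n\<^sup>2 + (t - t1)\<^sup>2)" by simp
  have "2 * max 0 s * ?n\<^sup>2 \<le> 2 * d * ?n\<^sup>2" using s by (intro mult_right_mono) auto
  also have "\<dots> \<le> 2 * d * (?n\<^sup>2 + (t - t1)\<^sup>2)" using s by (intro mult_left_mono) auto
  finally have "2 * max 0 s * (s' - s) \<le> (4 * max 0 s) * ((z1 - z0) \<bullet> (z - z1))
     + (4 * max 0 s * A * R) * (t - t1) + 2 * d * (?n\<^sup>2 + (t - t1)\<^sup>2)"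
    unfolding d1 by (simp add: algebra_simps)
  then show ?thesis
    using max_0_square_le[of s' s] sq unfolding s'_def[symmetric] by (simp add: algebra_simps)
qed

lemma norm_fst_le_norm: "norm (fst q) \<le> norm q"
  by (metis norm_fst_le prod.collapse)

lemma norm_snd_le_norm: "norm (snd q) \<le> norm q"
  by (metis norm_snd_le prod.collapse)

text \<open>Doubling of variables on a cone: the function to be maximized is \<open>u k\<close>
  minus \<open>w k\<close> at two points, less a linear term in time, the cone penalty and a
  weighted squared distance. All constants, including the largest admissible weight, are fixed
  before the index k. The touching paraboloids therefore obey the same bounds \<open>CC\<close> and
  \<epsilon> for all k, and the approximate inequalities apply eventually.\<close>

lemma approx_comparison:
  fixes H :: "'a::euclidean_space \<Rightarrow> 'a \<Rightarrow> real" and u w :: "'i \<Rightarrow> 'a \<times> real \<Rightarrow> real"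
  assumes reg: "regular_hamiltonian A H"
    and sub: "approx_subsolution H F u" and sup: "approx_supersolution H F w"
    and cont: "\<And>k. continuous_on (UNIV \<times> {0..}) (u k)" "\<And>k. continuous_on (UNIV \<times> {0..}) (w k)"
    and bd: "\<forall>\<^sub>F k in F. \<forall>z\<in>cball z0 R. \<forall>t\<in>{0..R / (2 * A)}. \<bar>u k (z, t)\<bar> \<le> C \<and> \<bar>w k (z, t)\<bar> \<le> C"
    and g: "continuous_on (cball z0 R) g"
    and init: "\<And>\<eta>. \<eta> > 0 \<Longrightarrow> \<exists>s>0. \<forall>\<^sub>F k in F. \<forall>z\<in>cball z0 R. \<forall>t\<in>{0..s}.
        u k (z, t) \<le> g z + \<eta> \<and> w k (z, t) \<ge> g z - \<eta>"
    and \<rho>: "0 < \<rho>" "\<rho> < R" and \<mu>: "0 < \<mu>"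
  shows "\<forall>\<^sub>F k in F. \<forall>z t. 0 \<le> t \<longrightarrow> (norm (z - z0))\<^sup>2 + 2 * A * R * t \<le> \<rho>\<^sup>2 \<longrightarrow>
           u k (z, t) \<le> w k (z, t) + \<mu>"
proof -
  have A: "A > 0" and R: "R > 0" using reg \<rho> unfolding regular_hamiltonian_def by auto
  define T where "T = R / (2 * A)"
  define C' where "C' = max C 1"
  define d where "d = R\<^sup>2 - \<rho>\<^sup>2"
  \<comment> \<open>Large enough that a maximum of nonnegative value has
    \<open>S \<le> d / 2\<close>, and so stays away from the lateral boundary and from the final
    time.\<close>
  define K where "K = 8 * C' / d\<^sup>2"
  \<comment> \<open>The slope in time that makes the subsolution strict; over [0, T] it uses up at
    most half of the gap \<mu>.\<close>
  define \<eta> where "\<eta> = \<mu> / (2 * (T + 1))"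
  \<comment> \<open>The room in space and in time that \<sigma> \<le> d / 2 leaves to the boundary
    of the cylinder.\<close>
  define e where "e = min (d / (4 * R)) (d / (4 * A * R))"
  have T: "T > 0" and C': "C' \<ge> 1" "C \<le> C'" using A R by (auto simp: T_def C'_def)
  have d: "d > 0" unfolding d_def using \<rho> by (simp add: power_strict_mono)
  have K: "K > 0" and \<eta>: "\<eta> > 0" and e: "e > 0" using C' d T \<mu> R A by (auto simp: K_def \<eta>_def e_def)
  have \<eta>T: "\<eta> * t \<le> \<mu> / 2" if "t \<le> T" for t
  proof -
    have "\<eta> * t \<le> \<eta> * (T + 1)" using that \<eta> by (intro mult_left_mono) auto
    also have "\<dots> = \<mu> / 2" using T by (simp add: \<eta>_def field_simps)
    finally show ?thesis .
  qed
  obtain B0 where B0: "\<forall>z z' p. norm z \<le> norm z0 + R \<longrightarrow> norm z' \<le> norm z0 + R \<longrightarrow>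
        \<bar>H z p - H z' p\<bar> \<le> B0 * norm (z - z') * (1 + norm p)"
    using reg unfolding regular_hamiltonian_def by meson
  define B where "B = max B0 1"
  have B1: "B \<ge> 1" by (simp add: B_def)
  have B: "\<bar>H z p - H z' p\<bar> \<le> B * norm (z - z') * (1 + norm p)"
    if "norm z \<le> norm z0 + R" "norm z' \<le> norm z0 + R" for z z' p
  proof -
    have "B0 * norm (z - z') * (1 + norm p) \<le> B * norm (z - z') * (1 + norm p)"
      unfolding B_def by (intro mult_right_mono) auto
    then show ?thesis using B0 that by (meson order_trans)
  qed
  obtain s where s: "s > 0" and ev_init: "\<forall>\<^sub>F k in F. \<forall>z\<in>cball z0 R. \<forall>t\<in>{0..s}.
        u k (z, t) \<le> g z + \<mu> / 8 \<and> w k (z, t) \<ge> g z - \<mu> / 8"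
    using init[of "\<mu> / 8"] \<mu> by auto
  have "uniformly_continuous_on (cball z0 R) g"
    using g by (intro compact_uniformly_continuous) auto
  then obtain \<delta> where \<delta>: "\<delta> > 0" and
    g\<delta>: "\<And>z z'. z \<in> cball z0 R \<Longrightarrow> z' \<in> cball z0 R \<Longrightarrow> dist z z' < \<delta> \<Longrightarrow> dist (g z) (g z') < \<mu> / 8"
    unfolding uniformly_continuous_on_def using \<mu> by (metis half_gt_zero_iff zero_less_divide_iff zero_less_numeral)
  \<comment> \<open>Allowed distance of the two points: below the time s of the initial layer, the
    modulus \<delta> of g and the room e, and small against \<eta> / B. The first weight
    \<open>a0\<close> already enforces it.\<close>
  define \<nu> where "\<nu> = min (min (s / 2) (\<delta> / 2)) (min (e / 2) (\<eta> / (8 * B)))"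
  have \<nu>: "\<nu> > 0" "\<nu> \<le> s / 2" "\<nu> < \<delta>" "\<nu> \<le> e / 2"
    unfolding \<nu>_def using s \<delta> e \<eta> B1 by auto
  have "\<nu> \<le> \<eta> / (8 * B)" unfolding \<nu>_def by auto
  then have \<nu>B: "B * \<nu> \<le> \<eta> / 8" using B1 by (simp add: field_simps)
  define a0 where "a0 = 2 * C' / \<nu>\<^sup>2"
  have a0: "a0 > 0" using C' \<nu> by (simp add: a0_def)
  \<comment> \<open>With J doublings the residual penalty is at most \<open>4 * C' / J\<close>; its
    contribution \<open>B * (8 * C' / J)\<close> to the difference of the Hamiltonians is then at
    most \<eta> / 8.\<close>
  obtain J :: nat where J0: "J > 64 * B * C' / \<eta>" using reals_Archimedean2 by blast
  have "64 * B * C' / \<eta> > 0" using B1 C' \<eta> by simp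
  then have J: "J > 0" using J0 by (metis of_nat_0 less_le_trans less_trans not_gr0 less_irrefl)
  have "64 * B * C' < \<eta> * J" using J0 \<eta> by (simp add: field_simps)
  then have JB: "B * (8 * C' / J) \<le> \<eta> / 8" using J by (simp add: field_simps)
  define aJ where "aJ = a0 * 2 ^ J"
  have aJ: "aJ > 0" using a0 by (simp add: aJ_def)
  define Q where "Q = cball z0 R \<times> {0..T}"
  define coef where "coef = 2 * d + 18 * R\<^sup>2 + 8 * A\<^sup>2 * R\<^sup>2"
  \<comment> \<open>The three groups bound the touching point, the slopes and the opening at the
    largest weight \<open>aJ\<close>.\<close>
  define CC where "CC = (norm z0 + R + T) + (2 * aJ * \<nu> + 4 * K * d * R + \<eta> + 4 * K * d * A * R)
      + (aJ + K * coef)"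
  have coef: "coef > 0" using d R A unfolding coef_def by (intro add_pos_nonneg) auto
  have pos: "norm z0 + R + T > 0" "2 * aJ * \<nu> + 4 * K * d * R + \<eta> + 4 * K * d * A * R > 0" "aJ + K * coef > 0"
    using aJ K d R A T \<eta> \<nu> coef by (auto intro!: add_pos_pos add_nonneg_pos mult_pos_pos)
  have CC: "norm z0 + R + T \<le> CC" "2 * aJ * \<nu> + 4 * K * d * R + \<eta> + 4 * K * d * A * R \<le> CC"
      "aJ + K * coef \<le> CC" "CC > 0"
    unfolding CC_def using pos by linarith+
  define \<epsilon> where "\<epsilon> = min (\<eta> / 8) (min (s / 2) (e / 2))"
  have \<epsilon>: "\<epsilon> > 0" "\<epsilon> \<le> \<eta> / 8" "\<epsilon> \<le> s / 2" "\<epsilon> \<le> e / 2" using \<eta> s e by (auto simp: \<epsilon>_def)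
  show ?thesis
    using bd ev_init approx_subsolutionD[OF sub CC(4) \<epsilon>(1)] approx_supersolutionD[OF sup CC(4) \<epsilon>(1)]
  proof eventually_elim
    case (elim k)
    show ?case
    proof (intro allI impI, rule ccontr)
      fix zs ts
      assume ts: "0 \<le> ts" and in_cone: "(norm (zs - z0))\<^sup>2 + 2 * A * R * ts \<le> \<rho>\<^sup>2"
        and "\<not> u k (zs, ts) \<le> w k (zs, ts) + \<mu>"
      then have gt: "u k (zs, ts) - w k (zs, ts) > \<mu>" by simp
      define \<sigma> where "\<sigma> q = (norm (fst q - z0))\<^sup>2 + 2 * A * R * snd q - \<rho>\<^sup>2" for q :: "'a \<times> real"
      define f where "f x = u k (fst x) - w k (snd x) - \<eta> * snd (fst x) - K * (max 0 (\<sigma> (fst x)))\<^sup>2"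
        for x :: "('a \<times> real) \<times> ('a \<times> real)"
      define D where "D x = (norm (fst x - snd x))\<^sup>2" for x :: "('a \<times> real) \<times> ('a \<times> real)"
      have \<rho>R: "\<rho>\<^sup>2 < R\<^sup>2" using d d_def by simp
      have "2 * A * R * ts \<le> R\<^sup>2"
        using in_cone \<rho>R zero_le_power2[of "norm (zs - z0)"] by linarith
      then have tsT: "ts \<le> T" using A R by (simp add: T_def field_simps power2_eq_square)
      have "0 \<le> 2 * A * R * ts" using A R ts by simp
      then have "(norm (zs - z0))\<^sup>2 \<le> R\<^sup>2"
        using in_cone \<rho>R by linarith
      then have zsR: "norm (zs - z0) \<le> R" using R by (simp add: power2_le_iff_abs_le)
      have q0: "(zs, ts) \<in> Q" using ts tsT zsR by (simp add: Q_def dist_norm norm_minus_commute)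
      have Qsub: "Q \<subseteq> UNIV \<times> {0..}" by (auto simp: Q_def)
      have compQ: "compact (Q \<times> Q)" unfolding Q_def by (intro compact_Times) auto
      have contQ: "continuous_on Q (u k)" "continuous_on Q (w k)"
        using cont Qsub continuous_on_subset by blast+
      have "continuous_on (Q \<times> Q) (\<lambda>x. u k (fst x))" "continuous_on (Q \<times> Q) (\<lambda>x. w k (snd x))"
        using contQ by (auto intro!: continuous_on_compose2[of Q "u k"] continuous_on_compose2[of Q "w k"]
             continuous_on_fst continuous_on_snd continuous_on_id)
      then have contf: "continuous_on (Q \<times> Q) f"
        unfolding f_def \<sigma>_def by (intro continuous_intros)
      have contD: "continuous_on (Q \<times> Q) D" unfolding D_def by (intro continuous_intros)
      have uw: "\<bar>u k q\<bar> \<le> C'" "\<bar>w k q\<bar> \<le> C'" if "q \<in> Q" for q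
      proof -
        have "fst q \<in> cball z0 R" "snd q \<in> {0..R / (2 * A)}"
          using that unfolding Q_def T_def mem_Times_iff by simp_all
        then have "\<bar>u k (fst q, snd q)\<bar> \<le> C \<and> \<bar>w k (fst q, snd q)\<bar> \<le> C"
          by (rule elim(1)[rule_format])
        then show "\<bar>u k q\<bar> \<le> C'" "\<bar>w k q\<bar> \<le> C'" using C' by auto
      qed
      have fM: "f x \<le> 2 * C'" if "x \<in> Q \<times> Q" for x
      proof -
        have *: "fst x \<in> Q" "snd x \<in> Q" using that by auto
        have "0 \<le> \<eta> * snd (fst x)" using * \<eta> by (auto simp: Q_def)
        moreover have "0 \<le> K * (max 0 (\<sigma> (fst x)))\<^sup>2" using K by simp
        ultimately show ?thesis using uw(1)[OF *(1)] uw(2)[OF *(2)] unfolding f_def by linarith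
      qed
      have f0: "f ((zs, ts), (zs, ts)) \<ge> \<mu> / 2"
        using gt \<eta>T[OF tsT] in_cone by (simp add: f_def \<sigma>_def)
      have x0: "((zs, ts), (zs, ts)) \<in> Q \<times> Q" using q0 by simp
      have D0: "D ((zs, ts), (zs, ts)) = 0" "\<And>x. 0 \<le> D x" by (simp_all add: D_def)
      have f00: "0 \<le> f ((zs, ts), (zs, ts))" using f0 \<mu> by linarith
      from penalized_maximum[OF compQ x0 contf contD D0(2) D0(1) fM f00 a0 J]
      obtain j x where j: "j \<le> J" and x: "x \<in> Q \<times> Q"
        and xmax: "\<And>y. y \<in> Q \<times> Q \<Longrightarrow> f y - a0 * 2 ^ j * D y \<le> f x - a0 * 2 ^ j * D x"
        and fx: "f ((zs, ts), (zs, ts)) \<le> f x - a0 * 2 ^ j * D x"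
        and small: "a0 * 2 ^ j * D x \<le> 2 * (2 * C') / J"
        by blast
      define a where "a = a0 * 2 ^ j"
      have a: "a > 0" "a \<ge> a0" "a \<le> aJ"
        using a0 j by (auto simp: a_def aJ_def power_increasing)
      obtain z1 t1 z2 t2 where x_eq: "x = ((z1, t1), (z2, t2))" by (metis surj_pair)
      have in1: "(z1, t1) \<in> Q" and in2: "(z2, t2) \<in> Q" using x x_eq by auto
      define N where "N = norm ((z1, t1) - (z2, t2))"
      have Dx: "D x = N\<^sup>2" by (simp add: D_def x_eq N_def)
      have fx': "\<mu> / 2 \<le> f x - a * N\<^sup>2" using fx f0 unfolding Dx a_def by simp
      have "a * N\<^sup>2 \<le> 2 * C'" using fx' fM[OF x] \<mu> by linarith
      then have "a0 * N\<^sup>2 \<le> 2 * C'" using a by (meson mult_right_mono zero_le_power2 order_trans)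
      then have "N\<^sup>2 \<le> \<nu>\<^sup>2" using \<nu> C' by (simp add: a0_def field_simps)
      then have N: "N \<le> \<nu>" "N \<ge> 0" using \<nu> by (auto simp: N_def power2_le_iff_abs_le)
      have zN: "norm (z1 - z2) \<le> N" and tN: "\<bar>t1 - t2\<bar> \<le> N"
        unfolding N_def by (auto simp: norm_Pair real_le_rsqrt)
      have f_le: "f x \<le> u k (z1, t1) - w k (z2, t2) - K * (max 0 (\<sigma> (z1, t1)))\<^sup>2"
        using in1 \<eta> by (auto simp: f_def x_eq Q_def)
      have aN: "a * N\<^sup>2 \<ge> 0" using a by simp
      have K\<sigma>: "K * (max 0 (\<sigma> (z1, t1)))\<^sup>2 \<le> 2 * C'"
        using f_le fx' aN \<mu> uw(1)[OF in1] uw(2)[OF in2] by linarith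
      define S where "S = max 0 (\<sigma> (z1, t1))"
      have S0: "S \<ge> 0" by (simp add: S_def)
      have "S\<^sup>2 \<le> (d / 2)\<^sup>2"
        using K\<sigma> d C' unfolding S_def[symmetric] by (simp add: K_def field_simps power2_eq_square)
      then have S: "S \<le> d / 2" using d S0 by (simp add: power2_le_iff_abs_le)
      then have \<sigma>1: "(norm (z1 - z0))\<^sup>2 + 2 * A * R * t1 \<le> R\<^sup>2 - d / 2"
      proof -
        have "\<sigma> (z1, t1) \<le> d / 2" using S unfolding S_def by simp
        then show ?thesis unfolding \<sigma>_def d_def by (simp add: field_simps)
      qed
      have \<sigma>d: "\<sigma> (z1, t1) \<le> d" using S d unfolding S_def by simp
      have t1: "0 \<le> t1" "t1 \<le> T" and t2: "0 \<le> t2" "t2 \<le> T"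
        and z1R: "norm (z1 - z0) \<le> R" and z2R: "norm (z2 - z0) \<le> R"
        using in1 in2 by (auto simp: Q_def dist_norm norm_minus_commute)
      have zz: "z1 \<in> cball z0 R" "z2 \<in> cball z0 R" using in1 in2 by (auto simp: Q_def)
      \<comment> \<open>In the initial layer both functions are within \<mu> / 8 of g, and g differs
        by less than \<mu> / 8 between the two points; this is less than the value \<mu> / 2 of the
        maximum.\<close>
      have not_init: "\<not> (t1 \<le> s \<and> t2 \<le> s)"
      proof
        assume "t1 \<le> s \<and> t2 \<le> s"
        then have "u k (z1, t1) \<le> g z1 + \<mu> / 8" "w k (z2, t2) \<ge> g z2 - \<mu> / 8"
          using elim(2) zz t1 t2 by auto
        moreover have "dist z1 z2 < \<delta>" using zN N \<nu> by (simp add: dist_norm)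
        then have "\<bar>g z1 - g z2\<bar> < \<mu> / 8" using g\<delta> zz by (simp add: dist_real_def)
        moreover have "0 \<le> K * (max 0 (\<sigma> (z1, t1)))\<^sup>2" using K by simp
        ultimately show False using f_le fx' aN \<mu> by linarith
      qed
      have t1s: "t1 > s / 2" and t2s: "t2 > s / 2" using not_init tN N \<nu> by linarith+
      have e1: "norm (z1 - z0) \<le> R - e"
      proof -
        have "0 \<le> 2 * A * R * t1" using A R t1 by simp
        then have "(norm (z1 - z0))\<^sup>2 \<le> R\<^sup>2 - d / 2" using \<sigma>1 by linarith
        also have "\<dots> \<le> (R - d / (4 * R))\<^sup>2" using R by (simp add: power2_diff)
        finally have "norm (z1 - z0) \<le> \<bar>R - d / (4 * R)\<bar>" by (simp add: abs_le_square_iff[symmetric])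
        moreover have "d \<le> 4 * (R * R)"
          using mult_pos_pos[OF R R] zero_le_power2[of \<rho>] unfolding d_def power2_eq_square by linarith
        then have "d / (4 * R) \<le> R" using R by (simp add: field_simps)
        ultimately show ?thesis unfolding e_def by auto
      qed
      have e2: "t1 \<le> T - e"
      proof -
        have "2 * A * R * t1 \<le> R\<^sup>2 - d / 2" using \<sigma>1 zero_le_power2[of "norm (z1 - z0)"] by linarith
        then have "t1 \<le> T - d / (4 * A * R)" using A R by (simp add: T_def field_simps power2_eq_square)
        then show ?thesis unfolding e_def by auto
      qed
      have e3: "norm (z2 - z0) \<le> R - e / 2"
        using e1 zN N \<nu> norm_triangle_ineq4[of "z1 - z0" "z1 - z2"] by (simp add: algebra_simps)
      have e4: "t2 \<le> T - e / 2" using e2 tN N \<nu> by linarith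
      have ball: "cball (z1, t1) \<epsilon> \<subseteq> Q" "cball (z2, t2) \<epsilon> \<subseteq> Q"
      proof -
        have "cball (z, t) \<epsilon> \<subseteq> Q"
          if "norm (z - z0) \<le> R - e / 2" "t \<le> T - e / 2" "t > s / 2" for z t
        proof
          fix q assume "q \<in> cball (z, t) \<epsilon>"
          then have "norm (q - (z, t)) \<le> \<epsilon>" by (simp add: dist_norm norm_minus_commute)
          then have "norm (fst q - z) \<le> \<epsilon>" "\<bar>snd q - t\<bar> \<le> \<epsilon>"
            using norm_fst_le_norm[of "q - (z, t)"] norm_snd_le_norm[of "q - (z, t)"] by auto
          moreover have "norm (fst q - z0) \<le> norm (fst q - z) + norm (z - z0)"
            using norm_triangle_ineq[of "fst q - z" "z - z0"] by simp
          ultimately have "norm (fst q - z0) \<le> R" "0 \<le> snd q" "snd q \<le> T"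
            using that \<epsilon> by linarith+
          then show "q \<in> Q" unfolding Q_def
            by (cases q) (simp add: dist_norm norm_minus_commute)
        qed
        then show "cball (z1, t1) \<epsilon> \<subseteq> Q" "cball (z2, t2) \<epsilon> \<subseteq> Q"
          using e1 e2 e3 e4 t1s t2s e by auto
      qed
      \<comment> \<open>\<open>P2\<close> is the gradient of the doubling term; \<open>P1\<close>
        adds the gradients of the time term and of the cone penalty.\<close>
      define P2 where "P2 = (2 * a) *\<^sub>R ((z1, t1) - (z2, t2))"
      define P1 where "P1 = P2 + ((4 * K * S) *\<^sub>R (z1 - z0), \<eta> + 4 * K * S * A * R)"
      have expand: "(norm (q - y))\<^sup>2 = (norm (x - y))\<^sup>2 + 2 * ((x - y) \<bullet> (q - x)) + (norm (q - x))\<^sup>2"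
        for q x y :: "'a \<times> real"
      proof -
        have "q - y = (x - y) + (q - x)" by simp
        then show ?thesis by (simp only: power2_norm_eq_inner inner_add_left inner_add_right)
            (simp add: inner_commute)
      qed
      have nsq: "(norm (q - (z, t)))\<^sup>2 = (norm (fst q - z))\<^sup>2 + (snd q - t)\<^sup>2" for q :: "'a \<times> real" and z t
        by (cases q) (simp add: norm_Pair)
      have touch1: "touches_above (u k) (z1, t1) P1 CC \<epsilon>"
        unfolding touches_above_def
      proof
        fix q assume qb: "q \<in> cball (z1, t1) \<epsilon>"
        then have qQ: "q \<in> Q" using ball by blast
        have "f (q, (z2, t2)) - a * D (q, (z2, t2)) \<le> f x - a * D x"
          using xmax[of "(q, (z2, t2))"] qQ in2 by (simp add: a_def)
        then have 1: "u k q \<le> u k (z1, t1) + a * ((norm (q - (z2, t2)))\<^sup>2 - N\<^sup>2)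
            + \<eta> * (snd q - t1) + K * ((max 0 (\<sigma> q))\<^sup>2 - S\<^sup>2)"
          by (simp add: f_def D_def x_eq S_def N_def algebra_simps)
        have 2: "(norm (q - (z2, t2)))\<^sup>2 - N\<^sup>2
            = 2 * (((z1, t1) - (z2, t2)) \<bullet> (q - (z1, t1))) + (norm (q - (z1, t1)))\<^sup>2"
          unfolding N_def using expand[of q "(z2, t2)" "(z1, t1)"] by simp
        have nq: "norm (q - (z1, t1)) \<le> \<epsilon>" using qb by (simp add: dist_norm norm_minus_commute)
        have "norm (fst q - z1) \<le> R"
        proof -
          have "e \<le> R" using e1 norm_ge_zero[of "z1 - z0"] by linarith
          then show ?thesis using nq norm_fst_le_norm[of "q - (z1, t1)"] \<epsilon> e R by simp
        qed
        then have 3: "(max 0 (\<sigma> q))\<^sup>2 \<le> S\<^sup>2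
           + (4 * S) * ((z1 - z0) \<bullet> (fst q - z1)) + (4 * S * A * R) * (snd q - t1)
           + coef * (norm (q - (z1, t1)))\<^sup>2"
          using cone_penalty_le[of "fst q" z1 R z0 A "\<sigma> (z1, t1)" t1 \<rho> d "snd q"] z1R A d \<sigma>d
          unfolding S_def \<sigma>_def coef_def nsq by simp
        have "K * ((max 0 (\<sigma> q))\<^sup>2 - S\<^sup>2) \<le> K * ((4 * S) * ((z1 - z0) \<bullet> (fst q - z1))
           + (4 * S * A * R) * (snd q - t1) + coef * (norm (q - (z1, t1)))\<^sup>2)"
          using 3 K by (intro mult_left_mono) auto
        then have "u k q \<le> u k (z1, t1) + a * (2 * (((z1, t1) - (z2, t2)) \<bullet> (q - (z1, t1))) + (norm (q - (z1, t1)))\<^sup>2)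
            + \<eta> * (snd q - t1) + K * ((4 * S) * ((z1 - z0) \<bullet> (fst q - z1))
           + (4 * S * A * R) * (snd q - t1) + coef * (norm (q - (z1, t1)))\<^sup>2)"
          using 1 unfolding 2 by linarith
        also have "\<dots> = u k (z1, t1) + P1 \<bullet> (q - (z1, t1)) + (a + K * coef) * (norm (q - (z1, t1)))\<^sup>2"
          unfolding P1_def P2_def
          by (cases q) (simp add: inner_add_left inner_Pair algebra_simps)
        also have "\<dots> \<le> u k (z1, t1) + P1 \<bullet> (q - (z1, t1)) + CC * (norm (q - (z1, t1)))\<^sup>2"
          using CC a by (intro add_left_mono mult_right_mono) auto
        finally show "u k q \<le> u k (z1, t1) + P1 \<bullet> (q - (z1, t1)) + CC * (norm (q - (z1, t1)))\<^sup>2" .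
      qed
      have touch2: "touches_above (\<lambda>q. - w k q) (z2, t2) (- P2) CC \<epsilon>"
        unfolding touches_above_def
      proof
        fix q assume qb: "q \<in> cball (z2, t2) \<epsilon>"
        then have qQ: "q \<in> Q" using ball by blast
        have "f ((z1, t1), q) - a * D ((z1, t1), q) \<le> f x - a * D x"
          using xmax[of "((z1, t1), q)"] qQ in1 by (simp add: a_def)
        then have 1: "- w k q \<le> - w k (z2, t2) + a * ((norm (q - (z1, t1)))\<^sup>2 - (norm ((z2, t2) - (z1, t1)))\<^sup>2)"
          unfolding f_def D_def x_eq by (simp add: norm_minus_commute[of q] norm_minus_commute[of z2] norm_Pair algebra_simps power2_commute)
        have 2: "(norm (q - (z1, t1)))\<^sup>2 - (norm ((z2, t2) - (z1, t1)))\<^sup>2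
            = 2 * (((z2, t2) - (z1, t1)) \<bullet> (q - (z2, t2))) + (norm (q - (z2, t2)))\<^sup>2"
          using expand[of q "(z1, t1)" "(z2, t2)"] by simp
        have "- w k q \<le> - w k (z2, t2) + (- P2) \<bullet> (q - (z2, t2)) + a * (norm (q - (z2, t2)))\<^sup>2"
        proof -
          have "(- P2) \<bullet> y = 2 * a * (((z2, t2) - (z1, t1)) \<bullet> y)" for y
            unfolding P2_def inner_minus_left inner_scaleR_left inner_diff_left
            by (simp add: right_diff_distrib)
          then show ?thesis using 1 unfolding 2
            by (simp add: distrib_left mult.assoc mult.left_commute[of a] del: diff_Pair)
        qed
        also have "\<dots> \<le> - w k (z2, t2) + (- P2) \<bullet> (q - (z2, t2)) + CC * (norm (q - (z2, t2)))\<^sup>2"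
        proof -
          have "a \<le> CC" using CC(3) a(3) K coef by (smt (verit) mult_pos_pos)
          then show ?thesis by (intro add_left_mono mult_right_mono) auto
        qed
        finally show "- w k q \<le> - w k (z2, t2) + (- P2) \<bullet> (q - (z2, t2)) + CC * (norm (q - (z2, t2)))\<^sup>2" .
      qed
      have nCC: "norm (z, t) \<le> CC" if "norm (z - z0) \<le> R" "0 \<le> t" "t \<le> T" for z and t :: real
      proof -
        have "norm (z, t) \<le> norm z + \<bar>t\<bar>" using norm_Pair_le[of z t] by simp
        moreover have "norm z \<le> norm (z - z0) + norm z0" using norm_triangle_ineq[of "z - z0" z0] by simp
        ultimately show ?thesis using that CC by linarith
      qed
      have nP2: "norm P2 \<le> 2 * aJ * \<nu>"
      proof -
        have "norm P2 = 2 * a * N" using a unfolding P2_def N_def norm_scaleR by simp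
        also have "\<dots> \<le> 2 * aJ * \<nu>" using a N \<nu> by (intro mult_mono) auto
        finally show ?thesis .
      qed
      have nP1: "norm P1 \<le> CC"
      proof -
        have "norm P1 \<le> norm P2 + norm ((4 * K * S) *\<^sub>R (z1 - z0), \<eta> + 4 * K * S * A * R)"
          unfolding P1_def by (rule norm_triangle_ineq)
        also have "\<dots> \<le> norm P2 + (norm ((4 * K * S) *\<^sub>R (z1 - z0)) + \<bar>\<eta> + 4 * K * S * A * R\<bar>)"
          using norm_Pair_le[of "(4 * K * S) *\<^sub>R (z1 - z0)" "\<eta> + 4 * K * S * A * R"] by simp
        also have "norm ((4 * K * S) *\<^sub>R (z1 - z0)) \<le> 4 * K * d * R"
        proof -
          have "4 * K * S * norm (z1 - z0) \<le> 4 * K * d * R"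
            using K S S0 d z1R R by (intro mult_mono) auto
          then show ?thesis using K S0 by simp
        qed
        also have "\<bar>\<eta> + 4 * K * S * A * R\<bar> \<le> \<eta> + 4 * K * d * A * R"
        proof -
          have "4 * K * S * A * R \<le> 4 * K * d * A * R"
            using K S S0 d A R by (intro mult_right_mono mult_left_mono) auto
          moreover have "0 \<le> 4 * K * S * A * R" using K S0 A R by simp
          ultimately show ?thesis using \<eta> by linarith
        qed
        finally show ?thesis using nP2 CC(2) by linarith
      qed
      have nP2': "norm P2 \<le> CC"
      proof -
        have "0 \<le> 4 * K * d * R" "0 \<le> 4 * K * d * A * R" using K d R A by simp_all
        then show ?thesis using nP2 CC(2) \<eta> by linarith
      qed
      have in1': "snd P1 + H z1 (fst P1) \<le> \<epsilon>"
        using elim(3)[rule_format, of "(z1, t1)" P1] touch1 nP1 nCC[OF z1R t1] t1s \<epsilon> by simp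
      have in2': "snd P2 + H z2 (fst P2) \<ge> - \<epsilon>"
        using elim(4)[rule_format, of "(z2, t2)" P2] touch2 nP2' nCC[OF z2R t2] t2s \<epsilon> by simp
      have "\<bar>H z1 (fst P1) - H z1 (fst P2)\<bar> \<le> A * norm (fst P1 - fst P2)"
        using reg unfolding regular_hamiltonian_def by blast
      also have "norm (fst P1 - fst P2) \<le> 4 * K * S * R"
      proof -
        have "4 * K * S * norm (z1 - z0) \<le> 4 * K * S * R"
          using K S0 z1R by (intro mult_left_mono) auto
        then show ?thesis using K S0 by (simp add: P1_def)
      qed
      finally have h1: "\<bar>H z1 (fst P1) - H z1 (fst P2)\<bar> \<le> 4 * K * S * A * R"
        using A by (simp add: algebra_simps)
      have nz: "norm z1 \<le> norm z0 + R" "norm z2 \<le> norm z0 + R"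
        using z1R z2R norm_triangle_ineq[of "z1 - z0" z0] norm_triangle_ineq[of "z2 - z0" z0] by auto
      have "\<bar>H z1 (fst P2) - H z2 (fst P2)\<bar> \<le> B * norm (z1 - z2) * (1 + norm (fst P2))"
        using B nz by blast
      also have "\<dots> = B * norm (z1 - z2) + B * (2 * a * (norm (z1 - z2))\<^sup>2)"
      proof -
        have "norm (fst P2) = 2 * a * norm (z1 - z2)" using a by (simp add: P2_def)
        then show ?thesis by (simp add: power2_eq_square algebra_simps)
      qed
      also have "\<dots> \<le> B * \<nu> + B * (8 * C' / J)"
      proof -
        have "(norm (z1 - z2))\<^sup>2 \<le> N\<^sup>2" using zN by (intro power_mono) auto
        then have "2 * a * (norm (z1 - z2))\<^sup>2 \<le> 2 * (a * N\<^sup>2)" using a by simp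
        also have "\<dots> \<le> 8 * C' / J" using small unfolding Dx a_def[symmetric] by simp
        finally show ?thesis using B1 zN N by (intro add_mono mult_left_mono) auto
      qed
      also have "\<dots> \<le> \<eta> / 4" using \<nu>B JB by linarith
      finally have h2: "\<bar>H z1 (fst P2) - H z2 (fst P2)\<bar> \<le> \<eta> / 4" .
      \<comment> \<open>The time slope \<open>4 * K * S * A * R\<close> of the cone penalty pays for
        the change of the Hamiltonian caused by its spatial slope. What remains is \<eta> \<le> 2
        \<epsilon> + \<eta> / 4 with \<epsilon> \<le> \<eta> / 8.\<close>
      have "snd P1 = snd P2 + \<eta> + 4 * K * S * A * R" by (simp add: P1_def)
      then show False using in1' in2' h1 h2 \<epsilon> \<eta> by linarith
    qed
  qed
qed

text \<open>The exact version, with arbitrary opening and radius. Testing with paraboloids only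
  follows from \<open>viscosity_subsolution\<close>, is what the doubling argument produces, and can
  be checked by hand for profiles with a corner.\<close>

definition touching_subsolution :: "('a::euclidean_space \<Rightarrow> 'a \<Rightarrow> real) \<Rightarrow> ('a \<times> real \<Rightarrow> real) \<Rightarrow> bool" where
  "touching_subsolution H u \<longleftrightarrow>
     (\<forall>q P C r. 0 < snd q \<longrightarrow> 0 < r \<longrightarrow> touches_above u q P C r \<longrightarrow> snd P + H (fst q) (fst P) \<le> 0)"

definition touching_supersolution :: "('a::euclidean_space \<Rightarrow> 'a \<Rightarrow> real) \<Rightarrow> ('a \<times> real \<Rightarrow> real) \<Rightarrow> bool" where
  "touching_supersolution H w \<longleftrightarrow> touching_subsolution (dual_hamiltonian H) (\<lambda>q. - w q)"

lemma approx_subsolution_touching: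
  assumes "\<And>k. touching_subsolution H (u k)"
  shows "approx_subsolution H F u"
  unfolding approx_subsolution_def
proof (intro allI impI always_eventually)
  fix C \<eta> :: real and k q P
  assume "0 < \<eta>" "\<eta> \<le> snd q" "touches_above (u k) q P C \<eta>"
  then have "snd P + H (fst q) (fst P) \<le> 0"
    using assms[of k] unfolding touching_subsolution_def by (meson less_le_trans)
  then show "snd P + H (fst q) (fst P) \<le> \<eta>" using \<open>0 < \<eta>\<close> by linarith
qed

lemma approx_supersolution_touching:
  assumes "\<And>k. touching_supersolution H (w k)"
  shows "approx_supersolution H F w"
  using assms unfolding approx_supersolution_def touching_supersolution_def
  by (intro approx_subsolution_touching)

text \<open>The Hamiltonian does not depend on time, so a solution may be restarted later; this
  serves to start a barrier just before a touching point.\<close>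

lemma touching_subsolution_shift:
  assumes u: "touching_subsolution H u" and s: "0 \<le> s"
  shows "touching_subsolution H (\<lambda>q. u (fst q, snd q + s))"
  unfolding touching_subsolution_def
proof (intro allI impI)
  fix q P C and r :: real
  assume q: "0 < snd q" "0 < r" and t: "touches_above (\<lambda>q. u (fst q, snd q + s)) q P C r"
  have "touches_above u (q + (0, s)) P C r"
    unfolding touches_above_def
  proof
    fix x assume "x \<in> cball (q + (0, s)) r"
    then have "x - (0, s) \<in> cball q r" by (simp add: dist_norm algebra_simps)
    then show "u x \<le> u (q + (0, s)) + P \<bullet> (x - (q + (0, s))) + C * (norm (x - (q + (0, s))))\<^sup>2"
    proof -
      have "(fst (x - (0, s)), snd (x - (0, s)) + s) = x" "(fst q, snd q + s) = q + (0, s)"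
        by (auto simp: prod_eq_iff)
      moreover have "x - (0, s) - q = x - (q + (0, s))" by simp
      ultimately show ?thesis
        using t[unfolded touches_above_def, rule_format, OF \<open>x - (0, s) \<in> cball q r\<close>] by metis
    qed
  qed
  then have "snd P + H (fst (q + (0, s))) (fst P) \<le> 0"
    using u q s unfolding touching_subsolution_def
    by (metis add_pos_nonneg snd_add snd_conv)
  then show "snd P + H (fst q) (fst P) \<le> 0" by simp
qed

section \<open>Comparison of two functions on a domain of dependence\<close>

lemma continuous_near_initial:
  fixes u :: "'a::euclidean_space \<times> real \<Rightarrow> real"
  assumes u: "continuous_on (UNIV \<times> {0..}) u" and "\<eta> > 0"
  shows "\<exists>s>0. \<forall>z\<in>cball z0 R. \<forall>t\<in>{0..s}. \<bar>u (z, t) - u (z, 0)\<bar> \<le> \<eta>"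
proof -
  let ?K = "cball z0 R \<times> {0..1::real}"
  have "continuous_on ?K u" by (rule continuous_on_subset[OF u]) auto
  then have "uniformly_continuous_on ?K u"
    by (intro compact_uniformly_continuous compact_Times) auto
  then obtain d where d: "d > 0"
    "\<And>x y. x \<in> ?K \<Longrightarrow> y \<in> ?K \<Longrightarrow> dist x y < d \<Longrightarrow> dist (u x) (u y) < \<eta>"
    unfolding uniformly_continuous_on_def using assms(2) by metis
  show ?thesis
  proof (intro exI[of _ "min (d / 2) 1"] conjI ballI)
    fix z t assume "z \<in> cball z0 R" "t \<in> {0..min (d / 2) 1}"
    then show "\<bar>u (z, t) - u (z, 0)\<bar> \<le> \<eta>"
      using d(2)[of "(z, t)" "(z, 0)"] d(1) by (auto simp: dist_Pair_Pair dist_real_def)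
  qed (use d in auto)
qed

lemma continuous_bounded_on_box:
  fixes u :: "'a::euclidean_space \<times> real \<Rightarrow> real"
  assumes u: "continuous_on (UNIV \<times> {0..}) u"
  shows "\<exists>C. \<forall>z\<in>cball z0 R. \<forall>t\<in>{0..T}. \<bar>u (z, t)\<bar> \<le> C"
proof -
  let ?K = "cball z0 R \<times> {0..T}"
  have "continuous_on ?K u" by (rule continuous_on_subset[OF u]) auto
  then have "compact (u ` ?K)" by (intro compact_continuous_image compact_Times) auto
  then obtain C where "\<forall>x\<in>u ` ?K. norm x \<le> C" using compact_imp_bounded bounded_iff by metis
  then show ?thesis by (intro exI[of _ C]) auto
qed

text \<open>Constant families over a trivial index turn the family version into a comparison of two
  functions. Initial data matter only on the ball of radius R; the strict cone condition leaves room
  for a smaller \<rho>, and the error \<mu> is arbitrary.\<close>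

lemma local_comparison:
  fixes H :: "'a::euclidean_space \<Rightarrow> 'a \<Rightarrow> real" and u w :: "'a \<times> real \<Rightarrow> real"
  assumes reg: "regular_hamiltonian A H"
    and sub: "touching_subsolution H u" and sup: "touching_supersolution H w"
    and cont: "continuous_on (UNIV \<times> {0..}) u" "continuous_on (UNIV \<times> {0..}) w"
    and le: "\<And>z. norm (z - z0) \<le> R \<Longrightarrow> u (z, 0) \<le> w (z, 0)"
    and R: "R > 0" and t: "0 \<le> t" and cone: "(norm (z - z0))\<^sup>2 + 2 * A * R * t < R\<^sup>2"
  shows "u (z, t) \<le> w (z, t)"
proof (rule field_le_epsilon)
  fix \<mu> :: real assume \<mu>: "\<mu> > 0"
  have A: "A > 0" using reg by (simp add: regular_hamiltonian_def)
  define S where "S = (norm (z - z0))\<^sup>2 + 2 * A * R * t"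
  \<comment> \<open>The square of \<rho> lies halfway between the value S of the cone function at
    (z, t) and the square of R.\<close>
  define \<rho> where "\<rho> = sqrt ((S + R\<^sup>2) / 2)"
  have S0: "S \<ge> 0" unfolding S_def using A R t by simp
  have S: "S < R\<^sup>2" using cone by (simp add: S_def)
  have \<rho>2: "\<rho>\<^sup>2 = (S + R\<^sup>2) / 2" using S0 by (simp add: \<rho>_def)
  have \<rho>: "0 < \<rho>" unfolding \<rho>_def using S0 R by (simp add: add_nonneg_pos)
  have "\<rho>\<^sup>2 < R\<^sup>2" using \<rho>2 S by simp
  then have \<rho>R: "\<rho> < R" using R power_less_imp_less_base[of \<rho> 2 R] by simp
  obtain C1 where C1: "\<forall>z\<in>cball z0 R. \<forall>t\<in>{0..R / (2 * A)}. \<bar>u (z, t)\<bar> \<le> C1"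
    using continuous_bounded_on_box[OF cont(1)] by metis
  obtain C2 where C2: "\<forall>z\<in>cball z0 R. \<forall>t\<in>{0..R / (2 * A)}. \<bar>w (z, t)\<bar> \<le> C2"
    using continuous_bounded_on_box[OF cont(2)] by metis
  have le': "u (z, 0) \<le> w (z, 0)" if "z \<in> cball z0 R" for z
    using le[of z] that by (simp add: dist_norm norm_minus_commute)
  have "\<forall>\<^sub>F k in (top :: unit filter). \<forall>z t. 0 \<le> t \<longrightarrow> (norm (z - z0))\<^sup>2 + 2 * A * R * t \<le> \<rho>\<^sup>2 \<longrightarrow>
           u (z, t) \<le> w (z, t) + \<mu>"
  proof (rule approx_comparison[OF reg _ _ _ _ _ _ _ \<rho> \<rho>R \<mu>, of top "\<lambda>_. u" "\<lambda>_. w" z0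
            "max C1 C2" "\<lambda>z. w (z, 0)"])
    show "continuous_on (cball z0 R) (\<lambda>z. w (z, 0))"
      by (rule continuous_on_compose2[OF cont(2)]) (auto intro!: continuous_intros)
    fix \<eta> :: real assume "\<eta> > 0"
    then obtain s1 s2 where
      s1: "s1 > 0" "\<forall>z\<in>cball z0 R. \<forall>t\<in>{0..s1}. \<bar>u (z, t) - u (z, 0)\<bar> \<le> \<eta>" and
      s2: "s2 > 0" "\<forall>z\<in>cball z0 R. \<forall>t\<in>{0..s2}. \<bar>w (z, t) - w (z, 0)\<bar> \<le> \<eta>"
      using continuous_near_initial[OF cont(1)] continuous_near_initial[OF cont(2)] by metis
    show "\<exists>s>0. \<forall>\<^sub>F k in top. \<forall>z\<in>cball z0 R. \<forall>t\<in>{0..s}. u (z, t) \<le> w (z, 0) + \<eta> \<and> w (z, t) \<ge> w (z, 0) - \<eta>"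
    proof (intro exI[of _ "min s1 s2"] conjI always_eventually allI ballI)
      fix z t assume z: "z \<in> cball z0 R" and t: "t \<in> {0..min s1 s2}"
      have "\<bar>u (z, t) - u (z, 0)\<bar> \<le> \<eta>" "\<bar>w (z, t) - w (z, 0)\<bar> \<le> \<eta>"
        using s1 s2 z t by auto
      then show "u (z, t) \<le> w (z, 0) + \<eta>" "w (z, t) \<ge> w (z, 0) - \<eta>" using le'[OF z] by linarith+
    qed (use s1 s2 in auto)
  next
    show "\<forall>\<^sub>F k in top. \<forall>z\<in>cball z0 R. \<forall>t\<in>{0..R / (2 * A)}. \<bar>u (z, t)\<bar> \<le> max C1 C2 \<and> \<bar>w (z, t)\<bar> \<le> max C1 C2"
      using C1 C2 by (intro always_eventually) (auto simp: le_max_iff_disj)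
  qed (use cont sub sup in \<open>auto intro: approx_subsolution_touching approx_supersolution_touching\<close>)
  then show "u (z, t) \<le> w (z, t) + \<mu>"
    using t S \<rho>2 unfolding S_def by (auto simp: eventually_top)
qed

section \<open>Classical and viscosity solutions satisfy the paraboloid tests\<close>

lemma touches_above_has_derivative:
  fixes u :: "'b::euclidean_space \<Rightarrow> real"
  assumes u: "(u has_derivative u') (at q)" and t: "touches_above u q P C r" and r: "r > 0"
  shows "u' h = P \<bullet> h"
proof -
  let ?g = "\<lambda>x. u x - P \<bullet> (x - q) - C * ((x - q) \<bullet> (x - q))"
  have "(?g has_derivative (\<lambda>h. u' h - P \<bullet> h)) (at q)"
    by (rule derivative_eq_intros u refl | simp)+
  moreover have "\<forall>y\<in>ball q r. ?g y \<le> ?g q"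
  proof
    fix y assume "y \<in> ball q r"
    then have "y \<in> cball q r" by simp
    then show "?g y \<le> ?g q" using t unfolding touches_above_def
      by (auto simp: power2_norm_eq_inner algebra_simps)
  qed
  ultimately have "(\<lambda>h. u' h - P \<bullet> h) = (\<lambda>h. 0)"
    using r by (intro differential_zero_maxmin[of q "ball q r" ?g]) auto
  then show ?thesis by (metis eq_iff_diff_eq_0)
qed

text \<open>At a point of differentiability every touching paraboloid has the gradient as its slope,
  so only the classical inequality is left to check.\<close>

lemma classical_touching_subsolution:
  assumes "\<And>q. 0 < snd q \<Longrightarrow> (u has_derivative (\<lambda>h. P q \<bullet> h)) (at q)"
    and "\<And>q. 0 < snd q \<Longrightarrow> snd (P q) + H (fst q) (fst (P q)) \<le> 0"
  shows "touching_subsolution H u"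
  unfolding touching_subsolution_def
proof (intro allI impI)
  fix q P' C and r :: real
  assume q: "0 < snd q" "0 < r" "touches_above u q P' C r"
  have "P q \<bullet> h = P' \<bullet> h" for h
    using touches_above_has_derivative[OF assms(1)[OF q(1)] q(3,2)] .
  then have "P' = P q" by (metis vector_eq_rdot)
  then show "snd P' + H (fst q) (fst P') \<le> 0" using assms(2)[OF q(1)] by simp
qed

lemma classical_touching_supersolution:
  assumes "\<And>q. 0 < snd q \<Longrightarrow> (w has_derivative (\<lambda>h. P q \<bullet> h)) (at q)"
    and "\<And>q. 0 < snd q \<Longrightarrow> snd (P q) + H (fst q) (fst (P q)) \<ge> 0"
  shows "touching_supersolution H w"
  unfolding touching_supersolution_def
proof (rule classical_touching_subsolution[where P = "\<lambda>q. - P q"])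
  fix q :: "'a \<times> real" assume q: "0 < snd q"
  show "((\<lambda>q. - w q) has_derivative (\<lambda>h. - P q \<bullet> h)) (at q)"
    using has_derivative_minus[OF assms(1)[OF q]] by simp
  show "snd (- P q) + dual_hamiltonian H (fst q) (fst (- P q)) \<le> 0"
    using assms(2)[OF q] by (simp add: dual_hamiltonian_def)
qed

text \<open>The paraboloid is itself an admissible test function; \<open>\<phi>\<close> omits its
  additive constant, which cancels in the test inequality.\<close>

lemma viscosity_touching_subsolution:
  assumes "viscosity_subsolution H u"
  shows "touching_subsolution H u"
  unfolding touching_subsolution_def
proof (intro allI impI)
  fix q1 P C and r :: real
  assume q1: "0 < snd q1" "0 < r" "touches_above u q1 P C r"
  define \<phi> where "\<phi> q = P \<bullet> q + C * ((q - q1) \<bullet> (q - q1))" for q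
  define D\<phi> where "D\<phi> q = fst P + (2 * C) *\<^sub>R (fst q - fst q1)" for q :: "'a \<times> real"
  define \<phi>t where "\<phi>t q = snd P + (2 * C) * (snd q - snd q1)" for q :: "'a \<times> real"
  have "(\<phi> has_derivative (\<lambda>(h, s). D\<phi> q \<bullet> h + \<phi>t q * s)) (at q)" for q
    unfolding \<phi>_def
    by (rule derivative_eq_intros refl | simp)+
       (auto simp: fun_eq_iff D\<phi>_def \<phi>t_def inner_prod_def inner_add_left inner_commute algebra_simps)
  then have "C1_test_function \<phi> D\<phi> \<phi>t"
    unfolding C1_test_function_def by (auto intro!: continuous_intros simp: D\<phi>_def[abs_def] \<phi>t_def[abs_def])
  moreover have "\<forall>\<^sub>F q in nhds (fst q1, snd q1). u q - \<phi> q \<le> u (fst q1, snd q1) - \<phi> (fst q1, snd q1)"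
    unfolding eventually_nhds_metric
  proof (intro exI[of _ r] conjI allI impI)
    fix q assume "dist q (fst q1, snd q1) < r"
    then have "q \<in> cball q1 r" by (simp add: dist_commute)
    then show "u q - \<phi> q \<le> u (fst q1, snd q1) - \<phi> (fst q1, snd q1)"
      using q1(3) unfolding touches_above_def \<phi>_def
      by (auto simp: power2_norm_eq_inner algebra_simps)
  qed (use q1 in auto)
  ultimately have "\<phi>t (fst q1, snd q1) + H (fst q1) (D\<phi> (fst q1, snd q1)) \<le> 0"
    using assms q1 unfolding viscosity_subsolution_def by blast
  then show "snd P + H (fst q1) (fst P) \<le> 0" by (simp add: D\<phi>_def \<phi>t_def)
qed

lemma C1_test_function_minus:
  assumes "C1_test_function \<phi> D\<phi> \<phi>t"
  shows "C1_test_function (\<lambda>q. - \<phi> q) (\<lambda>q. - D\<phi> q) (\<lambda>q. - \<phi>t q)"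
proof -
  have "((\<lambda>q. - \<phi> q) has_derivative (\<lambda>(h, s). - D\<phi> q \<bullet> h + - \<phi>t q * s)) (at q)"
    if "q \<in> UNIV \<times> {0<..}" for q
  proof -
    have "(\<phi> has_derivative (\<lambda>(h, s). D\<phi> q \<bullet> h + \<phi>t q * s)) (at q)"
      using assms that unfolding C1_test_function_def by blast
    from has_derivative_minus[OF this] show ?thesis by (simp add: case_prod_beta' algebra_simps)
  qed
  then show ?thesis using assms unfolding C1_test_function_def
    by (auto intro!: continuous_intros)
qed

lemma viscosity_supersolution_dual:
  "viscosity_supersolution H u \<longleftrightarrow> viscosity_subsolution (dual_hamiltonian H) (\<lambda>q. - u q)"
proof
  assume u: "viscosity_supersolution H u"
  show "viscosity_subsolution (dual_hamiltonian H) (\<lambda>q. - u q)"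
    unfolding viscosity_subsolution_def
  proof (intro allI impI)
    fix \<phi> D\<phi> \<phi>t z and t :: real
    assume *: "C1_test_function \<phi> D\<phi> \<phi>t" "0 < t"
      "\<forall>\<^sub>F q in nhds (z, t). - u q - \<phi> q \<le> - u (z, t) - \<phi> (z, t)"
    have "\<forall>\<^sub>F q in nhds (z, t). u q - - \<phi> q \<ge> u (z, t) - - \<phi> (z, t)"
      using *(3) by eventually_elim linarith
    then have "- \<phi>t (z, t) + H z (- D\<phi> (z, t)) \<ge> 0"
      using u C1_test_function_minus[OF *(1)] *(2) unfolding viscosity_supersolution_def by blast
    then show "\<phi>t (z, t) + dual_hamiltonian H z (D\<phi> (z, t)) \<le> 0"
      by (simp add: dual_hamiltonian_def)
  qed
next
  assume u: "viscosity_subsolution (dual_hamiltonian H) (\<lambda>q. - u q)"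
  show "viscosity_supersolution H u"
    unfolding viscosity_supersolution_def
  proof (intro allI impI)
    fix \<phi> D\<phi> \<phi>t z and t :: real
    assume *: "C1_test_function \<phi> D\<phi> \<phi>t" "0 < t"
      "\<forall>\<^sub>F q in nhds (z, t). u q - \<phi> q \<ge> u (z, t) - \<phi> (z, t)"
    have "\<forall>\<^sub>F q in nhds (z, t). - u q - - \<phi> q \<le> - u (z, t) - - \<phi> (z, t)"
      using *(3) by eventually_elim linarith
    then have "- \<phi>t (z, t) + dual_hamiltonian H z (- D\<phi> (z, t)) \<le> 0"
      using u C1_test_function_minus[OF *(1)] *(2) unfolding viscosity_subsolution_def by blast
    then show "\<phi>t (z, t) + H z (D\<phi> (z, t)) \<ge> 0"
      by (simp add: dual_hamiltonian_def)
  qed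
qed

lemma viscosity_touching_supersolution:
  "viscosity_supersolution H u \<Longrightarrow> touching_supersolution H u"
  unfolding viscosity_supersolution_dual touching_supersolution_def
  by (rule viscosity_touching_subsolution)

section \<open>Stability under locally uniform limits\<close>

lemma regular_hamiltonian_continuous:
  assumes reg: "regular_hamiltonian A H" and \<eta>: "\<eta> > 0"
  shows "\<exists>\<delta>>0. \<forall>z p. norm (z - z0) \<le> \<delta> \<longrightarrow> norm (p - p0) \<le> \<delta> \<longrightarrow> \<bar>H z p - H z0 p0\<bar> \<le> \<eta>"
proof -
  have A: "A > 0" using reg by (simp add: regular_hamiltonian_def)
  obtain B0 where B0: "\<forall>z z' p. norm z \<le> norm z0 + 1 \<longrightarrow> norm z' \<le> norm z0 + 1 \<longrightarrow>
        \<bar>H z p - H z' p\<bar> \<le> B0 * norm (z - z') * (1 + norm p)"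
    using reg unfolding regular_hamiltonian_def by meson
  define B where "B = max B0 1 * (2 + norm p0) + A"
  have Bpos: "B > 0" unfolding B_def using A by (intro add_nonneg_pos) auto
  show ?thesis
  proof (intro exI[of _ "min 1 (\<eta> / B)"] conjI allI impI)
    fix z p assume z: "norm (z - z0) \<le> min 1 (\<eta> / B)" and p: "norm (p - p0) \<le> min 1 (\<eta> / B)"
    have np: "1 + norm p \<le> 2 + norm p0" using p norm_triangle_ineq2[of p p0] by auto
    have nz: "norm z \<le> norm z0 + 1" using z norm_triangle_ineq2[of z z0] by auto
    have "\<bar>H z p - H z0 p\<bar> \<le> B0 * norm (z - z0) * (1 + norm p)" using B0 nz by simp
    also have "\<dots> \<le> max B0 1 * norm (z - z0) * (2 + norm p0)"
      using np by (intro mult_mono) auto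
    also have "\<dots> \<le> max B0 1 * (2 + norm p0) * (\<eta> / B)"
    proof -
      have "max B0 1 * (2 + norm p0) * norm (z - z0) \<le> max B0 1 * (2 + norm p0) * (\<eta> / B)"
        using z by (intro mult_left_mono) auto
      then show ?thesis by (simp add: mult_ac)
    qed
    finally have 1: "\<bar>H z p - H z0 p\<bar> \<le> max B0 1 * (2 + norm p0) * (\<eta> / B)" .
    have "\<bar>H z0 p - H z0 p0\<bar> \<le> A * norm (p - p0)"
      using reg unfolding regular_hamiltonian_def by blast
    also have "\<dots> \<le> A * (\<eta> / B)" using A p by (intro mult_left_mono) auto
    finally have "\<bar>H z p - H z0 p0\<bar> \<le> max B0 1 * (2 + norm p0) * (\<eta> / B) + A * (\<eta> / B)"
      using 1 by linarith
    also have "\<dots> = (max B0 1 * (2 + norm p0) + A) * (\<eta> / B)" by (rule distrib_right[symmetric])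
    also have "\<dots> = B * (\<eta> / B)" by (simp only: B_def)
    also have "\<dots> = \<eta>" using Bpos by simp
    finally show "\<bar>H z p - H z0 p0\<bar> \<le> \<eta>" .
  qed (use \<eta> Bpos in auto)
qed

text \<open>A C1 test function need not admit touching paraboloids, so doubling separates it from
  \<open>u k\<close>. In \<open>u k q1 - \<phi> q2\<close> with quadratic coupling, maximality in q1
  yields a paraboloid above \<open>u k\<close>, and criticality in q2 identifies its slope with the
  gradient of \<phi> up to a small error. The approximate inequality then contradicts a positive
  value \<theta> at the limit point.\<close>

lemma approx_limit_viscosity_subsolution:
  fixes H :: "'a::euclidean_space \<Rightarrow> 'a \<Rightarrow> real" and u :: "'i \<Rightarrow> 'a \<times> real \<Rightarrow> real"
  assumes reg: "regular_hamiltonian A H" and F: "F \<noteq> bot"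
    and sub: "approx_subsolution H F u"
    and cont: "\<And>k. continuous_on (UNIV \<times> {0..}) (u k)"
    and lim: "\<And>K. compact K \<Longrightarrow> K \<subseteq> UNIV \<times> {0..} \<Longrightarrow> uniform_limit K u U F"
  shows "viscosity_subsolution H U"
  unfolding viscosity_subsolution_def
proof (intro allI impI, rule ccontr)
  fix \<phi> D\<phi> \<phi>t z and t :: real
  assume test: "C1_test_function \<phi> D\<phi> \<phi>t" and t: "0 < t"
    and mx: "\<forall>\<^sub>F q in nhds (z, t). U q - \<phi> q \<le> U (z, t) - \<phi> (z, t)"
    and neg: "\<not> \<phi>t (z, t) + H z (D\<phi> (z, t)) \<le> 0"
  define q0 where "q0 = (z, t)"
  define G where "G q = (D\<phi> q, \<phi>t q)" for q
  define \<theta> where "\<theta> = \<phi>t q0 + H z (D\<phi> q0)"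
  have \<theta>: "\<theta> > 0" using neg by (simp add: \<theta>_def q0_def)
  obtain r0 where r0: "r0 > 0" "\<And>q. dist q q0 < r0 \<Longrightarrow> U q - \<phi> q \<le> U q0 - \<phi> q0"
    using mx unfolding q0_def[symmetric] eventually_nhds_metric by auto
  obtain \<delta> where \<delta>: "\<delta> > 0"
    "\<And>z' p. norm (z' - z) \<le> \<delta> \<Longrightarrow> norm (p - D\<phi> q0) \<le> \<delta> \<Longrightarrow> \<bar>H z' p - H z (D\<phi> q0)\<bar> \<le> \<theta> / 4"
    using regular_hamiltonian_continuous[OF reg, of "\<theta> / 4" z "D\<phi> q0"] \<theta> by auto
  define m where "m = min (\<delta> / 2) (\<theta> / 8)"
  have m: "m > 0" "2 * m \<le> \<delta>" "2 * m \<le> \<theta> / 4" using \<delta> \<theta> by (auto simp: m_def)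
  have contG: "continuous_on (UNIV \<times> {0<..}) G"
    using test unfolding C1_test_function_def G_def by (auto intro!: continuous_intros)
  have der: "(\<phi> has_derivative (\<lambda>h. G q \<bullet> h)) (at q)" if "0 < snd q" for q
  proof -
    have "(\<phi> has_derivative (\<lambda>(h, s). D\<phi> q \<bullet> h + \<phi>t q * s)) (at q)"
      using test that unfolding C1_test_function_def by (metis UNIV_I greaterThan_iff mem_Times_iff)
    moreover have "(\<lambda>(h, s). D\<phi> q \<bullet> h + \<phi>t q * s) = (\<lambda>h. G q \<bullet> h)"
      by (auto simp: fun_eq_iff G_def)
    ultimately show ?thesis by simp
  qed
  have "isCont G q0"
    using contG t unfolding q0_def
    by (subst (asm) continuous_on_eq_continuous_at) (auto simp: open_Times)
  then obtain r1 where r1: "r1 > 0" "\<And>q. dist q q0 < r1 \<Longrightarrow> dist (G q) (G q0) < m"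
    using m unfolding continuous_at_eps_delta by metis
  define r where "r = min (min (r0 / 2) (r1 / 2)) (min (t / 2) \<delta>)"
  have r: "r > 0" "r < r0" "r < r1" "r \<le> t / 2" "r \<le> \<delta>" using r0 r1 t \<delta> by (auto simp: r_def)
  define B where "B = cball q0 r"
  have compB: "compact B" by (simp add: B_def)
  have Bt: "t / 2 \<le> snd q" if "q \<in> B" for q
  proof -
    have "norm (q - q0) \<le> r" using that by (simp add: B_def dist_norm norm_minus_commute)
    then have "\<bar>snd q - t\<bar> \<le> r" using norm_snd_le_norm[of "q - q0"] by (simp add: q0_def)
    then show ?thesis using r by linarith
  qed
  have Bsub: "B \<subseteq> UNIV \<times> {0..}" using Bt t by (auto simp: mem_Times_iff) (smt (verit) half_gt_zero snd_conv)
  have cont\<phi>: "continuous_on B \<phi>"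
  proof (rule continuous_at_imp_continuous_on, rule ballI)
    fix q assume "q \<in> B"
    then have "0 < snd q" using Bt[of q] t by linarith
    then show "isCont \<phi> q" using der has_derivative_continuous by blast
  qed
  \<comment> \<open>The localization term makes the maximum strict; within distance r of
    \<open>q0\<close> it changes the slope by at most m.\<close>
  define b where "b = m / (2 * r)"
  have b: "b > 0" using m r by (simp add: b_def)
  have "uniformly_continuous_on B \<phi>" using cont\<phi> compB by (rule compact_uniformly_continuous)
  then obtain \<delta>2' where \<delta>2': "\<delta>2' > 0"
    "\<And>x y. x \<in> B \<Longrightarrow> y \<in> B \<Longrightarrow> dist x y < \<delta>2' \<Longrightarrow> dist (\<phi> x) (\<phi> y) < b * r\<^sup>2 / 32"
    unfolding uniformly_continuous_on_def using b r by (metis divide_pos_pos mult_pos_pos zero_less_numeral zero_less_power)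
  define \<delta>2 where "\<delta>2 = min (\<delta>2' / 2) (r / 4)"
  have \<delta>2: "\<delta>2 > 0" "\<delta>2 < \<delta>2'" "\<delta>2 \<le> r / 4" using \<delta>2' r by (auto simp: \<delta>2_def)
  have "compact (\<phi> ` B)" using cont\<phi> compB by (rule compact_continuous_image)
  then obtain M where M: "\<And>q. q \<in> B \<Longrightarrow> \<bar>\<phi> q\<bar> \<le> M"
    using compact_imp_bounded bounded_iff by (metis image_eqI real_norm_def)
  have q0B: "q0 \<in> B" using r by (simp add: B_def)
  have M0: "M \<ge> 0" using M[OF q0B] by linarith
  define \<kappa> where "\<kappa> = b * r\<^sup>2 / 64"
  have \<kappa>: "\<kappa> > 0" using b r by (simp add: \<kappa>_def)
  \<comment> \<open>Coupling strong enough to bring q1 and q2 within \<open>\<delta>2\<close>, where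
    \<phi> varies by less than \<open>b * r\<^sup>2 / 32\<close>. It is fixed before k, so the
    opening is uniform.\<close>
  define a where "a = (2 * M + 2 * \<kappa>) / \<delta>2\<^sup>2"
  have a: "a > 0" using M0 \<kappa> \<delta>2 by (simp add: a_def)
  define CC where "CC = norm (G q0) + 2 * m + a + norm q0 + r"
  have CC: "CC > 0" using m a r by (simp add: CC_def add_nonneg_pos)
  define \<eta> where "\<eta> = min (\<theta> / 4) (min (t / 4) (r / 2))"
  have \<eta>: "\<eta> > 0" "\<eta> \<le> \<theta> / 4" "\<eta> \<le> t / 4" "\<eta> \<le> r / 2" using \<theta> t r by (auto simp: \<eta>_def)
  have "\<forall>\<^sub>F k in F. False"
    using uniform_limitD[OF lim[OF compB Bsub] \<kappa>] approx_subsolutionD[OF sub CC \<eta>(1)]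
  proof eventually_elim
    case (elim k)
    define f where "f x = u k (fst x) - \<phi> (snd x) - a * (norm (fst x - snd x))\<^sup>2 - b * (norm (snd x - q0))\<^sup>2" for x
    have "continuous_on B (u k)" using cont Bsub continuous_on_subset by blast
    then have "continuous_on (B \<times> B) (\<lambda>x. u k (fst x))" "continuous_on (B \<times> B) (\<lambda>x. \<phi> (snd x))"
      using cont\<phi> by (auto intro!: continuous_on_compose2[of B "u k"] continuous_on_compose2[of B \<phi>]
             continuous_on_fst continuous_on_snd continuous_on_id)
    then have "continuous_on (B \<times> B) f" unfolding f_def by (intro continuous_intros)
    then obtain q1 q2 where q12: "q1 \<in> B" "q2 \<in> B" and fmax: "\<And>x y. x \<in> B \<Longrightarrow> y \<in> B \<Longrightarrow> f (x, y) \<le> f (q1, q2)"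
    proof -
      have "B \<times> B \<noteq> {}" using q0B by auto
      then obtain x where "x \<in> B \<times> B" "\<forall>y\<in>B \<times> B. f y \<le> f x"
        using continuous_attains_sup[OF compact_Times[OF compB compB] _ \<open>continuous_on (B \<times> B) f\<close>] by blast
      then show thesis using that[of "fst x" "snd x"] by auto
    qed
    define N where "N = norm (q1 - q2)"
    have u0: "\<bar>u k q - U q\<bar> < \<kappa>" if "q \<in> B" for q using elim(1) that by (simp add: dist_real_def)
    have "U q1 - \<phi> q1 \<le> U q0 - \<phi> q0"
      using r0(2)[of q1] q12 r by (simp add: B_def dist_commute)
    moreover have "f (q0, q0) \<le> f (q1, q2)" using fmax q0B by blast
    ultimately have main: "a * N\<^sup>2 + b * (norm (q2 - q0))\<^sup>2 \<le> \<phi> q1 - \<phi> q2 + 2 * \<kappa>"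
      using u0[OF q0B] u0[OF q12(1)] unfolding f_def N_def by simp
    have "0 \<le> b * (norm (q2 - q0))\<^sup>2" using b by simp
    then have "a * N\<^sup>2 \<le> 2 * M + 2 * \<kappa>" using main M[OF q12(1)] M[OF q12(2)] by linarith
    also have "\<dots> = a * \<delta>2\<^sup>2" using \<delta>2 by (simp add: a_def)
    finally have "N\<^sup>2 \<le> \<delta>2\<^sup>2" using a by simp
    then have N: "N \<le> \<delta>2" using \<delta>2 by (simp add: power2_le_iff_abs_le N_def)
    then have "dist (\<phi> q1) (\<phi> q2) < b * r\<^sup>2 / 32"
      using \<delta>2'(2)[OF q12] \<delta>2 by (simp add: N_def dist_norm)
    moreover have "0 \<le> a * N\<^sup>2" using a by simp
    moreover have "b * (r / 4)\<^sup>2 = b * r\<^sup>2 / 32 + 2 * \<kappa>" by (simp add: \<kappa>_def power2_eq_square)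
    ultimately have "b * (norm (q2 - q0))\<^sup>2 \<le> b * (r / 4)\<^sup>2"
      using main unfolding dist_real_def by linarith
    then have "norm (q2 - q0) \<le> r / 4" using b r by (simp add: power2_le_iff_abs_le)
    then have nq2: "norm (q2 - q0) \<le> r / 2" "norm (q2 - q0) < r" using r by linarith+
    have nq1: "norm (q1 - q0) \<le> r / 2"
      using norm_triangle_ineq[of "q1 - q2" "q2 - q0"] N \<delta>2 \<open>norm (q2 - q0) \<le> r / 4\<close> by (simp add: N_def)
    define P where "P = (2 * a) *\<^sub>R (q1 - q2)"
    \<comment> \<open>First-order condition in the second variable: it equates the coupling slope
      \<open>P\<close> with the gradient of \<phi> plus that of the localization.\<close>
    have "(\<lambda>h. - (G q2 \<bullet> h) + P \<bullet> h - (2 * b) * ((q2 - q0) \<bullet> h)) = (\<lambda>h. 0)"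
    proof (rule differential_zero_maxmin[of q2 "ball q0 r" "\<lambda>y. - \<phi> y - a * ((q1 - y) \<bullet> (q1 - y)) - b * ((y - q0) \<bullet> (y - q0))"])
      show "q2 \<in> ball q0 r" using nq2 by (simp add: dist_norm norm_minus_commute)
      have "0 < snd q2" using Bt[OF q12(2)] t by linarith
      then show "((\<lambda>y. - \<phi> y - a * ((q1 - y) \<bullet> (q1 - y)) - b * ((y - q0) \<bullet> (y - q0))) has_derivative
          (\<lambda>h. - (G q2 \<bullet> h) + P \<bullet> h - (2 * b) * ((q2 - q0) \<bullet> h))) (at q2)"
      proof -
        assume "0 < snd q2"
        have n1: "((\<lambda>y. (q1 - y) \<bullet> (q1 - y)) has_derivative (\<lambda>h. - 2 * ((q1 - q2) \<bullet> h))) (at q2)"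
          by (auto intro!: derivative_eq_intros simp: inner_commute)
        have n2: "((\<lambda>y. (y - q0) \<bullet> (y - q0)) has_derivative (\<lambda>h. 2 * ((q2 - q0) \<bullet> h))) (at q2)"
          by (auto intro!: derivative_eq_intros simp: inner_commute)
        show ?thesis
          by (rule has_derivative_eq_rhs, rule has_derivative_diff[OF has_derivative_diff[OF
                has_derivative_minus[OF der[OF \<open>0 < snd q2\<close>]] has_derivative_mult_right[OF n1]]
                has_derivative_mult_right[OF n2]])
             (simp add: fun_eq_iff P_def)
      qed
      show "(\<forall>y\<in>ball q0 r. - \<phi> y - a * ((q1 - y) \<bullet> (q1 - y)) - b * ((y - q0) \<bullet> (y - q0))
           \<le> - \<phi> q2 - a * ((q1 - q2) \<bullet> (q1 - q2)) - b * ((q2 - q0) \<bullet> (q2 - q0))) \<or>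
        (\<forall>y\<in>ball q0 r. - \<phi> q2 - a * ((q1 - q2) \<bullet> (q1 - q2)) - b * ((q2 - q0) \<bullet> (q2 - q0))
           \<le> - \<phi> y - a * ((q1 - y) \<bullet> (q1 - y)) - b * ((y - q0) \<bullet> (y - q0)))"
      proof (rule disjI1, rule ballI)
        fix y assume "y \<in> ball q0 r"
        then have "f (q1, y) \<le> f (q1, q2)" using fmax q12 by (simp add: B_def)
        then show "- \<phi> y - a * ((q1 - y) \<bullet> (q1 - y)) - b * ((y - q0) \<bullet> (y - q0))
           \<le> - \<phi> q2 - a * ((q1 - q2) \<bullet> (q1 - q2)) - b * ((q2 - q0) \<bullet> (q2 - q0))"
          by (simp add: f_def power2_norm_eq_inner)
      qed
    qed auto
    then have "P \<bullet> h = (G q2 + (2 * b) *\<^sub>R (q2 - q0)) \<bullet> h" for h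
      by (drule_tac fun_cong[where x = h]) (simp add: inner_add_left)
    then have P: "P = G q2 + (2 * b) *\<^sub>R (q2 - q0)" by (metis vector_eq_rdot)
    have "norm (P - G q0) \<le> norm (G q2 - G q0) + norm ((2 * b) *\<^sub>R (q2 - q0))"
      unfolding P using norm_triangle_ineq[of "G q2 - G q0" "(2 * b) *\<^sub>R (q2 - q0)"] by (simp add: algebra_simps)
    also have "norm (G q2 - G q0) \<le> m"
      using r1(2)[of q2] q12 r unfolding dist_norm[symmetric] by (simp add: B_def dist_commute)
    also have "norm ((2 * b) *\<^sub>R (q2 - q0)) \<le> m"
    proof -
      have "2 * b * norm (q2 - q0) \<le> 2 * b * r" using b nq2 by simp
      also have "\<dots> = m" using r by (simp add: b_def)
      finally show ?thesis using b by simp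
    qed
    finally have PG: "norm (P - G q0) \<le> 2 * m" by simp
    have PGs: "norm (fst P - D\<phi> q0) \<le> 2 * m" "\<bar>snd P - \<phi>t q0\<bar> \<le> 2 * m"
      using PG norm_fst_le_norm[of "P - G q0"] norm_snd_le_norm[of "P - G q0"] by (auto simp: G_def)
    have "touches_above (u k) q1 P CC \<eta>"
      unfolding touches_above_def
    proof
      fix q assume "q \<in> cball q1 \<eta>"
      then have "norm (q - q0) \<le> r"
        using norm_triangle_ineq[of "q - q1" "q1 - q0"] nq1 \<eta> by (simp add: dist_norm norm_minus_commute)
      then have "q \<in> B" by (simp add: B_def dist_norm norm_minus_commute)
      then have "f (q, q2) \<le> f (q1, q2)" using fmax q12 by blast
      then have "u k q \<le> u k q1 + a * ((norm (q - q2))\<^sup>2 - (norm (q1 - q2))\<^sup>2)"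
        by (simp add: f_def algebra_simps)
      also have "(norm (q - q2))\<^sup>2 = (norm (q1 - q2))\<^sup>2 + 2 * ((q1 - q2) \<bullet> (q - q1)) + (norm (q - q1))\<^sup>2"
      proof -
        have "q - q2 = (q1 - q2) + (q - q1)" by simp
        then show ?thesis by (simp only: power2_norm_eq_inner inner_add_left inner_add_right)
            (simp add: inner_commute)
      qed
      also have "u k q1 + a * (\<dots> - (norm (q1 - q2))\<^sup>2) = u k q1 + P \<bullet> (q - q1) + a * (norm (q - q1))\<^sup>2"
        by (simp add: P_def algebra_simps)
      also have "\<dots> \<le> u k q1 + P \<bullet> (q - q1) + CC * (norm (q - q1))\<^sup>2"
        using m r unfolding CC_def by (intro add_left_mono mult_right_mono) auto
      finally show "u k q \<le> u k q1 + P \<bullet> (q - q1) + CC * (norm (q - q1))\<^sup>2" .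
    qed
    moreover have "norm q1 \<le> CC"
    proof -
      have "norm q1 \<le> norm (q1 - q0) + norm q0" using norm_triangle_ineq[of "q1 - q0" q0] by simp
      then show ?thesis using nq1 m a r norm_ge_zero[of "G q0"] unfolding CC_def by linarith
    qed
    moreover have "norm P \<le> CC"
    proof -
      have "norm P \<le> norm (G q0) + 2 * m" using PG norm_triangle_ineq[of "P - G q0" "G q0"] by simp
      then show ?thesis using a r norm_ge_zero[of q0] unfolding CC_def by linarith
    qed
    moreover have "\<eta> \<le> snd q1" using Bt[OF q12(1)] \<eta> t by linarith
    ultimately have "snd P + H (fst q1) (fst P) \<le> \<eta>" using elim(2) by blast
    moreover have "norm (fst q1 - z) \<le> \<delta>"
      using norm_fst_le_norm[of "q1 - q0"] nq1 r by (simp add: q0_def)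
    then have "\<bar>H (fst q1) (fst P) - H z (D\<phi> q0)\<bar> \<le> \<theta> / 4"
      using PGs m by (intro \<delta>(2)) auto
    moreover have "\<theta> = \<phi>t q0 + H z (D\<phi> q0)" by (simp add: \<theta>_def)
    ultimately show False using PGs(2) m(3) \<eta>(2) \<theta> by argo
  qed
  then show False using F by (simp add: eventually_False)
qed

section \<open>Growth bounds by paraboloids and global comparison\<close>

lemma approx_subsolution_compose:
  assumes "approx_subsolution H F u" "filterlim f F G"
  shows "approx_subsolution H G (\<lambda>k. u (f k))"
  unfolding approx_subsolution_def
proof (intro allI impI)
  fix C \<eta> :: real assume "C > 0" "\<eta> > 0"
  from approx_subsolutionD[OF assms(1) this] assms(2)
  show "\<forall>\<^sub>F k in G. \<forall>q P. norm q \<le> C \<longrightarrow> \<eta> \<le> snd q \<longrightarrow> norm P \<le> C \<longrightarrow>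
          touches_above (u (f k)) q P C \<eta> \<longrightarrow> snd P + H (fst q) (fst P) \<le> \<eta>"
    unfolding filterlim_iff by blast
qed

text \<open>The right-hand side is an explicit supersolution that starts, at t + \<delta> = 0, from
  the paraboloid above g. Ranging over all such paraboloids encodes a one-sided attainment of the
  initial data and a growth bound at once; \<delta> is a time lag that absorbs the mesh of the
  scheme.\<close>

definition parabola_bounded :: "('a::euclidean_space \<Rightarrow> real) \<Rightarrow> 'i filter \<Rightarrow> ('i \<Rightarrow> 'a \<times> real \<Rightarrow> real) \<Rightarrow> bool" where
  "parabola_bounded g F u \<longleftrightarrow> (\<exists>L\<ge>0. \<forall>\<delta>>0. \<forall>\<^sub>F k in F. \<forall>a K z0 z t. 0 \<le> K \<longrightarrow>
     (\<forall>y. g y \<le> a + K * (norm (y - z0))\<^sup>2) \<longrightarrow> 0 \<le> t \<longrightarrow>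
     u k (z, t) \<le> a + K * (exp (L * (t + \<delta>)) * (1 + (norm (z - z0))\<^sup>2) - 1))"

lemma parabola_bounded_compose:
  assumes "parabola_bounded g F u" "filterlim f F G"
  shows "parabola_bounded g G (\<lambda>k. u (f k))"
  using assms unfolding parabola_bounded_def filterlim_iff by meson

text \<open>Walking from z to y in n steps of length at most d costs at most
  \<open>n * \<eta>\<close>. At distance s d with s > 1 one can take n \<le> s + 1 \<le> 2 s s,
  which turns the linear cost into a quadratic one.\<close>

lemma uniformly_continuous_quadratic_bound:
  fixes g :: "'a::real_normed_vector \<Rightarrow> real"
  assumes g: "uniformly_continuous_on UNIV g" and \<eta>: "\<eta> > 0"
  shows "\<exists>K\<ge>0. \<forall>y z. \<bar>g y - g z\<bar> \<le> \<eta> + K * (norm (y - z))\<^sup>2"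
proof -
  obtain d' where d': "d' > 0" "\<And>x y. dist x y < d' \<Longrightarrow> dist (g x) (g y) < \<eta>"
    using g \<eta> unfolding uniformly_continuous_on_def by (metis UNIV_I)
  define d where "d = d' / 2"
  have d: "d > 0" "\<And>x y. dist x y \<le> d \<Longrightarrow> \<bar>g x - g y\<bar> \<le> \<eta>"
    using d' unfolding d_def by (auto simp: dist_real_def) (smt (verit) field_sum_of_halves)
  have chain: "\<bar>g y - g z\<bar> \<le> n * \<eta>" if "norm (y - z) \<le> n * d" for n :: nat and y z
    using that
  proof (induction n arbitrary: y)
    case 0 then show ?case by simp
  next
    case (Suc n)
    \<comment> \<open>The last intermediate point of n + 1 equal steps from z to y.\<close>
    define x where "x = z + (n / (n + 1)) *\<^sub>R (y - z)"
    have "norm (x - z) = n / (n + 1) * norm (y - z)" by (simp add: x_def)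
    also have "\<dots> \<le> n / (n + 1) * (Suc n * d)" using Suc.prems by (intro mult_left_mono) auto
    also have "\<dots> = n * d" by (simp add: field_simps)
    finally have 1: "\<bar>g x - g z\<bar> \<le> n * \<eta>" by (rule Suc.IH)
    have "y - x = (1 / (n + 1)) *\<^sub>R (y - z)"
    proof -
      have "y - x = (1 - n / (n + 1)) *\<^sub>R (y - z)" unfolding x_def by (simp add: algebra_simps)
      also have "1 - n / (n + 1) = 1 / (n + 1)" by (simp add: field_simps)
      finally show ?thesis by (simp add: add.commute)
    qed
    then have "norm (y - x) = 1 / (n + 1) * norm (y - z)" by simp
    also have "\<dots> \<le> 1 / (n + 1) * (Suc n * d)" using Suc.prems by (intro mult_left_mono) auto
    also have "\<dots> = d" by simp
    finally have "\<bar>g y - g x\<bar> \<le> \<eta>" using d(2) by (simp add: dist_norm)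
    then show ?case using 1 by (simp add: algebra_simps)
  qed
  show ?thesis
  proof (intro exI[of _ "2 * \<eta> / d\<^sup>2"] conjI allI)
    fix y z
    show "\<bar>g y - g z\<bar> \<le> \<eta> + 2 * \<eta> / d\<^sup>2 * (norm (y - z))\<^sup>2"
    proof (cases "norm (y - z) \<le> d")
      case True
      then have "\<bar>g y - g z\<bar> \<le> \<eta>" using d(2) by (simp add: dist_norm)
      moreover have "0 \<le> 2 * \<eta> / d\<^sup>2 * (norm (y - z))\<^sup>2" using \<eta> by simp
      ultimately show ?thesis by linarith
    next
      case False
      define s where "s = norm (y - z) / d"
      have s: "s > 1" using False d by (simp add: s_def)
      define n where "n = nat \<lceil>s\<rceil>"
      have n: "s \<le> n" "n \<le> s + 1" using s unfolding n_def by linarith+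
      have "norm (y - z) \<le> n * d" using n d by (simp add: s_def field_simps)
      then have "\<bar>g y - g z\<bar> \<le> n * \<eta>" by (rule chain)
      also have "\<dots> \<le> (2 * (s * s)) * \<eta>"
      proof -
        have "1 * s \<le> s * s" using s by (intro mult_right_mono) auto
        then have "real n \<le> 2 * (s * s)" using n s by linarith
        then show ?thesis using \<eta> by (intro mult_right_mono) auto
      qed
      also have "\<dots> = 2 * \<eta> / d\<^sup>2 * (norm (y - z))\<^sup>2" by (simp add: s_def power2_eq_square)
      finally show ?thesis using \<eta> by linarith
    qed
  qed (use \<eta> in auto)
qed

text \<open>Every z carries a paraboloid above g with vertex value \<open>g z + \<eta> / 2\<close>
  and a common opening K. The associated supersolution rises at z by less than \<eta> / 2 up to a
  time that depends only on K, L and \<eta>.\<close>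

lemma parabola_bounded_init:
  assumes g: "uniformly_continuous_on UNIV g" and u: "parabola_bounded g F u" and \<eta>: "\<eta> > 0"
  shows "\<exists>s>0. \<forall>\<^sub>F k in F. \<forall>z. \<forall>t\<in>{0..s}. u k (z, t) \<le> g z + \<eta>"
proof -
  obtain K where K: "K \<ge> 0" "\<And>y z. \<bar>g y - g z\<bar> \<le> \<eta> / 2 + K * (norm (y - z))\<^sup>2"
    using uniformly_continuous_quadratic_bound[OF g, of "\<eta> / 2"] \<eta> by auto
  obtain L where L: "L \<ge> 0" and ev: "\<And>\<delta>. \<delta> > 0 \<Longrightarrow> \<forall>\<^sub>F k in F. \<forall>a K z0 z t. 0 \<le> K \<longrightarrow>
     (\<forall>y. g y \<le> a + K * (norm (y - z0))\<^sup>2) \<longrightarrow> 0 \<le> t \<longrightarrow>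
     u k (z, t) \<le> a + K * (exp (L * (t + \<delta>)) * (1 + (norm (z - z0))\<^sup>2) - 1)"
    using u unfolding parabola_bounded_def by meson
  have "((\<lambda>s. K * (exp (L * (s + s)) - 1)) \<longlongrightarrow> K * (exp (L * (0 + 0)) - 1)) (at_right 0)"
    by (intro tendsto_intros)
  then have "\<forall>\<^sub>F s in at_right 0. K * (exp (L * (s + s)) - 1) < \<eta> / 2"
    using \<eta> by (intro order_tendstoD) auto
  then obtain s where s: "s > 0" "K * (exp (L * (s + s)) - 1) < \<eta> / 2"
    by (metis (mono_tags, lifting) eventually_at_right_field dense)
  show ?thesis
  proof (intro exI[of _ s] conjI)
    show "\<forall>\<^sub>F k in F. \<forall>z. \<forall>t\<in>{0..s}. u k (z, t) \<le> g z + \<eta>"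
      using ev[OF s(1)]
    proof eventually_elim
      case (elim k)
      show ?case
      proof (intro allI ballI)
        fix z t assume t: "t \<in> {0..s}"
        have "g y \<le> (g z + \<eta> / 2) + K * (norm (y - z))\<^sup>2" for y using K(2)[of y z] by linarith
        then have "u k (z, t) \<le> (g z + \<eta> / 2) + K * (exp (L * (t + s)) * (1 + (norm (z - z))\<^sup>2) - 1)"
          using elim K(1) t by (metis atLeastAtMost_iff)
        also have "\<dots> \<le> (g z + \<eta> / 2) + K * (exp (L * (s + s)) - 1)"
          using t L K(1) by (auto intro!: mult_left_mono)
        finally show "u k (z, t) \<le> g z + \<eta>" using s(2) by linarith
      qed
    qed
  qed (use s in auto)
qed

lemma parabola_bounded_box:
  assumes g: "uniformly_continuous_on UNIV g" and u: "parabola_bounded g F u"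
  shows "\<exists>C. \<forall>\<^sub>F k in F. \<forall>z\<in>cball 0 R. \<forall>t\<in>{0..T}. u k (z, t) \<le> C"
proof -
  obtain K where K: "K \<ge> 0" "\<And>y z. \<bar>g y - g z\<bar> \<le> 1 + K * (norm (y - z))\<^sup>2"
    using uniformly_continuous_quadratic_bound[OF g, of 1] by auto
  obtain L where L: "L \<ge> 0" and ev: "\<And>\<delta>. \<delta> > 0 \<Longrightarrow> \<forall>\<^sub>F k in F. \<forall>a K z0 z t. 0 \<le> K \<longrightarrow>
     (\<forall>y. g y \<le> a + K * (norm (y - z0))\<^sup>2) \<longrightarrow> 0 \<le> t \<longrightarrow>
     u k (z, t) \<le> a + K * (exp (L * (t + \<delta>)) * (1 + (norm (z - z0))\<^sup>2) - 1)"
    using u unfolding parabola_bounded_def by meson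
  show ?thesis
  proof (intro exI)
    show "\<forall>\<^sub>F k in F. \<forall>z\<in>cball 0 R. \<forall>t\<in>{0..T}. u k (z, t) \<le> (g 0 + 1) + K * (exp (L * (T + 1)) * (1 + R\<^sup>2) - 1)"
      using ev[OF zero_less_one]
    proof eventually_elim
      case (elim k)
      show ?case
      proof (intro ballI)
        fix z t assume z: "z \<in> cball (0::'a) R" and t: "t \<in> {0..T}"
        have "g y \<le> (g 0 + 1) + K * (norm (y - 0))\<^sup>2" for y using K(2)[of y 0] by linarith
        then have "u k (z, t) \<le> (g 0 + 1) + K * (exp (L * (t + 1)) * (1 + (norm (z - 0))\<^sup>2) - 1)"
          using elim K(1) t by (metis atLeastAtMost_iff)
        also have "\<dots> \<le> (g 0 + 1) + K * (exp (L * (T + 1)) * (1 + R\<^sup>2) - 1)"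
          using t L K(1) z by (intro add_left_mono mult_left_mono diff_right_mono mult_mono)
            (auto intro!: mult_left_mono power_mono)
        finally show "u k (z, t) \<le> (g 0 + 1) + K * (exp (L * (T + 1)) * (1 + R\<^sup>2) - 1)" .
      qed
    qed
  qed
qed

text \<open>The two paraboloid bounds supply the initial condition and one-sided bounds on boxes,
  and \<open>low\<close> supplies the opposite sides. A compact set lies in the cone over a large
  ball, so the local comparison applies with \<rho> = R / 2.\<close>

lemma global_approx_comparison:
  fixes H :: "'a::euclidean_space \<Rightarrow> 'a \<Rightarrow> real" and u w :: "'i \<Rightarrow> 'a \<times> real \<Rightarrow> real"
  assumes reg: "regular_hamiltonian A H" and g: "uniformly_continuous_on UNIV g"
    and sub: "approx_subsolution H F u" and sup: "approx_supersolution H F w"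
    and cont: "\<And>k. continuous_on (UNIV \<times> {0..}) (u k)" "\<And>k. continuous_on (UNIV \<times> {0..}) (w k)"
    and ini: "parabola_bounded g F u" "parabola_bounded (\<lambda>z. - g z) F (\<lambda>k q. - w k q)"
    and low: "\<And>R T. \<exists>C. \<forall>\<^sub>F k in F. \<forall>z\<in>cball 0 R. \<forall>t\<in>{0..T}. - C \<le> u k (z, t) \<and> w k (z, t) \<le> C"
    and K: "compact K" "K \<subseteq> UNIV \<times> {0..}" and \<mu>: "\<mu> > 0"
  shows "\<forall>\<^sub>F k in F. \<forall>q\<in>K. u k q \<le> w k q + \<mu>"
proof -
  have A: "A > 0" using reg by (simp add: regular_hamiltonian_def)
  obtain r where r: "\<And>q. q \<in> K \<Longrightarrow> norm q \<le> r" "r > 0"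
    using compact_imp_bounded[OF K(1)] by (metis bounded_pos)
  \<comment> \<open>With this R the square of R / 2 equals 2 A R r + r R + R / 4, which dominates
    the cone function at all points of norm at most r.\<close>
  define R where "R = 8 * A * r + 4 * r + 1"
  have R: "R > 0" "r \<le> R" "4 * r \<le> R" using A r by (auto simp: R_def intro!: add_pos_pos)
  have g': "uniformly_continuous_on UNIV (\<lambda>z. - g z)"
    using uniformly_continuous_on_minus[OF g] by simp
  have cone: "(norm (z - 0))\<^sup>2 + 2 * A * R * t \<le> (R / 2)\<^sup>2" if "(z, t) \<in> K" for z t
  proof -
    have 1: "norm z \<le> r" "\<bar>t\<bar> \<le> r"
      using r(1)[OF that] norm_fst_le_norm[of "(z, t)"] norm_snd_le_norm[of "(z, t)"] by auto
    have "(norm z)\<^sup>2 \<le> r * R" using 1 R r by (auto simp: power2_eq_square intro!: mult_mono)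
    moreover have "2 * A * R * t \<le> 2 * A * R * r" using 1 A R by (intro mult_left_mono) auto
    moreover have "R * R = R * (8 * A * r + 4 * r + 1)" by (simp only: R_def)
    moreover have "R * (8 * A * r + 4 * r + 1) = 8 * (A * R * r) + 4 * (r * R) + R"
      by (simp add: algebra_simps)
    moreover have "(R / 2)\<^sup>2 = R * R / 4" by (simp add: power2_eq_square)
    ultimately have "(norm z)\<^sup>2 + 2 * A * R * t \<le> (R / 2)\<^sup>2" using R(1) by linarith
    then show ?thesis by simp
  qed
  have "\<forall>\<^sub>F k in F. \<forall>z t. 0 \<le> t \<longrightarrow> (norm (z - 0))\<^sup>2 + 2 * A * R * t \<le> (R / 2)\<^sup>2 \<longrightarrow> u k (z, t) \<le> w k (z, t) + \<mu>"
  proof -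
    obtain C1 where C1: "\<forall>\<^sub>F k in F. \<forall>z\<in>cball 0 R. \<forall>t\<in>{0..R / (2 * A)}. u k (z, t) \<le> C1"
      using parabola_bounded_box[OF g ini(1)] by blast
    obtain C2 where C2: "\<forall>\<^sub>F k in F. \<forall>z\<in>cball 0 R. \<forall>t\<in>{0..R / (2 * A)}. - w k (z, t) \<le> C2"
      using parabola_bounded_box[OF g' ini(2)] by blast
    obtain C3 where C3: "\<forall>\<^sub>F k in F. \<forall>z\<in>cball 0 R. \<forall>t\<in>{0..R / (2 * A)}. - C3 \<le> u k (z, t) \<and> w k (z, t) \<le> C3"
      using low[of R "R / (2 * A)"] by blast
    define C where "C = max (max C1 C2) C3"
    show ?thesis
    proof (rule approx_comparison[OF reg sub sup cont])
      show "\<forall>\<^sub>F k in F. \<forall>z\<in>cball 0 R. \<forall>t\<in>{0..R / (2 * A)}. \<bar>u k (z, t)\<bar> \<le> C \<and> \<bar>w k (z, t)\<bar> \<le> C"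
        using C1 C2 C3
      proof eventually_elim
        case (elim k)
        show ?case
        proof (intro ballI)
          fix z t assume "z \<in> cball (0::'a) R" "t \<in> {0..R / (2 * A)}"
          then have "u k (z, t) \<le> C1" "- w k (z, t) \<le> C2" "- C3 \<le> u k (z, t)" "w k (z, t) \<le> C3"
            using elim by blast+
          then show "\<bar>u k (z, t)\<bar> \<le> C \<and> \<bar>w k (z, t)\<bar> \<le> C" unfolding C_def by linarith
        qed
      qed
      show "continuous_on (cball 0 R) g"
        using g uniformly_continuous_imp_continuous continuous_on_subset by blast
      fix \<eta> :: real assume "\<eta> > 0"
      obtain s1 where s1: "s1 > 0" "\<forall>\<^sub>F k in F. \<forall>z. \<forall>t\<in>{0..s1}. u k (z, t) \<le> g z + \<eta>"
        using parabola_bounded_init[OF g ini(1) \<open>\<eta> > 0\<close>] by blast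
      obtain s2 where s2: "s2 > 0" "\<forall>\<^sub>F k in F. \<forall>z. \<forall>t\<in>{0..s2}. - w k (z, t) \<le> - g z + \<eta>"
        using parabola_bounded_init[OF g' ini(2) \<open>\<eta> > 0\<close>] by blast
      show "\<exists>s>0. \<forall>\<^sub>F k in F. \<forall>z\<in>cball 0 R. \<forall>t\<in>{0..s}. u k (z, t) \<le> g z + \<eta> \<and> w k (z, t) \<ge> g z - \<eta>"
      proof (intro exI[of _ "min s1 s2"] conjI)
        show "\<forall>\<^sub>F k in F. \<forall>z\<in>cball 0 R. \<forall>t\<in>{0..min s1 s2}. u k (z, t) \<le> g z + \<eta> \<and> w k (z, t) \<ge> g z - \<eta>"
          using s1(2) s2(2)
        proof eventually_elim
          case (elim k)
          show ?case
          proof (intro ballI)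
            fix z t assume "t \<in> {0..min s1 s2}"
            then have "t \<in> {0..s1}" "t \<in> {0..s2}" by auto
            then have "u k (z, t) \<le> g z + \<eta>" "- w k (z, t) \<le> - g z + \<eta>" using elim by blast+
            then show "u k (z, t) \<le> g z + \<eta> \<and> w k (z, t) \<ge> g z - \<eta>" by linarith
          qed
        qed
      qed (use s1 s2 in auto)
    qed (use R \<mu> in auto)
  qed
  then show ?thesis
  proof eventually_elim
    case (elim k)
    show ?case
    proof
      fix q assume q: "q \<in> K"
      then have "0 \<le> snd q" using K(2) by (auto simp: mem_Times_iff)
      then show "u k q \<le> w k q + \<mu>" using elim cone[of "fst q" "snd q"] q by (metis prod.collapse)
    qed
  qed
qed

text \<open>For the function on the right the inequality 2 x \<le> 1 + x x, with x the distance to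
  z0, shows that A times the norm of its gradient is at most its time derivative. It is thus a
  classical supersolution starting from the given paraboloid.\<close>

lemma touching_subsolution_parabola_bound:
  fixes H :: "'a::euclidean_space \<Rightarrow> 'a \<Rightarrow> real"
  assumes reg: "regular_hamiltonian A H" and u: "touching_subsolution H u"
    and cont: "continuous_on (UNIV \<times> {0..}) u"
    and K: "0 \<le> K" and le: "\<And>y. u (y, 0) \<le> a + K * (norm (y - z0))\<^sup>2" and t: "0 \<le> t"
  shows "u (z, t) \<le> a + K * (exp (A * t) * (1 + (norm (z - z0))\<^sup>2) - 1)"
proof -
  have A: "A > 0" using reg by (simp add: regular_hamiltonian_def)
  define w where "w q = a + K * (exp (A * snd q) * (1 + (fst q - z0) \<bullet> (fst q - z0)) - 1)" for q :: "'a \<times> real"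
  define P where "P q = ((2 * K * exp (A * snd q)) *\<^sub>R (fst q - z0),
      K * (A * exp (A * snd q) * (1 + (fst q - z0) \<bullet> (fst q - z0))))" for q :: "'a \<times> real"
  \<comment> \<open>Large enough for (z, t) to lie in the domain of dependence of the ball around
    z0.\<close>
  define R where "R = norm (z - z0) + 2 * A * t + 1"
  have "u (z, t) \<le> w (z, t)"
  proof (rule local_comparison[OF reg u])
    show "touching_supersolution H w"
    proof (rule classical_touching_supersolution[where P = P])
      fix q :: "'a \<times> real"
      show "(w has_derivative (\<lambda>h. P q \<bullet> h)) (at q)"
      proof -
        have e: "((\<lambda>q. exp (A * snd q)) has_derivative (\<lambda>h. exp (A * snd q) * (A * snd h))) (at q)"
          by (auto intro!: derivative_eq_intros)
        have n: "((\<lambda>q. 1 + (fst q - z0) \<bullet> (fst q - z0)) has_derivative (\<lambda>h. 2 * ((fst q - z0) \<bullet> fst h))) (at q)"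
          by (auto intro!: derivative_eq_intros simp: inner_commute)
        have "(w has_derivative (\<lambda>h. K * (exp (A * snd q) * (2 * ((fst q - z0) \<bullet> fst h))
            + exp (A * snd q) * (A * snd h) * (1 + (fst q - z0) \<bullet> (fst q - z0))))) (at q)"
          unfolding w_def
          by (rule has_derivative_eq_rhs, rule has_derivative_add[OF has_derivative_const
              has_derivative_mult_right[OF has_derivative_diff[OF has_derivative_mult[OF e n] has_derivative_const]]])
             simp
        then show ?thesis
          by (rule has_derivative_eq_rhs) (simp add: fun_eq_iff P_def inner_prod_def distrib_left mult_ac)
      qed
      define n where "n = norm (fst q - z0)"
      have "\<bar>H (fst q) (fst (P q))\<bar> \<le> A * norm (fst (P q))" by (rule regular_hamiltonian_bound[OF reg])
      also have "\<dots> = A * K * exp (A * snd q) * (2 * n)" using K by (simp add: P_def n_def)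
      also have "\<dots> \<le> A * K * exp (A * snd q) * (1 + n\<^sup>2)"
        using A K sum_squares_bound[of 1 n] by (intro mult_left_mono) auto
      also have "\<dots> = snd (P q)" by (simp add: P_def n_def power2_norm_eq_inner)
      finally show "snd (P q) + H (fst q) (fst (P q)) \<ge> 0" by linarith
    qed
    show "continuous_on (UNIV \<times> {0..}) w" unfolding w_def by (intro continuous_intros)
    show "u (y, 0) \<le> w (y, 0)" for y
      using le[of y] by (simp add: w_def power2_norm_eq_inner)
    show "R > 0" using A t by (simp add: R_def add_nonneg_pos)
    show "continuous_on (UNIV \<times> {0..}) u" by (rule cont)
    have "(norm (z - z0))\<^sup>2 + 2 * A * R * t = norm (z - z0) * norm (z - z0) + 2 * A * t * R"
      by (simp add: power2_eq_square)
    also have "\<dots> \<le> norm (z - z0) * R + 2 * A * t * R"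
      using A t by (intro add_right_mono mult_left_mono) (auto simp: R_def)
    also have "\<dots> < R\<^sup>2" using \<open>R > 0\<close> by (simp add: R_def power2_eq_square algebra_simps)
    finally show "(norm (z - z0))\<^sup>2 + 2 * A * R * t < R\<^sup>2" .
  qed (use t in auto)
  then show ?thesis by (simp add: w_def power2_norm_eq_inner)
qed

lemma parabola_bounded_touching_subsolution:
  assumes reg: "\<forall>\<^sub>F k in F. regular_hamiltonian A (H k)" and u: "\<forall>\<^sub>F k in F. touching_subsolution (H k) (u k)"
    and cont: "\<forall>\<^sub>F k in F. continuous_on (UNIV \<times> {0..}) (u k)" and g: "\<forall>\<^sub>F k in F. \<forall>y. u k (y, 0) = g y" and A: "A > 0"
  shows "parabola_bounded g F u"
  unfolding parabola_bounded_def
proof (intro exI[of _ A] conjI allI impI)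
  fix \<delta> :: real assume \<delta>: "\<delta> > 0"
  show "\<forall>\<^sub>F k in F. \<forall>a K z0 z t. 0 \<le> K \<longrightarrow> (\<forall>y. g y \<le> a + K * (norm (y - z0))\<^sup>2) \<longrightarrow> 0 \<le> t \<longrightarrow>
     u k (z, t) \<le> a + K * (exp (A * (t + \<delta>)) * (1 + (norm (z - z0))\<^sup>2) - 1)"
    using reg u cont g
  proof eventually_elim
    case (elim k)
    show ?case
    proof (intro allI impI)
      fix a K z0 z and t :: real
      assume K: "0 \<le> K" and "\<forall>y. g y \<le> a + K * (norm (y - z0))\<^sup>2" and t: "0 \<le> t"
      then have "u k (z, t) \<le> a + K * (exp (A * t) * (1 + (norm (z - z0))\<^sup>2) - 1)"
        using elim by (intro touching_subsolution_parabola_bound[of A "H k"]) auto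
      also have "\<dots> \<le> a + K * (exp (A * (t + \<delta>)) * (1 + (norm (z - z0))\<^sup>2) - 1)"
        using K A \<delta> by (intro add_left_mono mult_left_mono diff_right_mono mult_right_mono) auto
      finally show "u k (z, t) \<le> a + K * (exp (A * (t + \<delta>)) * (1 + (norm (z - z0))\<^sup>2) - 1)" .
    qed
  qed
qed (use A in auto)

section \<open>Existence by the Lax--Friedrichs scheme\<close>

text \<open>The mesh width l satisfies h A / (2 l) = 1 / (2 DIM): the sensitivity of the Hamiltonian
  to a neighbour is exactly balanced by the weight of that neighbour in the average. The type
  argument carries the dimension.\<close>

definition lf_width :: "'a::euclidean_space itself \<Rightarrow> real \<Rightarrow> real \<Rightarrow> real" where
  "lf_width _ A h = real DIM('a) * A * h"

definition lf_step ::
    "real \<Rightarrow> ('a::euclidean_space \<Rightarrow> 'a \<Rightarrow> real) \<Rightarrow> real \<Rightarrow> ('a \<Rightarrow> real) \<Rightarrow> 'a \<Rightarrow> real" where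
  "lf_step A H h f z = (let l = lf_width TYPE('a) A h in
     (\<Sum>e\<in>Basis. f (z + l *\<^sub>R e) + f (z - l *\<^sub>R e)) / (2 * DIM('a)) -
     h * H z (\<Sum>e\<in>Basis. ((f (z + l *\<^sub>R e) - f (z - l *\<^sub>R e)) / (2 * l)) *\<^sub>R e))"

text \<open>Raising one neighbour raises the average with weight 1 / (2 DIM), while the term with
  the Hamiltonian moves by at most h A / (2 l) times the same amount; the choice of
  \<open>lf_width\<close> makes these equal.\<close>

lemma lf_step_mono:
  fixes H :: "'a::euclidean_space \<Rightarrow> 'a \<Rightarrow> real"
  assumes reg: "regular_hamiltonian A H" and h: "h > 0"
    and le: "\<And>y. norm (y - z) \<le> lf_width TYPE('a) A h \<Longrightarrow> f y \<le> f' y"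
  shows "lf_step A H h f z \<le> lf_step A H h f' z"
proof -
  define l where "l = lf_width TYPE('a) A h"
  have A: "A > 0" using reg by (simp add: regular_hamiltonian_def)
  have l: "l > 0" using A h by (simp add: l_def lf_width_def)
  define p where "p e = f' (z + l *\<^sub>R e) - f (z + l *\<^sub>R e)" for e
  define n where "n e = f' (z - l *\<^sub>R e) - f (z - l *\<^sub>R e)" for e
  have pn: "p e \<ge> 0" "n e \<ge> 0" if "e \<in> Basis" for e
    using le[of "z + l *\<^sub>R e"] le[of "z - l *\<^sub>R e"] that l by (auto simp: p_def n_def l_def[symmetric])
  define D where "D g = (\<Sum>e\<in>Basis. ((g (z + l *\<^sub>R e) - g (z - l *\<^sub>R e)) / (2 * l)) *\<^sub>R e)" for g :: "'a \<Rightarrow> real"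
  have "D f' - D f = (\<Sum>e\<in>Basis. ((p e - n e) / (2 * l)) *\<^sub>R e)"
    unfolding D_def sum_subtractf[symmetric] scaleR_diff_left[symmetric] diff_divide_distrib[symmetric]
    by (simp add: p_def n_def algebra_simps)
  also have "norm \<dots> \<le> (\<Sum>e\<in>(Basis::'a set). (p e + n e) / (2 * l))"
  proof (rule sum_norm_le)
    fix e :: 'a assume e: "e \<in> Basis"
    have "\<bar>p e - n e\<bar> \<le> p e + n e" using pn[OF e] by linarith
    then show "norm (((p e - n e) / (2 * l)) *\<^sub>R e) \<le> (p e + n e) / (2 * l)"
      using e l by (simp add: divide_right_mono)
  qed
  finally have "A * norm (D f' - D f) \<le> A * (\<Sum>e\<in>(Basis::'a set). (p e + n e) / (2 * l))"
    using A by (intro mult_left_mono) auto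
  moreover have "\<bar>H z (D f') - H z (D f)\<bar> \<le> A * norm (D f' - D f)"
    using reg unfolding regular_hamiltonian_def by blast
  ultimately have "\<bar>H z (D f') - H z (D f)\<bar> \<le> A * (\<Sum>e\<in>(Basis::'a set). (p e + n e) / (2 * l))"
    by linarith
  then have "h * (H z (D f') - H z (D f)) \<le> h * (A * (\<Sum>e\<in>(Basis::'a set). (p e + n e) / (2 * l)))"
    using h by (intro mult_left_mono) auto
  also have "\<dots> = (\<Sum>e\<in>(Basis::'a set). p e + n e) / (2 * DIM('a))"
    using A h by (simp add: l_def lf_width_def sum_divide_distrib[symmetric])
  also have "\<dots> = (\<Sum>e\<in>Basis. f' (z + l *\<^sub>R e) + f' (z - l *\<^sub>R e)) / (2 * DIM('a))
      - (\<Sum>e\<in>Basis. f (z + l *\<^sub>R e) + f (z - l *\<^sub>R e)) / (2 * DIM('a))"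
    unfolding diff_divide_distrib[symmetric] sum_subtractf[symmetric]
    by (simp add: p_def n_def algebra_simps)
  finally show ?thesis
    unfolding lf_step_def Let_def l_def[symmetric] D_def[symmetric] by (simp add: algebra_simps)
qed

text \<open>Central differences at z reproduce the slope p exactly, and averaging adds exactly C
  times the squared width. This is the consistency of the scheme, with an error of order h squared
  per step.\<close>

lemma lf_step_quadratic:
  fixes H :: "'a::euclidean_space \<Rightarrow> 'a \<Rightarrow> real"
  assumes "A > 0" "h > 0"
  shows "lf_step A H h (\<lambda>y. a + p \<bullet> (y - z) + C * (norm (y - z))\<^sup>2) z
     = a + C * (lf_width TYPE('a) A h)\<^sup>2 - h * H z p"
proof -
  define l where "l = lf_width TYPE('a) A h"
  have l: "l > 0" using assms by (simp add: l_def lf_width_def)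
  have "(\<Sum>e\<in>Basis. ((a + p \<bullet> (z + l *\<^sub>R e - z) + C * (norm (z + l *\<^sub>R e - z))\<^sup>2
      - (a + p \<bullet> (z - l *\<^sub>R e - z) + C * (norm (z - l *\<^sub>R e - z))\<^sup>2)) / (2 * l)) *\<^sub>R e)
      = (\<Sum>e\<in>Basis. (p \<bullet> e) *\<^sub>R e)"
    using l by (intro sum.cong) auto
  also have "\<dots> = p" by (rule euclidean_representation)
  finally have 1: "(\<Sum>e\<in>Basis. ((a + p \<bullet> (z + l *\<^sub>R e - z) + C * (norm (z + l *\<^sub>R e - z))\<^sup>2
      - (a + p \<bullet> (z - l *\<^sub>R e - z) + C * (norm (z - l *\<^sub>R e - z))\<^sup>2)) / (2 * l)) *\<^sub>R e) = p" .
  have "(\<Sum>e\<in>Basis. (a + p \<bullet> (z + l *\<^sub>R e - z) + C * (norm (z + l *\<^sub>R e - z))\<^sup>2)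
      + (a + p \<bullet> (z - l *\<^sub>R e - z) + C * (norm (z - l *\<^sub>R e - z))\<^sup>2)) = (\<Sum>e\<in>(Basis::'a set). 2 * (a + C * l\<^sup>2))"
    by (intro sum.cong) (auto simp: power_mult_distrib)
  then have 2: "(\<Sum>e\<in>Basis. (a + p \<bullet> (z + l *\<^sub>R e - z) + C * (norm (z + l *\<^sub>R e - z))\<^sup>2)
      + (a + p \<bullet> (z - l *\<^sub>R e - z) + C * (norm (z - l *\<^sub>R e - z))\<^sup>2)) / (2 * DIM('a)) = a + C * l\<^sup>2"
    by simp
  show ?thesis
    unfolding lf_step_def Let_def l_def[symmetric] 1 2 ..
qed

lemma lf_step_dual:
  "lf_step A (dual_hamiltonian H) h (\<lambda>y. - f y) z = - lf_step A H h f z"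
proof -
  have 1: "(\<Sum>e\<in>Basis. - f (z + l *\<^sub>R e) + - f (z - l *\<^sub>R e)) = - (\<Sum>e\<in>Basis. f (z + l *\<^sub>R e) + f (z - l *\<^sub>R e))" for l
    by (simp add: sum_negf[symmetric])
  have 2: "(\<Sum>e\<in>Basis. ((- f (z + l *\<^sub>R e) - - f (z - l *\<^sub>R e)) / (2 * l)) *\<^sub>R e)
     = - (\<Sum>e\<in>Basis. ((f (z + l *\<^sub>R e) - f (z - l *\<^sub>R e)) / (2 * l)) *\<^sub>R e)" for l
    unfolding sum_negf[symmetric] scaleR_minus_left[symmetric] minus_divide_left by simp
  show ?thesis
    unfolding lf_step_def Let_def 1 2 dual_hamiltonian_def by simp
qed

lemma regular_hamiltonian_continuous_on:
  assumes reg: "regular_hamiltonian A H"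
  shows "continuous_on UNIV (\<lambda>x. H (fst x) (snd x))"
  unfolding continuous_on_iff
proof (intro ballI allI impI)
  fix x and e :: real assume e: "0 < e"
  obtain d where d: "d > 0"
    "\<forall>z p. norm (z - fst x) \<le> d \<longrightarrow> norm (p - snd x) \<le> d \<longrightarrow> \<bar>H z p - H (fst x) (snd x)\<bar> \<le> e / 2"
    using regular_hamiltonian_continuous[OF reg, of "e / 2" "fst x" "snd x"] e by auto
  show "\<exists>d>0. \<forall>x'\<in>UNIV. dist x' x < d \<longrightarrow> dist (H (fst x') (snd x')) (H (fst x) (snd x)) < e"
  proof (intro exI[of _ d] conjI ballI impI)
    fix x' assume "dist x' x < d"
    then have "dist (fst x') (fst x) \<le> d" "dist (snd x') (snd x) \<le> d"
      using dist_fst_le[of x' x] dist_snd_le[of x' x] by linarith+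
    then have "\<bar>H (fst x') (snd x') - H (fst x) (snd x)\<bar> \<le> e / 2" using d by (simp add: dist_norm)
    then show "dist (H (fst x') (snd x')) (H (fst x) (snd x)) < e" using e by (simp add: dist_real_def)
  qed (use d in auto)
qed

lemma continuous_on_lf_step:
  fixes f :: "'b::topological_space \<Rightarrow> 'a::euclidean_space \<Rightarrow> real"
  assumes reg: "regular_hamiltonian A H"
    and f: "continuous_on (S \<times> UNIV) (\<lambda>x. f (fst x) (snd x))" and g: "continuous_on S g"
  shows "continuous_on S (\<lambda>x. lf_step A H h (f x) (g x))"
proof -
  have c: "continuous_on S (\<lambda>x. f x (k x))" if "continuous_on S k" for k
  proof -
    have "continuous_on S (\<lambda>x. (x, k x))" using that by (intro continuous_intros)
    from continuous_on_compose2[OF f this] have "continuous_on S (\<lambda>x. f (fst (x, k x)) (snd (x, k x)))" by blast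
    then show ?thesis by simp
  qed
  have H: "continuous_on S (\<lambda>x. H (g x) (k x))" if "continuous_on S k" for k
  proof -
    have "continuous_on S (\<lambda>x. (g x, k x))" using that g by (intro continuous_intros)
    from continuous_on_compose2[OF regular_hamiltonian_continuous_on[OF reg] this] show ?thesis by simp
  qed
  have cp: "continuous_on S (\<lambda>x. f x (g x + l *\<^sub>R e))" "continuous_on S (\<lambda>x. f x (g x - l *\<^sub>R e))" for l e
    using g by (auto intro!: c continuous_intros)
  show ?thesis
    unfolding lf_step_def Let_def divide_inverse
    by (intro continuous_on_diff continuous_on_mult continuous_on_sum continuous_on_add H
        continuous_on_scaleR continuous_on_const continuous_on_id cp)
qed

text \<open>Linear interpolation in time between the data and one full step, constant outside
  [0, h]. At t = h it agrees with the recursion, which makes the scheme continuous in t.\<close>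

definition lf_start ::
    "real \<Rightarrow> ('a::euclidean_space \<Rightarrow> 'a \<Rightarrow> real) \<Rightarrow> real \<Rightarrow> ('a \<Rightarrow> real) \<Rightarrow> 'a \<Rightarrow> real \<Rightarrow> real" where
  "lf_start A H h g z t = (let \<theta> = max 0 (min 1 (t / h)) in (1 - \<theta>) * g z + \<theta> * lf_step A H h g z)"

text \<open>The natural number is an available recursion depth, not a time level: a real time t is
  stepped back by h until it falls into the starting interval.\<close>

primrec lf_iter ::
    "real \<Rightarrow> ('a::euclidean_space \<Rightarrow> 'a \<Rightarrow> real) \<Rightarrow> real \<Rightarrow> ('a \<Rightarrow> real) \<Rightarrow> nat \<Rightarrow> 'a \<Rightarrow> real \<Rightarrow> real" where
  "lf_iter A H h g 0 = lf_start A H h g"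
| "lf_iter A H h g (Suc n) = (\<lambda>z t. if t \<le> h then lf_start A H h g z t
     else lf_step A H h (\<lambda>y. lf_iter A H h g n y (t - h)) z)"

definition lf_solution ::
    "real \<Rightarrow> ('a::euclidean_space \<Rightarrow> 'a \<Rightarrow> real) \<Rightarrow> real \<Rightarrow> ('a \<Rightarrow> real) \<Rightarrow> 'a \<times> real \<Rightarrow> real" where
  "lf_solution A H h g q = lf_iter A H h g (nat \<lceil>snd q / h\<rceil>) (fst q) (snd q)"

lemma lf_iter_initial [simp]: "h > 0 \<Longrightarrow> t \<le> 0 \<Longrightarrow> lf_iter A H h g n z t = g z"
proof -
  assume h: "h > 0" and t: "t \<le> 0"
  then have "t / h \<le> 0" by (simp add: divide_nonpos_pos)
  then have "max 0 (min 1 (t / h)) = 0" by auto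
  then show ?thesis using h t by (cases n) (auto simp: Let_def lf_start_def)
qed

text \<open>Up to time (n + 1) h the recursion reaches the starting interval within depth n, so
  additional depth changes nothing. Hence \<open>lf_solution\<close> agrees locally with one fixed
  \<open>lf_iter\<close>.\<close>

lemma lf_iter_Suc_eq:
  assumes h: "h > 0" and t: "t \<le> (real n + 1) * h"
  shows "lf_iter A H h g (Suc n) z t = lf_iter A H h g n z t"
  using t
proof (induction n arbitrary: z t)
  case 0 then show ?case by simp
next
  case (Suc n)
  have "t - h \<le> (real n + 1) * h" using Suc.prems by (simp add: algebra_simps)
  then have "(\<lambda>y. lf_iter A H h g (Suc n) y (t - h)) = (\<lambda>y. lf_iter A H h g n y (t - h))"
    using Suc.IH by blast
  then show ?case by (subst lf_iter.simps(2), subst (2) lf_iter.simps(2)) (simp only: )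
qed

lemma lf_iter_eq:
  assumes h: "h > 0" and t: "t \<le> (real n + 1) * h" and nm: "n \<le> m"
  shows "lf_iter A H h g m z t = lf_iter A H h g n z t"
  using nm
proof (induction m rule: dec_induct)
  case base then show ?case by simp
next
  case (step m)
  have "t \<le> (real m + 1) * h"
    using t step h by (meson add_right_mono mult_right_mono of_nat_mono order_trans less_imp_le)
  then show ?case using lf_iter_Suc_eq[OF h] step.IH by metis
qed

lemma lf_solution_eq:
  assumes h: "h > 0" and t: "snd q \<le> (real n + 1) * h"
  shows "lf_solution A H h g q = lf_iter A H h g n (fst q) (snd q)"
proof -
  define m where "m = nat \<lceil>snd q / h\<rceil>"
  have "snd q / h \<le> m" unfolding m_def by linarith
  then have "snd q \<le> m * h" using h by (simp add: field_simps)
  then have m: "snd q \<le> (real m + 1) * h" using h by (simp add: algebra_simps)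
  show ?thesis
    unfolding lf_solution_def m_def[symmetric]
    using lf_iter_eq[OF h m, of "max m n" A H g "fst q"] lf_iter_eq[OF h t, of "max m n" A H g "fst q"] by simp
qed

lemma lf_solution_step:
  assumes h: "h > 0" and t: "h < t"
  shows "lf_solution A H h g (z, t) = lf_step A H h (\<lambda>y. lf_solution A H h g (y, t - h)) z"
proof -
  define n where "n = nat \<lceil>t / h\<rceil>"
  have "t / h \<le> n" unfolding n_def by linarith
  then have n: "t \<le> n * h" using h by (simp add: field_simps)
  have "lf_solution A H h g (z, t) = lf_iter A H h g (Suc n) z t"
    using lf_solution_eq[OF h, of "(z, t)" "Suc n"] n h by (simp add: algebra_simps)
  also have "\<dots> = lf_step A H h (\<lambda>y. lf_iter A H h g n y (t - h)) z" using t by simp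
  also have "(\<lambda>y. lf_iter A H h g n y (t - h)) = (\<lambda>y. lf_solution A H h g (y, t - h))"
  proof
    fix y
    have "t - h \<le> (real n + 1) * h" using n h by (simp add: algebra_simps)
    then show "lf_iter A H h g n y (t - h) = lf_solution A H h g (y, t - h)"
      using lf_solution_eq[OF h, of "(y, t - h)" n] by simp
  qed
  finally show ?thesis .
qed

lemma continuous_on_lf_iter:
  assumes reg: "regular_hamiltonian A H" and h: "h > 0" and g: "continuous_on UNIV g"
  shows "continuous_on UNIV (\<lambda>q. lf_iter A H h g n (fst q) (snd q))"
proof (induction n)
  case 0
  have "continuous_on UNIV (\<lambda>q::'a \<times> real. lf_step A H h g (fst q))"
    by (rule continuous_on_lf_step[OF reg])
       (auto intro!: continuous_intros continuous_on_compose2[OF g])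
  then show ?case using h
    by (auto simp: Let_def lf_start_def intro!: continuous_intros continuous_on_compose2[OF g])
next
  case (Suc n)
  have 0: "continuous_on UNIV (\<lambda>q. lf_start A H h g (fst q) (snd q))"
  proof -
    have "continuous_on UNIV (\<lambda>q::'a \<times> real. lf_step A H h g (fst q))"
      by (rule continuous_on_lf_step[OF reg])
         (auto intro!: continuous_intros continuous_on_compose2[OF g])
    then show ?thesis using h
      by (auto simp: Let_def lf_start_def intro!: continuous_intros continuous_on_compose2[OF g])
  qed
  have 1: "continuous_on UNIV (\<lambda>q. lf_step A H h (\<lambda>y. lf_iter A H h g n y (snd q - h)) (fst q))"
    by (rule continuous_on_lf_step[OF reg])
       (auto intro!: continuous_intros continuous_on_compose2[OF Suc, where f = "\<lambda>x. (snd x, snd (fst x) - h)", simplified])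
  have U: "UNIV = {q::'a \<times> real. snd q \<le> h} \<union> {q. h \<le> snd q}" by auto
  have "continuous_on ({q::'a \<times> real. snd q \<le> h} \<union> {q. h \<le> snd q})
     (\<lambda>q. if snd q \<le> h then lf_start A H h g (fst q) (snd q)
        else lf_step A H h (\<lambda>y. lf_iter A H h g n y (snd q - h)) (fst q))"
  proof (rule continuous_on_cases)
    show "closed {q::'a \<times> real. snd q \<le> h}" "closed {q::'a \<times> real. h \<le> snd q}"
      by (auto intro!: closed_Collect_le continuous_intros)
    show "\<forall>x. x \<in> {q. snd q \<le> h} \<and> \<not> snd x \<le> h \<or> x \<in> {q. h \<le> snd q} \<and> snd x \<le> h \<longrightarrow>
        lf_start A H h g (fst x) (snd x) = lf_step A H h (\<lambda>y. lf_iter A H h g n y (snd x - h)) (fst x)"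
      using h by (auto simp: Let_def lf_start_def)
  qed (use 0 1 in \<open>auto intro: continuous_on_subset\<close>)
  then show ?case unfolding U[symmetric] by simp
qed

lemma continuous_on_lf_solution:
  assumes reg: "regular_hamiltonian A H" and h: "h > 0" and g: "continuous_on UNIV g"
  shows "continuous_on S (lf_solution A H h g)"
proof (rule continuous_at_imp_continuous_on, rule ballI)
  fix q :: "'a \<times> real"
  define n where "n = nat \<lceil>snd q / h\<rceil>"
  have "snd q / h \<le> n" unfolding n_def by linarith
  then have n: "snd q < (real n + 1) * h" using h by (simp add: field_simps)
  have "isCont (\<lambda>q. lf_iter A H h g n (fst q) (snd q)) q"
    using continuous_on_lf_iter[OF reg h g] continuous_on_eq_continuous_at open_UNIV by blast
  moreover have "\<forall>\<^sub>F x in nhds q. lf_solution A H h g x = lf_iter A H h g n (fst x) (snd x)"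
  proof -
    have "open {x::'a \<times> real. snd x < (real n + 1) * h}"
      by (intro open_Collect_less continuous_intros)
    then have "\<forall>\<^sub>F x in nhds q. x \<in> {x. snd x < (real n + 1) * h}"
      using n by (intro eventually_nhds_in_open) auto
    then show ?thesis by eventually_elim (auto intro!: lf_solution_eq[OF h])
  qed
  ultimately show "isCont (lf_solution A H h g) q" by (simp add: isCont_cong)
qed

lemma lf_iter_dual:
  "lf_iter A (dual_hamiltonian H) h (\<lambda>y. - g y) n z t = - lf_iter A H h g n z t"
proof (induction n arbitrary: z t)
  case 0 show ?case by (simp add: Let_def lf_start_def lf_step_dual)
next
  case (Suc n)
  show ?case by (simp add: Let_def lf_start_def lf_step_dual Suc)
qed

lemma lf_solution_dual:
  "lf_solution A (dual_hamiltonian H) h (\<lambda>y. - g y) q = - lf_solution A H h g q"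
  by (simp add: lf_solution_def lf_iter_dual)

text \<open>One step maps the growth function at time s below the one at time s + h. Averaging
  contributes the square of \<open>lf_width\<close>, which is at most linear in h for h \<le> 1 and
  explains the second summand of L. The lag h in the conclusion stems from the starting interval,
  where part of a full step enters before time h.\<close>

lemma lf_iter_parabola_bound:
  fixes H :: "'a::euclidean_space \<Rightarrow> 'a \<Rightarrow> real"
  assumes reg: "regular_hamiltonian A H" and h: "0 < h" "h \<le> 1"
    and K: "0 \<le> K" and g: "\<And>y. g y \<le> a + K * (norm (y - z0))\<^sup>2"
    and L: "L = A + (real DIM('a) * A)\<^sup>2" and t: "0 \<le> t"
  shows "lf_iter A H h g n z t \<le> a + K * (exp (L * (t + h)) * (1 + (norm (z - z0))\<^sup>2) - 1)"
proof -
  define W where "W t z = a + K * (exp (L * t) * (1 + (norm (z - z0))\<^sup>2) - 1)" for t z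
  have A: "A > 0" using reg by (simp add: regular_hamiltonian_def)
  have L0: "L \<ge> 0" unfolding L using A by simp
  have Wmono: "W s z \<le> W t z" if "s \<le> t" for s t z
    unfolding W_def using that K L0 by (auto intro!: add_left_mono mult_left_mono mult_right_mono)
  have step: "lf_step A H h (W s) z \<le> W (s + h) z" for s z
  proof -
    define c where "c = K * exp (L * s)"
    have c: "c \<ge> 0" using K by (simp add: c_def)
    define v where "v = norm (z - z0)"
    have arith: "a + K * (E * (1 + (x + 2 * i + w)) - 1) = a + K * (E * (1 + x) - 1) + 2 * (K * E) * i + K * E * w"
      for x i w E :: real by (simp add: algebra_simps)
    have W_eq: "W s = (\<lambda>y. W s z + ((2 * c) *\<^sub>R (z - z0)) \<bullet> (y - z) + c * (norm (y - z))\<^sup>2)"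
    proof
      fix y
      have "y - z0 = (z - z0) + (y - z)" by simp
      then have eq: "(norm (y - z0))\<^sup>2 = (norm (z - z0))\<^sup>2 + 2 * ((z - z0) \<bullet> (y - z)) + (norm (y - z))\<^sup>2"
        by (simp only: power2_norm_eq_inner inner_add_left inner_add_right) (simp add: inner_commute)
      show "W s y = W s z + ((2 * c) *\<^sub>R (z - z0)) \<bullet> (y - z) + c * (norm (y - z))\<^sup>2"
        unfolding W_def c_def eq inner_scaleR_left by (rule arith)
    qed
    have "lf_step A H h (W s) z = W s z + c * (lf_width TYPE('a) A h)\<^sup>2 - h * H z ((2 * c) *\<^sub>R (z - z0))"
      by (rule trans[OF arg_cong[OF W_eq, of "\<lambda>f. lf_step A H h f z"] lf_step_quadratic[OF A h(1)]])
    also have "\<dots> \<le> W s z + c * (lf_width TYPE('a) A h)\<^sup>2 + h * (A * (2 * c * v))"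
    proof -
      have "\<bar>H z ((2 * c) *\<^sub>R (z - z0))\<bar> \<le> A * norm ((2 * c) *\<^sub>R (z - z0))"
        by (rule regular_hamiltonian_bound[OF reg])
      also have "\<dots> = A * (2 * c * v)" using c by (simp add: v_def)
      finally have "- H z ((2 * c) *\<^sub>R (z - z0)) \<le> A * (2 * c * v)" by linarith
      then have "h * - H z ((2 * c) *\<^sub>R (z - z0)) \<le> h * (A * (2 * c * v))"
        using h by (intro mult_left_mono) auto
      then show ?thesis by simp
    qed
    also have "\<dots> = a - K + c * (1 + v\<^sup>2 + (lf_width TYPE('a) A h)\<^sup>2 + h * A * (2 * v))"
      by (simp add: W_def v_def c_def algebra_simps)
    also have "\<dots> \<le> a - K + c * ((1 + v\<^sup>2) * (1 + L * h))"
    proof -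
      have "2 * v \<le> 1 + v\<^sup>2" using sum_squares_bound[of 1 v] by simp
      then have 1: "h * A * (2 * v) \<le> h * A * (1 + v\<^sup>2)" using h A by (intro mult_left_mono) auto
      have "(lf_width TYPE('a) A h)\<^sup>2 = (real DIM('a) * A)\<^sup>2 * (h * h)" by (simp add: lf_width_def power2_eq_square)
      also have "\<dots> \<le> (real DIM('a) * A)\<^sup>2 * (h * 1)" using h by (intro mult_left_mono) auto
      also have "\<dots> \<le> (real DIM('a) * A)\<^sup>2 * h * (1 + v\<^sup>2)"
      proof -
        have "0 \<le> (real DIM('a) * A)\<^sup>2 * h * v\<^sup>2" using h by simp
        then show ?thesis by (simp add: distrib_left)
      qed
      finally have 2: "(lf_width TYPE('a) A h)\<^sup>2 \<le> (real DIM('a) * A)\<^sup>2 * h * (1 + v\<^sup>2)" .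
      have "(1 + v\<^sup>2) * (1 + L * h) = 1 + v\<^sup>2 + (real DIM('a) * A)\<^sup>2 * h * (1 + v\<^sup>2) + h * A * (1 + v\<^sup>2)"
        unfolding L by (simp add: algebra_simps)
      then show ?thesis using 1 2 c by (intro add_left_mono mult_left_mono) auto
    qed
    also have "\<dots> \<le> a - K + c * ((1 + v\<^sup>2) * exp (L * h))"
      using c by (intro add_left_mono mult_left_mono exp_ge_add_one_self) (auto simp: add_nonneg_nonneg)
    also have "\<dots> = W (s + h) z" by (simp add: W_def c_def v_def exp_add algebra_simps)
    finally show ?thesis .
  qed
  have gW: "g y \<le> W 0 y" for y using g[of y] by (simp add: W_def algebra_simps)
  have mono: "lf_step A H h f z \<le> lf_step A H h f' z" if "\<And>y. f y \<le> f' y" for f f' z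
    using lf_step_mono[OF reg h(1)] that by blast
  have "lf_iter A H h g n z t \<le> W (t + h) z"
    using t
  proof (induction n arbitrary: z t)
    case 0
    define \<theta> where "\<theta> = max 0 (min 1 (t / h))"
    have \<theta>: "0 \<le> \<theta>" "\<theta> \<le> 1" by (auto simp: \<theta>_def)
    have "g z \<le> W (t + h) z" using gW[of z] Wmono[of 0 "t + h" z] 0 h by linarith
    moreover have "lf_step A H h g z \<le> W (t + h) z"
      using mono[of g "W 0" z] gW step[of 0 z] Wmono[of "0 + h" "t + h" z] 0 by (smt (verit))
    ultimately have "(1 - \<theta>) * g z + \<theta> * lf_step A H h g z \<le> (1 - \<theta>) * W (t + h) z + \<theta> * W (t + h) z"
      using \<theta> by (intro add_mono mult_left_mono) auto
    then show ?case by (simp add: \<theta>_def[symmetric] Let_def lf_start_def algebra_simps)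
  next
    case (Suc n)
    show ?case
    proof (cases "t \<le> h")
      case True
      define \<theta> where "\<theta> = max 0 (min 1 (t / h))"
      have \<theta>: "0 \<le> \<theta>" "\<theta> \<le> 1" by (auto simp: \<theta>_def)
      have "g z \<le> W (t + h) z" using gW[of z] Wmono[of 0 "t + h" z] Suc.prems h by linarith
      moreover have "lf_step A H h g z \<le> W (t + h) z"
        using mono[of g "W 0" z] gW step[of 0 z] Wmono[of "0 + h" "t + h" z] Suc.prems by (smt (verit))
      ultimately have "(1 - \<theta>) * g z + \<theta> * lf_step A H h g z \<le> (1 - \<theta>) * W (t + h) z + \<theta> * W (t + h) z"
        using \<theta> by (intro add_mono mult_left_mono) auto
      then show ?thesis using True by (simp add: \<theta>_def[symmetric] Let_def lf_start_def algebra_simps)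
    next
      case False
      have "lf_iter A H h g n y (t - h) \<le> W t y" for y using Suc.IH[of "t - h" y] False by simp
      then have "lf_step A H h (\<lambda>y. lf_iter A H h g n y (t - h)) z \<le> lf_step A H h (W t) z"
        by (rule mono)
      also have "\<dots> \<le> W (t + h) z" by (rule step)
      finally show ?thesis using False by simp
    qed
  qed
  then show ?thesis by (simp add: W_def)
qed

lemma parabola_bounded_lf_solution:
  fixes H :: "'a::euclidean_space \<Rightarrow> 'a \<Rightarrow> real"
  assumes reg: "regular_hamiltonian A H"
  shows "parabola_bounded g (at_right 0) (\<lambda>h. lf_solution A H h g)"
  unfolding parabola_bounded_def
proof (intro exI[of _ "A + (real DIM('a) * A)\<^sup>2"] conjI allI impI)
  define L where "L = A + (real DIM('a) * A)\<^sup>2"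
  have L: "L \<ge> 0" using reg unfolding L_def regular_hamiltonian_def by simp
  then show "A + (real DIM('a) * A)\<^sup>2 \<ge> 0" by (simp add: L_def)
  fix \<delta> :: real assume "\<delta> > 0"
  then have "\<forall>\<^sub>F h in at_right 0. h \<in> {0<..<min 1 \<delta>}" by (intro eventually_at_right_real) auto
  then show "\<forall>\<^sub>F h in at_right 0. \<forall>a K z0 z t. 0 \<le> K \<longrightarrow> (\<forall>y. g y \<le> a + K * (norm (y - z0))\<^sup>2) \<longrightarrow> 0 \<le> t \<longrightarrow>
     lf_solution A H h g (z, t) \<le> a + K * (exp ((A + (real DIM('a) * A)\<^sup>2) * (t + \<delta>)) * (1 + (norm (z - z0))\<^sup>2) - 1)"
  proof eventually_elim
    case (elim h)
    show ?case
    proof (intro allI impI)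
      fix a K z0 z and t :: real
      assume K: "0 \<le> K" and *: "\<forall>y. g y \<le> a + K * (norm (y - z0))\<^sup>2" and t: "0 \<le> t"
      then have "lf_solution A H h g (z, t) \<le> a + K * (exp (L * (t + h)) * (1 + (norm (z - z0))\<^sup>2) - 1)"
        unfolding lf_solution_def fst_conv snd_conv
        using elim by (intro lf_iter_parabola_bound[OF reg]) (auto simp: L_def)
      also have "\<dots> \<le> a + K * (exp (L * (t + \<delta>)) * (1 + (norm (z - z0))\<^sup>2) - 1)"
        using K L elim by (intro add_left_mono mult_left_mono diff_right_mono mult_right_mono) (auto intro!: mult_left_mono)
      finally show "lf_solution A H h g (z, t) \<le> a + K * (exp ((A + (real DIM('a) * A)\<^sup>2) * (t + \<delta>)) * (1 + (norm (z - z0))\<^sup>2) - 1)"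
        unfolding L_def .
    qed
  qed
qed

text \<open>A paraboloid touching at (z, t) dominates the scheme on the stencil at time t - h. By
  monotonicity the step may act on the paraboloid instead, and the quadratic formula leaves an error
  of C (1 + b b) h.\<close>

lemma approx_subsolution_lf_solution:
  fixes H :: "'a::euclidean_space \<Rightarrow> 'a \<Rightarrow> real"
  assumes reg: "regular_hamiltonian A H"
  shows "approx_subsolution H (at_right 0) (\<lambda>h. lf_solution A H h g)"
  unfolding approx_subsolution_def
proof (intro allI impI)
  fix C \<eta> :: real assume C: "C > 0" and \<eta>: "\<eta> > 0"
  have A: "A > 0" using reg by (simp add: regular_hamiltonian_def)
  define b where "b = real DIM('a) * A"
  have b: "b > 0" using A by (simp add: b_def)
  \<comment> \<open>Three requirements: t lies beyond the starting interval, the stencil lies in the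
    touching ball, and the final error is at most \<eta>.\<close>
  define h0 where "h0 = min \<eta> (min (\<eta> / (1 + b)) (\<eta> / (C * (1 + b\<^sup>2))))"
  have "h0 > 0" using C \<eta> b by (auto simp: h0_def intro!: divide_pos_pos mult_pos_pos add_pos_pos)
  then have "\<forall>\<^sub>F h in at_right 0. h \<in> {0<..<h0}" by (intro eventually_at_right_real) auto
  then show "\<forall>\<^sub>F h in at_right 0. \<forall>q P. norm q \<le> C \<longrightarrow> \<eta> \<le> snd q \<longrightarrow> norm P \<le> C \<longrightarrow>
        touches_above (lf_solution A H h g) q P C \<eta> \<longrightarrow> snd P + H (fst q) (fst P) \<le> \<eta>"
  proof eventually_elim
    case (elim h)
    then have h: "h > 0" "h < \<eta>" "h < \<eta> / (1 + b)" "h < \<eta> / (C * (1 + b\<^sup>2))" by (auto simp: h0_def)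
    define l where "l = lf_width TYPE('a) A h"
    have l: "l = b * h" by (simp add: l_def lf_width_def b_def)
    show ?case
    proof (intro allI impI)
      fix q :: "'a \<times> real" and P
      assume q: "\<eta> \<le> snd q" and touch: "touches_above (lf_solution A H h g) q P C \<eta>"
      let ?u = "lf_solution A H h g"
      obtain z t where zt: "q = (z, t)" by (metis surj_pair)
      obtain p \<tau> where P: "P = (p, \<tau>)" by (metis surj_pair)
      have ht: "h < t" using q h zt by simp
      have "?u (z, t) = lf_step A H h (\<lambda>y. ?u (y, t - h)) z" by (rule lf_solution_step[OF h(1) ht])
      also have "\<dots> \<le> lf_step A H h (\<lambda>y. (?u (z, t) - \<tau> * h + C * h\<^sup>2) + p \<bullet> (y - z) + C * (norm (y - z))\<^sup>2) z"
      proof (rule lf_step_mono[OF reg h(1)])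
        fix y assume "norm (y - z) \<le> lf_width TYPE('a) A h"
        then have "norm (y - z) \<le> b * h" using l l_def by simp
        moreover have "norm ((y, t - h) - q) \<le> norm (y - z) + h"
          using norm_Pair_le[of "y - z" "- h"] h by (simp add: zt)
        moreover have "b * h + h \<le> \<eta>" using h b by (simp add: field_simps)
        ultimately have "(y, t - h) \<in> cball q \<eta>" by (simp add: dist_norm norm_minus_commute)
        then have "?u (y, t - h) \<le> ?u q + P \<bullet> ((y, t - h) - q) + C * (norm ((y, t - h) - q))\<^sup>2"
          using touch unfolding touches_above_def by blast
        also have "\<dots> = (?u (z, t) - \<tau> * h + C * h\<^sup>2) + p \<bullet> (y - z) + C * (norm (y - z))\<^sup>2"
          by (simp add: zt P norm_Pair algebra_simps)
        finally show "?u (y, t - h) \<le> (?u (z, t) - \<tau> * h + C * h\<^sup>2) + p \<bullet> (y - z) + C * (norm (y - z))\<^sup>2" .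
      qed
      also have "\<dots> = (?u (z, t) - \<tau> * h + C * h\<^sup>2) + C * l\<^sup>2 - h * H z p"
        unfolding l_def by (rule lf_step_quadratic[OF A h(1)])
      finally have "h * (\<tau> + H z p) \<le> h * (C * (1 + b\<^sup>2) * h)"
        unfolding l by (simp add: power2_eq_square algebra_simps)
      then have "\<tau> + H z p \<le> C * (1 + b\<^sup>2) * h" using h by simp
      also have "\<dots> \<le> \<eta>"
      proof -
        have "C * (1 + b\<^sup>2) > 0" using C by (intro mult_pos_pos) (auto simp: add_pos_nonneg)
        then show ?thesis using h(4) by (simp add: pos_less_divide_eq mult.commute less_imp_le)
      qed
      finally show "snd P + H (fst q) (fst P) \<le> \<eta>" by (simp add: zt P)
    qed
  qed
qed

text \<open>A convergent sequence together with its limit is compact, so sequential continuity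
  reduces to the hypothesis.\<close>

lemma continuous_on_if_compact:
  fixes f :: "'a::heine_borel \<Rightarrow> 'b::metric_space"
  assumes "\<And>K. compact K \<Longrightarrow> K \<subseteq> S \<Longrightarrow> continuous_on K f"
  shows "continuous_on S f"
  unfolding continuous_on_sequentially
proof (intro allI ballI impI, elim conjE)
  fix x a assume a: "a \<in> S" and x: "\<forall>n. x n \<in> S" "x \<longlonglongrightarrow> a"
  have "compact (insert a (range x))" using x(2) by (rule compact_sequence_with_limit)
  moreover have "insert a (range x) \<subseteq> S" using a x(1) by auto
  ultimately have "continuous_on (insert a (range x)) f" by (rule assms)
  then show "(f \<circ> x) \<longlonglongrightarrow> f a"
    unfolding continuous_on_sequentially using x(2) by blast
qed

text \<open>The schemes for step 1 / (k + 1) are approximate sub- and supersolutions at the same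
  time. Comparing two independent indices through the product filter makes them uniformly Cauchy on
  compact sets, and stability identifies the limit.\<close>

theorem viscosity_solution_exists:
  fixes H :: "'a::euclidean_space \<Rightarrow> 'a \<Rightarrow> real"
  assumes reg: "regular_hamiltonian A H" and g: "uniformly_continuous_on UNIV g"
  shows "\<exists>u. viscosity_solution H g u"
proof -
  define h where "h k = inverse (real (Suc k))" for k
  define v where "v k = lf_solution A H (h k) g" for k
  have h0: "h k > 0" for k by (simp add: h_def)
  have h_lim: "filterlim h (at_right 0) sequentially"
    unfolding h_def using LIMSEQ_inverse_real_of_nat
    by (intro tendsto_imp_filterlim_at_right) auto
  have cg: "continuous_on UNIV g" using g by (rule uniformly_continuous_imp_continuous)
  have cont: "continuous_on (UNIV \<times> {0..}) (v k)" for k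
    unfolding v_def by (rule continuous_on_lf_solution[OF reg h0 cg])
  have g': "uniformly_continuous_on UNIV (\<lambda>z. - g z)"
    using uniformly_continuous_on_minus[OF g] by simp
  have reg': "regular_hamiltonian A (dual_hamiltonian H)" by (rule regular_dual_hamiltonian[OF reg])
  have sub: "approx_subsolution H sequentially v"
    unfolding v_def[abs_def] by (rule approx_subsolution_compose[OF approx_subsolution_lf_solution[OF reg] h_lim])
  have sup: "approx_supersolution H sequentially v"
    unfolding v_def[abs_def] approx_supersolution_def lf_solution_dual[symmetric]
    by (rule approx_subsolution_compose[OF approx_subsolution_lf_solution[OF reg'] h_lim])
  have pb: "parabola_bounded g sequentially v"
    unfolding v_def[abs_def] by (rule parabola_bounded_compose[OF parabola_bounded_lf_solution[OF reg] h_lim])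
  have pb': "parabola_bounded (\<lambda>z. - g z) sequentially (\<lambda>k q. - v k q)"
    unfolding v_def[abs_def] lf_solution_dual[symmetric]
    by (rule parabola_bounded_compose[OF parabola_bounded_lf_solution[OF reg'] h_lim])
  have low: "\<exists>C. \<forall>\<^sub>F k in sequentially. \<forall>z\<in>cball 0 R. \<forall>t\<in>{0..T}. \<bar>v k (z, t)\<bar> \<le> C" for R T
  proof -
    obtain C1 where C1: "\<forall>\<^sub>F k in sequentially. \<forall>z\<in>cball 0 R. \<forall>t\<in>{0..T}. v k (z, t) \<le> C1"
      using parabola_bounded_box[OF g pb] by blast
    obtain C2 where C2: "\<forall>\<^sub>F k in sequentially. \<forall>z\<in>cball 0 R. \<forall>t\<in>{0..T}. - v k (z, t) \<le> C2"
      using parabola_bounded_box[OF g' pb'] by blast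
    have "\<forall>\<^sub>F k in sequentially. \<forall>z\<in>cball 0 R. \<forall>t\<in>{0..T}. \<bar>v k (z, t)\<bar> \<le> max C1 C2"
      using C1 C2
    proof eventually_elim
      case (elim k)
      show ?case
      proof (intro ballI)
        fix z t assume zt: "z \<in> cball (0::'a) R" "t \<in> {0..T}"
        have "v k (z, t) \<le> C1" "- v k (z, t) \<le> C2" using elim zt by blast+
        then show "\<bar>v k (z, t)\<bar> \<le> max C1 C2" by linarith
      qed
    qed
    then show ?thesis by blast
  qed
  let ?P = "sequentially \<times>\<^sub>F sequentially"
  have cauchy: "\<forall>\<^sub>F x in ?P. \<forall>q\<in>K. v (fst x) q \<le> v (snd x) q + \<mu>"
    if K: "compact K" "K \<subseteq> UNIV \<times> {0..}" and \<mu>: "\<mu> > 0" for K \<mu>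
  proof (rule global_approx_comparison[OF reg g _ _ _ _ _ _ _ K \<mu>])
    show "approx_subsolution H ?P (\<lambda>x. v (fst x))"
      by (rule approx_subsolution_compose[OF sub filterlim_fst])
    show "approx_supersolution H ?P (\<lambda>x. v (snd x))"
      using sup unfolding approx_supersolution_def
      by (rule approx_subsolution_compose[where f = snd, OF _ filterlim_snd])
    show "parabola_bounded g ?P (\<lambda>x. v (fst x))"
      by (rule parabola_bounded_compose[OF pb filterlim_fst])
    show "parabola_bounded (\<lambda>z. - g z) ?P (\<lambda>x q. - v (snd x) q)"
      using pb' by (rule parabola_bounded_compose[where f = snd, OF _ filterlim_snd])
    show "\<exists>C. \<forall>\<^sub>F k in ?P. \<forall>z\<in>cball 0 R. \<forall>t\<in>{0..T}. - C \<le> v (fst k) (z, t) \<and> v (snd k) (z, t) \<le> C" for R T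
    proof -
      obtain C where C: "\<forall>\<^sub>F k in sequentially. \<forall>z\<in>cball 0 R. \<forall>t\<in>{0..T}. \<bar>v k (z, t)\<bar> \<le> C"
        using low by blast
      have "\<forall>\<^sub>F k in ?P. \<forall>z\<in>cball 0 R. \<forall>t\<in>{0..T}. - C \<le> v (fst k) (z, t) \<and> v (snd k) (z, t) \<le> C"
        using eventually_compose_filterlim[OF C filterlim_fst] eventually_compose_filterlim[OF C filterlim_snd]
        by eventually_elim (force simp: abs_le_iff minus_le_iff)
      then show ?thesis by blast
    qed
  qed (rule cont)+
  have "uniformly_convergent_on K v" if K: "compact K" "K \<subseteq> UNIV \<times> {0..}" for K
  proof (rule Cauchy_uniformly_convergent, rule uniformly_Cauchy_onI)
    fix e :: real assume "e > 0"
    then have "\<forall>\<^sub>F x in ?P. \<forall>q\<in>K. v (fst x) q \<le> v (snd x) q + e / 2" by (intro cauchy[OF K]) auto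
    then obtain N where N: "\<And>m n q. m \<ge> N \<Longrightarrow> n \<ge> N \<Longrightarrow> q \<in> K \<Longrightarrow> v m q \<le> v n q + e / 2"
      unfolding eventually_prod_sequentially by auto
    show "\<exists>M. \<forall>x\<in>K. \<forall>m\<ge>M. \<forall>n\<ge>M. dist (v m x) (v n x) < e"
    proof (intro exI[of _ N] ballI allI impI)
      fix x m n assume "x \<in> K" "N \<le> m" "N \<le> n"
      then have "v m x \<le> v n x + e / 2" "v n x \<le> v m x + e / 2" using N by blast+
      then show "dist (v m x) (v n x) < e" using \<open>e > 0\<close> by (simp add: dist_real_def abs_if)
    qed
  qed
  then have ul: "uniform_limit K v (\<lambda>q. lim (\<lambda>k. v k q)) sequentially"
    if "compact K" "K \<subseteq> UNIV \<times> {0..}" for K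
    using that by (simp add: uniformly_convergent_uniform_limit_iff)
  define U where "U q = lim (\<lambda>k. v k q)" for q
  have ul: "uniform_limit K v U sequentially" if "compact K" "K \<subseteq> UNIV \<times> {0..}" for K
    using ul[OF that] by (simp add: U_def[abs_def])
  have "continuous_on (UNIV \<times> {0..}) U"
  proof (rule continuous_on_if_compact)
    fix K :: "('a \<times> real) set" assume K: "compact K" "K \<subseteq> UNIV \<times> {0..}"
    show "continuous_on K U"
      by (rule uniform_limit_theorem[OF _ ul[OF K]])
         (auto intro!: always_eventually continuous_on_subset[OF cont K(2)])
  qed
  moreover have "U (z, 0) = g z" for z
  proof -
    have "v k (z, 0) = g z" for k using h0[of k] by (simp add: v_def lf_solution_def lf_start_def)
    then show ?thesis by (simp add: U_def)
  qed
  moreover have "viscosity_subsolution H U"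
    by (rule approx_limit_viscosity_subsolution[OF reg _ sub cont ul]) auto
  moreover have "viscosity_supersolution H U"
    unfolding viscosity_supersolution_dual
  proof (rule approx_limit_viscosity_subsolution[OF reg' _ sup[unfolded approx_supersolution_def]])
    show "continuous_on (UNIV \<times> {0..}) (\<lambda>q. - v k q)" for k using cont by (intro continuous_intros)
    show "uniform_limit K (\<lambda>k q. - v k q) (\<lambda>q. - U q) sequentially" if "compact K" "K \<subseteq> UNIV \<times> {0..}" for K
      using ul[OF that] by (rule uniform_limit_uminus)
  qed auto
  ultimately show ?thesis unfolding viscosity_solution_def by blast
qed

section \<open>An ergodic theorem along paths\<close>

text \<open>Linear growth of a primitive at rate \<mu> in both directions. An error \<kappa> |y| + D
  turns into \<kappa> |y| + \<epsilon> D under the scaling of correctors, so it can be made small on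
  bounded sets.\<close>

definition has_mean :: "(real \<Rightarrow> real) \<Rightarrow> real \<Rightarrow> bool" where
  "has_mean f \<mu> \<longleftrightarrow> (\<exists>F. (\<forall>y. (F has_real_derivative f y) (at y)) \<and>
     (\<forall>\<kappa>>0. \<exists>D. \<forall>y. \<bar>F y - \<mu> * y\<bar> \<le> \<kappa> * \<bar>y\<bar> + D))"

section \<open>Primitives of bounded continuous functions\<close>

lemma continuous_antiderivative:
  fixes f :: "real \<Rightarrow> real"
  assumes "continuous_on UNIV f"
  shows "\<exists>F. F 0 = 0 \<and> (\<forall>y. (F has_real_derivative f y) (at y))"
proof -
  have "\<exists>F. \<forall>x::real. - \<infinity> < ereal x \<longrightarrow> ereal x < \<infinity> \<longrightarrow> (F has_vector_derivative f x) (at x)"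
    using assms by (intro einterval_antiderivative) (auto simp: continuous_on_eq_continuous_at)
  then obtain F where "\<And>x::real. (F has_real_derivative f x) (at x)"
    by (auto simp: has_real_derivative_iff_has_vector_derivative)
  then show ?thesis
    by (intro exI[of _ "\<lambda>y. F y - F 0"]) (auto intro!: derivative_eq_intros)
qed

lemma antiderivative_lipschitz:
  fixes F :: "real \<Rightarrow> real"
  assumes "\<And>y. (F has_real_derivative f y) (at y)" and "\<And>y. \<bar>f y\<bar> \<le> C"
  shows "\<bar>F x - F y\<bar> \<le> C * \<bar>x - y\<bar>"
proof (cases x y rule: linorder_cases)
  case less
  then obtain z where "F y - F x = (y - x) * f z" using MVT2[of x y F f] assms(1) by auto
  then have "\<bar>F x - F y\<bar> = \<bar>x - y\<bar> * \<bar>f z\<bar>" by (simp add: abs_mult abs_minus_commute[of "F x" "F y"] abs_minus_commute[of x y])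
  also have "\<dots> \<le> \<bar>x - y\<bar> * C" using assms(2) by (intro mult_left_mono) auto
  finally show ?thesis by (simp add: mult.commute)
next
  case greater
  then obtain z where "F x - F y = (x - y) * f z" using MVT2[of y x F f] assms(1) by auto
  then have "\<bar>F x - F y\<bar> = \<bar>x - y\<bar> * \<bar>f z\<bar>" by (simp add: abs_mult)
  also have "\<dots> \<le> \<bar>x - y\<bar> * C" using assms(2) by (intro mult_left_mono) auto
  finally show ?thesis by (simp add: mult.commute)
qed simp

text \<open>Finite sums give access to the increment of the primitive over [0, 1]: they show its
  measurability in \<omega> and, by dominated convergence, compute its expectation.\<close>

lemma riemann_sums:
  fixes f F :: "real \<Rightarrow> real"
  assumes f: "continuous_on UNIV f" and F: "\<And>y. (F has_real_derivative f y) (at y)"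
  shows "(\<lambda>k. \<Sum>j<k. f (real j / real k) / real k) \<longlonglongrightarrow> F 1 - F 0"
proof (rule LIMSEQ_I)
  fix e :: real assume e: "e > 0"
  have "uniformly_continuous_on {0..1} f"
    using f by (intro compact_uniformly_continuous continuous_on_subset[OF f]) auto
  then obtain d where d: "d > 0"
    "\<And>x y. x \<in> {0..1} \<Longrightarrow> y \<in> {0..1} \<Longrightarrow> dist x y < d \<Longrightarrow> dist (f x) (f y) < e / 2"
    unfolding uniformly_continuous_on_def using e by (meson half_gt_zero)
  obtain N :: nat where N: "real N > 1 / d" using reals_Archimedean2 by blast
  show "\<exists>N. \<forall>k\<ge>N. norm ((\<Sum>j<k. f (real j / real k) / real k) - (F 1 - F 0)) < e"
  proof (intro exI[of _ "max N 1"] allI impI)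
    fix k assume k: "max N 1 \<le> k"
    then have k0: "real k > 0" by simp
    have "1 / d < real k" using N k by linarith
    then have kd: "1 / real k < d" using d k0 by (simp add: field_simps)
    have tele: "F 1 - F 0 = (\<Sum>j<k. F (real (Suc j) / real k) - F (real j / real k))"
      using k0 sum_lessThan_telescope[of "\<lambda>j. F (real j / real k)" k] by simp
    have "\<bar>f (real j / real k) / real k - (F (real (Suc j) / real k) - F (real j / real k))\<bar> \<le> e / 2 / real k"
      if j: "j < k" for j
    proof -
      let ?a = "real j / real k" and ?b = "real (Suc j) / real k"
      have ab: "?a < ?b" using k0 by (simp add: divide_strict_right_mono)
      then obtain x where x: "?a < x" "x < ?b" "F ?b - F ?a = (?b - ?a) * f x"
        using MVT2[of ?a ?b F f] F by auto
      have ba: "?b - ?a = 1 / real k" using k0 by (simp add: field_simps)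
      have "0 \<le> ?a" "?b \<le> 1" using j k0 by auto
      then have "0 \<le> ?a" "?a \<le> 1" "0 \<le> x" "x \<le> 1" using x(1,2) by linarith+
      then have "?a \<in> {0..1}" "x \<in> {0..1}" by auto
      moreover have "dist ?a x < d" using x ba kd by (simp add: dist_real_def)
      ultimately have "dist (f ?a) (f x) < e / 2" by (rule d(2))
      then have "\<bar>f ?a - f x\<bar> / real k \<le> e / 2 / real k"
        using k0 by (intro divide_right_mono) (auto simp: dist_real_def)
      then show ?thesis unfolding x(3) ba by (simp add: abs_divide diff_divide_distrib[symmetric])
    qed
    then have "\<bar>\<Sum>j<k. f (real j / real k) / real k - (F (real (Suc j) / real k) - F (real j / real k))\<bar>
        \<le> (\<Sum>j<k. e / 2 / real k)"
      by (intro order_trans[OF sum_abs] sum_mono) auto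
    also have "\<dots> = e / 2" using k0 by simp
    finally show "norm ((\<Sum>j<k. f (real j / real k) / real k) - (F 1 - F 0)) < e"
      unfolding tele sum_subtractf[symmetric] using e by simp
  qed
qed

text \<open>The primitive is Lipschitz, so replacing y by the next integer towards 0 costs a bounded
  error; this error and the range of small |y| are both absorbed in D.\<close>

lemma has_meanI_integers:
  assumes F: "\<And>y. (F has_real_derivative f y) (at y)" and bd: "\<And>y. \<bar>f y\<bar> \<le> C"
    and pos: "(\<lambda>n. F (real n) / real n) \<longlonglongrightarrow> \<mu>"
    and neg: "(\<lambda>n. F (- real n) / real n) \<longlonglongrightarrow> - \<mu>"
  shows "has_mean f \<mu>"
  unfolding has_mean_def
proof (intro exI[of _ F] conjI allI impI F)
  fix \<kappa> :: real assume \<kappa>: "\<kappa> > 0"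
  obtain N1 where N1: "\<And>n. n \<ge> N1 \<Longrightarrow> \<bar>F (real n) / real n - \<mu>\<bar> < \<kappa>"
    using LIMSEQ_D[OF pos \<kappa>] by auto
  obtain N2 where N2: "\<And>n. n \<ge> N2 \<Longrightarrow> \<bar>F (- real n) / real n - - \<mu>\<bar> < \<kappa>"
    using LIMSEQ_D[OF neg \<kappa>] unfolding real_norm_def by blast
  define N where "N = max (max N1 N2) 1"
  have C: "C \<ge> 0" using bd[of 0] by linarith
  define D where "D = (C + \<bar>\<mu>\<bar>) * (real N + 1) + \<bar>F 0\<bar>"
  have int: "\<bar>F (s * real n) - \<mu> * (s * real n)\<bar> \<le> \<kappa> * real n" if n: "n \<ge> N" and s: "s = 1 \<or> s = - 1" for n s
  proof -
    have n0: "real n > 0" using n by (simp add: N_def)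
    have nn: "n \<ge> N1" "n \<ge> N2" using n by (auto simp: N_def)
    have "F (s * real n) - \<mu> * (s * real n) = (F (s * real n) / real n - s * \<mu>) * real n"
      using n0 by (simp add: field_simps)
    then have "\<bar>F (s * real n) - \<mu> * (s * real n)\<bar> = \<bar>F (s * real n) / real n - s * \<mu>\<bar> * real n"
      by (simp add: abs_mult)
    also have "\<dots> \<le> \<kappa> * real n"
      using s N1[OF nn(1)] N2[OF nn(2)] n0 by (intro mult_right_mono) auto
    finally show ?thesis .
  qed
  show "\<exists>D. \<forall>y. \<bar>F y - \<mu> * y\<bar> \<le> \<kappa> * \<bar>y\<bar> + D"
  proof (intro exI[of _ D] allI)
    fix y :: real
    define s :: real where "s = (if y \<ge> 0 then 1 else - 1)"
    define n where "n = nat \<lfloor>\<bar>y\<bar>\<rfloor>"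
    have s: "s = 1 \<or> s = - 1" "y = s * \<bar>y\<bar>" "\<bar>s\<bar> = 1" by (auto simp: s_def)
    have n: "real n \<le> \<bar>y\<bar>" "\<bar>y\<bar> < real n + 1" unfolding n_def by linarith+
    show "\<bar>F y - \<mu> * y\<bar> \<le> \<kappa> * \<bar>y\<bar> + D"
    proof (cases "n \<ge> N")
      case True
      have "y - s * real n = s * (\<bar>y\<bar> - real n)" using s(2) by (simp add: right_diff_distrib)
      then have yn: "\<bar>y - s * real n\<bar> \<le> 1" using n s(3) by (simp add: abs_mult)
      have "\<bar>F y - F (s * real n)\<bar> \<le> C * \<bar>y - s * real n\<bar>" by (rule antiderivative_lipschitz[OF F bd])
      also have "\<dots> \<le> C * 1" using C yn by (intro mult_left_mono)
      finally have 1: "\<bar>F y - F (s * real n)\<bar> \<le> C" by simp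
      have "\<bar>\<mu> * (s * real n) - \<mu> * y\<bar> = \<bar>\<mu>\<bar> * \<bar>y - s * real n\<bar>"
        by (simp add: right_diff_distrib[symmetric] abs_mult abs_minus_commute)
      also have "\<dots> \<le> \<bar>\<mu>\<bar> * 1" using yn by (intro mult_left_mono) auto
      finally have 2: "\<bar>\<mu> * (s * real n) - \<mu> * y\<bar> \<le> \<bar>\<mu>\<bar>" by simp
      have 3: "\<kappa> * real n \<le> \<kappa> * \<bar>y\<bar>" using n \<kappa> by simp
      have "C + \<bar>\<mu>\<bar> \<le> (C + \<bar>\<mu>\<bar>) * (real N + 1)" using C by (simp add: mult_left_mono distrib_left)
      then have "C + \<bar>\<mu>\<bar> \<le> D" unfolding D_def by linarith
      then show ?thesis using int[OF True s(1)] 1 2 3 by linarith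
    next
      case False
      then have yN: "\<bar>y\<bar> \<le> real N + 1" using n by linarith
      have "\<bar>F y - F 0\<bar> \<le> C * \<bar>y\<bar>" using antiderivative_lipschitz[OF F bd, of y 0] by simp
      moreover have "\<bar>\<mu> * y\<bar> = \<bar>\<mu>\<bar> * \<bar>y\<bar>" by (simp add: abs_mult)
      ultimately have "\<bar>F y - \<mu> * y\<bar> \<le> (C + \<bar>\<mu>\<bar>) * \<bar>y\<bar> + \<bar>F 0\<bar>"
        unfolding distrib_right by linarith
      also have "\<dots> \<le> D" unfolding D_def using C yN by (intro add_right_mono mult_left_mono) auto
      also have "\<dots> \<le> \<kappa> * \<bar>y\<bar> + D" using \<kappa> by simp
      finally show ?thesis .
    qed
  qed
qed

section \<open>Ergodic flows and stationary paths\<close>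

locale ergodic_flow = prob_space M for M :: "'w measure" +
  fixes \<tau> :: "real \<Rightarrow> 'w \<Rightarrow> 'w"
  assumes ergodic: "ergodic_group M \<tau>"
begin

lemma flow_measurable [measurable]: "\<tau> a \<in> measurable M M"
  using ergodic unfolding ergodic_group_def measure_preserving_group_def by blast

lemma flow_space [simp]: "\<omega> \<in> space M \<Longrightarrow> \<tau> a \<omega> \<in> space M"
  using measurable_space[OF flow_measurable] .

lemma flow_add: "\<omega> \<in> space M \<Longrightarrow> \<tau> (a + b) \<omega> = \<tau> a (\<tau> b \<omega>)"
  using ergodic unfolding ergodic_group_def measure_preserving_group_def by blast

lemma flow_0: "\<omega> \<in> space M \<Longrightarrow> \<tau> 0 \<omega> = \<omega>"
  using ergodic unfolding ergodic_group_def measure_preserving_group_def by blast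

lemma flow_inverse: "\<omega> \<in> space M \<Longrightarrow> \<tau> a (\<tau> (- a) \<omega>) = \<omega>"
  using flow_add[of \<omega> a "- a"] flow_0 by simp

text \<open>Measure preservation is stated for images. By the group law the preimage under \<tau> a
  is the image under \<tau> (- a), which yields invariance of the push-forward measure.\<close>

lemma distr_flow: "distr M M (\<tau> a) = M"
proof (rule measure_eqI)
  fix A assume A: "A \<in> sets (distr M M (\<tau> a))"
  then have AM: "A \<in> sets M" by simp
  have As: "A \<subseteq> space M" using AM sets.sets_into_space by blast
  have "\<tau> a -` A \<inter> space M = \<tau> (- a) ` A"
  proof
    show "\<tau> a -` A \<inter> space M \<subseteq> \<tau> (- a) ` A"
    proof
      fix \<omega> assume \<omega>: "\<omega> \<in> \<tau> a -` A \<inter> space M"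
      then have "\<omega> = \<tau> (- a) (\<tau> a \<omega>)" using flow_inverse[of \<omega> "- a"] by simp
      then show "\<omega> \<in> \<tau> (- a) ` A" using \<omega> by blast
    qed
    show "\<tau> (- a) ` A \<subseteq> \<tau> a -` A \<inter> space M"
      using As flow_inverse by (auto simp: subset_iff)
  qed
  then have "emeasure (distr M M (\<tau> a)) A = emeasure M (\<tau> (- a) ` A)"
    using AM by (simp add: emeasure_distr)
  also have "\<dots> = emeasure M A"
    using ergodic AM unfolding ergodic_group_def measure_preserving_group_def
    by (simp add: emeasure_eq_measure)
  finally show "emeasure (distr M M (\<tau> a)) A = emeasure M A" .
qed simp

lemma expectation_flow:
  fixes f :: "'w \<Rightarrow> real"
  assumes [measurable]: "f \<in> borel_measurable M"
  shows "expectation (\<lambda>\<omega>. f (\<tau> a \<omega>)) = expectation f"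
  using integral_distr[of "\<tau> a" M M f] by (simp add: distr_flow)

lemma ergodic_flow_reverse: "ergodic_flow M (\<lambda>a. \<tau> (- a))"
proof
  show "ergodic_group M (\<lambda>a. \<tau> (- a))"
    unfolding ergodic_group_def measure_preserving_group_def
  proof (intro conjI allI ballI impI)
    fix a b and \<omega> assume \<omega>: "\<omega> \<in> space M"
    show "\<tau> (- 0) \<omega> = \<omega>" using flow_0[OF \<omega>] by simp
    show "\<tau> (- (a + b)) \<omega> = \<tau> (- a) (\<tau> (- b) \<omega>)" using flow_add[OF \<omega>, of "- a" "- b"] by simp
  next
    fix a and A assume "A \<in> sets M"
    then show "prob (\<tau> (- a) ` A) = prob A"
      using ergodic unfolding ergodic_group_def measure_preserving_group_def by blast
  next
    fix A assume A: "A \<in> sets M" and "\<forall>a. \<tau> (- a) ` A = A"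
    then have "\<forall>a. \<tau> a ` A = A" by (metis minus_minus)
    then show "prob A \<in> {0, 1}" using ergodic A unfolding ergodic_group_def by blast
  qed simp
qed

text \<open>Each sublevel set of an invariant variable is an invariant event, hence of probability 0
  or 1. Rational thresholds separate extended real values and keep the exceptional set null.\<close>

lemma invariant_AE_constant:
  fixes X :: "'w \<Rightarrow> ereal"
  assumes [measurable]: "X \<in> borel_measurable M"
    and inv: "\<And>a \<omega>. \<omega> \<in> space M \<Longrightarrow> X (\<tau> a \<omega>) = X \<omega>"
  shows "\<exists>c. AE \<omega> in M. X \<omega> = c"
proof -
  have "\<exists>b. AE \<omega> in M. (X \<omega> \<le> ereal r) = b" for r
  proof -
    let ?A = "{\<omega> \<in> space M. X \<omega> \<le> ereal r}"
    have A[measurable]: "?A \<in> sets M" by measurable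
    have "\<tau> a ` ?A = ?A" for a
    proof
      show "\<tau> a ` ?A \<subseteq> ?A" using inv by auto
      show "?A \<subseteq> \<tau> a ` ?A"
      proof
        fix \<omega> assume \<omega>: "\<omega> \<in> ?A"
        then have "\<omega> = \<tau> a (\<tau> (- a) \<omega>)" using flow_inverse by simp
        moreover have "\<tau> (- a) \<omega> \<in> ?A" using \<omega> inv by simp
        ultimately show "\<omega> \<in> \<tau> a ` ?A" by blast
      qed
    qed
    then have "prob ?A \<in> {0, 1}" using ergodic A unfolding ergodic_group_def by blast
    then have "(AE \<omega> in M. \<omega> \<notin> ?A) \<or> (AE \<omega> in M. \<omega> \<in> ?A)"
    proof
      assume "prob ?A = 0"
      then have "AE \<omega> in M. \<omega> \<notin> ?A" using prob_eq_0[OF A] by auto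
      then show ?thesis ..
    next
      assume "prob ?A \<in> {1}"
      then have "AE \<omega> in M. \<omega> \<in> ?A" using prob_eq_1[OF A] by auto
      then show ?thesis ..
    qed
    then show ?thesis
    proof
      assume "AE \<omega> in M. \<omega> \<notin> ?A"
      then have "AE \<omega> in M. (X \<omega> \<le> ereal r) = False" using AE_space by eventually_elim auto
      then show ?thesis by blast
    next
      assume "AE \<omega> in M. \<omega> \<in> ?A"
      then have "AE \<omega> in M. (X \<omega> \<le> ereal r) = True" by eventually_elim auto
      then show ?thesis by blast
    qed
  qed
  then obtain b where b: "\<And>r. AE \<omega> in M. (X \<omega> \<le> ereal r) = b r" by metis
  have "AE \<omega> in M. \<forall>r::rat. (X \<omega> \<le> ereal (of_rat r)) = b (of_rat r)"
    unfolding AE_all_countable using b by blast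
  then have *: "AE \<omega> in M. \<forall>r::rat. (X \<omega> \<le> ereal (of_rat r)) = b (of_rat r)" .
  obtain \<omega>0 where \<omega>0: "\<And>r::rat. (X \<omega>0 \<le> ereal (of_rat r)) = b (of_rat r)"
    using eventually_happens[OF *] by (metis AE_False prob_space_axioms eventually_False ae_filter_eq_bot_iff emeasure_space_1 zero_neq_one)
  have "AE \<omega> in M. X \<omega> = X \<omega>0"
    using *
  proof eventually_elim
    case (elim \<omega>)
    show ?case
    proof (rule antisym; rule ccontr)
      assume "\<not> X \<omega> \<le> X \<omega>0"
      then obtain r where "X \<omega>0 < ereal (real_of_rat r)" "ereal (real_of_rat r) < X \<omega>"
        using ereal_dense3[of "X \<omega>0" "X \<omega>"] by (auto simp: not_le)
      then show False using elim \<omega>0 by (metis less_imp_le not_le)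
    next
      assume "\<not> X \<omega>0 \<le> X \<omega>"
      then obtain r where "X \<omega> < ereal (real_of_rat r)" "ereal (real_of_rat r) < X \<omega>0"
        using ereal_dense3[of "X \<omega>" "X \<omega>0"] by (auto simp: not_le)
      then show False using elim \<omega>0 by (metis less_imp_le not_le)
    qed
  qed
  then show ?thesis by blast
qed

end

text \<open>The bound is demanded for every \<omega>; fields bounded only almost surely enter
  through truncated functionals.\<close>

locale stationary_path = ergodic_flow M \<tau> for M :: "'w measure" and \<tau> :: "real \<Rightarrow> 'w \<Rightarrow> 'w" +
  fixes X :: "real \<Rightarrow> 'w \<Rightarrow> real" and C :: real
  assumes X_measurable [measurable]: "\<And>y. X y \<in> borel_measurable M"
    and X_flow: "\<And>a y \<omega>. \<omega> \<in> space M \<Longrightarrow> X y (\<tau> a \<omega>) = X (y + a) \<omega>"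
    and X_continuous: "\<And>\<omega>. \<omega> \<in> space M \<Longrightarrow> continuous_on UNIV (\<lambda>y. X y \<omega>)"
    and X_bounded: "\<And>y \<omega>. \<omega> \<in> space M \<Longrightarrow> \<bar>X y \<omega>\<bar> \<le> C"
begin

definition primitive :: "'w \<Rightarrow> real \<Rightarrow> real" where
  "primitive \<omega> = (SOME F. F 0 = 0 \<and> (\<forall>y. (F has_real_derivative X y \<omega>) (at y)))"

lemma primitive:
  assumes "\<omega> \<in> space M"
  shows "primitive \<omega> 0 = 0" "(primitive \<omega> has_real_derivative X y \<omega>) (at y)"
  using someI_ex[OF continuous_antiderivative[OF X_continuous[OF assms]]] unfolding primitive_def by blast+

text \<open>Cocycle identity: both sides vanish at y = 0 and have derivative
  \<open>X (y + a) \<omega>\<close>.\<close>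

lemma primitive_flow:
  assumes \<omega>: "\<omega> \<in> space M"
  shows "primitive (\<tau> a \<omega>) y = primitive \<omega> (y + a) - primitive \<omega> a"
proof -
  have "\<forall>x. DERIV (\<lambda>y. primitive (\<tau> a \<omega>) y - primitive \<omega> (y + a)) x :> 0"
  proof
    fix x
    have "DERIV (primitive (\<tau> a \<omega>)) x :> X (x + a) \<omega>"
      using primitive(2)[of "\<tau> a \<omega>" x] \<omega> by (simp add: X_flow)
    moreover have "DERIV (\<lambda>y. primitive \<omega> (y + a)) x :> X (x + a) \<omega>"
      using primitive(2)[OF \<omega>, of "x + a"] by (simp add: DERIV_shift)
    ultimately show "DERIV (\<lambda>y. primitive (\<tau> a \<omega>) y - primitive \<omega> (y + a)) x :> 0"
      using DERIV_diff by fastforce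
  qed
  from DERIV_isconst_all[OF this, of y 0] show ?thesis
    using primitive(1)[of "\<tau> a \<omega>"] \<omega> by simp
qed

lemma primitive_lipschitz:
  "\<omega> \<in> space M \<Longrightarrow> \<bar>primitive \<omega> x - primitive \<omega> y\<bar> \<le> C * \<bar>x - y\<bar>"
  by (rule antiderivative_lipschitz[OF primitive(2) X_bounded])

lemma C_nonneg: "0 \<le> C"
proof -
  obtain \<omega> where "\<omega> \<in> space M" using not_empty by blast
  then show ?thesis using X_bounded[of \<omega> 0] by linarith
qed

lemma primitive_1_measurable [measurable]: "(\<lambda>\<omega>. primitive \<omega> 1) \<in> borel_measurable M"
proof (rule borel_measurable_LIMSEQ_real)
  fix \<omega> assume \<omega>: "\<omega> \<in> space M"
  show "(\<lambda>k. \<Sum>j<k. X (real j / real k) \<omega> / real k) \<longlonglongrightarrow> primitive \<omega> 1"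
    using riemann_sums[OF X_continuous[OF \<omega>] primitive(2)[OF \<omega>]] primitive(1)[OF \<omega>] by simp
qed simp

lemma expectation_X: "expectation (X y) = expectation (X 0)"
proof -
  have "expectation (X 0) = expectation (\<lambda>\<omega>. X 0 (\<tau> y \<omega>))" by (rule expectation_flow[symmetric]) simp
  also have "\<dots> = expectation (X y)" by (rule Bochner_Integration.integral_cong) (simp_all add: X_flow)
  finally show ?thesis ..
qed

text \<open>By stationarity every nonempty Riemann sum has expectation
  \<open>expectation (X 0)\<close>; the sums are bounded by C, so dominated convergence
  applies.\<close>

lemma expectation_primitive_1: "expectation (\<lambda>\<omega>. primitive \<omega> 1) = expectation (X 0)"
proof -
  have int: "integrable M (X y)" for y
    by (rule integrable_const_bound[of _ C]) (auto intro!: AE_I2 X_bounded)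
  have "(\<lambda>k. expectation (\<lambda>\<omega>. \<Sum>j<k. X (real j / real k) \<omega> / real k)) \<longlonglongrightarrow> expectation (\<lambda>\<omega>. primitive \<omega> 1)"
  proof (rule integral_dominated_convergence[where w = "\<lambda>_. C"])
    show "AE \<omega> in M. (\<lambda>k. \<Sum>j<k. X (real j / real k) \<omega> / real k) \<longlonglongrightarrow> primitive \<omega> 1"
    proof (rule AE_I2)
      fix \<omega> assume \<omega>: "\<omega> \<in> space M"
      show "(\<lambda>k. \<Sum>j<k. X (real j / real k) \<omega> / real k) \<longlonglongrightarrow> primitive \<omega> 1"
        using riemann_sums[OF X_continuous[OF \<omega>] primitive(2)[OF \<omega>]] primitive(1)[OF \<omega>] by simp
    qed
    show "AE \<omega> in M. norm (\<Sum>j<k. X (real j / real k) \<omega> / real k) \<le> C" for k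
    proof (rule AE_I2)
      fix \<omega> assume \<omega>: "\<omega> \<in> space M"
      have "norm (\<Sum>j<k. X (real j / real k) \<omega> / real k) \<le> (\<Sum>j<k. C / real k)"
        by (rule sum_norm_le) (auto intro!: divide_right_mono X_bounded \<omega>)
      also have "\<dots> \<le> C" using C_nonneg by simp
      finally show "norm (\<Sum>j<k. X (real j / real k) \<omega> / real k) \<le> C" .
    qed
  qed auto
  moreover have "\<forall>\<^sub>F k in sequentially. expectation (\<lambda>\<omega>. \<Sum>j<k. X (real j / real k) \<omega> / real k) = expectation (X 0)"
    using eventually_gt_at_top[of 0]
  proof eventually_elim
    case (elim k)
    have "expectation (\<lambda>\<omega>. \<Sum>j<k. X (real j / real k) \<omega> / real k) = (\<Sum>j<k. expectation (X (real j / real k)) / real k)"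
      using int by (simp add: Bochner_Integration.integral_sum)
    also have "\<dots> = (\<Sum>j<k. expectation (X 0) / real k)"
      by (intro sum.cong refl arg_cong2[where f = "(/)"] expectation_X)
    also have "\<dots> = expectation (X 0)" using elim by simp
    finally show ?case .
  qed
  ultimately have "(\<lambda>k. expectation (X 0)) \<longlonglongrightarrow> expectation (\<lambda>\<omega>. primitive \<omega> 1)"
    by (rule Lim_transform_eventually)
  then show ?thesis using LIMSEQ_unique tendsto_const by blast
qed

lemma primitive_nat_sum:
  assumes \<omega>: "\<omega> \<in> space M"
  shows "primitive \<omega> (real n) = (\<Sum>i<n. primitive (\<tau> (real i) \<omega>) 1)"
proof (induction n)
  case 0 show ?case using primitive(1)[OF \<omega>] by simp
next
  case (Suc n) then show ?case using primitive_flow[OF \<omega>, of "real n" 1] by (simp add: add.commute)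
qed

lemma primitive_nat_measurable [measurable]: "(\<lambda>\<omega>. primitive \<omega> (real n)) \<in> borel_measurable M"
proof -
  have "(\<lambda>\<omega>. \<Sum>i<n. primitive (\<tau> (real i) \<omega>) 1) \<in> borel_measurable M"
    by (intro borel_measurable_sum measurable_compose[OF flow_measurable primitive_1_measurable])
  then show ?thesis by (subst measurable_cong[OF primitive_nat_sum])
qed

lemma sum_lessThan_add: "(\<Sum>i<n + k. f i) = (\<Sum>i<n. f i) + (\<Sum>i<k. f (n + i :: nat) :: real)"
  by (induction k) (simp_all add: add.assoc)

text \<open>Katznelson--Weiss: away from a set of small probability every starting point has an average
  over a block of bounded length close to the upper limit; paste these blocks together.\<close>

lemma block_bound:
  fixes a \<beta> :: real and N :: nat and B :: "'w set" and Y :: "'w \<Rightarrow> real"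
  assumes Y: "\<And>\<omega>. \<omega> \<in> space M \<Longrightarrow> \<bar>Y \<omega>\<bar> \<le> C" and \<beta>: "\<beta> \<le> C"
    and block: "\<And>\<omega>. \<omega> \<in> space M \<Longrightarrow> \<exists>n\<in>{1..N}. real n * \<beta> \<le> (\<Sum>i<n. Y (\<tau> (real i) \<omega>))"
    and \<omega>: "\<omega> \<in> space M"
  shows "real L * \<beta> - 2 * C * real N \<le> (\<Sum>i<L. Y (\<tau> (real i) \<omega>))"
  using \<omega>
proof (induction L arbitrary: \<omega> rule: less_induct)
  case (less L)
  obtain n where n: "n \<in> {1..N}" "real n * \<beta> \<le> (\<Sum>i<n. Y (\<tau> (real i) \<omega>))" using block[OF less.prems] by blast
  show ?case
  proof (cases "n \<le> L")
    case True
    have "real (L - n) * \<beta> - 2 * C * real N \<le> (\<Sum>i<L - n. Y (\<tau> (real i) (\<tau> (real n) \<omega>)))"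
      using n True by (intro less.IH) (auto simp: less.prems)
    also have "\<dots> = (\<Sum>i<L - n. Y (\<tau> (real (n + i)) \<omega>))"
    proof (rule sum.cong)
      fix i
      show "Y (\<tau> (real i) (\<tau> (real n) \<omega>)) = Y (\<tau> (real (n + i)) \<omega>)"
        using flow_add[OF less.prems, of "real i" "real n"] by (simp add: add.commute)
    qed simp
    finally have "real (L - n) * \<beta> + real n * \<beta> - 2 * C * real N
        \<le> (\<Sum>i<n. Y (\<tau> (real i) \<omega>)) + (\<Sum>i<L - n. Y (\<tau> (real (n + i)) \<omega>))" using n(2) by linarith
    also have "\<dots> = (\<Sum>i<n + (L - n). Y (\<tau> (real i) \<omega>))"
      by (rule sum_lessThan_add[symmetric])
    finally show ?thesis using True by (simp add: of_nat_diff algebra_simps)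
  next
    \<comment> \<open>The remaining stretch is shorter than a block. Bounding each term below by -C
      and \<beta> above by C costs at most twice C N.\<close>
    case False
    then have LN: "real L \<le> real N" using n by auto
    have "(\<Sum>i<L. - C) \<le> (\<Sum>i<L. Y (\<tau> (real i) \<omega>))"
    proof (rule sum_mono)
      fix i show "- C \<le> Y (\<tau> (real i) \<omega>)" using Y[of "\<tau> (real i) \<omega>"] less.prems by auto
    qed
    then have "- (real L * C) \<le> (\<Sum>i<L. Y (\<tau> (real i) \<omega>))" by simp
    moreover have "real L * \<beta> \<le> real L * C" using \<beta> by (intro mult_left_mono) auto
    moreover have "real L * C \<le> real N * C" using C_nonneg LN by (intro mult_right_mono)
    moreover have "2 * C * real N = 2 * (real N * C)" by simp
    ultimately show ?thesis by linarith
  qed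
qed

text \<open>The upper limit is invariant, hence almost surely a constant c. With \<alpha> strictly
  between the mean and c, almost every path has a block with average at least \<alpha>. After a
  change on a small event the blocks have bounded length, and integrating the pasted bound over
  longer and longer stretches gives \<alpha> \<le> mean + \<open>2 * C * prob (B N)\<close>, which
  is less than \<alpha>.\<close>

lemma limsup_le_expectation:
  "AE \<omega> in M. limsup (\<lambda>n. ereal (primitive \<omega> (real n) / real n)) \<le> ereal (expectation (X 0))"
proof -
  define A where "A \<omega> = limsup (\<lambda>n. ereal (primitive \<omega> (real n) / real n))" for \<omega>
  have A_meas: "A \<in> borel_measurable M"
    unfolding A_def[abs_def] by measurable
  have A_inv: "A (\<tau> a \<omega>) = A \<omega>" if \<omega>: "\<omega> \<in> space M" for a \<omega>
  proof -
    have "(\<lambda>n. (2 * C * \<bar>a\<bar>) * inverse (real n)) \<longlonglongrightarrow> (2 * C * \<bar>a\<bar>) * 0"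
      by (intro tendsto_intros lim_inverse_n)
    then have "(\<lambda>n. 2 * C * \<bar>a\<bar> / real n) \<longlonglongrightarrow> 0" by (simp add: divide_inverse)
    then have "(\<lambda>n. primitive (\<tau> a \<omega>) (real n) / real n - primitive \<omega> (real n) / real n) \<longlonglongrightarrow> 0"
    proof (rule Lim_null_comparison[rotated], intro always_eventually allI)
      fix n
      have "\<bar>primitive (\<tau> a \<omega>) (real n) - primitive \<omega> (real n)\<bar> \<le> 2 * C * \<bar>a\<bar>"
        using primitive_lipschitz[OF \<omega>, of "real n + a" "real n"] primitive_lipschitz[OF \<omega>, of a 0]
          primitive_flow[OF \<omega>, of a "real n"] primitive(1)[OF \<omega>] by (simp add: abs_le_iff)
      then have "\<bar>primitive (\<tau> a \<omega>) (real n) - primitive \<omega> (real n)\<bar> / real n \<le> 2 * C * \<bar>a\<bar> / real n"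
        by (intro divide_right_mono) auto
      then show "norm (primitive (\<tau> a \<omega>) (real n) / real n - primitive \<omega> (real n) / real n) \<le> 2 * C * \<bar>a\<bar> / real n"
        by (simp add: diff_divide_distrib[symmetric])
    qed
    then have "(\<lambda>n. ereal (primitive (\<tau> a \<omega>) (real n) / real n - primitive \<omega> (real n) / real n)) \<longlonglongrightarrow> ereal 0"
      by (intro tendsto_ereal)
    from ereal_limsup_lim_add[OF this, of "\<lambda>n. ereal (primitive \<omega> (real n) / real n)"]
    show ?thesis unfolding A_def by (simp add: zero_ereal_def[symmetric])
  qed
  obtain c where c: "AE \<omega> in M. A \<omega> = c" using invariant_AE_constant[OF A_meas A_inv] by blast
  have "c \<le> ereal (expectation (X 0))"
  proof (rule ccontr)
    assume "\<not> ?thesis"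
    then obtain \<alpha> where \<alpha>: "expectation (X 0) < \<alpha>" "ereal \<alpha> < c"
      using ereal_dense2[of "ereal (expectation (X 0))" c] by (auto simp: not_le)
    have freq: "AE \<omega> in M. \<exists>n\<ge>1. real n * \<alpha> \<le> primitive \<omega> (real n)"
      using c AE_space
    proof eventually_elim
      case (elim \<omega>)
      show ?case
      proof (rule ccontr)
        assume "\<not> (\<exists>n\<ge>1. real n * \<alpha> \<le> primitive \<omega> (real n))"
        then have lt: "primitive \<omega> (real n) < real n * \<alpha>" if "n \<ge> 1" for n
          using that not_le by blast
        have "\<forall>n\<ge>1. primitive \<omega> (real n) / real n \<le> \<alpha>"
        proof (intro allI impI)
          fix n :: nat assume "1 \<le> n"
          then show "primitive \<omega> (real n) / real n \<le> \<alpha>"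
            using lt[of n] by (simp add: divide_le_eq mult.commute less_imp_le)
        qed
        then have "\<forall>\<^sub>F n in sequentially. ereal (primitive \<omega> (real n) / real n) \<le> ereal \<alpha>"
          unfolding eventually_sequentially by auto
        then have "A \<omega> \<le> ereal \<alpha>" unfolding A_def by (rule Limsup_bounded)
        then show False using elim \<alpha> by simp
      qed
    qed
    \<comment> \<open>The event that no block of length at most N reaches the average \<alpha>; it
      shrinks to a null event.\<close>
    define B where "B N = {\<omega> \<in> space M. \<forall>n\<in>{1..N}. primitive \<omega> (real n) < real n * \<alpha>}" for N
    have B[measurable]: "B N \<in> sets M" for N unfolding B_def by measurable
    have "(\<lambda>N. prob (B N)) \<longlonglongrightarrow> prob (\<Inter>N. B N)"
      by (rule finite_Lim_measure_decseq) (auto simp: decseq_def B_def)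
    moreover have "prob (\<Inter>N. B N) = 0"
    proof -
      have "AE \<omega> in M. \<omega> \<notin> (\<Inter>N. B N)"
        using freq
      proof eventually_elim
        case (elim \<omega>)
        then obtain n where n: "n \<ge> 1" "real n * \<alpha> \<le> primitive \<omega> (real n)" by blast
        then have "\<omega> \<notin> B n" by (auto simp: B_def not_less intro!: bexI[of _ n])
        then show ?case by blast
      qed
      then show ?thesis by (subst prob_eq_0) auto
    qed
    ultimately have B0: "(\<lambda>N. prob (B N)) \<longlonglongrightarrow> 0" by simp
    define e where "e = \<alpha> - expectation (X 0)"
    have e: "e > 0" using \<alpha> by (simp add: e_def)
    have "\<forall>\<^sub>F N in sequentially. prob (B N) < e / (2 * C + 1)"
      using B0 e C_nonneg by (intro order_tendstoD) auto
    then obtain N0 where "prob (B N0) < e / (2 * C + 1)" by (auto simp: eventually_sequentially)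
    then have N0: "prob (B N0) * (2 * C + 1) < e" using C_nonneg by (simp add: field_simps)
    define N where "N = max N0 1"
    have "B N \<subseteq> B N0" by (auto simp: B_def N_def)
    then have "prob (B N) \<le> prob (B N0)" by (intro finite_measure_mono) auto
    then have "prob (B N) * (2 * C) \<le> prob (B N0) * (2 * C + 1)"
      using C_nonneg by (intro mult_mono) auto
    then have N: "2 * C * prob (B N) < e" using N0 by (simp add: mult.commute)
    \<comment> \<open>On the bad event the increment is raised to its maximal value C, so that a
      block of length 1 works there, since \<alpha> \<le> C.\<close>
    define Y where "Y \<omega> = (if \<omega> \<in> B N then C else primitive \<omega> 1)" for \<omega>
    have Y_meas[measurable]: "Y \<in> borel_measurable M" unfolding Y_def[abs_def] by measurable
    have p1: "\<bar>primitive \<omega> 1\<bar> \<le> C" if "\<omega> \<in> space M" for \<omega>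
      using primitive_lipschitz[OF that, of 1 0] primitive(1)[OF that] by simp
    have Yb: "\<bar>Y \<omega>\<bar> \<le> C" if "\<omega> \<in> space M" for \<omega> using p1[OF that] C_nonneg by (simp add: Y_def)
    have Yge: "primitive \<omega> 1 \<le> Y \<omega>" if "\<omega> \<in> space M" for \<omega> using p1[OF that] by (auto simp: Y_def)
    have prim_le: "primitive \<omega> (real n) \<le> C * real n" if "\<omega> \<in> space M" for \<omega> n
      using primitive_lipschitz[OF that, of "real n" 0] primitive(1)[OF that] by simp
    have \<alpha>C: "\<alpha> \<le> C"
    proof -
      obtain \<omega> where "\<omega> \<in> space M" "\<exists>n\<ge>1. real n * \<alpha> \<le> primitive \<omega> (real n)"
        using eventually_happens'[OF ae_filter_bot eventually_conj[OF freq AE_space]] by blast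
      then obtain n where n: "n \<ge> 1" "real n * \<alpha> \<le> real n * C" using prim_le[of \<omega>] by (metis mult.commute order_trans)
      then show ?thesis by simp
    qed
    have block: "\<exists>n\<in>{1..N}. real n * \<alpha> \<le> (\<Sum>i<n. Y (\<tau> (real i) \<omega>))" if \<omega>: "\<omega> \<in> space M" for \<omega>
    proof (cases "\<omega> \<in> B N")
      case True
      then show ?thesis using \<alpha>C flow_0[OF \<omega>] by (intro bexI[of _ 1]) (auto simp: Y_def N_def)
    next
      case False
      then obtain n where n: "n \<in> {1..N}" "real n * \<alpha> \<le> primitive \<omega> (real n)" using \<omega> by (auto simp: B_def not_less)
      have "primitive \<omega> (real n) \<le> (\<Sum>i<n. Y (\<tau> (real i) \<omega>))"
        unfolding primitive_nat_sum[OF \<omega>] by (intro sum_mono Yge) (simp add: \<omega>)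
      then show ?thesis using n by (intro bexI[of _ n]) auto
    qed
    have intY: "integrable M Y" by (rule integrable_const_bound[of _ C]) (auto intro!: AE_I2 Yb)
    have intp: "integrable M (\<lambda>\<omega>. primitive \<omega> 1)"
      by (rule integrable_const_bound[of _ C]) (auto intro!: AE_I2 p1)
    have intY': "integrable M (\<lambda>\<omega>. Y (\<tau> a \<omega>))" for a
      by (rule integrable_const_bound[of _ C]) (auto intro!: AE_I2 Yb)
    have ind: "integrable M (indicator (B N) :: 'w \<Rightarrow> real)"
      by (rule integrable_real_indicator) (simp_all add: emeasure_eq_measure)
    have "real L * \<alpha> - 2 * C * real N \<le> real L * expectation Y" for L
    proof -
      have "(\<integral>\<omega>. real L * \<alpha> - 2 * C * real N \<partial>M) \<le> expectation (\<lambda>\<omega>. \<Sum>i<L. Y (\<tau> (real i) \<omega>))"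
        using block_bound[OF Yb \<alpha>C block] by (intro integral_mono) (auto intro!: intY')
      also have "\<dots> = (\<Sum>i<L. expectation (\<lambda>\<omega>. Y (\<tau> (real i) \<omega>)))"
        by (rule Bochner_Integration.integral_sum) (rule intY')
      also have "\<dots> = real L * expectation Y" by (simp add: expectation_flow)
      finally show ?thesis by (simp add: prob_space)
    qed
    then have *: "real L * (\<alpha> - expectation Y) \<le> 2 * C * real N" for L
      by (simp add: right_diff_distrib algebra_simps)
    have "\<alpha> \<le> expectation Y"
    proof (rule ccontr)
      assume "\<not> ?thesis"
      then have pos: "\<alpha> - expectation Y > 0" by simp
      obtain L :: nat where "real L > 2 * C * real N / (\<alpha> - expectation Y)" using reals_Archimedean2 by blast
      then have "real L * (\<alpha> - expectation Y) > 2 * C * real N" using pos by (simp add: field_simps)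
      then show False using *[of L] by linarith
    qed
    also have "expectation Y \<le> expectation (\<lambda>\<omega>. primitive \<omega> 1 + 2 * C * indicator (B N) \<omega>)"
    proof (rule integral_mono[OF intY])
      show "integrable M (\<lambda>\<omega>. primitive \<omega> 1 + 2 * C * indicator (B N) \<omega>)"
        using intp ind by (intro Bochner_Integration.integrable_add integrable_mult_right)
      fix \<omega> assume \<omega>: "\<omega> \<in> space M"
      show "Y \<omega> \<le> primitive \<omega> 1 + 2 * C * indicator (B N) \<omega>"
        using p1[OF \<omega>] by (auto simp: Y_def)
    qed
    also have "\<dots> = expectation (X 0) + 2 * C * prob (B N)"
      using Bochner_Integration.integral_add[OF intp integrable_mult_right[OF ind, of "2 * C"]]
        expectation_primitive_1 by simp
    finally show False using N by (simp add: e_def)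
  qed
  then have "AE \<omega> in M. A \<omega> \<le> ereal (expectation (X 0))"
    using c by (rule_tac eventually_mono[OF c]) simp
  then show ?thesis unfolding A_def .
qed

lemma stationary_path_uminus: "stationary_path M \<tau> (\<lambda>y \<omega>. - X y \<omega>) C"
proof
  fix y a \<omega> assume \<omega>: "\<omega> \<in> space M"
  show "- X y (\<tau> a \<omega>) = - X (y + a) \<omega>" using X_flow[OF \<omega>] by simp
  show "\<bar>- X y \<omega>\<bar> \<le> C" using X_bounded[OF \<omega>] by simp
next
  fix \<omega> assume "\<omega> \<in> space M"
  then show "continuous_on UNIV (\<lambda>y. - X y \<omega>)" using X_continuous by (intro continuous_on_minus)
qed simp

lemma stationary_path_reverse: "stationary_path M (\<lambda>a. \<tau> (- a)) (\<lambda>y. X (- y)) C"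
proof -
  interpret rev: ergodic_flow M "\<lambda>a. \<tau> (- a)" by (rule ergodic_flow_reverse)
  show ?thesis
  proof
    fix \<omega> assume \<omega>: "\<omega> \<in> space M"
    show "continuous_on UNIV (\<lambda>y. X (- y) \<omega>)"
      by (rule continuous_on_compose2[OF X_continuous[OF \<omega>]]) (auto intro!: continuous_intros)
  qed (auto simp: X_flow X_bounded)
qed

lemma primitive_unique:
  assumes "\<omega> \<in> space M" "F 0 = 0" "\<And>y. (F has_real_derivative X y \<omega>) (at y)"
  shows "primitive \<omega> = F"
proof
  fix y
  have "\<forall>x. DERIV (\<lambda>y. primitive \<omega> y - F y) x :> 0"
    using DERIV_diff[OF primitive(2)[OF assms(1)] assms(3)] by simp
  from DERIV_isconst_all[OF this, of y 0] show "primitive \<omega> y = F y"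
    using primitive(1)[OF assms(1)] assms(2) by simp
qed

text \<open>The bound on the upper limit, for X and for -X, squeezes upper and lower limit to the
  expectation.\<close>

lemma primitive_average:
  "AE \<omega> in M. (\<lambda>n. primitive \<omega> (real n) / real n) \<longlonglongrightarrow> expectation (X 0)"
proof -
  interpret minus: stationary_path M \<tau> "\<lambda>y \<omega>. - X y \<omega>" C by (rule stationary_path_uminus)
  show ?thesis
    using limsup_le_expectation minus.limsup_le_expectation AE_space
  proof eventually_elim
    case (elim \<omega>)
    define s where "s n = primitive \<omega> (real n) / real n" for n
    have "minus.primitive \<omega> = (\<lambda>y. - primitive \<omega> y)"
      using elim(3) primitive by (intro minus.primitive_unique) (auto intro!: derivative_intros)
    then have "limsup (\<lambda>n. - ereal (s n)) \<le> - ereal (expectation (X 0))"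
      using elim(2) by (simp add: s_def)
    then have "ereal (expectation (X 0)) \<le> liminf (\<lambda>n. ereal (s n))"
      unfolding ereal_Limsup_uminus by (simp add: ereal_uminus_le_reorder)
    moreover have "limsup (\<lambda>n. ereal (s n)) \<le> ereal (expectation (X 0))" using elim(1) by (simp add: s_def)
    moreover have "liminf (\<lambda>n. ereal (s n)) \<le> limsup (\<lambda>n. ereal (s n))" by (rule Liminf_le_Limsup) simp
    ultimately have "(\<lambda>n. ereal (s n)) \<longlonglongrightarrow> ereal (expectation (X 0))"
      by (intro Liminf_eq_Limsup) auto
    then show ?case by (simp add: s_def)
  qed
qed

text \<open>Averages over negative integers come from the reversed flow, which is again ergodic and
  carries the field y \<mapsto> X (- y).\<close>

theorem pathwise_mean: "AE \<omega> in M. has_mean (\<lambda>y. X y \<omega>) (expectation (X 0))"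
proof -
  interpret rev: stationary_path M "\<lambda>a. \<tau> (- a)" "\<lambda>y. X (- y)" C by (rule stationary_path_reverse)
  show ?thesis
    using primitive_average rev.primitive_average AE_space
  proof eventually_elim
    case (elim \<omega>)
    have "((\<lambda>y. - primitive \<omega> (- y)) has_real_derivative X (- y) \<omega>) (at y)" for y
    proof -
      have "((\<lambda>y. primitive \<omega> (- y)) has_real_derivative X (- y) \<omega> * - 1) (at y)"
        by (rule DERIV_chain2[OF primitive(2)[OF elim(3)]]) (auto intro!: derivative_eq_intros)
      from DERIV_minus[OF this] show ?thesis by simp
    qed
    then have "rev.primitive \<omega> = (\<lambda>y. - primitive \<omega> (- y))"
      using primitive(1)[OF elim(3)] by (intro rev.primitive_unique[OF elim(3)]) auto
    then have "(\<lambda>n. - (primitive \<omega> (- real n) / real n)) \<longlonglongrightarrow> expectation (X 0)"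
      using elim(2) by simp
    then have "(\<lambda>n. primitive \<omega> (- real n) / real n) \<longlonglongrightarrow> - expectation (X 0)"
      using tendsto_minus by fastforce
    then show ?case
      by (rule has_meanI_integers[OF primitive(2)[OF elim(3)] X_bounded[OF elim(3)] elim(1)])
  qed
qed

end

section \<open>The cell problem\<close>

definition cell_ham :: "real \<Rightarrow> real \<Rightarrow> real \<Rightarrow> real" where
  "cell_ham m b q = sqrt (m\<^sup>2 + q\<^sup>2) + b * q / sqrt (m\<^sup>2 + q\<^sup>2)"

text \<open>Meaningful for s > |m| and b = 0 whenever m = 0: for m = 0 and b \<noteq> 0 the function
  \<open>cell_ham\<close> jumps at q = 0 and a root may be missing. In the application b carries the
  factor m.\<close>

definition cell_root :: "real \<Rightarrow> real \<Rightarrow> real \<Rightarrow> real" where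
  "cell_root m b s = (THE q. 0 < q \<and> cell_ham m b q = s)"

lemma cell_ham_minus: "cell_ham m b (- q) = cell_ham m (- b) q"
  by (simp add: cell_ham_def)

lemma cell_ham_0 [simp]: "cell_ham m b 0 = \<bar>m\<bar>"
  by (simp add: cell_ham_def)

lemma abs_quotient_sqrt_le: "\<bar>q / sqrt (m\<^sup>2 + q\<^sup>2)\<bar> \<le> 1" for q m :: real
proof -
  have "\<bar>q\<bar> \<le> sqrt (m\<^sup>2 + q\<^sup>2)" by (rule real_le_rsqrt) simp
  then have "\<bar>q\<bar> / sqrt (m\<^sup>2 + q\<^sup>2) \<le> 1"
    by (cases "sqrt (m\<^sup>2 + q\<^sup>2) = 0") (simp_all add: divide_le_eq_1_pos less_le)
  then show ?thesis by (simp add: abs_divide)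
qed

lemma cell_ham_diff: "\<bar>cell_ham m b q - cell_ham m b' q\<bar> \<le> \<bar>b - b'\<bar>"
proof -
  have "cell_ham m b q - cell_ham m b' q = (b - b') * (q / sqrt (m\<^sup>2 + q\<^sup>2))"
    by (simp add: cell_ham_def diff_divide_distrib[symmetric] left_diff_distrib)
  then have "\<bar>cell_ham m b q - cell_ham m b' q\<bar> = \<bar>b - b'\<bar> * \<bar>q / sqrt (m\<^sup>2 + q\<^sup>2)\<bar>" by (simp only: abs_mult)
  also have "\<dots> \<le> \<bar>b - b'\<bar> * 1" by (intro mult_left_mono abs_quotient_sqrt_le) simp
  finally show ?thesis by simp
qed

lemma sqrt_le_cell_ham: "sqrt (m\<^sup>2 + q\<^sup>2) - \<bar>b\<bar> \<le> cell_ham m b q"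
proof -
  have "\<bar>cell_ham m b q - cell_ham m 0 q\<bar> \<le> \<bar>b\<bar>" using cell_ham_diff[of m b q 0] by simp
  moreover have "cell_ham m 0 q = sqrt (m\<^sup>2 + q\<^sup>2)" by (simp add: cell_ham_def)
  ultimately show ?thesis by linarith
qed

text \<open>Valid for every slope q: where |b| is small, any corner is admissible at a level
  slightly below |m|.\<close>

lemma cell_ham_ge: "\<bar>m\<bar> - \<bar>b\<bar> \<le> cell_ham m b q"
proof -
  have "\<bar>m\<bar> \<le> sqrt (m\<^sup>2 + q\<^sup>2)" by (rule real_le_rsqrt) simp
  then show ?thesis using sqrt_le_cell_ham[of m q b] by linarith
qed

text \<open>The factorization \<open>cell_ham - |m| = u * (k + b)\<close> with \<open>u\<close> and \<open>k\<close> increasing shows that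
  above the level \<open>|m|\<close> the map \<open>cell_ham m b\<close> grows, although it need not be convex.\<close>

lemma cell_ham_growth:
  assumes q: "0 < q" "q \<le> q'" and \<kappa>: "0 < \<kappa>" "\<bar>m\<bar> + \<kappa> \<le> cell_ham m b q"
  shows "cell_ham m b q + \<kappa> * (q' - q) / (2 * (q + \<bar>b\<bar>)) \<le> cell_ham m b q'"
proof -
  define F where "F x = sqrt (m\<^sup>2 + x\<^sup>2)" for x
  define u where "u x = x / F x" for x
  define k where "k x = x * (F x / (F x + \<bar>m\<bar>))" for x
  have F: "F x > 0" "F x * F x = m\<^sup>2 + x\<^sup>2" "x \<le> F x" "\<bar>m\<bar> \<le> F x" if "x > 0" for x
  proof -
    have "m\<^sup>2 + x\<^sup>2 > 0" using that by (simp add: add_nonneg_pos)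
    then show "F x > 0" "F x * F x = m\<^sup>2 + x\<^sup>2" by (simp_all add: F_def)
    show "x \<le> F x" "\<bar>m\<bar> \<le> F x" unfolding F_def by (rule real_le_rsqrt, simp)+
  qed
  have fact: "cell_ham m b x - \<bar>m\<bar> = u x * (k x + b)" if "x > 0" for x
  proof -
    have ne: "F x + \<bar>m\<bar> \<noteq> 0" "F x \<noteq> 0" using F(1)[OF that] by linarith+
    have "u x * k x = x * x / (F x + \<bar>m\<bar>)" using ne by (simp add: u_def k_def)
    also have "x * x = (F x - \<bar>m\<bar>) * (F x + \<bar>m\<bar>)"
      using F(2)[OF that] by (simp add: algebra_simps power2_eq_square)
    finally have "u x * k x = F x - \<bar>m\<bar>" using ne by simp
    then show ?thesis unfolding distrib_left by (simp add: cell_ham_def F_def u_def)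
  qed
  have q': "q' > 0" using q by simp
  have FF: "F q \<le> F q'" using q by (simp add: F_def power_mono)
  have u0: "u q > 0" using F(1) q by (simp add: u_def)
  have uu: "u q \<le> u q'"
  proof -
    have "q * F q' \<le> q' * F q"
    proof (rule power2_le_imp_le)
      have "q\<^sup>2 * m\<^sup>2 \<le> q'\<^sup>2 * m\<^sup>2" using q by (intro mult_right_mono power_mono) auto
      then have "q\<^sup>2 * (m\<^sup>2 + q'\<^sup>2) \<le> q'\<^sup>2 * (m\<^sup>2 + q\<^sup>2)" by (simp add: algebra_simps)
      then show "(q * F q')\<^sup>2 \<le> (q' * F q)\<^sup>2"
        using F(2)[OF q'] F(2)[OF q(1)] by (simp add: power_mult_distrib power2_eq_square[of "F _"])
      show "0 \<le> q' * F q" using q' F(1)[OF q(1)] by simp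
    qed
    then show ?thesis using F(1)[OF q'] F(1)[OF q(1)] by (simp add: u_def divide_le_eq pos_le_divide_eq mult.commute)
  qed
  \<comment> \<open>The factor F / (F + |m|) is increasing and at least 1 / 2, so k grows at least
    half as fast as its argument.\<close>
  have kk: "k q + (q' - q) / 2 \<le> k q'"
  proof -
    define r where "r x = F x / (F x + \<bar>m\<bar>)" for x
    have rr: "r q \<le> r q'"
    proof -
      have "F q * \<bar>m\<bar> \<le> F q' * \<bar>m\<bar>" using FF by (intro mult_right_mono) auto
      then have "F q * (F q' + \<bar>m\<bar>) \<le> F q' * (F q + \<bar>m\<bar>)" by (simp add: algebra_simps)
      moreover have "F q + \<bar>m\<bar> > 0" "F q' + \<bar>m\<bar> > 0" using F(1)[OF q(1)] F(1)[OF q'] by linarith+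
      moreover have "x / c \<le> y / d" if "x * d \<le> y * c" "0 < c" "0 < d" for x y c d :: real
        using that by (simp add: field_simps)
      ultimately show ?thesis unfolding r_def by blast
    qed
    have r2: "1 / 2 \<le> r q'" using F(1,4)[OF q'] by (simp add: r_def pos_le_divide_eq)
    have "k q + (q' - q) / 2 = q * r q + (q' - q) * (1 / 2)" by (simp add: k_def r_def)
    also have "\<dots> \<le> q * r q' + (q' - q) * r q'"
      using q rr r2 by (intro add_mono mult_left_mono) auto
    also have "\<dots> = q' * r q'" by (simp add: algebra_simps)
    also have "\<dots> = k q'" by (simp add: k_def r_def)
    finally show ?thesis .
  qed
  \<comment> \<open>Being above |m| + \<kappa> forces \<open>k q + b\<close> to be positive; only
    then do two increasing factors give an increasing product.\<close>
  have ukb: "\<kappa> \<le> u q * (k q + b)" using fact[OF q(1)] \<kappa> by linarith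
  then have kb: "k q + b > 0" using u0 \<kappa>(1) by (smt (verit) mult_nonneg_nonpos)
  have "k q \<le> q * 1" unfolding k_def using q F(1)[OF q(1)] by (intro mult_left_mono) (auto simp: divide_le_eq_1)
  then have kq: "k q + b \<le> q + \<bar>b\<bar>" by linarith
  have qb: "q + \<bar>b\<bar> > 0" using q by linarith
  have "\<kappa> \<le> u q * (q + \<bar>b\<bar>)" using ukb kq u0 by (meson mult_left_mono order_trans less_imp_le)
  then have uk: "\<kappa> / (q + \<bar>b\<bar>) \<le> u q" using qb by (simp add: pos_divide_le_eq)
  have "\<kappa> * (q' - q) / (2 * (q + \<bar>b\<bar>)) = \<kappa> / (q + \<bar>b\<bar>) * ((q' - q) / 2)" by simp
  also have "\<dots> \<le> u q * ((q' - q) / 2)" using uk q by (intro mult_right_mono) auto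
  finally have "u q * (k q + b) + \<kappa> * (q' - q) / (2 * (q + \<bar>b\<bar>)) \<le> u q * (k q + b + (q' - q) / 2)"
    by (simp add: distrib_left)
  also have "\<dots> \<le> u q' * (k q' + b)" using uu u0 kk kb q by (intro mult_mono) auto
  finally show ?thesis using fact[OF q(1)] fact[OF q'] by linarith
qed

lemma cell_root_unique:
  assumes s: "\<bar>m\<bar> < s" and q: "0 < q" "cell_ham m b q = s" and q': "0 < q'" "cell_ham m b q' = s"
  shows "q = q'"
proof -
  have *: "x = y" if "x \<le> y" "0 < x" "cell_ham m b x = s" "cell_ham m b y = s" for x y
  proof (rule ccontr)
    assume "x \<noteq> y"
    then have "0 < (s - \<bar>m\<bar>) * (y - x) / (2 * (x + \<bar>b\<bar>))" using that s by (intro divide_pos_pos mult_pos_pos) auto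
    moreover have "cell_ham m b x + (s - \<bar>m\<bar>) * (y - x) / (2 * (x + \<bar>b\<bar>)) \<le> cell_ham m b y"
      using that s by (intro cell_ham_growth) auto
    ultimately show False using that by linarith
  qed
  show ?thesis using *[of q q'] *[of q' q] q q' by linarith
qed

text \<open>Intermediate values on [0, s + |b|]: the value at 0 is |m| < s, and at the right end the
  strain term, at most |b| in size, cannot push the value below s. The case m = 0 is explicit, since
  the quotient is not continuous there.\<close>

lemma cell_root:
  assumes s: "\<bar>m\<bar> < s" and mb: "m = 0 \<longrightarrow> b = 0"
  shows "0 < cell_root m b s" "cell_ham m b (cell_root m b s) = s"
proof -
  have "\<exists>q>0. cell_ham m b q = s"
  proof (cases "m = 0")
    case True
    then show ?thesis using s mb by (intro exI[of _ s]) (simp add: cell_ham_def)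
  next
    case False
    have cont: "continuous_on {0..s + \<bar>b\<bar>} (cell_ham m b)"
    proof -
      have "sqrt (m\<^sup>2 + q\<^sup>2) \<noteq> 0" for q using False by (simp add: sum_power2_eq_zero_iff)
      then show ?thesis unfolding cell_ham_def[abs_def] by (intro continuous_intros) auto
    qed
    have "s + \<bar>b\<bar> \<le> sqrt (m\<^sup>2 + (s + \<bar>b\<bar>)\<^sup>2)" by (rule real_le_rsqrt) simp
    then have "s \<le> cell_ham m b (s + \<bar>b\<bar>)" using sqrt_le_cell_ham[of m "s + \<bar>b\<bar>" b] by linarith
    then obtain q where q: "0 \<le> q" "q \<le> s + \<bar>b\<bar>" "cell_ham m b q = s"
      using IVT'[of "cell_ham m b" 0 s "s + \<bar>b\<bar>"] s cont by auto
    then have "q \<noteq> 0" using s by auto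
    then show ?thesis using q by (intro exI[of _ q]) auto
  qed
  then have "\<exists>!q. 0 < q \<and> cell_ham m b q = s" using cell_root_unique[OF s] by blast
  from theI'[OF this] show "0 < cell_root m b s" "cell_ham m b (cell_root m b s) = s"
    unfolding cell_root_def by blast+
qed

lemma cell_ham_below_root:
  assumes s: "\<bar>m\<bar> < s" and mb: "m = 0 \<longrightarrow> b = 0" and q: "0 \<le> q" "q \<le> cell_root m b s"
  shows "cell_ham m b q \<le> s"
proof (cases "q = 0")
  case True then show ?thesis using s by simp
next
  case False
  show ?thesis
  proof (rule ccontr)
    assume "\<not> ?thesis"
    then have gt: "cell_ham m b q > s" by simp
    have "cell_ham m b q + (s - \<bar>m\<bar>) * (cell_root m b s - q) / (2 * (q + \<bar>b\<bar>)) \<le> cell_ham m b (cell_root m b s)"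
      using q False s gt by (intro cell_ham_growth) auto
    moreover have "0 \<le> (s - \<bar>m\<bar>) * (cell_root m b s - q) / (2 * (q + \<bar>b\<bar>))" using q s by simp
    ultimately show False using cell_root[OF s mb] gt by linarith
  qed
qed

lemma cell_ham_above_root:
  assumes s: "\<bar>m\<bar> < s" and mb: "m = 0 \<longrightarrow> b = 0" and q: "cell_root m b s \<le> q"
  shows "s \<le> cell_ham m b q"
proof -
  have "cell_ham m b (cell_root m b s) + (s - \<bar>m\<bar>) * (q - cell_root m b s) / (2 * (cell_root m b s + \<bar>b\<bar>)) \<le> cell_ham m b q"
    using q s cell_root[OF s mb] by (intro cell_ham_growth) auto
  moreover have "0 \<le> (s - \<bar>m\<bar>) * (q - cell_root m b s) / (2 * (cell_root m b s + \<bar>b\<bar>))"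
    using q s cell_root[OF s mb] by simp
  ultimately show ?thesis using cell_root[OF s mb] by linarith
qed

section \<open>Bounds, Lipschitz dependence and strain comparison of the roots\<close>

lemma cell_root_bounds:
  assumes s: "\<bar>m\<bar> < s" and mb: "m = 0 \<longrightarrow> b = 0"
  shows "cell_root m b s \<le> s + \<bar>b\<bar>" "s - \<bar>b\<bar> - \<bar>m\<bar> \<le> cell_root m b s"
proof -
  let ?q = "cell_root m b s" and ?F = "sqrt (m\<^sup>2 + (cell_root m b s)\<^sup>2)"
  have "?F - \<bar>b\<bar> \<le> s" using sqrt_le_cell_ham[of m ?q b] cell_root[OF s mb] by simp
  moreover have "?q \<le> ?F" by (rule real_le_rsqrt) simp
  ultimately show "?q \<le> s + \<bar>b\<bar>" by linarith
  have "\<bar>cell_ham m b ?q - cell_ham m 0 ?q\<bar> \<le> \<bar>b\<bar>" using cell_ham_diff[of m b ?q 0] by simp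
  moreover have "cell_ham m 0 ?q = ?F" by (simp add: cell_ham_def)
  ultimately have "s \<le> ?F + \<bar>b\<bar>" using cell_root(2)[OF s mb] by linarith
  moreover have "?F \<le> \<bar>m\<bar> + ?q" using sqrt_sum_squares_le_sum_abs[of m ?q] cell_root(1)[OF s mb] by simp
  ultimately show "s - \<bar>b\<bar> - \<bar>m\<bar> \<le> ?q" by linarith
qed

text \<open>A gap between two roots forces, by \<open>cell_ham_growth\<close>, a proportional gap
  between the values, while a change of b moves a value by at most the change itself.\<close>

lemma cell_root_lipschitz:
  assumes \<kappa>: "0 < \<kappa>" and s: "\<bar>m\<bar> + \<kappa> \<le> s" "s \<le> S" and s': "\<bar>m\<bar> + \<kappa> \<le> s'" "s' \<le> S"
    and b: "\<bar>b\<bar> \<le> B" "\<bar>b'\<bar> \<le> B" and mb: "m = 0 \<longrightarrow> b = 0" "m = 0 \<longrightarrow> b' = 0"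
  shows "\<bar>cell_root m b s - cell_root m b' s'\<bar> \<le> 2 * (S + 2 * B) / \<kappa> * (\<bar>s - s'\<bar> + \<bar>b - b'\<bar>)"
proof -
  have *: "cell_root m b' s' - cell_root m b s \<le> 2 * (S + 2 * B) / \<kappa> * (\<bar>s - s'\<bar> + \<bar>b - b'\<bar>)"
    if s: "\<bar>m\<bar> + \<kappa> \<le> s" "s \<le> S" and s': "\<bar>m\<bar> + \<kappa> \<le> s'" "s' \<le> S"
      and b: "\<bar>b\<bar> \<le> B" and mb: "m = 0 \<longrightarrow> b = 0" "m = 0 \<longrightarrow> b' = 0" for b b' s s'
  proof -
    define q where "q = cell_root m b s"
    define q' where "q' = cell_root m b' s'"
    have sm: "\<bar>m\<bar> < s" "\<bar>m\<bar> < s'" using s s' \<kappa> by auto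
    have q: "0 < q" "cell_ham m b q = s" unfolding q_def using cell_root sm mb by auto
    have q': "0 < q'" "cell_ham m b' q' = s'" unfolding q'_def using cell_root sm mb by auto
    have SB: "S + 2 * B > 0" using s \<kappa> b abs_ge_zero[of m] abs_ge_zero[of b] by linarith
    show ?thesis
    proof (cases "q \<le> q'")
      case True
      have qb: "q + \<bar>b\<bar> \<le> S + 2 * B"
        using cell_root_bounds(1)[OF sm(1) mb(1)] s b by (simp add: q_def)
      have "cell_ham m b q + \<kappa> * (q' - q) / (2 * (q + \<bar>b\<bar>)) \<le> cell_ham m b q'"
        using True q \<kappa> s by (intro cell_ham_growth) auto
      also have "\<dots> \<le> s' + \<bar>b - b'\<bar>" using cell_ham_diff[of m b q' b'] q' by linarith
      finally have 1: "\<kappa> * (q' - q) / (2 * (q + \<bar>b\<bar>)) \<le> \<bar>s - s'\<bar> + \<bar>b - b'\<bar>" using q by linarith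
      have "\<kappa> * (q' - q) / (2 * (S + 2 * B)) \<le> \<kappa> * (q' - q) / (2 * (q + \<bar>b\<bar>))"
        using qb q True \<kappa> by (intro divide_left_mono mult_pos_pos) auto
      then have "\<kappa> * (q' - q) / (2 * (S + 2 * B)) \<le> \<bar>s - s'\<bar> + \<bar>b - b'\<bar>" using 1 by linarith
      then show ?thesis using SB \<kappa> unfolding q_def[symmetric] q'_def[symmetric]
        by (simp add: pos_divide_le_eq pos_le_divide_eq mult.commute)
    next
      case False
      have "0 \<le> 2 * (S + 2 * B) / \<kappa> * (\<bar>s - s'\<bar> + \<bar>b - b'\<bar>)" using SB \<kappa> by simp
      then show ?thesis using False unfolding q_def[symmetric] q'_def[symmetric] by linarith
    qed
  qed
  show ?thesis
    using *[OF s s' b(1) mb] *[OF s' s b(2) mb(2,1)]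
    by (simp add: abs_le_iff abs_minus_commute[of s' s] abs_minus_commute[of b' b])
qed

lemma cell_root_mono:
  assumes "\<bar>m\<bar> < s" "s \<le> s'" and mb: "m = 0 \<longrightarrow> b = 0"
  shows "cell_root m b s \<le> cell_root m b s'"
proof (rule ccontr)
  assume "\<not> ?thesis"
  then have lt: "cell_root m b s' < cell_root m b s" by simp
  have s': "\<bar>m\<bar> < s'" using assms by simp
  have "cell_ham m b (cell_root m b s') + (s' - \<bar>m\<bar>) * (cell_root m b s - cell_root m b s') / (2 * (cell_root m b s' + \<bar>b\<bar>))
     \<le> cell_ham m b (cell_root m b s)"
    using cell_root[OF s' mb] lt s' by (intro cell_ham_growth) auto
  moreover have "0 < (s' - \<bar>m\<bar>) * (cell_root m b s - cell_root m b s') / (2 * (cell_root m b s' + \<bar>b\<bar>))"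
    using cell_root(1)[OF s' mb] lt s' by (intro divide_pos_pos mult_pos_pos) auto
  ultimately show False using cell_root(2)[OF s' mb] cell_root(2)[OF assms(1) mb] assms by linarith
qed

text \<open>Write q, q0 for the roots and F, F0 for the norms of (m, q), (m, q0). The identity q (q
  - q0 + b) = F0 F - (m m + q q0) turns the convexity inequality into Cauchy-Schwarz for these two
  vectors. The difference of the squares is the square of m (q - q0), so for m \<noteq> 0 equality
  forces q = q0 and then b = 0.\<close>

lemma cell_root_strain:
  assumes s: "\<bar>m\<bar> < s" and mb: "m = 0 \<longrightarrow> b = 0"
  shows "0 \<le> cell_root m b s - cell_root m 0 s + b"
    and "m \<noteq> 0 \<Longrightarrow> cell_root m b s - cell_root m 0 s + b = 0 \<Longrightarrow> b = 0"
proof -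
  define q where "q = cell_root m b s"
  define q0 where "q0 = cell_root m 0 s"
  define F where "F = sqrt (m\<^sup>2 + q\<^sup>2)"
  define F0 where "F0 = sqrt (m\<^sup>2 + q0\<^sup>2)"
  have q: "0 < q" "F + b * q / F = s" using cell_root[OF s mb] by (auto simp: q_def F_def cell_ham_def)
  have q0: "0 < q0" "F0 = s" using cell_root[OF s, of 0] by (auto simp: q0_def F0_def cell_ham_def)
  have F: "F > 0" "F * F = m\<^sup>2 + q\<^sup>2" using q by (auto simp: F_def add_nonneg_pos)
  have F0: "F0 > 0" "F0 * F0 = m\<^sup>2 + q0\<^sup>2" using q0(1) by (auto simp: F0_def add_nonneg_pos)
  have "F * F + b * q = F0 * F" using q(2) q0(2) F(1) by (simp add: field_simps)
  then have key: "q * (q - q0 + b) = F0 * F - (m\<^sup>2 + q * q0)"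
    using F(2) by (simp add: algebra_simps power2_eq_square)
  have sq: "(F0 * F)\<^sup>2 - (m\<^sup>2 + q * q0)\<^sup>2 = m\<^sup>2 * (q - q0)\<^sup>2"
  proof -
    have "(F0 * F)\<^sup>2 = (m\<^sup>2 + q0\<^sup>2) * (m\<^sup>2 + q\<^sup>2)"
      using F(2) F0(2) by (simp add: power2_eq_square mult.assoc mult.left_commute)
    then show ?thesis by (simp add: power2_eq_square algebra_simps)
  qed
  have "m\<^sup>2 + q * q0 \<le> F0 * F"
  proof (rule power2_le_imp_le)
    have "0 \<le> m\<^sup>2 * (q - q0)\<^sup>2" by simp
    then show "(m\<^sup>2 + q * q0)\<^sup>2 \<le> (F0 * F)\<^sup>2" using sq by linarith
  qed (use F F0 in auto)
  then have "0 \<le> q * (q - q0 + b)" using key by linarith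
  then show "0 \<le> cell_root m b s - cell_root m 0 s + b"
    using q(1) by (simp add: q_def q0_def zero_le_mult_iff)
  assume m: "m \<noteq> 0" and eq: "cell_root m b s - cell_root m 0 s + b = 0"
  have "F0 * F = m\<^sup>2 + q * q0" using key eq by (simp add: q_def q0_def)
  then have "m\<^sup>2 * (q - q0)\<^sup>2 = 0" using sq by simp
  then have "q = q0" using m by simp
  then show "b = 0" using eq by (simp add: q_def q0_def)
qed

section \<open>Homogenization from barriers\<close>

text \<open>Such w show that the effective Hamiltonian at p is at least l. The upper bound is
  required at z1 alone and the data only on a ball around it; uniformity in z1 replaces the
  translation invariance that is absent at a fixed \<omega>.\<close>

definition upper_barriers ::
    "(real \<Rightarrow> 'a::euclidean_space \<Rightarrow> 'a \<Rightarrow> real) \<Rightarrow> 'a \<Rightarrow> real \<Rightarrow> bool" where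
  "upper_barriers H p l \<longleftrightarrow> (\<forall>R>0. \<forall>T>0. \<forall>\<kappa>>0. \<forall>\<^sub>F \<epsilon> in at_right 0. \<forall>z1. norm z1 \<le> R \<longrightarrow>
     (\<exists>w. touching_supersolution (H \<epsilon>) w \<and> continuous_on (UNIV \<times> {0..}) w \<and>
        (\<forall>z. norm (z - z1) \<le> R \<longrightarrow> p \<bullet> (z - z1) \<le> w (z, 0)) \<and>
        (\<forall>t\<in>{0..T}. w (z1, t) \<le> - (l * t) + \<kappa>)))"

definition lower_barriers ::
    "(real \<Rightarrow> 'a::euclidean_space \<Rightarrow> 'a \<Rightarrow> real) \<Rightarrow> 'a \<Rightarrow> real \<Rightarrow> bool" where
  "lower_barriers H p l \<longleftrightarrow> upper_barriers (\<lambda>\<epsilon>. dual_hamiltonian (H \<epsilon>)) (- p) (- l)"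

lemma upper_barriersD:
  assumes "upper_barriers H p l" "R > 0" "T > 0" "\<kappa> > 0"
  shows "\<forall>\<^sub>F \<epsilon> in at_right 0. \<forall>z1. norm z1 \<le> R \<longrightarrow>
     (\<exists>w. touching_supersolution (H \<epsilon>) w \<and> continuous_on (UNIV \<times> {0..}) w \<and>
        (\<forall>z. norm (z - z1) \<le> R \<longrightarrow> p \<bullet> (z - z1) \<le> w (z, 0)) \<and>
        (\<forall>t\<in>{0..T}. w (z1, t) \<le> - (l * t) + \<kappa>))"
  using assms unfolding upper_barriers_def by blast

text \<open>Up to time T a level slightly below \<open>l0\<close> causes an error that \<kappa>
  absorbs. This permits approximation by a sequence of levels, each with its own null set.\<close>

lemma upper_barriers_limit:
  assumes "\<And>e. e > 0 \<Longrightarrow> \<exists>l>l0 - e. upper_barriers H p l"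
  shows "upper_barriers H p l0"
  unfolding upper_barriers_def
proof (intro allI impI)
  fix R T \<kappa> :: real assume R: "R > 0" "T > 0" "\<kappa> > 0"
  have "\<kappa> / (2 * T) > 0" using R by simp
  then obtain l where l: "l > l0 - \<kappa> / (2 * T)" "upper_barriers H p l" using assms by blast
  have le: "- (l * t) + \<kappa> / 2 \<le> - (l0 * t) + \<kappa>" if "t \<in> {0..T}" for t
  proof -
    have "(l0 - l) * t \<le> \<kappa> / (2 * T) * t" using l that by (intro mult_right_mono) auto
    also have "\<dots> \<le> \<kappa> / (2 * T) * T" using that R by (intro mult_left_mono) auto
    also have "\<dots> = \<kappa> / 2" using R by simp
    finally show ?thesis by (simp add: left_diff_distrib)
  qed
  have "\<kappa> / 2 > 0" using R by simp
  from upper_barriersD[OF l(2) R(1,2) this]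
  show "\<forall>\<^sub>F \<epsilon> in at_right 0. \<forall>z1. norm z1 \<le> R \<longrightarrow>
     (\<exists>w. touching_supersolution (H \<epsilon>) w \<and> continuous_on (UNIV \<times> {0..}) w \<and>
        (\<forall>z. norm (z - z1) \<le> R \<longrightarrow> p \<bullet> (z - z1) \<le> w (z, 0)) \<and>
        (\<forall>t\<in>{0..T}. w (z1, t) \<le> - (l0 * t) + \<kappa>))"
  proof eventually_elim
    case (elim \<epsilon>)
    show ?case
    proof (intro allI impI)
      fix z1 :: 'a assume "norm z1 \<le> R"
      then obtain w where w: "touching_supersolution (H \<epsilon>) w" "continuous_on (UNIV \<times> {0..}) w"
        "\<forall>z. norm (z - z1) \<le> R \<longrightarrow> p \<bullet> (z - z1) \<le> w (z, 0)" "\<forall>t\<in>{0..T}. w (z1, t) \<le> - (l * t) + \<kappa> / 2"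
        using elim by blast
      then have "\<forall>t\<in>{0..T}. w (z1, t) \<le> - (l0 * t) + \<kappa>" using le by (meson order_trans)
      then show "\<exists>w. touching_supersolution (H \<epsilon>) w \<and> continuous_on (UNIV \<times> {0..}) w \<and>
        (\<forall>z. norm (z - z1) \<le> R \<longrightarrow> p \<bullet> (z - z1) \<le> w (z, 0)) \<and>
        (\<forall>t\<in>{0..T}. w (z1, t) \<le> - (l0 * t) + \<kappa>)" using w by blast
    qed
  qed
qed

lemma touching_supersolution_add_const:
  assumes "touching_supersolution H w"
  shows "touching_supersolution H (\<lambda>q. w q + a)"
proof -
  have "(- (x + a) \<le> - (y + a) + b + c) = (- x \<le> - y + b + c)" for x y b c :: real by linarith
  then have "touches_above (\<lambda>q. - (w q + a)) = touches_above (\<lambda>q. - w q)"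
    by (simp only: fun_eq_iff touches_above_def) simp
  then show ?thesis using assms unfolding touching_supersolution_def touching_subsolution_def by simp
qed

lemma touching_supersolution_minus:
  "touching_supersolution (dual_hamiltonian H) (\<lambda>q. - u q) \<longleftrightarrow> touching_subsolution H u"
  by (simp add: touching_supersolution_def)

text \<open>The barrier for p is compared with the negated barrier for p' up to time 1; on a ball of
  radius R their affine data differ by at most |p - p'| R. For p = p' it says that upper levels
  never exceed lower ones.\<close>

lemma barriers_lipschitz:
  fixes H :: "real \<Rightarrow> 'a::euclidean_space \<Rightarrow> 'a \<Rightarrow> real"
  assumes reg: "\<And>\<epsilon>. \<epsilon> > 0 \<Longrightarrow> regular_hamiltonian A (H \<epsilon>)"
    and up: "upper_barriers H p l" and low: "lower_barriers H p' l'"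
  shows "l - l' \<le> 4 * A * norm (p - p')"
proof (rule field_le_epsilon)
  fix e :: real assume e: "e > 0"
  have A: "A > 0" using reg[of 1] by (simp add: regular_hamiltonian_def)
  \<comment> \<open>Any R > 2 A puts (0, 1) inside the domain of dependence of the ball.\<close>
  define R where "R = 4 * A"
  have R: "R > 0" using A by (simp add: R_def)
  have e2: "e / 2 > 0" using e by simp
  have pos: "\<forall>\<^sub>F \<epsilon>::real in at_right 0. \<epsilon> > 0" by (rule eventually_at_right_less)
  have "\<forall>\<^sub>F \<epsilon> in at_right (0::real). l - l' \<le> 4 * A * norm (p - p') + e"
    using upper_barriersD[OF up R zero_less_one e2]
      upper_barriersD[OF low[unfolded lower_barriers_def] R zero_less_one e2] pos
  proof eventually_elim
    case (elim \<epsilon>)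
    have n0: "norm (0::'a) \<le> R" using R by simp
    obtain w where w: "touching_supersolution (H \<epsilon>) w" "continuous_on (UNIV \<times> {0..}) w"
      "\<forall>z. norm (z - 0) \<le> R \<longrightarrow> p \<bullet> (z - 0) \<le> w (z, 0)" "\<forall>t\<in>{0..1}. w (0, t) \<le> - (l * t) + e / 2"
      using elim(1) n0 by blast
    obtain u where u: "touching_supersolution (dual_hamiltonian (H \<epsilon>)) u" "continuous_on (UNIV \<times> {0..}) u"
      "\<forall>z. norm (z - 0) \<le> R \<longrightarrow> (- p') \<bullet> (z - 0) \<le> u (z, 0)" "\<forall>t\<in>{0..1}. u (0, t) \<le> - (- l' * t) + e / 2"
      using elim(2) n0 by blast
    have "- u (0, 1) \<le> w (0, 1) + norm (p - p') * R"
    proof (rule local_comparison[OF reg[OF elim(3)], where z0 = 0 and R = R])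
      show "touching_subsolution (H \<epsilon>) (\<lambda>q. - u q)"
        using u(1) unfolding touching_supersolution_def by simp
      show "touching_supersolution (H \<epsilon>) (\<lambda>q. w q + norm (p - p') * R)"
        by (rule touching_supersolution_add_const[OF w(1)])
      fix z :: 'a assume z: "norm (z - 0) \<le> R"
      have "(p' - p) \<bullet> z \<le> norm (p' - p) * norm z" by (rule norm_cauchy_schwarz)
      also have "\<dots> \<le> norm (p - p') * R" using z by (simp add: norm_minus_commute mult_left_mono)
      finally have "p' \<bullet> z - p \<bullet> z \<le> norm (p - p') * R" by (simp add: inner_diff_left)
      moreover have "p \<bullet> z \<le> w (z, 0)" "- (p' \<bullet> z) \<le> u (z, 0)" using w(3) u(3) z by simp_all
      ultimately show "- u (z, 0) \<le> w (z, 0) + norm (p - p') * R" by linarith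
    next
      show "(norm (0 - 0 :: 'a))\<^sup>2 + 2 * A * R * 1 < R\<^sup>2" using A by (simp add: R_def power2_eq_square)
    qed (use R u w in \<open>auto intro!: continuous_intros\<close>)
    moreover have "w (0, 1) \<le> - l + e / 2" "u (0, 1) \<le> l' + e / 2"
      using w(4)[rule_format, of 1] u(4)[rule_format, of 1] by simp_all
    ultimately show ?case by (simp add: R_def mult.commute)
  qed
  then show "l - l' \<le> 4 * A * norm (p - p') + e" by simp
qed

text \<open>Shortly before a touching point the solution lies below an affine function up to order h
  squared on the ball of radius \<rho> = 4 A h. Comparison with a barrier over time h gives the
  effective inequality with that error divided by h. Finitely many slopes from S approximate all
  slopes of norm at most C, so finitely many barrier conditions are combined.\<close>

theorem approx_subsolution_effective:
  fixes H :: "real \<Rightarrow> 'a::euclidean_space \<Rightarrow> 'a \<Rightarrow> real" and Hbar :: "'a \<Rightarrow> real"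
  assumes reg: "\<And>\<epsilon>. \<epsilon> > 0 \<Longrightarrow> regular_hamiltonian A (H \<epsilon>)"
    and lip: "\<And>p q. \<bar>Hbar p - Hbar q\<bar> \<le> L * norm (p - q)"
    and dense: "closure S = UNIV" and up: "\<And>p. p \<in> S \<Longrightarrow> upper_barriers H p (Hbar p)"
    and G: "\<And>\<epsilon>. \<epsilon> > 0 \<Longrightarrow> touching_subsolution (H \<epsilon>) (G \<epsilon>)"
    and cont: "\<And>\<epsilon>. \<epsilon> > 0 \<Longrightarrow> continuous_on (UNIV \<times> {0..}) (G \<epsilon>)"
  shows "approx_subsolution (\<lambda>z p. Hbar p) (at_right 0) G"
  unfolding approx_subsolution_def
proof (intro allI impI)
  fix C \<eta> :: real assume C: "C > 0" and \<eta>: "\<eta> > 0"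
  have A: "A > 0" using reg[of 1] by (simp add: regular_hamiltonian_def)
  \<comment> \<open>Keeps the ball of radius \<rho> at time t1 - h inside the touching ball of
    radius \<eta>, and the quadratic error below h \<eta> / 4.\<close>
  define h where "h = min (\<eta> / 2) (min (\<eta> / (1 + 4 * A)) (\<eta> / (4 * C * (16 * A\<^sup>2 + 1))))"
  have c: "0 < 4 * C * (16 * A\<^sup>2 + 1)" "0 < 1 + 4 * A"
    using C A by (auto intro!: mult_pos_pos add_nonneg_pos add_pos_pos)
  have h: "h > 0" "h \<le> \<eta> / 2" unfolding h_def using c \<eta> by (simp, intro min.cobounded1)
  have "h \<le> \<eta> / (1 + 4 * A)" "h \<le> \<eta> / (4 * C * (16 * A\<^sup>2 + 1))" by (auto simp: h_def)
  then have h3: "h * (1 + 4 * A) \<le> \<eta>" "h * (4 * C * (16 * A\<^sup>2 + 1)) \<le> \<eta>"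
    using c by (simp_all only: pos_le_divide_eq)
  define \<rho> where "\<rho> = 4 * A * h"
  have \<rho>: "\<rho> > 0" using A h by (simp add: \<rho>_def)
  \<comment> \<open>Slope tolerance: it enters over the ball, as \<delta> \<rho> / h = 4 A \<delta>,
    and through the Lipschitz bound of \<open>Hbar\<close>; each share is at most \<eta> /
    8.\<close>
  define \<delta> where "\<delta> = \<eta> / (32 * A + 8 * \<bar>L\<bar>)"
  have \<delta>pos: "32 * A + 8 * \<bar>L\<bar> > 0" using A by linarith
  have \<delta>: "\<delta> > 0" using \<eta> \<delta>pos by (simp add: \<delta>_def)
  have \<delta>': "\<delta> * (32 * A) \<le> \<eta>" "\<delta> * (8 * \<bar>L\<bar>) \<le> \<eta>"
  proof -
    have "\<delta> * (32 * A + 8 * \<bar>L\<bar>) = \<eta>" using \<delta>pos by (simp add: \<delta>_def)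
    then have "\<delta> * (32 * A) + \<delta> * (8 * \<bar>L\<bar>) = \<eta>" by (simp only: distrib_left)
    moreover have "0 \<le> \<delta> * (8 * \<bar>L\<bar>)" "0 \<le> \<delta> * (32 * A)" using \<delta> A by simp_all
    ultimately show "\<delta> * (32 * A) \<le> \<eta>" "\<delta> * (8 * \<bar>L\<bar>) \<le> \<eta>" by linarith+
  qed
  have "cball (0::'a) C \<subseteq> (\<Union>p\<in>S. ball p \<delta>)"
  proof
    fix p :: 'a
    have "p \<in> closure S" using dense by simp
    then obtain p' where "p' \<in> S" "dist p' p < \<delta>" using \<delta> closure_approachable by blast
    then show "p \<in> (\<Union>p\<in>S. ball p \<delta>)" by auto
  qed
  then obtain S0 where S0: "S0 \<subseteq> S" "finite S0" "cball (0::'a) C \<subseteq> (\<Union>p\<in>S0. ball p \<delta>)"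
    using compactE_image[of "cball (0::'a) C" S "\<lambda>p. ball p \<delta>"] by auto
  define R where "R = max C \<rho>"
  have R: "R > 0" "C \<le> R" "\<rho> \<le> R" using C by (auto simp: R_def)
  have \<kappa>: "h * \<eta> / 8 > 0" using h \<eta> by simp
  have pos: "\<forall>\<^sub>F \<epsilon>::real in at_right 0. \<epsilon> > 0" by (rule eventually_at_right_less)
  have "\<forall>\<^sub>F \<epsilon> in at_right 0. \<forall>p\<in>S0. \<forall>z1. norm z1 \<le> R \<longrightarrow>
     (\<exists>w. touching_supersolution (H \<epsilon>) w \<and> continuous_on (UNIV \<times> {0..}) w \<and>
        (\<forall>z. norm (z - z1) \<le> R \<longrightarrow> p \<bullet> (z - z1) \<le> w (z, 0)) \<and>
        (\<forall>t\<in>{0..h}. w (z1, t) \<le> - (Hbar p * t) + h * \<eta> / 8))"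
    using S0 up by (intro eventually_ball_finite ballI upper_barriersD[OF _ R(1) h(1) \<kappa>]) auto
  then show "\<forall>\<^sub>F \<epsilon> in at_right 0. \<forall>q P. norm q \<le> C \<longrightarrow> \<eta> \<le> snd q \<longrightarrow> norm P \<le> C \<longrightarrow>
          touches_above (G \<epsilon>) q P C \<eta> \<longrightarrow> snd P + Hbar (fst P) \<le> \<eta>"
    using pos
  proof eventually_elim
    case (elim \<epsilon>)
    show ?case
    proof (intro allI impI)
      fix q :: "'a \<times> real" and P
      assume qC: "norm q \<le> C" and qt: "\<eta> \<le> snd q" and PC: "norm P \<le> C" and touch: "touches_above (G \<epsilon>) q P C \<eta>"
      obtain z1 t1 where q: "q = (z1, t1)" by (metis surj_pair)
      obtain p \<tau> where P: "P = (p, \<tau>)" by (metis surj_pair)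
      have "norm p \<le> C" using PC norm_fst_le_norm[of P] by (simp add: P)
      then have "p \<in> (\<Union>p\<in>S0. ball p \<delta>)" by (intro subsetD[OF S0(3)]) simp
      then obtain p' where p': "p' \<in> S0" "norm (p - p') < \<delta>" by (auto simp: dist_norm norm_minus_commute)
      have "norm z1 \<le> R" using qC norm_fst_le_norm[of q] R by (simp add: q)
      then obtain w where w: "touching_supersolution (H \<epsilon>) w" "continuous_on (UNIV \<times> {0..}) w"
        "\<forall>z. norm (z - z1) \<le> R \<longrightarrow> p' \<bullet> (z - z1) \<le> w (z, 0)"
        "\<forall>t\<in>{0..h}. w (z1, t) \<le> - (Hbar p' * t) + h * \<eta> / 8"
        using elim(1) p'(1) by blast
      define a where "a = G \<epsilon> q - \<tau> * h + C * (\<rho>\<^sup>2 + h\<^sup>2) + \<delta> * \<rho>"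
      have th: "0 \<le> t1 - h" using qt h \<eta> by (simp add: q)
      have "G \<epsilon> (fst (z1, h), snd (z1, h) + (t1 - h)) \<le> w (z1, h) + a"
      proof (rule local_comparison[OF reg[OF elim(2)], where z0 = z1 and R = \<rho> and z = z1 and t = h
            and u = "\<lambda>q. G \<epsilon> (fst q, snd q + (t1 - h))" and w = "\<lambda>q. w q + a"])
        show "touching_subsolution (H \<epsilon>) (\<lambda>q. G \<epsilon> (fst q, snd q + (t1 - h)))"
          by (rule touching_subsolution_shift[OF G[OF elim(2)] th])
        show "touching_supersolution (H \<epsilon>) (\<lambda>q. w q + a)"
          by (rule touching_supersolution_add_const[OF w(1)])
        show "continuous_on (UNIV \<times> {0..}) (\<lambda>q. G \<epsilon> (fst q, snd q + (t1 - h)))"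
          by (rule continuous_on_compose2[OF cont[OF elim(2)]])
             (use th in \<open>auto intro!: continuous_intros\<close>)
        show "continuous_on (UNIV \<times> {0..}) (\<lambda>q. w q + a)" using w(2) by (intro continuous_intros)
        show "(norm (z1 - z1))\<^sup>2 + 2 * A * \<rho> * h < \<rho>\<^sup>2"
          using A h by (simp add: \<rho>_def power2_eq_square)
        fix z :: 'a assume z: "norm (z - z1) \<le> \<rho>"
        have "norm ((z, t1 - h) - q) \<le> norm (z - z1) + h"
          using norm_Pair_le[of "z - z1" "- h"] h by (simp add: q)
        also have "\<dots> \<le> \<eta>" using z h3(1) by (simp add: \<rho>_def algebra_simps)
        finally have "(z, t1 - h) \<in> cball q \<eta>" by (simp add: dist_norm norm_minus_commute)
        then have "G \<epsilon> (z, t1 - h) \<le> G \<epsilon> q + P \<bullet> ((z, t1 - h) - q) + C * (norm ((z, t1 - h) - q))\<^sup>2"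
          using touch unfolding touches_above_def by blast
        also have "\<dots> = G \<epsilon> q + p \<bullet> (z - z1) - \<tau> * h + C * ((norm (z - z1))\<^sup>2 + h\<^sup>2)"
          by (simp add: q P norm_Pair)
        also have "\<dots> \<le> G \<epsilon> q + p \<bullet> (z - z1) - \<tau> * h + C * (\<rho>\<^sup>2 + h\<^sup>2)"
          using z C by (intro add_left_mono mult_left_mono add_right_mono power_mono) auto
        also have "p \<bullet> (z - z1) \<le> p' \<bullet> (z - z1) + \<delta> * \<rho>"
        proof -
          have "(p - p') \<bullet> (z - z1) \<le> norm (p - p') * norm (z - z1)" by (rule norm_cauchy_schwarz)
          also have "\<dots> \<le> \<delta> * \<rho>" using z p'(2) \<delta> by (intro mult_mono) auto
          finally show ?thesis by (simp add: inner_diff_left)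
        qed
        finally have "G \<epsilon> (z, t1 - h) \<le> p' \<bullet> (z - z1) + a" by (simp add: a_def)
        moreover have "p' \<bullet> (z - z1) \<le> w (z, 0)" using w(3) z R by simp
        ultimately show "G \<epsilon> (fst (z, 0), snd (z, 0) + (t1 - h)) \<le> w (z, 0) + a" by simp
      qed (use \<rho> h in auto)
      moreover have "w (z1, h) \<le> - (Hbar p' * h) + h * \<eta> / 8" using w(4) h by simp
      ultimately have "h * (\<tau> + Hbar p') \<le> h * \<eta> / 8 + C * (\<rho>\<^sup>2 + h\<^sup>2) + \<delta> * \<rho>"
        by (simp add: a_def q algebra_simps)
      moreover have "C * (\<rho>\<^sup>2 + h\<^sup>2) \<le> h * (\<eta> / 4)"
      proof -
        have "C * (\<rho>\<^sup>2 + h\<^sup>2) = h * (h * (4 * C * (16 * A\<^sup>2 + 1)) / 4)"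
          by (simp add: \<rho>_def power2_eq_square algebra_simps)
        also have "\<dots> \<le> h * (\<eta> / 4)" using h h3(2) by (intro mult_left_mono divide_right_mono) auto
        finally show ?thesis .
      qed
      moreover have "\<delta> * \<rho> \<le> h * (\<eta> / 8)"
      proof -
        have "\<delta> * \<rho> = h * (\<delta> * (32 * A) / 8)" by (simp add: \<rho>_def)
        also have "\<dots> \<le> h * (\<eta> / 8)" using h \<delta>' by (intro mult_left_mono divide_right_mono) auto
        finally show ?thesis .
      qed
      ultimately have "h * (\<tau> + Hbar p') \<le> h * (\<eta> / 2)" by (simp add: field_simps)
      then have 1: "\<tau> + Hbar p' \<le> \<eta> / 2" using h by simp
      have "\<bar>Hbar p - Hbar p'\<bar> \<le> L * norm (p - p')" by (rule lip)
      also have "\<dots> \<le> \<bar>L\<bar> * \<delta>" using p'(2) by (intro mult_mono) auto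
      also have "\<dots> \<le> \<eta> / 8" using \<delta>'(2) by (simp add: mult.commute)
      finally show "snd P + Hbar (fst P) \<le> \<eta>" using 1 \<eta> unfolding P fst_conv snd_conv by linarith
    qed
  qed
qed

lemma regular_effective:
  assumes lip: "\<And>p q. \<bar>Hbar p - Hbar q\<bar> \<le> L * norm (p - q)" and L: "L > 0" and 0: "Hbar 0 = 0"
  shows "regular_hamiltonian L (\<lambda>z p. Hbar p)"
  using assms unfolding regular_hamiltonian_def by (auto intro!: exI[of _ 0])

text \<open>The solutions of the oscillating equations are approximate sub- and supersolutions of
  the effective equation, so both sides of the limit come from comparing this family with the single
  function U.\<close>

theorem barriers_homogenization:
  fixes H :: "real \<Rightarrow> 'a::euclidean_space \<Rightarrow> 'a \<Rightarrow> real" and Hbar :: "'a \<Rightarrow> real"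
  assumes reg: "\<And>\<epsilon>. \<epsilon> > 0 \<Longrightarrow> regular_hamiltonian A (H \<epsilon>)"
    and lip: "\<And>p q. \<bar>Hbar p - Hbar q\<bar> \<le> L * norm (p - q)" and L: "L > 0" and H0: "Hbar 0 = 0"
    and dense: "closure S = UNIV"
    and up: "\<And>p. p \<in> S \<Longrightarrow> upper_barriers H p (Hbar p)"
    and low: "\<And>p. p \<in> S \<Longrightarrow> lower_barriers H p (Hbar p)"
    and g: "uniformly_continuous_on UNIV g"
    and G: "\<And>\<epsilon>. \<epsilon> > 0 \<Longrightarrow> viscosity_solution (H \<epsilon>) g (G \<epsilon>)"
    and U: "viscosity_solution (\<lambda>z p. Hbar p) g U"
    and K: "compact K" "K \<subseteq> UNIV \<times> {0..}"
  shows "uniform_limit K G U (at_right 0)"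
proof -
  have A: "A > 0" using reg[of 1] by (simp add: regular_hamiltonian_def)
  have rege: "regular_hamiltonian L (\<lambda>z p. Hbar p)" by (rule regular_effective[OF lip L H0])
  have g': "uniformly_continuous_on UNIV (\<lambda>z. - g z)"
    using uniformly_continuous_on_minus[OF g] by simp
  \<comment> \<open>The comparison asks for continuity at every index; U fills the indices
    \<epsilon> \<le> 0, which the filter does not see.\<close>
  define G' where "G' \<epsilon> = (if \<epsilon> > 0 then G \<epsilon> else U)" for \<epsilon>
  have pos: "\<forall>\<^sub>F \<epsilon>::real in at_right 0. \<epsilon> > 0" by (rule eventually_at_right_less)
  have G_sub: "touching_subsolution (H \<epsilon>) (G \<epsilon>)" "touching_supersolution (H \<epsilon>) (G \<epsilon>)"
    "continuous_on (UNIV \<times> {0..}) (G \<epsilon>)" "\<And>y. G \<epsilon> (y, 0) = g y" if "\<epsilon> > 0" for \<epsilon>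
    using G[OF that] unfolding viscosity_solution_def
    by (auto intro: viscosity_touching_subsolution viscosity_touching_supersolution)
  have U_sub: "touching_subsolution (\<lambda>z p. Hbar p) U" "touching_supersolution (\<lambda>z p. Hbar p) U"
    "continuous_on (UNIV \<times> {0..}) U" "\<And>y. U (y, 0) = g y"
    using U unfolding viscosity_solution_def
    by (auto intro: viscosity_touching_subsolution viscosity_touching_supersolution)
  have cont': "continuous_on (UNIV \<times> {0..}) (G' \<epsilon>)" for \<epsilon>
    using G_sub(3) U_sub(3) by (simp add: G'_def)
  have sub: "approx_subsolution (\<lambda>z p. Hbar p) (at_right 0) G'"
    by (rule approx_subsolution_effective[OF reg lip dense up]) (auto simp: G'_def G_sub)
  have sup: "approx_supersolution (\<lambda>z p. Hbar p) (at_right 0) G'"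
  proof -
    have "approx_subsolution (\<lambda>z p. - Hbar (- p)) (at_right 0) (\<lambda>\<epsilon> q. - G' \<epsilon> q)"
    proof (rule approx_subsolution_effective[where H = "\<lambda>\<epsilon>. dual_hamiltonian (H \<epsilon>)" and S = "uminus ` S" and A = A and L = L])
      show "regular_hamiltonian A (dual_hamiltonian (H \<epsilon>))" if "\<epsilon> > 0" for \<epsilon>
        by (rule regular_dual_hamiltonian[OF reg[OF that]])
      show "\<bar>- Hbar (- p) - - Hbar (- q)\<bar> \<le> L * norm (p - q)" for p q
        using lip[of "- p" "- q"] by (simp add: norm_minus_commute abs_minus_commute)
      show "closure (uminus ` S) = UNIV"
      proof (intro equalityI subsetI)
        fix p :: 'a
        have "- p \<in> closure S" using dense by simp
        then show "p \<in> closure (uminus ` S)"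
          unfolding closure_approachable
        proof (intro allI impI)
          fix e :: real assume "e > 0" and "\<forall>e>0. \<exists>y\<in>S. dist y (- p) < e"
          then obtain y where y: "y \<in> S" "dist y (- p) < e" by blast
          have "- y - p = - (y + p)" by simp
          then have "dist (- y) p = dist y (- p)" unfolding dist_norm by (simp only: norm_minus_cancel) simp
          then show "\<exists>x\<in>uminus ` S. dist x p < e" using y by (intro bexI[of _ "- y"]) auto
        qed
      qed simp
      show "upper_barriers (\<lambda>\<epsilon>. dual_hamiltonian (H \<epsilon>)) p (- Hbar (- p))" if "p \<in> uminus ` S" for p
        using that low unfolding lower_barriers_def by auto
      show "touching_subsolution (dual_hamiltonian (H \<epsilon>)) (\<lambda>q. - G' \<epsilon> q)" if "\<epsilon> > 0" for \<epsilon>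
        using G_sub(2)[OF that] that by (simp add: G'_def touching_supersolution_def)
      show "continuous_on (UNIV \<times> {0..}) (\<lambda>q. - G' \<epsilon> q)" for \<epsilon>
        using cont' by (intro continuous_intros)
    qed
    then show ?thesis by (simp add: approx_supersolution_def dual_hamiltonian_def[abs_def])
  qed
  have pbG: "parabola_bounded g (at_right 0) G'"
  proof (rule parabola_bounded_touching_subsolution[where H = H and A = A])
    show "\<forall>\<^sub>F \<epsilon> in at_right 0. regular_hamiltonian A (H \<epsilon>)"
      "\<forall>\<^sub>F \<epsilon> in at_right 0. touching_subsolution (H \<epsilon>) (G' \<epsilon>)"
      "\<forall>\<^sub>F \<epsilon> in at_right 0. \<forall>y. G' \<epsilon> (y, 0) = g y"
      by (rule eventually_mono[OF pos], simp add: reg G_sub G'_def)+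
  qed (use A cont' in auto)
  have pbG': "parabola_bounded (\<lambda>z. - g z) (at_right 0) (\<lambda>\<epsilon> q. - G' \<epsilon> q)"
  proof (rule parabola_bounded_touching_subsolution[where H = "\<lambda>\<epsilon>. dual_hamiltonian (H \<epsilon>)" and A = A])
    show "\<forall>\<^sub>F \<epsilon> in at_right 0. regular_hamiltonian A (dual_hamiltonian (H \<epsilon>))"
      "\<forall>\<^sub>F \<epsilon> in at_right 0. touching_subsolution (dual_hamiltonian (H \<epsilon>)) (\<lambda>q. - G' \<epsilon> q)"
      "\<forall>\<^sub>F \<epsilon> in at_right 0. \<forall>y. - G' \<epsilon> (y, 0) = - g y"
      by (rule eventually_mono[OF pos],
          simp add: reg regular_dual_hamiltonian G_sub G'_def touching_supersolution_def[symmetric])+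
    show "\<forall>\<^sub>F \<epsilon> in at_right 0. continuous_on (UNIV \<times> {0..}) (\<lambda>q. - G' \<epsilon> q)"
      using cont' by (intro always_eventually allI continuous_on_minus)
  qed (rule A)
  have pbU: "parabola_bounded g (at_right (0::real)) (\<lambda>_. U)"
    by (rule parabola_bounded_touching_subsolution[where H = "\<lambda>_ z p. Hbar p" and A = L])
       (use rege U_sub L in auto)
  have pbU': "parabola_bounded (\<lambda>z. - g z) (at_right (0::real)) (\<lambda>_ q. - U q)"
    by (rule parabola_bounded_touching_subsolution[where H = "\<lambda>_. dual_hamiltonian (\<lambda>z p. Hbar p)" and A = L])
       (use regular_dual_hamiltonian[OF rege] U_sub L in
          \<open>auto intro!: continuous_on_minus simp: touching_supersolution_def[symmetric]\<close>)
  have bdU: "\<exists>C. \<forall>z\<in>cball 0 R. \<forall>t\<in>{0..T}. \<bar>U (z, t)\<bar> \<le> C" for R T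
    by (rule continuous_bounded_on_box[OF U_sub(3)])
  have bdG: "\<exists>C. \<forall>\<^sub>F \<epsilon> in at_right 0. \<forall>z\<in>cball 0 R. \<forall>t\<in>{0..T}. G' \<epsilon> (z, t) \<le> C"
     "\<exists>C. \<forall>\<^sub>F \<epsilon> in at_right 0. \<forall>z\<in>cball 0 R. \<forall>t\<in>{0..T}. - G' \<epsilon> (z, t) \<le> C" for R T
    using parabola_bounded_box[OF g pbG] parabola_bounded_box[OF g' pbG'] by blast+
  have up1: "\<forall>\<^sub>F \<epsilon> in at_right 0. \<forall>q\<in>K. G' \<epsilon> q \<le> U q + \<mu>" if "\<mu> > 0" for \<mu>
  proof (rule global_approx_comparison[OF rege g sub _ cont' _ pbG pbU' _ K that])
    show "approx_supersolution (\<lambda>z p. Hbar p) (at_right (0::real)) (\<lambda>_. U)"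
      by (rule approx_supersolution_touching[OF U_sub(2)])
    show "\<exists>C. \<forall>\<^sub>F \<epsilon> in at_right 0. \<forall>z\<in>cball 0 R. \<forall>t\<in>{0..T}. - C \<le> G' \<epsilon> (z, t) \<and> U (z, t) \<le> C" for R T
    proof -
      obtain C1 where C1: "\<forall>z\<in>cball 0 R. \<forall>t\<in>{0..T}. \<bar>U (z, t)\<bar> \<le> C1" using bdU by blast
      obtain C2 where C2: "\<forall>\<^sub>F \<epsilon> in at_right 0. \<forall>z\<in>cball 0 R. \<forall>t\<in>{0..T}. - G' \<epsilon> (z, t) \<le> C2" using bdG(2) by blast
      have "\<forall>\<^sub>F \<epsilon> in at_right 0. \<forall>z\<in>cball 0 R. \<forall>t\<in>{0..T}. - max C1 C2 \<le> G' \<epsilon> (z, t) \<and> U (z, t) \<le> max C1 C2"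
        using C2
      proof eventually_elim
        case (elim \<epsilon>)
        show ?case
        proof (intro ballI)
          fix z t assume zt: "z \<in> cball (0::'a) R" "t \<in> {0..T}"
          have "- G' \<epsilon> (z, t) \<le> C2" "\<bar>U (z, t)\<bar> \<le> C1" using elim C1 zt by blast+
          then show "- max C1 C2 \<le> G' \<epsilon> (z, t) \<and> U (z, t) \<le> max C1 C2" by linarith
        qed
      qed
      then show ?thesis by blast
    qed
  qed (rule U_sub)
  have up2: "\<forall>\<^sub>F \<epsilon> in at_right 0. \<forall>q\<in>K. U q \<le> G' \<epsilon> q + \<mu>" if "\<mu> > 0" for \<mu>
  proof (rule global_approx_comparison[OF rege g _ sup _ cont' pbU pbG' _ K that])
    show "approx_subsolution (\<lambda>z p. Hbar p) (at_right (0::real)) (\<lambda>_. U)"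
      by (rule approx_subsolution_touching[OF U_sub(1)])
    show "\<exists>C. \<forall>\<^sub>F \<epsilon> in at_right 0. \<forall>z\<in>cball 0 R. \<forall>t\<in>{0..T}. - C \<le> U (z, t) \<and> G' \<epsilon> (z, t) \<le> C" for R T
    proof -
      obtain C1 where C1: "\<forall>z\<in>cball 0 R. \<forall>t\<in>{0..T}. \<bar>U (z, t)\<bar> \<le> C1" using bdU by blast
      obtain C2 where C2: "\<forall>\<^sub>F \<epsilon> in at_right 0. \<forall>z\<in>cball 0 R. \<forall>t\<in>{0..T}. G' \<epsilon> (z, t) \<le> C2" using bdG(1) by blast
      have "\<forall>\<^sub>F \<epsilon> in at_right 0. \<forall>z\<in>cball 0 R. \<forall>t\<in>{0..T}. - max C1 C2 \<le> U (z, t) \<and> G' \<epsilon> (z, t) \<le> max C1 C2"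
        using C2
      proof eventually_elim
        case (elim \<epsilon>)
        show ?case
        proof (intro ballI)
          fix z t assume zt: "z \<in> cball (0::'a) R" "t \<in> {0..T}"
          have "G' \<epsilon> (z, t) \<le> C2" "\<bar>U (z, t)\<bar> \<le> C1" using elim C1 zt by blast+
          then show "- max C1 C2 \<le> U (z, t) \<and> G' \<epsilon> (z, t) \<le> max C1 C2" by linarith
        qed
      qed
      then show ?thesis by blast
    qed
  qed (rule U_sub)
  show ?thesis
  proof (rule uniform_limitI)
    fix e :: real assume e: "e > 0"
    then have e2: "e / 2 > 0" by simp
    show "\<forall>\<^sub>F \<epsilon> in at_right 0. \<forall>q\<in>K. dist (G \<epsilon> q) (U q) < e"
      using up1[OF e2] up2[OF e2] pos
    proof eventually_elim
      case (elim \<epsilon>)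
      show ?case
      proof
        fix q assume "q \<in> K"
        then have "G \<epsilon> q \<le> U q + e / 2" "U q \<le> G \<epsilon> q + e / 2" using elim by (auto simp: G'_def)
        then show "dist (G \<epsilon> q) (U q) < e" using e by (simp add: dist_real_def abs_if)
      qed
    qed
  qed
qed

section \<open>Correctors of the shear flow\<close>

definition shear_ham :: "(real \<Rightarrow> real) \<Rightarrow> (real \<Rightarrow> real) \<Rightarrow> real \<Rightarrow> real^2 \<Rightarrow> real^2 \<Rightarrow> real" where
  "shear_ham f d c z p = norm p + f (z $ 2) * p $ 1 + c * (p $ 1 * p $ 2 * d (z $ 2) / norm p)"

lemma norm_2: "norm (p :: real^2) = sqrt ((p $ 1)\<^sup>2 + (p $ 2)\<^sup>2)"
  by (simp add: norm_vec_def L2_set_def sum_2)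

lemma shear_ham_cell: "shear_ham f d c z p = p $ 1 * f (z $ 2) + cell_ham (p $ 1) (c * p $ 1 * d (z $ 2)) (p $ 2)"
  by (simp add: shear_ham_def cell_ham_def norm_2 algebra_simps)

text \<open>The unit vector is discontinuous at 0, but its variation weighted by the norm is
  controlled; this tames the strain term near p = 0.\<close>

lemma norm_normalize_diff: "norm q * norm (p /\<^sub>R norm p - q /\<^sub>R norm q) \<le> 2 * norm (p - q)" for p q :: "'a::real_normed_vector"
proof (cases "p = 0 \<or> q = 0")
  case True
  then show ?thesis by (cases "q = 0") auto
next
  case False
  have "norm q *\<^sub>R (p /\<^sub>R norm p - q /\<^sub>R norm q) = ((norm q - norm p) / norm p) *\<^sub>R p + (p - q)"
    using False by (simp add: algebra_simps divide_inverse)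
  then have "norm q * norm (p /\<^sub>R norm p - q /\<^sub>R norm q) = norm (((norm q - norm p) / norm p) *\<^sub>R p + (p - q))"
    by (metis abs_norm_cancel norm_scaleR)
  also have "\<dots> \<le> norm (((norm q - norm p) / norm p) *\<^sub>R p) + norm (p - q)" by (rule norm_triangle_ineq)
  also have "norm (((norm q - norm p) / norm p) *\<^sub>R p) = \<bar>norm q - norm p\<bar>" using False by simp
  also have "\<dots> \<le> norm (p - q)" using norm_triangle_ineq3[of q p] by (simp add: norm_minus_commute)
  finally show ?thesis by simp
qed

text \<open>The map taking p to p1 p2 / |p| is Lipschitz with constant 3: one unit-vector factor is
  at most 1, and the other part is a weighted normalized difference. The resulting constant uses
  only the bound B, so rescaling the arguments of f and d leaves it unchanged.\<close>

lemma regular_shear_ham: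
  assumes f: "\<And>y. \<bar>f y\<bar> \<le> B" and d: "\<And>y. \<bar>d y\<bar> \<le> B"
    and fl: "\<And>R. \<exists>L. \<forall>y y'. \<bar>y\<bar> \<le> R \<longrightarrow> \<bar>y'\<bar> \<le> R \<longrightarrow> \<bar>f y - f y'\<bar> \<le> L * \<bar>y - y'\<bar>"
    and dl: "\<And>R. \<exists>L. \<forall>y y'. \<bar>y\<bar> \<le> R \<longrightarrow> \<bar>y'\<bar> \<le> R \<longrightarrow> \<bar>d y - d y'\<bar> \<le> L * \<bar>y - y'\<bar>"
  shows "regular_hamiltonian (1 + B + 3 * \<bar>c\<bar> * B) (shear_ham f d c)"
  unfolding regular_hamiltonian_def
proof (intro conjI allI)
  have B: "B \<ge> 0" using f[of 0] by linarith
  then show "1 + B + 3 * \<bar>c\<bar> * B > 0" by (simp add: add_pos_nonneg)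
  show "shear_ham f d c z 0 = 0" for z by (simp add: shear_ham_def)
  have quot: "\<bar>p $ 1 * p $ 2 / norm p - q $ 1 * q $ 2 / norm q\<bar> \<le> 3 * norm (p - q)" for p q :: "real^2"
  proof -
    have "p $ 1 * p $ 2 / norm p - q $ 1 * q $ 2 / norm q
       = (p /\<^sub>R norm p) $ 1 * (p - q) $ 2 + q $ 2 * (p /\<^sub>R norm p - q /\<^sub>R norm q) $ 1"
      by (simp add: divide_inverse algebra_simps)
    also have "\<bar>\<dots>\<bar> \<le> \<bar>(p /\<^sub>R norm p) $ 1\<bar> * \<bar>(p - q) $ 2\<bar> + \<bar>q $ 2\<bar> * \<bar>(p /\<^sub>R norm p - q /\<^sub>R norm q) $ 1\<bar>"
      by (simp only: abs_mult[symmetric] abs_triangle_ineq)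
    also have "\<dots> \<le> 1 * norm (p - q) + norm q * norm (p /\<^sub>R norm p - q /\<^sub>R norm q)"
    proof (intro add_mono mult_mono component_le_norm_cart)
      have "\<bar>(p /\<^sub>R norm p) $ 1\<bar> \<le> norm (p /\<^sub>R norm p)" by (rule component_le_norm_cart)
      also have "\<dots> \<le> 1" by (cases "p = 0") auto
      finally show "\<bar>(p /\<^sub>R norm p) $ 1\<bar> \<le> 1" .
    qed auto
    also have "\<dots> \<le> 3 * norm (p - q)" using norm_normalize_diff[of q p] by simp
    finally show ?thesis .
  qed
  show "\<bar>shear_ham f d c z p - shear_ham f d c z q\<bar> \<le> (1 + B + 3 * \<bar>c\<bar> * B) * norm (p - q)" for z p q
  proof -
    have tri: "\<bar>x + y + w\<bar> \<le> a + b + e" if "\<bar>x\<bar> \<le> a" "\<bar>y\<bar> \<le> b" "\<bar>w\<bar> \<le> e" for x y w a b e :: real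
      using that by linarith
    have eq: "shear_ham f d c z p - shear_ham f d c z q = (norm p - norm q) + f (z $ 2) * (p - q) $ 1
      + c * d (z $ 2) * (p $ 1 * p $ 2 / norm p - q $ 1 * q $ 2 / norm q)"
      by (simp add: shear_ham_def algebra_simps)
    have "\<bar>norm p - norm q\<bar> \<le> norm (p - q)" by (rule norm_triangle_ineq3)
    moreover have "\<bar>f (z $ 2) * (p - q) $ 1\<bar> \<le> B * norm (p - q)"
      unfolding abs_mult using f B by (intro mult_mono component_le_norm_cart) auto
    moreover have "\<bar>c * d (z $ 2) * (p $ 1 * p $ 2 / norm p - q $ 1 * q $ 2 / norm q)\<bar> \<le> \<bar>c\<bar> * B * (3 * norm (p - q))"
      unfolding abs_mult using d B quot[of p q] by (intro mult_mono mult_nonneg_nonneg) auto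
    ultimately have "\<bar>shear_ham f d c z p - shear_ham f d c z q\<bar> \<le> norm (p - q) + B * norm (p - q) + \<bar>c\<bar> * B * (3 * norm (p - q))"
      unfolding eq by (rule tri)
    then show ?thesis by (simp add: algebra_simps)
  qed
  fix R
  obtain L1 where L1: "\<forall>y y'. \<bar>y\<bar> \<le> R \<longrightarrow> \<bar>y'\<bar> \<le> R \<longrightarrow> \<bar>f y - f y'\<bar> \<le> L1 * \<bar>y - y'\<bar>" using fl by blast
  obtain L2 where L2: "\<forall>y y'. \<bar>y\<bar> \<le> R \<longrightarrow> \<bar>y'\<bar> \<le> R \<longrightarrow> \<bar>d y - d y'\<bar> \<le> L2 * \<bar>y - y'\<bar>" using dl by blast
  show "\<exists>C. \<forall>z z' p. norm z \<le> R \<longrightarrow> norm z' \<le> R \<longrightarrow>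
      \<bar>shear_ham f d c z p - shear_ham f d c z' p\<bar> \<le> C * norm (z - z') * (1 + norm p)"
  proof (intro exI[of _ "\<bar>L1\<bar> + \<bar>c\<bar> * \<bar>L2\<bar>"] allI impI)
    fix z z' p :: "real^2" assume z: "norm z \<le> R" "norm z' \<le> R"
    have zR: "\<bar>z $ 2\<bar> \<le> R" "\<bar>z' $ 2\<bar> \<le> R" using z component_le_norm_cart order_trans by blast+
    have zz: "\<bar>z $ 2 - z' $ 2\<bar> \<le> norm (z - z')" using component_le_norm_cart[of "z - z'" 2] by simp
    have 1: "\<bar>f (z $ 2) - f (z' $ 2)\<bar> \<le> \<bar>L1\<bar> * norm (z - z')"
    proof -
      have "\<bar>f (z $ 2) - f (z' $ 2)\<bar> \<le> L1 * \<bar>z $ 2 - z' $ 2\<bar>" using L1 zR by blast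
      also have "\<dots> \<le> \<bar>L1\<bar> * norm (z - z')" using zz by (intro mult_mono) auto
      finally show ?thesis .
    qed
    have 2: "\<bar>d (z $ 2) - d (z' $ 2)\<bar> \<le> \<bar>L2\<bar> * norm (z - z')"
    proof -
      have "\<bar>d (z $ 2) - d (z' $ 2)\<bar> \<le> L2 * \<bar>z $ 2 - z' $ 2\<bar>" using L2 zR by blast
      also have "\<dots> \<le> \<bar>L2\<bar> * norm (z - z')" using zz by (intro mult_mono) auto
      finally show ?thesis .
    qed
    have pq: "\<bar>p $ 1 * p $ 2 / norm p\<bar> \<le> norm p"
    proof (cases "p = 0")
      case False
      have "\<bar>p $ 1\<bar> * \<bar>p $ 2\<bar> \<le> norm p * norm p" by (intro mult_mono component_le_norm_cart) auto
      then show ?thesis using False by (simp add: abs_mult divide_le_eq)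
    qed simp
    have tri: "\<bar>x + y\<bar> \<le> a + b" if "\<bar>x\<bar> \<le> a" "\<bar>y\<bar> \<le> b" for x y a b :: real
      using that by linarith
    have eq: "shear_ham f d c z p - shear_ham f d c z' p = (f (z $ 2) - f (z' $ 2)) * p $ 1
       + c * ((d (z $ 2) - d (z' $ 2)) * (p $ 1 * p $ 2 / norm p))"
      by (simp add: shear_ham_def algebra_simps diff_divide_distrib)
    have "\<bar>(f (z $ 2) - f (z' $ 2)) * p $ 1\<bar> \<le> \<bar>L1\<bar> * norm (z - z') * norm p"
      unfolding abs_mult using 1 by (intro mult_mono component_le_norm_cart) auto
    moreover have "\<bar>c * ((d (z $ 2) - d (z' $ 2)) * (p $ 1 * p $ 2 / norm p))\<bar> \<le> \<bar>c\<bar> * (\<bar>L2\<bar> * norm (z - z') * norm p)"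
      unfolding abs_mult[of c] abs_mult[of "d _ - d _"] using 2 pq by (intro mult_left_mono mult_mono) auto
    ultimately have "\<bar>shear_ham f d c z p - shear_ham f d c z' p\<bar>
        \<le> \<bar>L1\<bar> * norm (z - z') * norm p + \<bar>c\<bar> * (\<bar>L2\<bar> * norm (z - z') * norm p)"
      unfolding eq by (rule tri)
    also have "\<dots> = (\<bar>L1\<bar> + \<bar>c\<bar> * \<bar>L2\<bar>) * norm (z - z') * norm p" by (simp add: algebra_simps)
    also have "\<dots> \<le> (\<bar>L1\<bar> + \<bar>c\<bar> * \<bar>L2\<bar>) * norm (z - z') * (1 + norm p)"
      by (intro mult_left_mono) auto
    finally show "\<bar>shear_ham f d c z p - shear_ham f d c z' p\<bar> \<le> (\<bar>L1\<bar> + \<bar>c\<bar> * \<bar>L2\<bar>) * norm (z - z') * (1 + norm p)" .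
  qed
qed

section \<open>Profiles with one corner and the paraboloids touching them\<close>

lemma right_derivative_le:
  fixes G :: "real \<Rightarrow> real"
  assumes G: "(G has_real_derivative g) (at y)" and r: "r > 0"
    and le: "\<And>s. 0 < s \<Longrightarrow> s \<le> r \<Longrightarrow> G (y + s) - G y \<le> p * s + C * s\<^sup>2"
  shows "g \<le> p"
proof (rule tendsto_le)
  show "((\<lambda>s. p + C * s) \<longlongrightarrow> p) (at_right 0)" by (rule tendsto_eq_intros refl | simp)+
  have "((\<lambda>h. (G (y + h) - G y) / h) \<longlongrightarrow> g) (at 0)" using G by (simp add: DERIV_def)
  then show "((\<lambda>h. (G (y + h) - G y) / h) \<longlongrightarrow> g) (at_right 0)"
    by (rule filterlim_mono) (auto simp: at_le)
  have "\<forall>\<^sub>F s in at_right 0. s \<in> {0<..<r}" using r by (rule eventually_at_right_real)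
  then show "\<forall>\<^sub>F s in at_right 0. (G (y + s) - G y) / s \<le> p + C * s"
  proof eventually_elim
    case (elim s)
    then show ?case using le[of s] by (simp add: divide_le_eq power2_eq_square algebra_simps)
  qed
qed simp

lemma left_derivative_ge:
  fixes G :: "real \<Rightarrow> real"
  assumes G: "(G has_real_derivative g) (at y)" and r: "r > 0"
    and le: "\<And>s. 0 < s \<Longrightarrow> s \<le> r \<Longrightarrow> G (y - s) - G y \<le> - p * s + C * s\<^sup>2"
  shows "p \<le> g"
proof -
  have "((\<lambda>x. G (- x)) has_real_derivative g * - 1) (at (- y))"
    by (rule DERIV_chain2[where f = G]) (use G in \<open>auto intro!: derivative_eq_intros\<close>)
  then have "g * - 1 \<le> - p"
    by (rule right_derivative_le[OF _ r, where C = C]) (use le in \<open>auto simp: algebra_simps\<close>)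
  then show ?thesis by simp
qed

definition profile :: "real \<Rightarrow> (real \<Rightarrow> real) \<Rightarrow> real \<Rightarrow> real \<Rightarrow> (real^2) \<times> real \<Rightarrow> real" where
  "profile m M l a q = m * (fst q $ 1) + M (fst q $ 2) - l * snd q + a"

definition kink :: "(real \<Rightarrow> real) \<Rightarrow> (real \<Rightarrow> real) \<Rightarrow> real \<Rightarrow> real \<Rightarrow> real" where
  "kink Gr Gl \<eta> y = (if y \<ge> \<eta> then Gr y - Gr \<eta> else Gl y - Gl \<eta>)"

lemma continuous_on_kink:
  assumes "continuous_on UNIV Gr" "continuous_on UNIV Gl"
  shows "continuous_on UNIV (kink Gr Gl \<eta>)"
proof -
  have U: "(UNIV :: real set) = {y. \<eta> \<le> y} \<union> {y. y \<le> \<eta>}" by auto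
  have "continuous_on ({y. \<eta> \<le> y} \<union> {y. y \<le> \<eta>}) (\<lambda>y. if y \<ge> \<eta> then Gr y - Gr \<eta> else Gl y - Gl \<eta>)"
    by (rule continuous_on_cases)
       (auto intro!: closed_Collect_le continuous_intros continuous_on_subset[OF assms(1)] continuous_on_subset[OF assms(2)])
  then show ?thesis unfolding U[symmetric] kink_def[abs_def] .
qed

lemma continuous_on_profile:
  assumes "continuous_on UNIV M"
  shows "continuous_on S (profile m M l a)"
proof -
  have "continuous_on S (\<lambda>q. M (fst q $ 2))"
    by (rule continuous_on_compose2[OF assms]) (auto intro!: continuous_intros)
  then show ?thesis unfolding profile_def[abs_def] by (intro continuous_intros)
qed

text \<open>Test along the three axes: in x and t the profile is affine, which forces the slope of
  the paraboloid; in y only a one-dimensional inequality for M remains.\<close>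

lemma profile_touches_above:
  assumes t: "touches_above (profile m M l a) q P C r" and r: "r > 0"
  shows "fst P $ 1 = m" "snd P = - l"
    "\<And>s. \<bar>s\<bar> \<le> r \<Longrightarrow> M (fst q $ 2 + s) - M (fst q $ 2) \<le> fst P $ 2 * s + C * s\<^sup>2"
proof -
  have *: "profile m M l a (q + e) \<le> profile m M l a q + P \<bullet> e + C * (norm e)\<^sup>2" if "norm e \<le> r" for e
  proof -
    have "q + e \<in> cball q r" using that by (simp add: dist_norm)
    then show ?thesis using t unfolding touches_above_def by fastforce
  qed
  have ax: "(axis 1 1 :: real^2) $ 1 = 1" "(axis 1 1 :: real^2) $ 2 = 0"
    "(axis 2 1 :: real^2) $ 1 = 0" "(axis 2 1 :: real^2) $ 2 = 1" by (simp_all add: axis_def)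
  have x: "m * s \<le> fst P $ 1 * s + C * s\<^sup>2" if "\<bar>s\<bar> \<le> r" for s
    using *[of "(s *\<^sub>R axis 1 1, 0)"] that
    by (cases P) (simp add: profile_def norm_Pair inner_axis power_mult_distrib algebra_simps ax)
  have y: "M (fst q $ 2 + s) - M (fst q $ 2) \<le> fst P $ 2 * s + C * s\<^sup>2" if "\<bar>s\<bar> \<le> r" for s
    using *[of "(s *\<^sub>R axis 2 1, 0)"] that
    by (cases P) (simp add: profile_def norm_Pair inner_axis power_mult_distrib algebra_simps ax)
  have t: "- l * s \<le> snd P * s + C * s\<^sup>2" if "\<bar>s\<bar> \<le> r" for s
    using *[of "(0, s)"] that by (cases P) (simp add: profile_def norm_Pair algebra_simps)
  show "\<And>s. \<bar>s\<bar> \<le> r \<Longrightarrow> M (fst q $ 2 + s) - M (fst q $ 2) \<le> fst P $ 2 * s + C * s\<^sup>2" by (rule y)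
  have lin: "k = k'" if "\<And>s. \<bar>s\<bar> \<le> r \<Longrightarrow> k * s \<le> k' * s + C * s\<^sup>2" for k k' :: real
  proof (rule antisym)
    have D: "((\<lambda>x. k * x) has_real_derivative k) (at 0)" by (auto intro!: derivative_eq_intros)
    show "k \<le> k'" by (rule right_derivative_le[OF D r, where C = C]) (use that in auto)
    show "k' \<le> k"
    proof (rule left_derivative_ge[OF D r, where C = C])
      fix s assume "0 < s" "s \<le> r"
      then show "k * (0 - s) - k * 0 \<le> - k' * s + C * s\<^sup>2" using that[of "- s"] by simp
    qed
  qed
  show "fst P $ 1 = m" using lin[OF x] by simp
  show "snd P = - l" using lin[OF t] by simp
qed

text \<open>Away from the corner the slope is the derivative. At the corner the one-sided
  derivatives confine it to the range from gr to gl, which is empty for a convex corner.\<close>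

lemma kink_touch_slope:
  assumes Gr: "\<And>y. (Gr has_real_derivative gr y) (at y)" and Gl: "\<And>y. (Gl has_real_derivative gl y) (at y)"
    and r: "r > 0" and le: "\<And>s. \<bar>s\<bar> \<le> r \<Longrightarrow> kink Gr Gl \<eta> (y + s) - kink Gr Gl \<eta> y \<le> p * s + C * s\<^sup>2"
  shows "y > \<eta> \<Longrightarrow> p = gr y" "y < \<eta> \<Longrightarrow> p = gl y" "y = \<eta> \<Longrightarrow> gr y \<le> p \<and> p \<le> gl y"
proof -
  have R: "gr y \<le> p" if "y \<ge> \<eta>"
  proof (rule right_derivative_le[OF Gr r, where C = C])
    fix s assume "0 < s" "s \<le> r"
    then show "Gr (y + s) - Gr y \<le> p * s + C * s\<^sup>2" using le[of s] that by (simp add: kink_def)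
  qed
  have L: "p \<le> gl y" if "y \<le> \<eta>"
  proof (rule left_derivative_ge[OF Gl r, where C = C])
    fix s assume "0 < s" "s \<le> r"
    then show "Gl (y - s) - Gl y \<le> - p * s + C * s\<^sup>2" using le[of "- s"] that by (cases "y = \<eta>") (simp_all add: kink_def)
  qed
  show "y = \<eta> \<Longrightarrow> gr y \<le> p \<and> p \<le> gl y" using R L by simp
  assume *: "y > \<eta>"
  show "p = gr y"
  proof (rule antisym)
    show "gr y \<le> p" using R * by simp
    show "p \<le> gr y"
    proof (rule left_derivative_ge[OF Gr, where C = C and r = "min r (y - \<eta>)"])
      fix s assume "0 < s" "s \<le> min r (y - \<eta>)"
      then show "Gr (y - s) - Gr y \<le> - p * s + C * s\<^sup>2" using le[of "- s"] * by (simp add: kink_def)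
    qed (use r * in auto)
  qed
next
  assume *: "y < \<eta>"
  have L: "p \<le> gl y"
  proof (rule left_derivative_ge[OF Gl r, where C = C])
    fix s assume "0 < s" "s \<le> r"
    then show "Gl (y - s) - Gl y \<le> - p * s + C * s\<^sup>2" using le[of "- s"] * by (simp add: kink_def)
  qed
  have "gl y \<le> p"
  proof (rule right_derivative_le[OF Gl, where C = C and r = "min r ((\<eta> - y) / 2)"])
    fix s assume "0 < s" "s \<le> min r ((\<eta> - y) / 2)"
    then show "Gl (y + s) - Gl y \<le> p * s + C * s\<^sup>2" using le[of s] * by (simp add: kink_def)
  qed (use r * in auto)
  then show "p = gl y" using L by simp
qed

lemma kink_touching_subsolution:
  assumes Gr: "\<And>y. (Gr has_real_derivative gr y) (at y)" and Gl: "\<And>y. (Gl has_real_derivative gl y) (at y)"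
    and Hr: "\<And>y. y > \<eta> \<Longrightarrow> m * f y + cell_ham m (c * m * d y) (gr y) \<le> l"
    and Hl: "\<And>y. y < \<eta> \<Longrightarrow> m * f y + cell_ham m (c * m * d y) (gl y) \<le> l"
    and H\<eta>: "\<And>p. gr \<eta> \<le> p \<Longrightarrow> p \<le> gl \<eta> \<Longrightarrow> m * f \<eta> + cell_ham m (c * m * d \<eta>) p \<le> l"
  shows "touching_subsolution (shear_ham f d c) (profile m (kink Gr Gl \<eta>) l a)"
  unfolding touching_subsolution_def
proof (intro allI impI)
  fix q P C and r :: real
  assume r: "0 < r" and t: "touches_above (profile m (kink Gr Gl \<eta>) l a) q P C r"
  note pt = profile_touches_above[OF t r]
  define y where "y = fst q $ 2"
  have le: "kink Gr Gl \<eta> (y + s) - kink Gr Gl \<eta> y \<le> fst P $ 2 * s + C * s\<^sup>2" if "\<bar>s\<bar> \<le> r" for s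
    using pt(3)[OF that] by (simp add: y_def)
  note ks = kink_touch_slope[OF Gr Gl r le]
  have "m * f y + cell_ham m (c * m * d y) (fst P $ 2) \<le> l"
    using ks Hr[of y] Hl[of y] H\<eta>[of "fst P $ 2"] by (cases y \<eta> rule: linorder_cases) auto
  then show "snd P + shear_ham f d c (fst q) (fst P) \<le> 0"
    unfolding shear_ham_cell pt y_def by simp
qed

lemma profile_minus: "- profile m M l a q = profile (- m) (\<lambda>y. - M y) (- l) (- a) q"
  by (simp add: profile_def)

lemma kink_minus: "- kink Gr Gl \<eta> y = kink (\<lambda>y. - Gr y) (\<lambda>y. - Gl y) \<eta> y"
  by (simp add: kink_def)

text \<open>Negation exchanges convex and concave corners, so the slopes to be tested at \<eta> are
  those from gl up to gr.\<close>

lemma kink_touching_supersolution: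
  assumes Gr: "\<And>y. (Gr has_real_derivative gr y) (at y)" and Gl: "\<And>y. (Gl has_real_derivative gl y) (at y)"
    and Hr: "\<And>y. y > \<eta> \<Longrightarrow> m * f y + cell_ham m (c * m * d y) (gr y) \<ge> l"
    and Hl: "\<And>y. y < \<eta> \<Longrightarrow> m * f y + cell_ham m (c * m * d y) (gl y) \<ge> l"
    and H\<eta>: "\<And>p. gl \<eta> \<le> p \<Longrightarrow> p \<le> gr \<eta> \<Longrightarrow> m * f \<eta> + cell_ham m (c * m * d \<eta>) p \<ge> l"
  shows "touching_supersolution (shear_ham f d c) (profile m (kink Gr Gl \<eta>) l a)"
  unfolding touching_supersolution_def touching_subsolution_def profile_minus kink_minus
proof (intro allI impI)
  fix q P C and r :: real
  assume r: "0 < r" and t: "touches_above (profile (- m) (kink (\<lambda>y. - Gr y) (\<lambda>y. - Gl y) \<eta>) (- l) (- a)) q P C r"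
  note pt = profile_touches_above[OF t r]
  define y where "y = fst q $ 2"
  have le: "kink (\<lambda>y. - Gr y) (\<lambda>y. - Gl y) \<eta> (y + s) - kink (\<lambda>y. - Gr y) (\<lambda>y. - Gl y) \<eta> y \<le> fst P $ 2 * s + C * s\<^sup>2" if "\<bar>s\<bar> \<le> r" for s
    using pt(3)[OF that] by (simp add: y_def)
  note ks = kink_touch_slope[OF DERIV_minus[OF Gr] DERIV_minus[OF Gl] r le]
  have "m * f y + cell_ham m (c * m * d y) (- fst P $ 2) \<ge> l"
    using ks Hr[of y] Hl[of y] H\<eta>[of "- fst P $ 2"] by (cases y \<eta> rule: linorder_cases) auto
  then show "snd P + dual_hamiltonian (shear_ham f d c) (fst q) (fst P) \<le> 0"
    unfolding dual_hamiltonian_def shear_ham_cell y_def using pt(1,2) by simp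
qed

section \<open>Barriers from two slope fields with given means\<close>

definition scaled_shear_ham :: "(real \<Rightarrow> real) \<Rightarrow> (real \<Rightarrow> real) \<Rightarrow> real \<Rightarrow> real \<Rightarrow> real^2 \<Rightarrow> real^2 \<Rightarrow> real" where
  "scaled_shear_ham f d c \<epsilon> = shear_ham (\<lambda>y. f (y / \<epsilon>)) (\<lambda>y. d (y / \<epsilon>)) c"

definition rescale :: "real \<Rightarrow> (real \<Rightarrow> real) \<Rightarrow> real \<Rightarrow> real" where
  "rescale \<epsilon> G y = \<epsilon> * G (y / \<epsilon>)"

lemma rescale_derivative:
  assumes "\<And>y. (G has_real_derivative g y) (at y)" "\<epsilon> > 0"
  shows "(rescale \<epsilon> G has_real_derivative g (y / \<epsilon>)) (at y)"
proof -
  have "((\<lambda>y. G (y / \<epsilon>)) has_real_derivative g (y / \<epsilon>) * (1 / \<epsilon>)) (at y)"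
    by (rule DERIV_chain2[OF assms(1)]) (use assms(2) in \<open>auto intro!: derivative_eq_intros\<close>)
  from DERIV_cmult[OF this, of \<epsilon>] show ?thesis
    using assms(2) by (simp add: rescale_def[abs_def])
qed

lemma rescale_mean:
  assumes "\<And>y. \<bar>G y - a * y\<bar> \<le> \<kappa> * \<bar>y\<bar> + D" "\<epsilon> > 0"
  shows "\<bar>rescale \<epsilon> G y - a * y\<bar> \<le> \<kappa> * \<bar>y\<bar> + \<epsilon> * D"
proof -
  have "rescale \<epsilon> G y - a * y = \<epsilon> * (G (y / \<epsilon>) - a * (y / \<epsilon>))"
    using assms(2) by (simp add: rescale_def right_diff_distrib)
  then have "\<bar>rescale \<epsilon> G y - a * y\<bar> = \<epsilon> * \<bar>G (y / \<epsilon>) - a * (y / \<epsilon>)\<bar>"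
    using assms(2) by (simp add: abs_mult)
  also have "\<dots> \<le> \<epsilon> * (\<kappa> * \<bar>y / \<epsilon>\<bar> + D)"
    using assms(2) by (intro mult_left_mono assms(1)) auto
  also have "\<dots> = \<kappa> * \<bar>y\<bar> + \<epsilon> * D" using assms(2) by (simp add: distrib_left abs_divide)
  finally show ?thesis .
qed

text \<open>With mean slope b to the left and a to the right, and b \<le> n \<le> a, the glued
  function stays above the line of slope n through the corner, up to the error of the means.\<close>

lemma kink_bounds:
  assumes r: "\<bar>Gr y - a * y\<bar> \<le> e" "\<bar>Gr \<eta> - a * \<eta>\<bar> \<le> e"
    and l: "\<bar>Gl y - b * y\<bar> \<le> e" "\<bar>Gl \<eta> - b * \<eta>\<bar> \<le> e" and n: "b \<le> n" "n \<le> a"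
  shows "n * (y - \<eta>) - 2 * e \<le> kink Gr Gl \<eta> y" "kink Gr Gl \<eta> y \<le> (\<bar>a\<bar> + \<bar>b\<bar>) * \<bar>y - \<eta>\<bar> + 2 * e"
proof -
  have ab: "a * (y - \<eta>) \<le> (\<bar>a\<bar> + \<bar>b\<bar>) * \<bar>y - \<eta>\<bar>" "b * (y - \<eta>) \<le> (\<bar>a\<bar> + \<bar>b\<bar>) * \<bar>y - \<eta>\<bar>"
  proof -
    have "a * (y - \<eta>) \<le> \<bar>a\<bar> * \<bar>y - \<eta>\<bar>" "b * (y - \<eta>) \<le> \<bar>b\<bar> * \<bar>y - \<eta>\<bar>"
      by (metis abs_ge_self abs_mult)+
    moreover have "0 \<le> \<bar>a\<bar> * \<bar>y - \<eta>\<bar>" "0 \<le> \<bar>b\<bar> * \<bar>y - \<eta>\<bar>" by simp_all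
    ultimately show "a * (y - \<eta>) \<le> (\<bar>a\<bar> + \<bar>b\<bar>) * \<bar>y - \<eta>\<bar>" "b * (y - \<eta>) \<le> (\<bar>a\<bar> + \<bar>b\<bar>) * \<bar>y - \<eta>\<bar>"
      unfolding distrib_right by linarith+
  qed
  have na: "n * (y - \<eta>) \<le> a * (y - \<eta>)" if "y \<ge> \<eta>" using that n by (intro mult_right_mono) auto
  have nb: "n * (y - \<eta>) \<le> b * (y - \<eta>)" if "\<not> y \<ge> \<eta>" using that n by (intro mult_right_mono_neg) auto
  have "a * (y - \<eta>) = a * y - a * \<eta>" "b * (y - \<eta>) = b * y - b * \<eta>" by (simp_all add: right_diff_distrib)
  then have d: "\<bar>Gr y - Gr \<eta> - a * (y - \<eta>)\<bar> \<le> 2 * e" "\<bar>Gl y - Gl \<eta> - b * (y - \<eta>)\<bar> \<le> 2 * e"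
    using r l by linarith+
  have k: "y \<ge> \<eta> \<Longrightarrow> kink Gr Gl \<eta> y = Gr y - Gr \<eta>" "\<not> y \<ge> \<eta> \<Longrightarrow> kink Gr Gl \<eta> y = Gl y - Gl \<eta>"
    by (simp_all add: kink_def)
  show "n * (y - \<eta>) - 2 * e \<le> kink Gr Gl \<eta> y"
  proof (cases "y \<ge> \<eta>")
    case True show ?thesis using k(1)[OF True] na[OF True] d(1) by linarith
  next
    case False show ?thesis using k(2)[OF False] nb[OF False] d(2) by linarith
  qed
  show "kink Gr Gl \<eta> y \<le> (\<bar>a\<bar> + \<bar>b\<bar>) * \<bar>y - \<eta>\<bar> + 2 * e"
  proof (cases "y \<ge> \<eta>")
    case True show ?thesis using k(1)[OF True] ab(1) d(1) by linarith
  next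
    case False show ?thesis using k(2)[OF False] ab(2) d(2) by linarith
  qed
qed

lemma continuous_on_rescale:
  assumes "\<And>y. (G has_real_derivative g y) (at y)"
  shows "continuous_on UNIV (rescale \<epsilon> G)"
proof -
  have "continuous_on UNIV G" using assms by (meson DERIV_isCont continuous_at_imp_continuous_on)
  then have "continuous_on UNIV (\<lambda>y. G (y / \<epsilon>))"
    by (rule continuous_on_compose2) (auto simp: divide_inverse intro!: continuous_intros)
  then show ?thesis unfolding rescale_def[abs_def] by (intro continuous_intros)
qed

text \<open>Q marks the points where a corner is admissible. Such points occur within \<kappa> |y| +
  D of every y, so after scaling there is one close to any prescribed point, and the corner placed
  there dominates affine data of slope n.\<close>

lemma upper_barriers_profile:
  assumes Gr: "\<And>y. (Gr has_real_derivative gr y) (at y)" "\<And>\<kappa>. \<kappa> > 0 \<Longrightarrow> \<exists>D. \<forall>y. \<bar>Gr y - a * y\<bar> \<le> \<kappa> * \<bar>y\<bar> + D"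
    and Gl: "\<And>y. (Gl has_real_derivative gl y) (at y)" "\<And>\<kappa>. \<kappa> > 0 \<Longrightarrow> \<exists>D. \<forall>y. \<bar>Gl y - b * y\<bar> \<le> \<kappa> * \<bar>y\<bar> + D"
    and n: "b \<le> n" "n \<le> a"
    and recur: "\<And>\<kappa>. \<kappa> > 0 \<Longrightarrow> \<exists>D. \<forall>y. \<exists>\<eta>. \<bar>\<eta> - y\<bar> \<le> \<kappa> * \<bar>y\<bar> + D \<and> Q \<eta>"
    and super: "\<And>\<epsilon> \<eta> \<alpha>. \<epsilon> > 0 \<Longrightarrow> Q \<eta> \<Longrightarrow>
        touching_supersolution (H \<epsilon>) (profile m (kink (rescale \<epsilon> Gr) (rescale \<epsilon> Gl) (\<epsilon> * \<eta>)) l \<alpha>)"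
  shows "upper_barriers H (vector [m, n]) l"
  unfolding upper_barriers_def
proof (intro allI impI)
  fix R T \<kappa> :: real assume R: "R > 0" and \<kappa>: "\<kappa> > 0"
  define A0 where "A0 = \<bar>a\<bar> + \<bar>b\<bar> + \<bar>n\<bar>"
  have A0: "A0 \<ge> 0" by (simp add: A0_def)
  \<comment> \<open>The corner may miss z1 by \<open>e0\<close>, at a cost of at most \<kappa> / 2;
    four errors e = \<kappa> / 8 make up the other half.\<close>
  define e0 where "e0 = min 1 (\<kappa> / (2 * (A0 + 1)))"
  have e0: "e0 > 0" "e0 \<le> 1" "A0 * e0 \<le> \<kappa> / 2"
  proof -
    show "e0 > 0" "e0 \<le> 1" using \<kappa> A0 by (auto simp: e0_def)
    have "A0 * e0 \<le> (A0 + 1) * (\<kappa> / (2 * (A0 + 1)))" using A0 \<kappa> by (intro mult_mono) (auto simp: e0_def)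
    also have "\<dots> = \<kappa> / 2" using A0 by (simp add: field_simps)
    finally show "A0 * e0 \<le> \<kappa> / 2" .
  qed
  define \<rho> where "\<rho> = 2 * R + 1"
  have \<rho>: "\<rho> > 0" using R by (simp add: \<rho>_def)
  define \<kappa>1 where "\<kappa>1 = \<kappa> / (16 * \<rho>)"
  define \<kappa>2 where "\<kappa>2 = e0 / (2 * R)"
  have \<kappa>12: "\<kappa>1 > 0" "\<kappa>2 > 0" using \<kappa> \<rho> e0 R by (auto simp: \<kappa>1_def \<kappa>2_def)
  obtain D1 where D1: "\<And>y. \<bar>Gr y - a * y\<bar> \<le> \<kappa>1 * \<bar>y\<bar> + D1" using Gr(2)[OF \<kappa>12(1)] by blast
  obtain D2 where D2: "\<And>y. \<bar>Gl y - b * y\<bar> \<le> \<kappa>1 * \<bar>y\<bar> + D2" using Gl(2)[OF \<kappa>12(1)] by blast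
  obtain D3 where D3: "\<And>y. \<exists>\<eta>. \<bar>\<eta> - y\<bar> \<le> \<kappa>2 * \<bar>y\<bar> + D3 \<and> Q \<eta>" using recur[OF \<kappa>12(2)] by blast
  define D where "D = \<bar>D1\<bar> + \<bar>D2\<bar> + \<bar>D3\<bar> + 1"
  have D: "D > 0" "D1 \<le> D" "D2 \<le> D" "D3 \<le> D" by (auto simp: D_def)
  define \<epsilon>0 where "\<epsilon>0 = min (\<kappa> / (16 * D)) (e0 / (2 * D))"
  have "\<epsilon>0 > 0" using \<kappa> e0 D by (simp add: \<epsilon>0_def)
  then have "\<forall>\<^sub>F \<epsilon> in at_right 0. \<epsilon> \<in> {0<..<\<epsilon>0}" by (rule eventually_at_right_real)
  then show "\<forall>\<^sub>F \<epsilon> in at_right 0. \<forall>z1. norm z1 \<le> R \<longrightarrow>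
     (\<exists>w. touching_supersolution (H \<epsilon>) w \<and> continuous_on (UNIV \<times> {0..}) w \<and>
        (\<forall>z. norm (z - z1) \<le> R \<longrightarrow> vector [m, n] \<bullet> (z - z1) \<le> w (z, 0)) \<and>
        (\<forall>t\<in>{0..T}. w (z1, t) \<le> - (l * t) + \<kappa>))"
  proof eventually_elim
    case (elim \<epsilon>)
    have \<epsilon>: "\<epsilon> > 0" using elim by simp
    have "\<epsilon> \<le> \<kappa> / (16 * D)" "\<epsilon> \<le> e0 / (2 * D)" using elim by (auto simp: \<epsilon>0_def)
    then have \<epsilon>D: "\<epsilon> * D \<le> \<kappa> / 16" "\<epsilon> * D \<le> e0 / 2" using D by (simp_all add: pos_le_divide_eq)
    define e where "e = \<kappa> / 8"
    have mean: "\<bar>rescale \<epsilon> Gr y - a * y\<bar> \<le> e" "\<bar>rescale \<epsilon> Gl y - b * y\<bar> \<le> e" if "\<bar>y\<bar> \<le> \<rho>" for y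
    proof -
      have 1: "\<kappa>1 * \<bar>y\<bar> \<le> \<kappa> / 16"
      proof -
        have "\<kappa>1 * \<bar>y\<bar> \<le> \<kappa>1 * \<rho>" using that \<kappa>12 by (intro mult_left_mono) auto
        then show ?thesis using \<rho> by (simp add: \<kappa>1_def)
      qed
      have "\<epsilon> * D1 \<le> \<epsilon> * D" "\<epsilon> * D2 \<le> \<epsilon> * D" using \<epsilon> D by (auto intro: mult_left_mono)
      then show "\<bar>rescale \<epsilon> Gr y - a * y\<bar> \<le> e" "\<bar>rescale \<epsilon> Gl y - b * y\<bar> \<le> e"
        using rescale_mean[OF D1 \<epsilon>, of y] rescale_mean[OF D2 \<epsilon>, of y] 1 \<epsilon>D unfolding e_def by linarith+
    qed
    show ?case
    proof (intro allI impI)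
      fix z1 :: "real^2" assume z1: "norm z1 \<le> R"
      define y1 where "y1 = z1 $ 2"
      have y1: "\<bar>y1\<bar> \<le> R" using component_le_norm_cart[of z1 2] z1 by (simp add: y1_def)
      obtain \<eta> where \<eta>: "\<bar>\<eta> - y1 / \<epsilon>\<bar> \<le> \<kappa>2 * \<bar>y1 / \<epsilon>\<bar> + D3" "Q \<eta>" using D3 by blast
      have \<eta>e: "\<bar>\<epsilon> * \<eta> - y1\<bar> \<le> e0"
      proof -
        have "\<bar>\<epsilon> * \<eta> - y1\<bar> = \<epsilon> * \<bar>\<eta> - y1 / \<epsilon>\<bar>"
        proof -
          have "\<epsilon> * \<eta> - y1 = \<epsilon> * (\<eta> - y1 / \<epsilon>)" using \<epsilon> by (simp add: right_diff_distrib)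
          then show ?thesis using \<epsilon> by (simp add: abs_mult)
        qed
        also have "\<dots> \<le> \<epsilon> * (\<kappa>2 * \<bar>y1 / \<epsilon>\<bar> + D3)" using \<eta>(1) \<epsilon> by (intro mult_left_mono) auto
        also have "\<dots> = \<kappa>2 * \<bar>y1\<bar> + \<epsilon> * D3" using \<epsilon> by (simp add: distrib_left abs_divide)
        also have "\<kappa>2 * \<bar>y1\<bar> \<le> e0 / 2"
        proof -
          have "\<kappa>2 * \<bar>y1\<bar> \<le> \<kappa>2 * R" using y1 \<kappa>12 by (intro mult_left_mono) auto
          then show ?thesis using R by (simp add: \<kappa>2_def)
        qed
        also have "\<epsilon> * D3 \<le> \<epsilon> * D" using \<epsilon> D by (intro mult_left_mono) auto
        finally show ?thesis using \<epsilon>D(2) by linarith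
      qed
      have \<eta>\<rho>: "\<bar>\<epsilon> * \<eta>\<bar> \<le> \<rho>" using \<eta>e y1 e0 R by (simp add: \<rho>_def)
      let ?k = "kink (rescale \<epsilon> Gr) (rescale \<epsilon> Gl) (\<epsilon> * \<eta>)"
      \<comment> \<open>Moves the line of slope n from the corner back to z1 and lifts it by the
        error \<open>2 * e\<close> of \<open>kink_bounds\<close>.\<close>
      define \<alpha> where "\<alpha> = - m * (z1 $ 1) + n * (\<epsilon> * \<eta> - y1) + 2 * e"
      define w where "w = profile m ?k l \<alpha>"
      have kb: "n * (y - \<epsilon> * \<eta>) - 2 * e \<le> ?k y" "?k y \<le> (\<bar>a\<bar> + \<bar>b\<bar>) * \<bar>y - \<epsilon> * \<eta>\<bar> + 2 * e" if "\<bar>y\<bar> \<le> \<rho>" for y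
        using kink_bounds[OF mean(1)[OF that] mean(1)[OF \<eta>\<rho>] mean(2)[OF that] mean(2)[OF \<eta>\<rho>] n] by blast+
      have "touching_supersolution (H \<epsilon>) w" unfolding w_def by (rule super[OF \<epsilon> \<eta>(2)])
      moreover have "continuous_on (UNIV \<times> {0..}) w"
        unfolding w_def by (intro continuous_on_profile continuous_on_kink continuous_on_rescale[OF Gr(1)] continuous_on_rescale[OF Gl(1)])
      moreover have "vector [m, n] \<bullet> (z - z1) \<le> w (z, 0)" if z: "norm (z - z1) \<le> R" for z
      proof -
        have "\<bar>z $ 2 - y1\<bar> \<le> R" using component_le_norm_cart[of "z - z1" 2] z by (simp add: y1_def)
        then have "\<bar>z $ 2\<bar> \<le> \<rho>" using y1 R by (simp add: \<rho>_def)
        then have "n * (z $ 2 - \<epsilon> * \<eta>) - 2 * e \<le> ?k (z $ 2)" by (rule kb)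
        then have "m * (z $ 1 - z1 $ 1) + n * (z $ 2 - y1) \<le> w (z, 0)"
          by (simp add: w_def profile_def \<alpha>_def algebra_simps)
        then show ?thesis by (simp add: inner_vec_def sum_2 y1_def)
      qed
      moreover have "w (z1, t) \<le> - (l * t) + \<kappa>" for t
      proof -
        have "\<bar>y1\<bar> \<le> \<rho>" using y1 R by (simp add: \<rho>_def)
        then have "?k y1 \<le> (\<bar>a\<bar> + \<bar>b\<bar>) * \<bar>y1 - \<epsilon> * \<eta>\<bar> + 2 * e" by (rule kb)
        moreover have "n * (\<epsilon> * \<eta> - y1) \<le> \<bar>n\<bar> * \<bar>y1 - \<epsilon> * \<eta>\<bar>"
          by (metis abs_ge_self abs_minus_commute abs_mult)
        moreover have "A0 * \<bar>y1 - \<epsilon> * \<eta>\<bar> \<le> A0 * e0" using \<eta>e A0 by (intro mult_left_mono) (auto simp: abs_minus_commute)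
        ultimately have "?k y1 + n * (\<epsilon> * \<eta> - y1) \<le> \<kappa> / 2 + 2 * e" using e0(3) by (simp add: A0_def algebra_simps)
        then show ?thesis by (simp add: w_def profile_def \<alpha>_def y1_def e_def)
      qed
      ultimately show "\<exists>w. touching_supersolution (H \<epsilon>) w \<and> continuous_on (UNIV \<times> {0..}) w \<and>
        (\<forall>z. norm (z - z1) \<le> R \<longrightarrow> vector [m, n] \<bullet> (z - z1) \<le> w (z, 0)) \<and>
        (\<forall>t\<in>{0..T}. w (z1, t) \<le> - (l * t) + \<kappa>)" by blast
    qed
  qed
qed

lemma upper_barriers_scaled_shear:
  assumes gr: "has_mean gr a" and gl: "has_mean gl b" and n: "b \<le> n" "n \<le> a"
    and Hr: "\<And>y. l \<le> m * f y + cell_ham m (c * m * d y) (gr y)"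
    and Hl: "\<And>y. l \<le> m * f y + cell_ham m (c * m * d y) (gl y)"
    and recur: "\<And>\<kappa>. \<kappa> > 0 \<Longrightarrow> \<exists>D. \<forall>y. \<exists>\<eta>. \<bar>\<eta> - y\<bar> \<le> \<kappa> * \<bar>y\<bar> + D \<and>
        (\<forall>p. gl \<eta> \<le> p \<longrightarrow> p \<le> gr \<eta> \<longrightarrow> l \<le> m * f \<eta> + cell_ham m (c * m * d \<eta>) p)"
  shows "upper_barriers (scaled_shear_ham f d c) (vector [m, n]) l"
proof -
  obtain Gr where Gr: "\<And>y. (Gr has_real_derivative gr y) (at y)"
    "\<And>\<kappa>. \<kappa> > 0 \<Longrightarrow> \<exists>D. \<forall>y. \<bar>Gr y - a * y\<bar> \<le> \<kappa> * \<bar>y\<bar> + D" using gr unfolding has_mean_def by blast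
  obtain Gl where Gl: "\<And>y. (Gl has_real_derivative gl y) (at y)"
    "\<And>\<kappa>. \<kappa> > 0 \<Longrightarrow> \<exists>D. \<forall>y. \<bar>Gl y - b * y\<bar> \<le> \<kappa> * \<bar>y\<bar> + D" using gl unfolding has_mean_def by blast
  show ?thesis
  proof (rule upper_barriers_profile[OF Gr Gl n recur])
    fix \<epsilon> \<eta> \<alpha> :: real
    assume \<epsilon>: "\<epsilon> > 0" and \<eta>: "\<forall>p. gl \<eta> \<le> p \<longrightarrow> p \<le> gr \<eta> \<longrightarrow> l \<le> m * f \<eta> + cell_ham m (c * m * d \<eta>) p"
    show "touching_supersolution (scaled_shear_ham f d c \<epsilon>) (profile m (kink (rescale \<epsilon> Gr) (rescale \<epsilon> Gl) (\<epsilon> * \<eta>)) l \<alpha>)"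
      unfolding scaled_shear_ham_def
      by (rule kink_touching_supersolution[OF rescale_derivative[OF Gr(1) \<epsilon>] rescale_derivative[OF Gl(1) \<epsilon>]])
         (use Hr Hl \<eta> \<epsilon> in auto)
  qed
qed

lemma has_mean_minus: "has_mean g a \<Longrightarrow> has_mean (\<lambda>y. - g y) (- a)"
  unfolding has_mean_def
proof (elim exE conjE)
  fix F assume F: "\<forall>y. (F has_real_derivative g y) (at y)" "\<forall>\<kappa>>0. \<exists>D. \<forall>y. \<bar>F y - a * y\<bar> \<le> \<kappa> * \<bar>y\<bar> + D"
  have "\<bar>- F y - - a * y\<bar> = \<bar>F y - a * y\<bar>" for y by (simp add: abs_minus_commute)
  then show "\<exists>F. (\<forall>y. (F has_real_derivative - g y) (at y)) \<and> (\<forall>\<kappa>>0. \<exists>D. \<forall>y. \<bar>F y - - a * y\<bar> \<le> \<kappa> * \<bar>y\<bar> + D)"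
    using F by (intro exI[of _ "\<lambda>y. - F y"]) (auto intro: DERIV_minus)
qed

lemma has_mean_add_const: "has_mean g a \<Longrightarrow> has_mean (\<lambda>y. g y + k) (a + k)"
  unfolding has_mean_def
proof (elim exE conjE)
  fix F assume F: "\<forall>y. (F has_real_derivative g y) (at y)" "\<forall>\<kappa>>0. \<exists>D. \<forall>y. \<bar>F y - a * y\<bar> \<le> \<kappa> * \<bar>y\<bar> + D"
  have eq: "F y + k * y - (a + k) * y = F y - a * y" for y by (simp add: algebra_simps)
  have "\<forall>\<kappa>>0. \<exists>D. \<forall>y. \<bar>F y + k * y - (a + k) * y\<bar> \<le> \<kappa> * \<bar>y\<bar> + D"
    unfolding eq by (rule F(2))
  moreover have "((\<lambda>y. F y + k * y) has_real_derivative g y + k) (at y)" for y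
    using F(1) by (auto intro!: derivative_eq_intros)
  ultimately show "\<exists>F. (\<forall>y. (F has_real_derivative g y + k) (at y)) \<and> (\<forall>\<kappa>>0. \<exists>D. \<forall>y. \<bar>F y - (a + k) * y\<bar> \<le> \<kappa> * \<bar>y\<bar> + D)"
    by (intro exI[of _ "\<lambda>y. F y + k * y"]) blast
qed

text \<open>Here the corner is concave, and at every y the Hamiltonian is at most l on the whole
  range between the branches, so the corner may sit at any point.\<close>

lemma lower_barriers_scaled_shear:
  assumes gr: "has_mean gr a" and gl: "has_mean gl b" and n: "a \<le> n" "n \<le> b"
    and H: "\<And>y p. gr y \<le> p \<Longrightarrow> p \<le> gl y \<Longrightarrow> m * f y + cell_ham m (c * m * d y) p \<le> l"
    and le: "\<And>y. gr y \<le> gl y"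
  shows "lower_barriers (scaled_shear_ham f d c) (vector [m, n]) l"
proof -
  have mn: "- (vector [m, n] :: real^2) = vector [- m, - n]" by (simp add: vec_eq_iff forall_2)
  obtain Gr where Gr: "\<And>y. (Gr has_real_derivative gr y) (at y)"
    "\<And>\<kappa>. \<kappa> > 0 \<Longrightarrow> \<exists>D. \<forall>y. \<bar>Gr y - a * y\<bar> \<le> \<kappa> * \<bar>y\<bar> + D" using gr unfolding has_mean_def by blast
  obtain Gl where Gl: "\<And>y. (Gl has_real_derivative gl y) (at y)"
    "\<And>\<kappa>. \<kappa> > 0 \<Longrightarrow> \<exists>D. \<forall>y. \<bar>Gl y - b * y\<bar> \<le> \<kappa> * \<bar>y\<bar> + D" using gl unfolding has_mean_def by blast
  have neg: "\<bar>- G y - - k * y\<bar> = \<bar>G y - k * y\<bar>" for G :: "real \<Rightarrow> real" and k y by (simp add: abs_minus_commute)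
  show ?thesis
    unfolding lower_barriers_def mn
  proof (rule upper_barriers_profile[where Gr = "\<lambda>y. - Gr y" and Gl = "\<lambda>y. - Gl y" and a = "- a" and b = "- b" and Q = "\<lambda>_. True"])
    show "((\<lambda>y. - Gr y) has_real_derivative - gr y) (at y)" "((\<lambda>y. - Gl y) has_real_derivative - gl y) (at y)" for y
      using Gr(1) Gl(1) by (auto intro: DERIV_minus)
    show "\<exists>D. \<forall>y. \<bar>- Gr y - - a * y\<bar> \<le> \<kappa> * \<bar>y\<bar> + D" "\<exists>D. \<forall>y. \<bar>- Gl y - - b * y\<bar> \<le> \<kappa> * \<bar>y\<bar> + D" if "\<kappa> > 0" for \<kappa>
      unfolding neg using Gr(2)[OF that] Gl(2)[OF that] .
    show "\<exists>D. \<forall>y. \<exists>\<eta>. \<bar>\<eta> - y\<bar> \<le> \<kappa> * \<bar>y\<bar> + D \<and> True" if "\<kappa> > 0" for \<kappa> :: real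
    proof (rule exI[of _ 0], rule allI)
      fix y :: real show "\<exists>\<eta>. \<bar>\<eta> - y\<bar> \<le> \<kappa> * \<bar>y\<bar> + 0 \<and> True" using that by (intro exI[of _ y]) simp
    qed
    fix \<epsilon> \<eta> \<alpha> :: real assume \<epsilon>: "\<epsilon> > 0"
    have eq: "profile (- m) (kink (rescale \<epsilon> (\<lambda>y. - Gr y)) (rescale \<epsilon> (\<lambda>y. - Gl y)) (\<epsilon> * \<eta>)) (- l) \<alpha>
        = (\<lambda>q. - profile m (kink (rescale \<epsilon> Gr) (rescale \<epsilon> Gl) (\<epsilon> * \<eta>)) l (- \<alpha>) q)"
      by (rule ext) (simp add: profile_def kink_def rescale_def)
    show "touching_supersolution (dual_hamiltonian (scaled_shear_ham f d c \<epsilon>))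
        (profile (- m) (kink (rescale \<epsilon> (\<lambda>y. - Gr y)) (rescale \<epsilon> (\<lambda>y. - Gl y)) (\<epsilon> * \<eta>)) (- l) \<alpha>)"
      unfolding eq touching_supersolution_minus scaled_shear_ham_def
      by (rule kink_touching_subsolution[OF rescale_derivative[OF Gr(1) \<epsilon>] rescale_derivative[OF Gl(1) \<epsilon>]])
         (use H le in auto)
  qed (use n in auto)
qed

section \<open>Means, recurrence and almost maxima on the line\<close>

lemma has_mean_unique:
  assumes "has_mean g a" "has_mean g b"
  shows "a = b"
proof (rule ccontr)
  assume "a \<noteq> b"
  define k where "k = \<bar>a - b\<bar> / 4"
  have k: "k > 0" using \<open>a \<noteq> b\<close> by (simp add: k_def)
  obtain F D where F: "\<And>y. (F has_real_derivative g y) (at y)" and D: "\<And>y. \<bar>F y - a * y\<bar> \<le> k * \<bar>y\<bar> + D"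
    using assms(1) k unfolding has_mean_def by meson
  obtain F' D' where F': "\<And>y. (F' has_real_derivative g y) (at y)" and D': "\<And>y. \<bar>F' y - b * y\<bar> \<le> k * \<bar>y\<bar> + D'"
    using assms(2) k unfolding has_mean_def by meson
  have "\<forall>x. DERIV (\<lambda>y. F y - F' y) x :> 0" using DERIV_diff[OF F F'] by simp
  then have const: "F y - F' y = F 0 - F' 0" for y using DERIV_isconst_all by blast
  have *: "\<bar>a - b\<bar> * y \<le> 2 * k * y + (D + D' + \<bar>F 0 - F' 0\<bar>)" if "y \<ge> 0" for y
  proof -
    have "(a - b) * y = (F' y - b * y) - (F y - a * y) + (F y - F' y)" by (simp add: algebra_simps)
    then have "\<bar>(a - b) * y\<bar> \<le> 2 * (k * y) + D + D' + \<bar>F 0 - F' 0\<bar>"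
      using D[of y] D'[of y] const[of y] that by linarith
    then show ?thesis using that by (simp add: abs_mult)
  qed
  have "2 * k * y \<le> D + D' + \<bar>F 0 - F' 0\<bar>" if "y \<ge> 0" for y
    using *[OF that] by (simp add: k_def)
  from this[of "(\<bar>D + D' + \<bar>F 0 - F' 0\<bar>\<bar> + 1) / (2 * k)"] show False using k by simp
qed

text \<open>On an interval free of such points the primitive has equal values at both ends, whereas
  growth at rate \<mu> makes it rise once the length exceeds a small multiple of |y| plus a
  constant.\<close>

lemma has_mean_positive_recurrent:
  assumes g: "has_mean g \<mu>" and \<mu>: "\<mu> > 0" and \<kappa>: "\<kappa> > 0"
  shows "\<exists>D. \<forall>y. \<exists>\<eta>. \<bar>\<eta> - y\<bar> \<le> \<kappa> * \<bar>y\<bar> + D \<and> g \<eta> \<noteq> 0"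
proof -
  \<comment> \<open>The error rate must be small against the growth over the interval and also,
    multiplied by |y|, against the share \<mu> \<kappa> |y| of that growth.\<close>
  define k where "k = min (\<mu> / 2) (\<mu> * \<kappa> / 4)"
  have k: "k > 0" "k \<le> \<mu> / 2" "k \<le> \<mu> * \<kappa> / 4" using \<mu> \<kappa> by (auto simp: k_def)
  obtain F D where F: "\<And>y. (F has_real_derivative g y) (at y)" and D: "\<And>y. \<bar>F y - \<mu> * y\<bar> \<le> k * \<bar>y\<bar> + D"
    using g k unfolding has_mean_def by meson
  define D1 where "D1 = (2 * \<bar>D\<bar> + 1) / \<mu> * 2"
  show ?thesis
  proof (rule exI[of _ D1], rule allI, rule ccontr)
    fix y
    assume none: "\<not> (\<exists>\<eta>. \<bar>\<eta> - y\<bar> \<le> \<kappa> * \<bar>y\<bar> + D1 \<and> g \<eta> \<noteq> 0)"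
    define L where "L = \<kappa> * \<bar>y\<bar> + D1"
    have D1: "D1 > 0" using \<mu> by (simp add: D1_def)
    then have L: "L > 0" using \<kappa> by (simp add: L_def add_nonneg_pos)
    have "\<exists>x. y < x \<and> x < y + L \<and> F (y + L) - F y = (y + L - y) * g x" using L F by (intro MVT2) auto
    then obtain x where x: "y < x" "x < y + L" "F (y + L) - F y = L * g x" by auto
    have "g x = 0" using none x unfolding L_def[symmetric] by (metis abs_of_pos diff_gt_0_iff_gt less_imp_le diff_less_eq add.commute)
    then have eq: "F (y + L) = F y" using x by simp
    have "k * \<bar>y + L\<bar> \<le> k * (\<bar>y\<bar> + L)" using k L by (intro mult_left_mono) auto
    moreover have "\<mu> * (y + L) = \<mu> * y + \<mu> * L" "k * (\<bar>y\<bar> + L) = k * \<bar>y\<bar> + k * L" by (simp_all add: distrib_left)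
    ultimately have "\<mu> * L \<le> 2 * (k * \<bar>y\<bar>) + k * L + 2 * D" using D[of y] D[of "y + L"] eq by linarith
    moreover have "k * L \<le> \<mu> / 2 * L" using k L by (intro mult_right_mono) auto
    moreover have "k * \<bar>y\<bar> \<le> \<mu> * \<kappa> / 4 * \<bar>y\<bar>" using k by (intro mult_right_mono) auto
    moreover have "\<mu> * L = \<mu> * \<kappa> * \<bar>y\<bar> + 2 * (2 * \<bar>D\<bar> + 1)"
    proof -
      have "\<mu> * D1 = 2 * (2 * \<bar>D\<bar> + 1)" using \<mu> by (simp add: D1_def)
      then show ?thesis by (simp add: L_def distrib_left mult.assoc)
    qed
    ultimately show False by (simp add: field_simps)
  qed
qed

lemma C1_locally_lipschitz:
  fixes f :: "real \<Rightarrow> real"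
  assumes f: "\<And>y. (f has_real_derivative g y) (at y)" and g: "continuous_on UNIV g"
  shows "\<exists>L. \<forall>y y'. \<bar>y\<bar> \<le> R \<longrightarrow> \<bar>y'\<bar> \<le> R \<longrightarrow> \<bar>f y - f y'\<bar> \<le> L * \<bar>y - y'\<bar>"
proof -
  have "compact (g ` {- R..R})" by (intro compact_continuous_image continuous_on_subset[OF g]) auto
  then obtain L where L: "\<And>y. y \<in> {- R..R} \<Longrightarrow> \<bar>g y\<bar> \<le> L"
    using compact_imp_bounded bounded_iff by (metis image_eqI real_norm_def)
  have *: "\<bar>f y' - f y\<bar> \<le> L * \<bar>y' - y\<bar>" if lt: "y < y'" and R: "\<bar>y\<bar> \<le> R" "\<bar>y'\<bar> \<le> R" for y y'
  proof -
    obtain x where x: "y < x" "x < y'" "f y' - f y = (y' - y) * g x" using MVT2[OF lt, of f g] f by auto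
    have "x \<in> {- R..R}" using x R by auto
    then have "\<bar>y' - y\<bar> * \<bar>g x\<bar> \<le> \<bar>y' - y\<bar> * L" by (intro mult_left_mono L) auto
    then show ?thesis by (simp add: x(3) abs_mult mult.commute)
  qed
  show ?thesis
  proof (intro exI[of _ L] allI impI)
    fix y y' :: real assume R: "\<bar>y\<bar> \<le> R" "\<bar>y'\<bar> \<le> R"
    show "\<bar>f y - f y'\<bar> \<le> L * \<bar>y - y'\<bar>"
      using *[of y y'] *[of y' y] R
      by (cases y y' rule: linorder_cases) (auto simp: abs_minus_commute[of y y'] abs_minus_commute[of "f y" "f y'"])
  qed
qed

text \<open>Ekeland's principle in one dimension: perturb by a small multiple of the distance to an
  almost maximal point.\<close>

lemma almost_maximum_small_derivative:
  fixes f :: "real \<Rightarrow> real"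
  assumes f: "\<And>y. (f has_real_derivative g y) (at y)" and s: "\<And>y. f y \<le> s"
    and sup: "\<And>e. e > 0 \<Longrightarrow> \<exists>y. f y > s - e" and e: "e > 0"
  shows "\<exists>y. f y > s - e \<and> \<bar>g y\<bar> \<le> e"
proof -
  obtain y0 where y0: "f y0 > s - e / 2" using sup[of "e / 2"] e by auto
  have e2: "e / 2 > 0" using e by simp
  \<comment> \<open>On a window of half-width 2 the maximizer pays less than e / 2 of quadratic
    penalty, so it is interior, and the derivative of the penalty there is at most e.\<close>
  define h where "h y = f y - e / 4 * (y - y0)\<^sup>2" for y
  have "\<exists>y\<in>{y0 - 2..y0 + 2}. \<forall>x\<in>{y0 - 2..y0 + 2}. h x \<le> h y"
  proof (rule continuous_attains_sup)
    have "continuous_on UNIV f" using f by (meson DERIV_isCont continuous_at_imp_continuous_on)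
    then show "continuous_on {y0 - 2..y0 + 2} h"
      unfolding h_def by (intro continuous_intros) (auto intro: continuous_on_subset)
  qed auto
  then obtain y where y: "y \<in> {y0 - 2..y0 + 2}" "\<And>x. x \<in> {y0 - 2..y0 + 2} \<Longrightarrow> h x \<le> h y" by blast
  have "h y0 \<le> h y" by (rule y(2)) simp
  then have fy: "f y0 + e / 4 * (y - y0)\<^sup>2 \<le> f y" by (simp add: h_def)
  have "e / 4 * (y - y0)\<^sup>2 < e / 2" using fy s[of y] y0 by linarith
  then have "(y - y0)\<^sup>2 < 2" using e by (simp add: field_simps)
  then have "\<bar>y - y0\<bar>\<^sup>2 < 2\<^sup>2" by simp
  then have yy: "\<bar>y - y0\<bar> < 2" by (rule power2_less_imp_less) simp
  have "0 \<le> e / 4 * (y - y0)\<^sup>2" using e by simp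
  then have 1: "f y > s - e" using fy y0 e by linarith
  have "(h has_real_derivative g y - e / 2 * (y - y0)) (at y)"
    unfolding h_def by (rule derivative_eq_intros f refl | simp)+
  then have "g y - e / 2 * (y - y0) = 0"
  proof (rule DERIV_local_max)
    show "0 < 2 - \<bar>y - y0\<bar>" using yy by simp
    show "\<forall>x. \<bar>y - x\<bar> < 2 - \<bar>y - y0\<bar> \<longrightarrow> h x \<le> h y"
    proof (intro allI impI)
      fix x assume "\<bar>y - x\<bar> < 2 - \<bar>y - y0\<bar>"
      then have "x \<in> {y0 - 2..y0 + 2}" by (auto simp: abs_if split: if_splits)
      then show "h x \<le> h y" by (rule y(2))
    qed
  qed
  then have "g y = e / 2 * (y - y0)" by simp
  then have "\<bar>g y\<bar> = e / 2 * \<bar>y - y0\<bar>" using e by (simp only: abs_mult)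
  also have "\<dots> \<le> e / 2 * 2" using yy e by (intro mult_left_mono) auto
  finally show ?thesis using 1 by auto
qed

text \<open>Applied to the bounded function v, this is the source of the zero mean of v'.\<close>

lemma has_mean_bounded_primitive:
  assumes f: "\<And>y. (f has_real_derivative g y) (at y)" and B: "\<And>y. \<bar>f y\<bar> \<le> B"
  shows "has_mean g 0"
  unfolding has_mean_def
proof (intro exI[of _ f] conjI allI impI f)
  fix \<kappa> :: real assume \<kappa>: "\<kappa> > 0"
  show "\<exists>D. \<forall>y. \<bar>f y - 0 * y\<bar> \<le> \<kappa> * \<bar>y\<bar> + D"
  proof (intro exI[of _ B] allI)
    fix y
    have "0 \<le> \<kappa> * \<bar>y\<bar>" using \<kappa> by simp
    then show "\<bar>f y - 0 * y\<bar> \<le> \<kappa> * \<bar>y\<bar> + B" using B[of y] by simp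
  qed
qed

section \<open>The random shear flow\<close>

locale random_shear = ergodic_flow M \<tau> for M :: "'w measure" and \<tau> :: "real \<Rightarrow> 'w \<Rightarrow> 'w" +
  fixes v :: "real \<Rightarrow> 'w \<Rightarrow> real" and B :: real
  assumes stationary: "stationary_field M \<tau> v"
    and smooth: "\<And>\<omega>. \<omega> \<in> space M \<Longrightarrow> C_infinity (\<lambda>y. v y \<omega>)"
    and v_bounded: "AE \<omega> in M. \<forall>y. \<bar>v y \<omega>\<bar> \<le> B"
    and dv_bounded: "AE \<omega> in M. \<forall>y. \<bar>deriv (\<lambda>s. v s \<omega>) y\<bar> \<le> B"
begin

definition dv :: "real \<Rightarrow> 'w \<Rightarrow> real" where
  "dv y \<omega> = deriv (\<lambda>s. v s \<omega>) y"

section \<open>Functionals of v and its derivative along paths\<close>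

lemma B_nonneg: "0 \<le> B"
proof -
  obtain \<omega> where "\<forall>y. \<bar>v y \<omega>\<bar> \<le> B" using eventually_happens'[OF ae_filter_bot v_bounded] by blast
  then show ?thesis by (meson abs_ge_zero order_trans)
qed

lemma v_measurable [measurable]: "v y \<in> borel_measurable M"
  using stationary unfolding stationary_field_def by blast

lemma v_flow: "\<omega> \<in> space M \<Longrightarrow> v y (\<tau> a \<omega>) = v (y + a) \<omega>"
  using stationary unfolding stationary_field_def by blast

lemma v_derivative: "\<omega> \<in> space M \<Longrightarrow> ((\<lambda>y. v y \<omega>) has_real_derivative dv y \<omega>) (at y)"
  using smooth[of \<omega>] unfolding C_infinity_def dv_def
  by (metis field_differentiable_derivI funpow_0)

lemma dv_derivative:
  assumes "\<omega> \<in> space M"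
  shows "((\<lambda>y. dv y \<omega>) has_real_derivative deriv (\<lambda>y. dv y \<omega>) y) (at y)"
    "continuous_on UNIV (deriv (\<lambda>y. dv y \<omega>))"
proof -
  have d1: "(deriv ^^ 1) (\<lambda>y. v y \<omega>) = (\<lambda>y. dv y \<omega>)" by (simp add: dv_def[abs_def])
  have d2: "(deriv ^^ 2) (\<lambda>y. v y \<omega>) = deriv (\<lambda>y. dv y \<omega>)" by (simp add: dv_def[abs_def] numeral_2_eq_2)
  show "((\<lambda>y. dv y \<omega>) has_real_derivative deriv (\<lambda>y. dv y \<omega>) y) (at y)"
    using smooth[OF assms] unfolding C_infinity_def d1[symmetric] by (blast intro: field_differentiable_derivI)
  have "deriv (\<lambda>y. dv y \<omega>) field_differentiable at x" for x
    using smooth[OF assms] unfolding C_infinity_def d2[symmetric] by blast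
  then show "continuous_on UNIV (deriv (\<lambda>y. dv y \<omega>))"
    by (intro continuous_at_imp_continuous_on ballI field_differentiable_imp_continuous_at)
qed

lemma v_continuous: "\<omega> \<in> space M \<Longrightarrow> continuous_on UNIV (\<lambda>y. v y \<omega>)"
  by (rule continuous_at_imp_continuous_on) (blast intro: DERIV_isCont v_derivative)

lemma dv_continuous: "\<omega> \<in> space M \<Longrightarrow> continuous_on UNIV (\<lambda>y. dv y \<omega>)"
  by (rule continuous_at_imp_continuous_on) (blast intro: DERIV_isCont dv_derivative(1))

lemma dv_flow: "\<omega> \<in> space M \<Longrightarrow> dv y (\<tau> a \<omega>) = dv (y + a) \<omega>"
proof -
  assume \<omega>: "\<omega> \<in> space M"
  have "((\<lambda>s. v (s + a) \<omega>) has_real_derivative dv (y + a) \<omega>) (at y)"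
    using v_derivative[OF \<omega>, of "y + a"] by (simp add: DERIV_shift)
  then have "deriv (\<lambda>s. v s (\<tau> a \<omega>)) y = dv (y + a) \<omega>"
    unfolding v_flow[OF \<omega>] by (rule DERIV_imp_deriv)
  then show ?thesis by (simp add: dv_def)
qed

lemma dv_measurable [measurable]: "dv y \<in> borel_measurable M"
proof (rule borel_measurable_LIMSEQ_real)
  fix \<omega> assume \<omega>: "\<omega> \<in> space M"
  have "((\<lambda>h. (v (y + h) \<omega> - v y \<omega>) / h) \<longlongrightarrow> dv y \<omega>) (at 0)"
    using v_derivative[OF \<omega>, of y] by (simp add: DERIV_def)
  moreover have "filterlim (\<lambda>n. inverse (real (Suc n))) (at 0) sequentially"
    using LIMSEQ_inverse_real_of_nat by (intro filterlim_atI) auto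
  ultimately show "(\<lambda>n. (v (y + inverse (real (Suc n))) \<omega> - v y \<omega>) / inverse (real (Suc n))) \<longlonglongrightarrow> dv y \<omega>"
    by (rule filterlim_compose)
qed simp

text \<open>A bounded continuous function of the pair (v, v') is again a bounded stationary path, so
  the ergodic theorem covers the roots, the near-maximum function and v' itself.\<close>

lemma pathwise_mean_functional:
  fixes \<Phi> :: "real \<times> real \<Rightarrow> real"
  assumes \<Phi>: "continuous_on UNIV \<Phi>" and C: "\<And>x. \<bar>\<Phi> x\<bar> \<le> C"
  shows "AE \<omega> in M. has_mean (\<lambda>y. \<Phi> (v y \<omega>, dv y \<omega>)) (expectation (\<lambda>\<omega>. \<Phi> (v 0 \<omega>, dv 0 \<omega>)))"
proof -
  have [measurable]: "\<Phi> \<in> borel_measurable borel" using \<Phi> by (rule borel_measurable_continuous_onI)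
  interpret stationary_path M \<tau> "\<lambda>y \<omega>. \<Phi> (v y \<omega>, dv y \<omega>)" C
  proof
    show "(\<lambda>\<omega>. \<Phi> (v y \<omega>, dv y \<omega>)) \<in> borel_measurable M" for y by measurable
    show "\<Phi> (v y (\<tau> a \<omega>), dv y (\<tau> a \<omega>)) = \<Phi> (v (y + a) \<omega>, dv (y + a) \<omega>)" if "\<omega> \<in> space M" for a y \<omega>
      using that by (simp add: v_flow dv_flow)
    show "continuous_on UNIV (\<lambda>y. \<Phi> (v y \<omega>, dv y \<omega>))" if "\<omega> \<in> space M" for \<omega>
      by (rule continuous_on_compose2[OF \<Phi>]) (auto intro!: continuous_on_Pair v_continuous dv_continuous that)
  qed (rule C)
  show ?thesis using pathwise_mean .
qed

lemma functional_integrable: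
  fixes \<Phi> :: "real \<times> real \<Rightarrow> real"
  assumes \<Phi>: "continuous_on UNIV \<Phi>" and C: "\<And>x. \<bar>\<Phi> x\<bar> \<le> C"
  shows "integrable M (\<lambda>\<omega>. \<Phi> (v y \<omega>, dv y \<omega>))"
proof -
  have [measurable]: "\<Phi> \<in> borel_measurable borel" using \<Phi> by (rule borel_measurable_continuous_onI)
  show ?thesis by (rule integrable_const_bound[of _ C]) (auto simp: C)
qed

text \<open>The bound B holds only almost surely, whereas functionals must be bounded and continuous
  everywhere; truncation at B achieves this and is inactive on almost every path.\<close>

definition clamp :: "real \<Rightarrow> real" where
  "clamp x = max (- B) (min B x)"

lemma clamp_bounded: "\<bar>clamp x\<bar> \<le> B"
  using B_nonneg by (auto simp: clamp_def)

lemma clamp_eq: "\<bar>x\<bar> \<le> B \<Longrightarrow> clamp x = x"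
  by (auto simp: clamp_def)

lemma clamp_continuous [continuous_intros]: "continuous_on S f \<Longrightarrow> continuous_on S (\<lambda>x. clamp (f x))"
  unfolding clamp_def by (intro continuous_intros)

definition msup :: "real \<Rightarrow> real" where
  "msup m = real_of_ereal (sup_field M (\<lambda>y \<omega>. m * v y \<omega>))"

text \<open>The pathwise supremum is invariant under shifts, hence almost surely constant by
  ergodicity, and the constant is its essential supremum. One value thus serves almost every
  path.\<close>

lemma sup_field_AE:
  "AE \<omega> in M. (SUP y. ereal (m * v y \<omega>)) = sup_field M (\<lambda>y \<omega>. m * v y \<omega>)"
proof -
  let ?S = "\<lambda>\<omega>. SUP y. ereal (m * v y \<omega>)"
  have meas [measurable]: "?S \<in> borel_measurable M"
    by (rule SUP_field_measurable) (auto intro!: continuous_intros v_continuous)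
  have inv: "?S (\<tau> a \<omega>) = ?S \<omega>" if \<omega>: "\<omega> \<in> space M" for a \<omega>
  proof -
    have "range (\<lambda>y. ereal (m * v (y + a) \<omega>)) = range (\<lambda>y. ereal (m * v y \<omega>))"
    proof (intro equalityI subsetI)
      fix x assume "x \<in> range (\<lambda>y. ereal (m * v y \<omega>))"
      then obtain y where "x = ereal (m * v y \<omega>)" by blast
      then have "x = (\<lambda>y. ereal (m * v (y + a) \<omega>)) (y - a)" by simp
      then show "x \<in> range (\<lambda>y. ereal (m * v (y + a) \<omega>))" by (rule range_eqI)
    qed auto
    then show ?thesis by (simp add: v_flow[OF \<omega>])
  qed
  obtain k where k: "AE \<omega> in M. ?S \<omega> = k" using invariant_AE_constant[OF meas inv] by blast
  have "esssup M ?S = k"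
  proof (rule antisym)
    show "esssup M ?S \<le> k" using k by (intro esssup_I) (auto elim!: eventually_mono)
    have "AE \<omega> in M. ?S \<omega> \<le> esssup M ?S" by (rule esssup_AE)
    then show "k \<le> esssup M ?S" using eventually_happens'[OF ae_filter_bot eventually_conj[OF k \<open>AE \<omega> in M. ?S \<omega> \<le> esssup M ?S\<close>]] by auto
  qed
  then show ?thesis using k by (simp add: sup_field_def)
qed

lemma msup:
  "sup_field M (\<lambda>y \<omega>. m * v y \<omega>) = ereal (msup m)"
  "AE \<omega> in M. (\<forall>y. m * v y \<omega> \<le> msup m) \<and> (\<forall>e>0. \<exists>y. m * v y \<omega> > msup m - e)"
proof -
  have 1: "AE \<omega> in M. \<bar>sup_field M (\<lambda>y \<omega>. m * v y \<omega>)\<bar> \<noteq> \<infinity>"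
    using sup_field_AE[of m] v_bounded
  proof eventually_elim
    case (elim \<omega>)
    have b: "\<bar>m * v y \<omega>\<bar> \<le> \<bar>m\<bar> * B" for y using elim(2) by (simp add: abs_mult mult_left_mono)
    have "(SUP y. ereal (m * v y \<omega>)) \<le> ereal (\<bar>m\<bar> * B)"
      by (rule SUP_least) (use b in \<open>auto simp: abs_le_iff\<close>)
    moreover have "ereal (m * v 0 \<omega>) \<le> (SUP y. ereal (m * v y \<omega>))" by (rule SUP_upper) simp
    ultimately show ?case unfolding elim(1)[symmetric] by (auto simp: ereal_infty_less_eq)
  qed
  have fin: "\<bar>sup_field M (\<lambda>y \<omega>. m * v y \<omega>)\<bar> \<noteq> \<infinity>"
    using eventually_happens'[OF ae_filter_bot 1] by simp
  then show eq: "sup_field M (\<lambda>y \<omega>. m * v y \<omega>) = ereal (msup m)"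
    unfolding msup_def by (simp add: ereal_real')
  show "AE \<omega> in M. (\<forall>y. m * v y \<omega> \<le> msup m) \<and> (\<forall>e>0. \<exists>y. m * v y \<omega> > msup m - e)"
    using sup_field_AE[of m]
  proof eventually_elim
    case (elim \<omega>)
    have S: "(SUP y. ereal (m * v y \<omega>)) = ereal (msup m)" using elim eq by simp
    have "m * v y \<omega> \<le> msup m" for y
    proof -
      have "ereal (m * v y \<omega>) \<le> (SUP y. ereal (m * v y \<omega>))" by (rule SUP_upper) simp
      then show ?thesis using S by simp
    qed
    moreover have "\<exists>y. m * v y \<omega> > msup m - e" if "e > 0" for e
    proof -
      have "ereal (msup m - e) < (SUP y. ereal (m * v y \<omega>))" using S that by simp
      then show ?thesis by (auto simp: less_SUP_iff)
    qed
    ultimately show ?case by blast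
  qed
qed

text \<open>The level of the flat part, which is the lower bound in the theorem.\<close>

definition lam :: "real \<Rightarrow> real" where
  "lam m = \<bar>m\<bar> + msup m"

text \<open>The positive root at level l. The maximum and the truncations keep the arguments, for
  every \<omega>, in the range where \<open>cell_root\<close> is defined and Lipschitz; on almost
  every path they are inactive.\<close>

definition slope :: "real \<Rightarrow> real \<Rightarrow> real \<Rightarrow> real \<times> real \<Rightarrow> real" where
  "slope c m l x = cell_root m (c * m * clamp (snd x)) (max (\<bar>m\<bar> + (l - lam m)) (l - m * clamp (fst x)))"

lemma slope_args:
  assumes "lam m < l"
  shows "\<bar>m\<bar> < max (\<bar>m\<bar> + (l - lam m)) (l - m * clamp (fst x))" "m = 0 \<longrightarrow> c * m * clamp (snd x) = 0"
  using assms by auto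

lemma mult_clamp_bounded: "\<bar>k * clamp x\<bar> \<le> \<bar>k\<bar> * B"
  using clamp_bounded[of x] by (simp add: abs_mult mult_left_mono)

lemma slope_continuous:
  assumes l: "lam m < l"
  shows "continuous_on UNIV (slope c m l)"
proof -
  define \<kappa> where "\<kappa> = l - lam m"
  define b where "b x = c * m * clamp (snd x)" for x :: "real \<times> real"
  define s where "s x = max (\<bar>m\<bar> + \<kappa>) (l - m * clamp (fst x))" for x :: "real \<times> real"
  define S where "S = max (\<bar>m\<bar> + \<kappa>) (\<bar>l\<bar> + \<bar>m\<bar> * B)"
  define K where "K = 2 * (S + 2 * (\<bar>c * m\<bar> * B)) / \<kappa>"
  have \<kappa>: "\<kappa> > 0" using l by (simp add: \<kappa>_def)
  have sS: "s x \<le> S" for x using mult_clamp_bounded[of m "fst x"] by (auto simp: s_def S_def max_def)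
  have lip: "\<bar>slope c m l x - slope c m l y\<bar> \<le> K * (\<bar>s x - s y\<bar> + \<bar>b x - b y\<bar>)" for x y
    unfolding slope_def b_def[symmetric] \<kappa>_def[symmetric] s_def[symmetric] K_def
    by (rule cell_root_lipschitz[OF \<kappa>]) (auto simp: sS, auto simp: s_def b_def mult_clamp_bounded)
  have cs: "continuous_on UNIV s" "continuous_on UNIV b"
    unfolding s_def[abs_def] b_def[abs_def] by (intro continuous_intros)+
  show ?thesis
    unfolding continuous_on_def
  proof
    fix x :: "real \<times> real"
    have "(s \<longlongrightarrow> s x) (at x within UNIV)" "(b \<longlongrightarrow> b x) (at x within UNIV)"
      using cs unfolding continuous_on_def by blast+
    then have "((\<lambda>y. K * (\<bar>s y - s x\<bar> + \<bar>b y - b x\<bar>)) \<longlongrightarrow> K * (\<bar>s x - s x\<bar> + \<bar>b x - b x\<bar>)) (at x within UNIV)"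
      by (intro tendsto_intros)
    then have "((\<lambda>y. K * (\<bar>s y - s x\<bar> + \<bar>b y - b x\<bar>)) \<longlongrightarrow> 0) (at x within UNIV)" by simp
    then have "((\<lambda>y. slope c m l y - slope c m l x) \<longlongrightarrow> 0) (at x within UNIV)"
      by (rule Lim_null_comparison[rotated]) (simp add: lip)
    then show "(slope c m l \<longlongrightarrow> slope c m l x) (at x within UNIV)" by (simp add: LIM_zero_iff)
  qed
qed

lemma slope_nonneg: "lam m < l \<Longrightarrow> 0 < slope c m l x"
  unfolding slope_def by (intro cell_root slope_args)

definition slope_bound :: "real \<Rightarrow> real \<Rightarrow> real \<Rightarrow> real" where
  "slope_bound c m l = max (\<bar>m\<bar> + (l - lam m)) (\<bar>l\<bar> + \<bar>m\<bar> * B) + \<bar>c * m\<bar> * B"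

lemma slope_bounded: "lam m < l \<Longrightarrow> \<bar>slope c m l x\<bar> \<le> slope_bound c m l"
proof -
  assume l: "lam m < l"
  have "slope c m l x \<le> max (\<bar>m\<bar> + (l - lam m)) (l - m * clamp (fst x)) + \<bar>c * m * clamp (snd x)\<bar>"
    unfolding slope_def by (rule cell_root_bounds(1)[OF slope_args[OF l]])
  also have "\<dots> \<le> slope_bound c m l"
    unfolding slope_bound_def
    using mult_clamp_bounded[of m "fst x"] mult_clamp_bounded[of "c * m" "snd x"]
    by (intro add_mono max.mono) auto
  finally show ?thesis using slope_nonneg[OF l, of c x] by linarith
qed

text \<open>The negative root for c is minus the positive root for -c, so its mean is
  \<open>- Pe (- c) m l\<close>.\<close>

definition Pe :: "real \<Rightarrow> real \<Rightarrow> real \<Rightarrow> real" where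
  "Pe c m l = expectation (\<lambda>\<omega>. slope c m l (v 0 \<omega>, dv 0 \<omega>))"

lemma slope_integrable: "lam m < l \<Longrightarrow> integrable M (\<lambda>\<omega>. slope c m l (v y \<omega>, dv y \<omega>))"
  by (rule functional_integrable[OF slope_continuous slope_bounded])

lemma slope_mono: "lam m < l \<Longrightarrow> l \<le> l' \<Longrightarrow> slope c m l x \<le> slope c m l' x"
  unfolding slope_def by (intro cell_root_mono slope_args max.mono) auto

lemma Pe_mono: "lam m < l \<Longrightarrow> l \<le> l' \<Longrightarrow> Pe c m l \<le> Pe c m l'"
  unfolding Pe_def by (intro integral_mono slope_integrable slope_mono) auto

lemma Pe_nonneg: "lam m < l \<Longrightarrow> 0 \<le> Pe c m l"
  unfolding Pe_def by (intro integral_nonneg_AE AE_I2 less_imp_le slope_nonneg)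

lemma Pe_lower: "lam m < l \<Longrightarrow> l - \<bar>m\<bar> * B - \<bar>c * m\<bar> * B - \<bar>m\<bar> \<le> Pe c m l"
proof -
  assume l: "lam m < l"
  have "l - \<bar>m\<bar> * B - \<bar>c * m\<bar> * B - \<bar>m\<bar> \<le> slope c m l x" for x
  proof -
    have "l - m * clamp (fst x) - \<bar>c * m * clamp (snd x)\<bar> - \<bar>m\<bar> \<le> slope c m l x"
      using cell_root_bounds(2)[OF slope_args(1)[OF l, of x] slope_args(2)[OF l, of c x]] unfolding slope_def by linarith
    then show ?thesis using mult_clamp_bounded[of m "fst x"] mult_clamp_bounded[of "c * m" "snd x"] by linarith
  qed
  then have "(\<integral>\<omega>. l - \<bar>m\<bar> * B - \<bar>c * m\<bar> * B - \<bar>m\<bar> \<partial>M) \<le> Pe c m l"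
    unfolding Pe_def by (intro integral_mono slope_integrable[OF l]) auto
  then show ?thesis by (simp add: prob_space)
qed

definition levels :: "real \<Rightarrow> real \<Rightarrow> real \<Rightarrow> real set" where
  "levels c m n = {l. lam m < l \<and> - Pe (- c) m l \<le> n \<and> n \<le> Pe c m l}"

text \<open>The means are monotone in l, so with a level the set contains all larger ones. Its
  infimum separates levels with a subsolution of slope n from levels with a supersolution of slope
  n.\<close>

definition hb :: "real \<Rightarrow> real \<Rightarrow> real \<Rightarrow> real" where
  "hb c m n = Inf (levels c m n)"

lemma levels_nonempty: "levels c m n \<noteq> {}"
proof -
  define l where "l = max (lam m + 1) (\<bar>n\<bar> + \<bar>m\<bar> * B + \<bar>c * m\<bar> * B + \<bar>m\<bar>)"
  have l: "lam m < l" "\<bar>n\<bar> + \<bar>m\<bar> * B + \<bar>c * m\<bar> * B + \<bar>m\<bar> \<le> l" by (auto simp: l_def)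
  have "\<bar>n\<bar> \<le> Pe c m l" "\<bar>n\<bar> \<le> Pe (- c) m l"
    using Pe_lower[OF l(1), of c] Pe_lower[OF l(1), of "- c"] l(2) by auto
  then have "l \<in> levels c m n" using l(1) by (auto simp: levels_def)
  then show ?thesis by blast
qed

lemma levels_bdd_below: "bdd_below (levels c m n)"
  by (rule bdd_belowI[of _ "lam m"]) (auto simp: levels_def)

lemma lam_le_hb: "lam m \<le> hb c m n"
  unfolding hb_def by (rule cInf_greatest[OF levels_nonempty]) (auto simp: levels_def)

lemma above_hb: "hb c m n < l \<Longrightarrow> l \<in> levels c m n"
proof -
  assume "hb c m n < l"
  then obtain l' where l': "l' \<in> levels c m n" "l' < l"
    unfolding hb_def using cInf_less_iff[OF levels_nonempty levels_bdd_below] by blast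
  then have "Pe c m l' \<le> Pe c m l" "Pe (- c) m l' \<le> Pe (- c) m l"
    by (auto intro!: Pe_mono simp: levels_def)
  then show ?thesis using l' by (auto simp: levels_def)
qed

lemma below_hb: "l < hb c m n \<Longrightarrow> l \<notin> levels c m n"
  unfolding hb_def using cInf_lower[OF _ levels_bdd_below] not_le by blast

lemma slope_path_AE:
  assumes l: "lam m < l"
  shows "AE \<omega> in M. has_mean (\<lambda>y. slope c m l (v y \<omega>, dv y \<omega>)) (Pe c m l)"
    and "AE \<omega> in M. \<forall>y. slope c m l (v y \<omega>, dv y \<omega>) = cell_root m (c * m * dv y \<omega>) (l - m * v y \<omega>)"
    and "AE \<omega> in M. \<forall>y. \<bar>m\<bar> < l - m * v y \<omega>"
proof -
  show "AE \<omega> in M. has_mean (\<lambda>y. slope c m l (v y \<omega>, dv y \<omega>)) (Pe c m l)"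
    unfolding Pe_def by (rule pathwise_mean_functional[OF slope_continuous[OF l] slope_bounded[OF l]])
  show "AE \<omega> in M. \<forall>y. slope c m l (v y \<omega>, dv y \<omega>) = cell_root m (c * m * dv y \<omega>) (l - m * v y \<omega>)"
    using v_bounded dv_bounded msup(2)[of m]
  proof eventually_elim
    case (elim \<omega>)
    show ?case
    proof
      fix y
      have "m * v y \<omega> \<le> msup m" using elim(3) by blast
      then have "\<bar>m\<bar> + (l - lam m) \<le> l - m * v y \<omega>" by (simp add: lam_def)
      then show "slope c m l (v y \<omega>, dv y \<omega>) = cell_root m (c * m * dv y \<omega>) (l - m * v y \<omega>)"
        using elim(1,2) by (simp add: slope_def clamp_eq dv_def max_def)
    qed
  qed
  show "AE \<omega> in M. \<forall>y. \<bar>m\<bar> < l - m * v y \<omega>"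
    using msup(2)[of m]
  proof eventually_elim
    case (elim \<omega>)
    show ?case
    proof
      fix y
      have "m * v y \<omega> \<le> msup m" using elim by blast
      then show "\<bar>m\<bar> < l - m * v y \<omega>" using l by (simp add: lam_def)
    qed
  qed
qed

section \<open>Barriers at the effective level\<close>

abbreviation path_ham :: "'w \<Rightarrow> real \<Rightarrow> real \<Rightarrow> real^2 \<Rightarrow> real^2 \<Rightarrow> real" where
  "path_ham \<omega> c \<equiv> scaled_shear_ham (\<lambda>y. v y \<omega>) (\<lambda>y. dv y \<omega>) c"

lemma trivial_recurrence:
  fixes \<kappa> :: real
  assumes "\<kappa> > 0" "\<And>y. Q y"
  shows "\<exists>D. \<forall>y. \<exists>\<eta>. \<bar>\<eta> - y\<bar> \<le> \<kappa> * \<bar>y\<bar> + D \<and> Q \<eta>"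
proof (rule exI[of _ 0], rule allI)
  fix y :: real
  show "\<exists>\<eta>. \<bar>\<eta> - y\<bar> \<le> \<kappa> * \<bar>y\<bar> + 0 \<and> Q \<eta>" using assms by (intro exI[of _ y]) simp
qed

text \<open>Adding the nonnegative constant \<open>n - Pe c m l\<close> to the positive root gives
  mean slope n and stays above the root, where the Hamiltonian is at least the level. Both branches
  are the same field, so there is no corner.\<close>

lemma upper_barriers_right:
  assumes l: "lam m < l" and n: "Pe c m l \<le> n"
  shows "AE \<omega> in M. upper_barriers (path_ham \<omega> c) (vector [m, n]) l"
  using slope_path_AE(1)[OF l, of c] slope_path_AE(2)[OF l, of c] slope_path_AE(3)[OF l]
proof eventually_elim
  case (elim \<omega>)
  let ?g = "\<lambda>y. slope c m l (v y \<omega>, dv y \<omega>) + (n - Pe c m l)"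
  have mean: "has_mean ?g n" using has_mean_add_const[OF elim(1), of "n - Pe c m l"] by simp
  have H: "l \<le> m * v y \<omega> + cell_ham m (c * m * dv y \<omega>) (?g y)" for y
    using cell_ham_above_root[of m "l - m * v y \<omega>" "c * m * dv y \<omega>" "?g y"] elim(2,3) n by auto
  show ?case
  proof (rule upper_barriers_scaled_shear[OF mean mean order_refl order_refl H H])
    fix \<kappa> :: real assume "\<kappa> > 0"
    then show "\<exists>D. \<forall>y. \<exists>\<eta>. \<bar>\<eta> - y\<bar> \<le> \<kappa> * \<bar>y\<bar> + D \<and>
        (\<forall>p. ?g \<eta> \<le> p \<longrightarrow> p \<le> ?g \<eta> \<longrightarrow> l \<le> m * v \<eta> \<omega> + cell_ham m (c * m * dv \<eta> \<omega>) p)"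
    proof (rule trivial_recurrence, intro allI impI)
      fix \<eta> p assume "?g \<eta> \<le> p" "p \<le> ?g \<eta>"
      then have "p = ?g \<eta>" by linarith
      then show "l \<le> m * v \<eta> \<omega> + cell_ham m (c * m * dv \<eta> \<omega>) p" using H[of \<eta>] by simp
    qed
  qed
qed

lemma cell_ham_above_root_minus:
  assumes "\<bar>m\<bar> < s" "m = 0 \<longrightarrow> b = 0" "q \<le> - cell_root m (- b) s"
  shows "s \<le> cell_ham m b q"
  using cell_ham_above_root[of m s "- b" "- q"] assms cell_ham_minus[of m b "- q"] by auto

text \<open>Mirror image: the negative root is lowered by a constant until its mean is n.\<close>

lemma upper_barriers_left:
  assumes l: "lam m < l" and n: "n \<le> - Pe (- c) m l"
  shows "AE \<omega> in M. upper_barriers (path_ham \<omega> c) (vector [m, n]) l"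
  using slope_path_AE(1)[OF l, of "- c"] slope_path_AE(2)[OF l, of "- c"] slope_path_AE(3)[OF l]
proof eventually_elim
  case (elim \<omega>)
  let ?g = "\<lambda>y. - slope (- c) m l (v y \<omega>, dv y \<omega>) + (n + Pe (- c) m l)"
  have mean: "has_mean ?g n" using has_mean_add_const[OF has_mean_minus[OF elim(1)], of "n + Pe (- c) m l"] by simp
  have H: "l \<le> m * v y \<omega> + cell_ham m (c * m * dv y \<omega>) (?g y)" for y
    using cell_ham_above_root_minus[of m "l - m * v y \<omega>" "c * m * dv y \<omega>" "?g y"] elim(2,3) n by auto
  show ?case
  proof (rule upper_barriers_scaled_shear[OF mean mean order_refl order_refl H H])
    fix \<kappa> :: real assume "\<kappa> > 0"
    then show "\<exists>D. \<forall>y. \<exists>\<eta>. \<bar>\<eta> - y\<bar> \<le> \<kappa> * \<bar>y\<bar> + D \<and>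
        (\<forall>p. ?g \<eta> \<le> p \<longrightarrow> p \<le> ?g \<eta> \<longrightarrow> l \<le> m * v \<eta> \<omega> + cell_ham m (c * m * dv \<eta> \<omega>) p)"
    proof (rule trivial_recurrence, intro allI impI)
      fix \<eta> p assume "?g \<eta> \<le> p" "p \<le> ?g \<eta>"
      then have "p = ?g \<eta>" by linarith
      then show "l \<le> m * v \<eta> \<omega> + cell_ham m (c * m * dv \<eta> \<omega>) p" using H[of \<eta>] by simp
    qed
  qed
qed

text \<open>Between the two roots the Hamiltonian is at most the level, at every y; this is exactly
  what a concave corner requires.\<close>

lemma lower_barriers_level:
  assumes l: "l \<in> levels c m n"
  shows "AE \<omega> in M. lower_barriers (path_ham \<omega> c) (vector [m, n]) l"
proof -
  have lam: "lam m < l" and n: "- Pe (- c) m l \<le> n" "n \<le> Pe c m l" using l by (auto simp: levels_def)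
  show ?thesis
    using slope_path_AE(1)[OF lam, of c] slope_path_AE(1)[OF lam, of "- c"]
      slope_path_AE(2)[OF lam, of c] slope_path_AE(2)[OF lam, of "- c"] slope_path_AE(3)[OF lam]
  proof eventually_elim
    case (elim \<omega>)
    show ?case
    proof (rule lower_barriers_scaled_shear[OF has_mean_minus[OF elim(2)] elim(1) n])
      fix y
      show "- slope (- c) m l (v y \<omega>, dv y \<omega>) \<le> slope c m l (v y \<omega>, dv y \<omega>)"
        using slope_nonneg[OF lam, of c "(v y \<omega>, dv y \<omega>)"] slope_nonneg[OF lam, of "- c" "(v y \<omega>, dv y \<omega>)"] by linarith
      fix p assume p: "- slope (- c) m l (v y \<omega>, dv y \<omega>) \<le> p" "p \<le> slope c m l (v y \<omega>, dv y \<omega>)"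
      show "m * v y \<omega> + cell_ham m (c * m * dv y \<omega>) p \<le> l"
      proof (cases "0 \<le> p")
        case True
        then show ?thesis
          using cell_ham_below_root[of m "l - m * v y \<omega>" "c * m * dv y \<omega>" p] p elim(3,5) by auto
      next
        case False
        then show ?thesis
          using cell_ham_below_root[of m "l - m * v y \<omega>" "- (c * m * dv y \<omega>)" "- p"] p elim(4,5)
            cell_ham_minus[of m "c * m * dv y \<omega>" "- p"] by auto
      qed
    qed
  qed
qed

lemma expectation_functional:
  fixes \<Phi> :: "real \<times> real \<Rightarrow> real"
  assumes \<Phi>: "continuous_on UNIV \<Phi>"
  shows "expectation (\<lambda>\<omega>. \<Phi> (v y \<omega>, dv y \<omega>)) = expectation (\<lambda>\<omega>. \<Phi> (v 0 \<omega>, dv 0 \<omega>))"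
proof -
  have [measurable]: "\<Phi> \<in> borel_measurable borel" using \<Phi> by (rule borel_measurable_continuous_onI)
  have "expectation (\<lambda>\<omega>. \<Phi> (v y \<omega>, dv y \<omega>)) = expectation (\<lambda>\<omega>. \<Phi> (v 0 (\<tau> y \<omega>), dv 0 (\<tau> y \<omega>)))"
    by (rule Bochner_Integration.integral_cong) (simp_all add: v_flow dv_flow)
  also have "\<dots> = expectation (\<lambda>\<omega>. \<Phi> (v 0 \<omega>, dv 0 \<omega>))"
    by (rule expectation_flow[where f = "\<lambda>\<omega>. \<Phi> (v 0 \<omega>, dv 0 \<omega>)"]) measurable
  finally show ?thesis .
qed

text \<open>A nonnegative variable of mean 0 vanishes almost surely, here at each fixed y; rational
  y and continuity of the paths give one null set for all y.\<close>

lemma functional_zero_AE: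
  fixes \<Phi> :: "real \<times> real \<Rightarrow> real"
  assumes \<Phi>: "continuous_on UNIV \<Phi>" and C: "\<And>x. \<bar>\<Phi> x\<bar> \<le> C"
    and nonneg: "AE \<omega> in M. \<forall>y. 0 \<le> \<Phi> (v y \<omega>, dv y \<omega>)"
    and zero: "expectation (\<lambda>\<omega>. \<Phi> (v 0 \<omega>, dv 0 \<omega>)) = 0"
  shows "AE \<omega> in M. \<forall>y. \<Phi> (v y \<omega>, dv y \<omega>) = 0"
proof -
  have "AE \<omega> in M. \<Phi> (v y \<omega>, dv y \<omega>) = 0" for y
  proof -
    have "AE \<omega> in M. 0 \<le> \<Phi> (v y \<omega>, dv y \<omega>)" using nonneg by eventually_elim blast
    then show ?thesis
      using integral_nonneg_eq_0_iff_AE[OF functional_integrable[OF \<Phi> C, of y]]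
        expectation_functional[OF \<Phi>, of y] zero by simp
  qed
  then have "AE \<omega> in M. \<forall>r\<in>\<rat>. \<Phi> (v r \<omega>, dv r \<omega>) = 0"
    by (subst AE_ball_countable) (auto simp: countable_rat)
  then show ?thesis
    using AE_space
  proof eventually_elim
    case (elim \<omega>)
    have "continuous_on UNIV (\<lambda>y. \<Phi> (v y \<omega>, dv y \<omega>))"
      by (rule continuous_on_compose2[OF \<Phi>]) (auto intro!: continuous_on_Pair v_continuous dv_continuous elim)
    then have "closed {y. \<Phi> (v y \<omega>, dv y \<omega>) = 0}" by (intro closed_Collect_eq continuous_intros)
    moreover have "\<rat> \<subseteq> {y. \<Phi> (v y \<omega>, dv y \<omega>) = 0}" using elim by blast
    ultimately have "closure \<rat> \<subseteq> {y. \<Phi> (v y \<omega>, dv y \<omega>) = 0}" by (rule closure_minimal[rotated])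
    then show ?case using Rats_closure_real by auto
  qed
qed

text \<open>Positive where m v - |c m v'| exceeds sup m v - \<delta>; there
  \<open>cell_ham_ge\<close> makes every slope admissible at the level
  \<open>lam m - \<delta>\<close>. A continuous function replaces the indicator so that the ergodic
  theorem applies.\<close>

definition near_max :: "real \<Rightarrow> real \<Rightarrow> real \<Rightarrow> real \<times> real \<Rightarrow> real" where
  "near_max c m \<delta> x = max 0 (m * clamp (fst x) - \<bar>c * m * clamp (snd x)\<bar> - msup m + \<delta>)"

lemma near_max_continuous: "continuous_on UNIV (near_max c m \<delta>)"
  unfolding near_max_def[abs_def] by (intro continuous_intros)

lemma near_max_bounded: "\<bar>near_max c m \<delta> x\<bar> \<le> \<bar>m\<bar> * B + \<bar>msup m\<bar> + \<bar>\<delta>\<bar>"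
proof -
  have "0 \<le> \<bar>m\<bar> * B" using B_nonneg by simp
  then show ?thesis unfolding near_max_def using mult_clamp_bounded[of m "fst x"] by linarith
qed

text \<open>Otherwise it would vanish along almost every path, which contradicts the existence of
  almost maxima of m v with small derivative.\<close>

lemma near_max_positive:
  assumes \<delta>: "\<delta> > 0"
  shows "expectation (\<lambda>\<omega>. near_max c m \<delta> (v 0 \<omega>, dv 0 \<omega>)) > 0"
proof (rule ccontr)
  assume "\<not> ?thesis"
  moreover have "0 \<le> expectation (\<lambda>\<omega>. near_max c m \<delta> (v 0 \<omega>, dv 0 \<omega>))"
    by (intro integral_nonneg_AE AE_I2) (simp add: near_max_def)
  ultimately have "expectation (\<lambda>\<omega>. near_max c m \<delta> (v 0 \<omega>, dv 0 \<omega>)) = 0" by linarith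
  then have "AE \<omega> in M. \<forall>y. near_max c m \<delta> (v y \<omega>, dv y \<omega>) = 0"
    by (intro functional_zero_AE[OF near_max_continuous near_max_bounded]) (auto simp: near_max_def)
  then have "AE \<omega> in M. False"
    using v_bounded dv_bounded msup(2)[of m] AE_space
  proof eventually_elim
    case (elim \<omega>)
    \<comment> \<open>The loss e in m v and the loss |c| e in the strain term together make \<delta>
      / 2.\<close>
    define e where "e = \<delta> / (2 * (1 + \<bar>c\<bar>))"
    have e: "e > 0" using \<delta> by (simp add: e_def add_pos_nonneg)
    have der: "((\<lambda>y. m * v y \<omega>) has_real_derivative m * dv y \<omega>) (at y)" for y
      by (rule DERIV_cmult[OF v_derivative[OF elim(5)]])
    obtain y where y: "m * v y \<omega> > msup m - e" "\<bar>m * dv y \<omega>\<bar> \<le> e"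
      using almost_maximum_small_derivative[OF der _ _ e, of "msup m"] elim(4) by blast
    have "\<bar>c * m * dv y \<omega>\<bar> \<le> \<bar>c\<bar> * e" using y(2) by (simp add: abs_mult mult.assoc mult_left_mono)
    moreover have "e + \<bar>c\<bar> * e = \<delta> / 2"
    proof -
      have "\<delta> / (2 * k) * k = \<delta> / 2" if "k > 0" for k :: real using that by simp
      from this[of "1 + \<bar>c\<bar>"] have "e * (1 + \<bar>c\<bar>) = \<delta> / 2" by (simp only: e_def)
      then show ?thesis by (simp add: algebra_simps)
    qed
    ultimately have "0 < m * v y \<omega> - \<bar>c * m * dv y \<omega>\<bar> - msup m + \<delta>" using y(1) \<delta> by linarith
    then have "near_max c m \<delta> (v y \<omega>, dv y \<omega>) > 0"
      using elim(2,3) by (simp add: near_max_def clamp_eq dv_def)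
    then show ?case using elim(1) by (metis less_irrefl)
  qed
  then show False using eventually_happens'[OF ae_filter_bot] by auto
qed

text \<open>The negative root on the left and the positive root on the right form a convex corner,
  whose intermediate slopes may fall below the required level. Corners are therefore put where
  \<open>near_max\<close> is positive; such points recur along the path because its mean is
  positive.\<close>

lemma upper_barriers_flat:
  assumes l: "l \<in> levels c m n" and \<delta>: "\<delta> > 0"
  shows "AE \<omega> in M. upper_barriers (path_ham \<omega> c) (vector [m, n]) (lam m - \<delta>)"
proof -
  have lam: "lam m < l" and n: "- Pe (- c) m l \<le> n" "n \<le> Pe c m l" using l by (auto simp: levels_def)
  have "AE \<omega> in M. has_mean (\<lambda>y. near_max c m \<delta> (v y \<omega>, dv y \<omega>)) (expectation (\<lambda>\<omega>. near_max c m \<delta> (v 0 \<omega>, dv 0 \<omega>)))"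
    by (rule pathwise_mean_functional[OF near_max_continuous near_max_bounded])
  then show ?thesis
    using slope_path_AE(1)[OF lam, of c] slope_path_AE(1)[OF lam, of "- c"]
      slope_path_AE(2)[OF lam, of c] slope_path_AE(2)[OF lam, of "- c"] slope_path_AE(3)[OF lam] v_bounded dv_bounded
  proof eventually_elim
    case (elim \<omega>)
    show ?case
    proof (rule upper_barriers_scaled_shear[OF elim(2) has_mean_minus[OF elim(3)] n])
      show "lam m - \<delta> \<le> m * v y \<omega> + cell_ham m (c * m * dv y \<omega>) (slope c m l (v y \<omega>, dv y \<omega>))" for y
      proof -
        have "l - m * v y \<omega> \<le> cell_ham m (c * m * dv y \<omega>) (slope c m l (v y \<omega>, dv y \<omega>))"
          by (rule cell_ham_above_root) (use elim(4,6) in auto)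
        then show ?thesis using lam \<delta> by linarith
      qed
      show "lam m - \<delta> \<le> m * v y \<omega> + cell_ham m (c * m * dv y \<omega>) (- slope (- c) m l (v y \<omega>, dv y \<omega>))" for y
      proof -
        have "l - m * v y \<omega> \<le> cell_ham m (c * m * dv y \<omega>) (- slope (- c) m l (v y \<omega>, dv y \<omega>))"
          by (rule cell_ham_above_root_minus) (use elim(5,6) in auto)
        then show ?thesis using lam \<delta> by linarith
      qed
      fix \<kappa> :: real assume "\<kappa> > 0"
      then obtain D where D: "\<And>y. \<exists>\<eta>. \<bar>\<eta> - y\<bar> \<le> \<kappa> * \<bar>y\<bar> + D \<and> near_max c m \<delta> (v \<eta> \<omega>, dv \<eta> \<omega>) \<noteq> 0"
        using has_mean_positive_recurrent[OF elim(1) near_max_positive[OF \<delta>]] by meson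
      have flat: "lam m - \<delta> \<le> m * v \<eta> \<omega> + cell_ham m (c * m * dv \<eta> \<omega>) p"
        if "near_max c m \<delta> (v \<eta> \<omega>, dv \<eta> \<omega>) \<noteq> 0" for \<eta> p
      proof -
        have "near_max c m \<delta> (v \<eta> \<omega>, dv \<eta> \<omega>) = max 0 (m * v \<eta> \<omega> - \<bar>c * m * dv \<eta> \<omega>\<bar> - msup m + \<delta>)"
          using elim(7,8) by (simp add: near_max_def clamp_eq dv_def)
        then have "m * v \<eta> \<omega> - \<bar>c * m * dv \<eta> \<omega>\<bar> - msup m + \<delta> > 0" using that by (simp add: max_def split: if_splits)
        then show ?thesis using cell_ham_ge[of m "c * m * dv \<eta> \<omega>" p] by (simp add: lam_def)
      qed
      show "\<exists>D. \<forall>y. \<exists>\<eta>. \<bar>\<eta> - y\<bar> \<le> \<kappa> * \<bar>y\<bar> + D \<and>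
        (\<forall>p. - slope (- c) m l (v \<eta> \<omega>, dv \<eta> \<omega>) \<le> p \<longrightarrow> p \<le> slope c m l (v \<eta> \<omega>, dv \<eta> \<omega>) \<longrightarrow>
          lam m - \<delta> \<le> m * v \<eta> \<omega> + cell_ham m (c * m * dv \<eta> \<omega>) p)"
        using D flat by meson
    qed
  qed
qed

text \<open>If \<open>hb\<close> equals \<open>lam\<close>, a level just above brackets n and the
  flat construction applies. Otherwise each level strictly between them leaves n on one side of the
  two means, and a shifted root serves. Countably many levels keep the exceptional set null.\<close>

lemma upper_barriers_hb: "AE \<omega> in M. upper_barriers (path_ham \<omega> c) (vector [m, n]) (hb c m n)"
proof (cases "hb c m n = lam m")
  case True
  have "AE \<omega> in M. \<forall>j. upper_barriers (path_ham \<omega> c) (vector [m, n]) (lam m - inverse (real (Suc j)))"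
    unfolding AE_all_countable
  proof
    fix j
    have "hb c m n < lam m + 1" using True by simp
    then show "AE \<omega> in M. upper_barriers (path_ham \<omega> c) (vector [m, n]) (lam m - inverse (real (Suc j)))"
      by (intro upper_barriers_flat[OF above_hb]) auto
  qed
  then show ?thesis
  proof eventually_elim
    case (elim \<omega>)
    show ?case
    proof (rule upper_barriers_limit)
      fix e :: real assume "e > 0"
      then obtain j where "inverse (real (Suc j)) < e" using reals_Archimedean by blast
      then have "lam m - inverse (real (Suc j)) > hb c m n - e" using True by linarith
      then show "\<exists>l>hb c m n - e. upper_barriers (path_ham \<omega> c) (vector [m, n]) l" using elim by blast
    qed
  qed
next
  case False
  then have lt: "lam m < hb c m n" using lam_le_hb[of m c n] by linarith
  define h where "h = hb c m n - lam m"
  \<comment> \<open>The double successor keeps already the first level strictly above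
    \<open>lam m\<close>.\<close>
  define l where "l j = hb c m n - h * inverse (real (Suc (Suc j)))" for j
  have h: "h > 0" using lt by (simp add: h_def)
  have l: "lam m < l j" "l j < hb c m n" for j
  proof -
    have "inverse (real (Suc (Suc j))) < 1" by (simp add: inverse_less_1_iff)
    then have "h * inverse (real (Suc (Suc j))) < h * 1" using h by (intro mult_strict_left_mono)
    then show "lam m < l j" by (simp add: l_def h_def)
    show "l j < hb c m n" using h by (simp add: l_def)
  qed
  have "AE \<omega> in M. \<forall>j. upper_barriers (path_ham \<omega> c) (vector [m, n]) (l j)"
    unfolding AE_all_countable
  proof
    fix j
    have "l j \<notin> levels c m n" by (rule below_hb[OF l(2)])
    then have "n \<le> - Pe (- c) m (l j) \<or> Pe c m (l j) \<le> n" using l(1) by (auto simp: levels_def)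
    then show "AE \<omega> in M. upper_barriers (path_ham \<omega> c) (vector [m, n]) (l j)"
      using upper_barriers_left[OF l(1)] upper_barriers_right[OF l(1)] by blast
  qed
  then show ?thesis
  proof eventually_elim
    case (elim \<omega>)
    show ?case
    proof (rule upper_barriers_limit)
      fix e :: real assume e: "e > 0"
      then obtain j where "inverse (real (Suc j)) < e / h" using reals_Archimedean[of "e / h"] h by auto
      moreover have "inverse (real (Suc (Suc j))) \<le> inverse (real (Suc j))" by (simp add: le_imp_inverse_le)
      ultimately have "h * inverse (real (Suc (Suc j))) < e" using h e by (simp add: field_simps)
      then have "l j > hb c m n - e" by (simp add: l_def)
      then show "\<exists>l>hb c m n - e. upper_barriers (path_ham \<omega> c) (vector [m, n]) l" using elim by blast
    qed
  qed
qed

lemma lower_barriers_hb: "AE \<omega> in M. lower_barriers (path_ham \<omega> c) (vector [m, n]) (hb c m n)"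
proof -
  have "AE \<omega> in M. \<forall>j. lower_barriers (path_ham \<omega> c) (vector [m, n]) (hb c m n + inverse (real (Suc j)))"
    unfolding AE_all_countable
  proof
    fix j
    show "AE \<omega> in M. lower_barriers (path_ham \<omega> c) (vector [m, n]) (hb c m n + inverse (real (Suc j)))"
      by (intro lower_barriers_level above_hb) simp
  qed
  then show ?thesis
  proof eventually_elim
    case (elim \<omega>)
    show ?case
      unfolding lower_barriers_def
    proof (rule upper_barriers_limit)
      fix e :: real assume "e > 0"
      then obtain j where "inverse (real (Suc j)) < e" using reals_Archimedean by blast
      then have "- (hb c m n + inverse (real (Suc j))) > - hb c m n - e" by linarith
      then show "\<exists>l>- hb c m n - e. upper_barriers (\<lambda>\<epsilon>. dual_hamiltonian (path_ham \<omega> c \<epsilon>)) (- vector [m, n]) l"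
        using elim unfolding lower_barriers_def by blast
    qed
  qed
qed

section \<open>Homogenization of the random shear flow\<close>

definition Hb :: "real \<Rightarrow> real^2 \<Rightarrow> real" where
  "Hb c p = hb c (p $ 1) (p $ 2)"

lemma vector_2_eq: "vector [p $ 1, p $ 2] = (p :: real^2)"
  by (simp add: vec_eq_iff forall_2)

lemma barriers_Hb:
  "AE \<omega> in M. upper_barriers (path_ham \<omega> c) p (Hb c p)"
  "AE \<omega> in M. lower_barriers (path_ham \<omega> c) p (Hb c p)"
  using upper_barriers_hb[of c "p $ 1" "p $ 2"] lower_barriers_hb[of c "p $ 1" "p $ 2"]
  by (simp_all add: vector_2_eq Hb_def)

lemma regular_path_ham_AE:
  "AE \<omega> in M. \<forall>\<epsilon>>0. regular_hamiltonian (1 + B + 3 * \<bar>c\<bar> * B) (path_ham \<omega> c \<epsilon>)"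
  using v_bounded dv_bounded AE_space
proof eventually_elim
  case (elim \<omega>)
  show ?case
  proof (intro allI impI)
    fix \<epsilon> :: real assume \<epsilon>: "\<epsilon> > 0"
    have chain: "((\<lambda>y. f (y / \<epsilon>)) has_real_derivative g (y / \<epsilon>) * (1 / \<epsilon>)) (at y)"
      if "\<And>y. (f has_real_derivative g y) (at y)" for f g :: "real \<Rightarrow> real" and y
      by (rule DERIV_chain2[OF that]) (use \<epsilon> in \<open>auto intro!: derivative_eq_intros\<close>)
    have cont: "continuous_on UNIV (\<lambda>y. g (y / \<epsilon>) * (1 / \<epsilon>))" if "continuous_on UNIV g" for g :: "real \<Rightarrow> real"
    proof -
      have "continuous_on UNIV (\<lambda>y. g (y / \<epsilon>))"
        by (rule continuous_on_compose2[OF that]) (use \<epsilon> in \<open>auto intro!: continuous_intros\<close>)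
      then show ?thesis by (intro continuous_intros)
    qed
    show "regular_hamiltonian (1 + B + 3 * \<bar>c\<bar> * B) (path_ham \<omega> c \<epsilon>)"
      unfolding scaled_shear_ham_def
    proof (rule regular_shear_ham)
      show "\<bar>v (y / \<epsilon>) \<omega>\<bar> \<le> B" "\<bar>dv (y / \<epsilon>) \<omega>\<bar> \<le> B" for y using elim by (auto simp: dv_def)
      show "\<exists>L. \<forall>y y'. \<bar>y\<bar> \<le> R \<longrightarrow> \<bar>y'\<bar> \<le> R \<longrightarrow> \<bar>v (y / \<epsilon>) \<omega> - v (y' / \<epsilon>) \<omega>\<bar> \<le> L * \<bar>y - y'\<bar>" for R
        by (rule C1_locally_lipschitz[OF chain[OF v_derivative[OF elim(3)]] cont[OF dv_continuous[OF elim(3)]]])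
      show "\<exists>L. \<forall>y y'. \<bar>y\<bar> \<le> R \<longrightarrow> \<bar>y'\<bar> \<le> R \<longrightarrow> \<bar>dv (y / \<epsilon>) \<omega> - dv (y' / \<epsilon>) \<omega>\<bar> \<le> L * \<bar>y - y'\<bar>" for R
        by (rule C1_locally_lipschitz[OF chain[OF dv_derivative(1)[OF elim(3)]] cont[OF dv_derivative(2)[OF elim(3)]]])
    qed
  qed
qed

text \<open>Almost every path carries all four barriers for p and q, so a single good path compares
  the two deterministic values.\<close>

lemma Hb_lipschitz: "\<bar>Hb c p - Hb c q\<bar> \<le> 4 * (1 + B + 3 * \<bar>c\<bar> * B) * norm (p - q)"
proof -
  have "AE \<omega> in M. \<bar>Hb c p - Hb c q\<bar> \<le> 4 * (1 + B + 3 * \<bar>c\<bar> * B) * norm (p - q)"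
    using regular_path_ham_AE[of c] barriers_Hb[of c p] barriers_Hb[of c q]
  proof eventually_elim
    case (elim \<omega>)
    have reg: "regular_hamiltonian (1 + B + 3 * \<bar>c\<bar> * B) (path_ham \<omega> c \<epsilon>)" if "\<epsilon> > 0" for \<epsilon>
      using elim(1) that by blast
    have "Hb c p - Hb c q \<le> 4 * (1 + B + 3 * \<bar>c\<bar> * B) * norm (p - q)"
      by (rule barriers_lipschitz[OF reg elim(2,5)])
    moreover have "Hb c q - Hb c p \<le> 4 * (1 + B + 3 * \<bar>c\<bar> * B) * norm (q - p)"
      by (rule barriers_lipschitz[OF reg elim(4,3)])
    ultimately show ?case by (simp add: abs_le_iff norm_minus_commute)
  qed
  then show ?thesis using eventually_happens'[OF ae_filter_bot] by simp
qed

text \<open>For m = 0 the flat level is 0, and slope 0 lies between the two means at every positive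
  level.\<close>

lemma Hb_0: "Hb c 0 = 0"
proof -
  have s: "msup 0 = 0"
  proof -
    have "AE \<omega> in M. msup 0 = 0" using msup(2)[of 0]
    proof eventually_elim
      case (elim \<omega>)
      then have "0 \<le> msup 0" "\<And>e. e > 0 \<Longrightarrow> 0 > msup 0 - e" by auto
      then show ?case by (metis diff_0_right diff_self less_irrefl not_le antisym)
    qed
    then show ?thesis using eventually_happens'[OF ae_filter_bot] by simp
  qed
  have "levels c 0 0 = {0<..}"
    using Pe_nonneg[of 0 _ c] Pe_nonneg[of 0 _ "- c"] by (auto simp: levels_def lam_def s)
  then show ?thesis by (simp add: Hb_def hb_def)
qed

lemma G_hamiltonian_path_ham:
  assumes "\<omega> \<in> space M"
  shows "G_hamiltonian (shear_flow v \<omega>) c (z /\<^sub>R \<epsilon>) p = path_ham \<omega> c \<epsilon> z p"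
proof -
  have "(\<lambda>y. v y \<omega>) field_differentiable at ((z /\<^sub>R \<epsilon>) $ 2)"
    using v_derivative[OF assms] field_differentiable_def by blast
  from G_hamiltonian_shear_flow[where v = v and \<omega> = \<omega> and z = "z /\<^sub>R \<epsilon>", OF this, of c p] show ?thesis
    by (auto simp: scaled_shear_ham_def shear_ham_def dv_def divide_inverse mult.commute)
qed

lemma rational_vectors:
  "countable {p :: real^2. p $ 1 \<in> \<rat> \<and> p $ 2 \<in> \<rat>}" "closure {p :: real^2. p $ 1 \<in> \<rat> \<and> p $ 2 \<in> \<rat>} = UNIV"
proof -
  let ?S = "{p :: real^2. p $ 1 \<in> \<rat> \<and> p $ 2 \<in> \<rat>}"
  have "?S \<subseteq> (\<lambda>x. vector [fst x, snd x]) ` (\<rat> \<times> \<rat>)"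
  proof
    fix p :: "real^2" assume "p \<in> ?S"
    then show "p \<in> (\<lambda>x. vector [fst x, snd x]) ` (\<rat> \<times> \<rat>)"
      by (intro image_eqI[of _ _ "(p $ 1, p $ 2)"]) (auto simp: vector_2_eq)
  qed
  then show "countable ?S" by (rule countable_subset) (simp add: countable_rat)
  show "closure ?S = UNIV"
  proof (intro equalityI subsetI)
    fix p :: "real^2"
    show "p \<in> closure ?S"
      unfolding closure_approachable
    proof (intro allI impI)
      fix e :: real assume e: "e > 0"
      have e2: "e / 2 > 0" using e by simp
      have "p $ 1 \<in> closure \<rat>" by (simp add: Rats_closure_real)
      then obtain a where a: "a \<in> \<rat>" "dist a (p $ 1) < e / 2"
        using e2 unfolding closure_approachable by blast
      have "p $ 2 \<in> closure \<rat>" by (simp add: Rats_closure_real)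
      then obtain b where b: "b \<in> \<rat>" "dist b (p $ 2) < e / 2"
        using e2 unfolding closure_approachable by blast
      have "norm (vector [a, b] - p) \<le> \<bar>a - p $ 1\<bar> + \<bar>b - p $ 2\<bar>"
        using norm_le_l1_cart[of "vector [a, b] - p"] by (simp add: sum_2)
      then have "dist (vector [a, b]) p < e" using a b by (simp add: dist_norm)
      then show "\<exists>y\<in>?S. dist y p < e" using a b by (intro bexI[of _ "vector [a, b]"]) auto
    qed
  qed simp
qed

text \<open>The null set of the barriers depends on p. Rational p are countable and dense, and the
  Lipschitz bound of \<open>Hb\<close> extends homogenization from them to all slopes and data on
  one event of full measure.\<close>

theorem effective_hamiltonian_Hb: "effective_hamiltonian M v c (Hb c)"
  unfolding effective_hamiltonian_def
proof
  define A where "A = 1 + B + 3 * \<bar>c\<bar> * B"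
  define L where "L = 4 * A"
  have A: "A > 0" using B_nonneg by (simp add: A_def add_pos_nonneg)
  have L: "L > 0" using A by (simp add: L_def)
  have lip: "\<bar>Hb c p - Hb c q\<bar> \<le> L * norm (p - q)" for p q
    unfolding L_def A_def by (rule Hb_lipschitz)
  show "continuous_on UNIV (Hb c)"
    unfolding continuous_on_def
  proof
    fix p :: "real^2"
    have "((\<lambda>q. L * norm (q - p)) \<longlongrightarrow> L * norm (p - p)) (at p within UNIV)" by (intro tendsto_intros)
    then have "((\<lambda>q. L * norm (q - p)) \<longlongrightarrow> 0) (at p within UNIV)" by simp
    then have "((\<lambda>q. Hb c q - Hb c p) \<longlongrightarrow> 0) (at p within UNIV)"
      by (rule Lim_null_comparison[rotated]) (simp add: lip)
    then show "(Hb c \<longlongrightarrow> Hb c p) (at p within UNIV)" by (simp add: LIM_zero_iff)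
  qed
  let ?S = "{p :: real^2. p $ 1 \<in> \<rat> \<and> p $ 2 \<in> \<rat>}"
  have bar: "AE \<omega> in M. \<forall>p\<in>?S. upper_barriers (path_ham \<omega> c) p (Hb c p) \<and> lower_barriers (path_ham \<omega> c) p (Hb c p)"
    using rational_vectors(1) barriers_Hb by (subst AE_ball_countable) (auto intro: AE_conjI)
  show "AE \<omega> in M. \<forall>G0. uniformly_continuous_on UNIV G0 \<longrightarrow>
     (let H\<epsilon> = (\<lambda>\<epsilon> z p. G_hamiltonian (shear_flow v \<omega>) c (z /\<^sub>R \<epsilon>) p) in
       (\<forall>\<epsilon>>0. \<exists>G. viscosity_solution (H\<epsilon> \<epsilon>) G0 G) \<and>
       (\<exists>G. viscosity_solution (\<lambda>z p. Hb c p) G0 G) \<and>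
       (\<forall>G Gbar. (\<forall>\<epsilon>>0. viscosity_solution (H\<epsilon> \<epsilon>) G0 (G \<epsilon>)) \<longrightarrow>
          viscosity_solution (\<lambda>z p. Hb c p) G0 Gbar \<longrightarrow>
          (\<forall>K. compact K \<longrightarrow> K \<subseteq> UNIV \<times> {0..} \<longrightarrow> uniform_limit K G Gbar (at_right 0))))"
    using bar regular_path_ham_AE[of c] AE_space
  proof eventually_elim
    case (elim \<omega>)
    have ham: "(\<lambda>\<epsilon> z p. G_hamiltonian (shear_flow v \<omega>) c (z /\<^sub>R \<epsilon>) p) = path_ham \<omega> c"
      by (intro ext) (rule G_hamiltonian_path_ham[OF elim(3)])
    have reg: "regular_hamiltonian A (path_ham \<omega> c \<epsilon>)" if "\<epsilon> > 0" for \<epsilon>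
      using elim(2) that by (simp add: A_def)
    have rege: "regular_hamiltonian L (\<lambda>z p. Hb c p)" by (rule regular_effective[OF lip L Hb_0])
    show ?case
      unfolding ham Let_def
    proof (intro allI impI conjI)
      fix G0 :: "real^2 \<Rightarrow> real" assume G0: "uniformly_continuous_on UNIV G0"
      show "\<exists>G. viscosity_solution (path_ham \<omega> c \<epsilon>) G0 G" if "\<epsilon> > 0" for \<epsilon>
        by (rule viscosity_solution_exists[OF reg[OF that] G0])
      show "\<exists>G. viscosity_solution (\<lambda>z p. Hb c p) G0 G"
        by (rule viscosity_solution_exists[OF rege G0])
      fix G :: "real \<Rightarrow> (real^2) \<times> real \<Rightarrow> real" and Gbar and K :: "((real^2) \<times> real) set"
      assume G: "\<forall>\<epsilon>>0. viscosity_solution (path_ham \<omega> c \<epsilon>) G0 (G \<epsilon>)"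
        and Gbar: "viscosity_solution (\<lambda>z p. Hb c p) G0 Gbar" and K: "compact K" "K \<subseteq> UNIV \<times> {0..}"
      show "uniform_limit K G Gbar (at_right 0)"
        by (rule barriers_homogenization[OF reg lip L Hb_0 rational_vectors(2) _ _ G0 _ Gbar K])
           (use elim(1) G in blast)+
    qed
  qed
qed

end

section \<open>Uniqueness of the effective Hamiltonian\<close>

lemma viscosity_solution_affine:
  fixes p :: "'a::euclidean_space"
  shows "viscosity_solution (\<lambda>z p. H p) (\<lambda>z. p \<bullet> z) (\<lambda>q. p \<bullet> fst q - H p * snd q)"
proof -
  have grad: "D\<phi> (z, t) = p \<and> \<phi>t (z, t) = - H p"
    if test: "C1_test_function \<phi> D\<phi> \<phi>t" and t: "0 < t"
      and ext: "(\<forall>\<^sub>F q in nhds (z, t). p \<bullet> fst q - H p * snd q - \<phi> q \<le> p \<bullet> fst (z, t) - H p * snd (z, t) - \<phi> (z, t))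
        \<or> (\<forall>\<^sub>F q in nhds (z, t). p \<bullet> fst q - H p * snd q - \<phi> q \<ge> p \<bullet> fst (z, t) - H p * snd (z, t) - \<phi> (z, t))"
    for \<phi> D\<phi> \<phi>t z and t :: real
  proof -
    let ?g = "\<lambda>q. p \<bullet> fst q - H p * snd q - \<phi> q"
    have "(\<phi> has_derivative (\<lambda>(h, s). D\<phi> (z, t) \<bullet> h + \<phi>t (z, t) * s)) (at (z, t))"
      using test t unfolding C1_test_function_def by simp
    then have "(?g has_derivative (\<lambda>x. p \<bullet> fst x - H p * snd x - (\<lambda>(h, s). D\<phi> (z, t) \<bullet> h + \<phi>t (z, t) * s) x)) (at (z, t))"
      by (auto intro!: derivative_eq_intros)
    moreover obtain r where r: "r > 0" "(\<forall>y\<in>ball (z, t) r. ?g y \<le> ?g (z, t)) \<or> (\<forall>y\<in>ball (z, t) r. ?g (z, t) \<le> ?g y)"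
    proof -
      from ext show thesis
      proof
        assume "\<forall>\<^sub>F q in nhds (z, t). p \<bullet> fst q - H p * snd q - \<phi> q \<le> p \<bullet> fst (z, t) - H p * snd (z, t) - \<phi> (z, t)"
        then obtain r where "r > 0" "\<forall>y. dist y (z, t) < r \<longrightarrow> ?g y \<le> ?g (z, t)"
          unfolding eventually_nhds_metric by blast
        then show thesis using that[of r] by (metis dist_commute mem_ball)
      next
        assume "\<forall>\<^sub>F q in nhds (z, t). p \<bullet> fst q - H p * snd q - \<phi> q \<ge> p \<bullet> fst (z, t) - H p * snd (z, t) - \<phi> (z, t)"
        then obtain r where "r > 0" "\<forall>y. dist y (z, t) < r \<longrightarrow> ?g (z, t) \<le> ?g y"
          unfolding eventually_nhds_metric by blast
        then show thesis using that[of r] by (metis dist_commute mem_ball)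
      qed
    qed
    ultimately have "(\<lambda>x. p \<bullet> fst x - H p * snd x - (\<lambda>(h, s). D\<phi> (z, t) \<bullet> h + \<phi>t (z, t) * s) x) = (\<lambda>x. 0)"
      by (intro differential_zero_maxmin[of "(z, t)" "ball (z, t) r" ?g]) auto
    then have eq: "p \<bullet> h - H p * s - (D\<phi> (z, t) \<bullet> h + \<phi>t (z, t) * s) = 0" for h s
      by (drule_tac fun_cong[where x = "(h, s)"]) simp
    have "p \<bullet> h = D\<phi> (z, t) \<bullet> h" for h using eq[of h 0] by simp
    then have "D\<phi> (z, t) = p" by (metis vector_eq_rdot)
    moreover have "\<phi>t (z, t) = - H p" using eq[of 0 1] by simp
    ultimately show ?thesis by simp
  qed
  have cont: "continuous_on (UNIV \<times> {0..}) (\<lambda>q. p \<bullet> fst q - H p * snd q)" by (intro continuous_intros)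
  show ?thesis
    unfolding viscosity_solution_def viscosity_subsolution_def viscosity_supersolution_def
  proof (intro conjI allI impI cont)
    fix \<phi> D\<phi> \<phi>t z and t :: real
    assume "C1_test_function \<phi> D\<phi> \<phi>t" "0 < t"
      "\<forall>\<^sub>F q in nhds (z, t). p \<bullet> fst q - H p * snd q - \<phi> q \<le> p \<bullet> fst (z, t) - H p * snd (z, t) - \<phi> (z, t)"
    then have "D\<phi> (z, t) = p \<and> \<phi>t (z, t) = - H p" by (intro grad) auto
    then show "\<phi>t (z, t) + H (D\<phi> (z, t)) \<le> 0" by simp
  next
    fix \<phi> D\<phi> \<phi>t z and t :: real
    assume "C1_test_function \<phi> D\<phi> \<phi>t" "0 < t"
      "\<forall>\<^sub>F q in nhds (z, t). p \<bullet> fst q - H p * snd q - \<phi> q \<ge> p \<bullet> fst (z, t) - H p * snd (z, t) - \<phi> (z, t)"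
    then have "D\<phi> (z, t) = p \<and> \<phi>t (z, t) = - H p" by (intro grad) auto
    then show "\<phi>t (z, t) + H (D\<phi> (z, t)) \<ge> 0" by simp
  qed simp
qed

lemma uniformly_continuous_on_inner_left: "uniformly_continuous_on UNIV (\<lambda>z :: 'a::real_inner. p \<bullet> z)"
  by (rule bounded_linear.uniformly_continuous_on[OF bounded_linear_inner_right])
     (rule uniformly_continuous_on_id)

context random_shear begin

text \<open>On a common good path the same solutions with linear data of slope p converge to both
  affine functions; their values at (0, 1) are -H p and -Hb c p.\<close>

lemma effective_hamiltonian_eq_Hb:
  assumes H: "effective_hamiltonian M v c H"
  shows "H p = Hb c p"
proof -
  have "AE \<omega> in M. H p = Hb c p"
    using conjunct2[OF H[unfolded effective_hamiltonian_def]]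
      conjunct2[OF effective_hamiltonian_Hb[of c, unfolded effective_hamiltonian_def]]
  proof eventually_elim
    case (elim \<omega>)
    let ?H = "\<lambda>\<epsilon> z p. G_hamiltonian (shear_flow v \<omega>) c (z /\<^sub>R \<epsilon>) p"
    have uc: "uniformly_continuous_on UNIV (\<lambda>z. p \<bullet> z)" by (rule uniformly_continuous_on_inner_left)
    note e1 = elim(1)[rule_format, OF uc, unfolded Let_def] and e2 = elim(2)[rule_format, OF uc, unfolded Let_def]
    obtain G where G: "\<forall>\<epsilon>>0. viscosity_solution (?H \<epsilon>) (\<lambda>z. p \<bullet> z) (G \<epsilon>)"
      using conjunct1[OF e1] by metis
    have K: "compact {(0 :: real^2, 1 :: real)}" "{(0 :: real^2, 1 :: real)} \<subseteq> UNIV \<times> {0..}" by auto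
    have "uniform_limit {(0, 1)} G (\<lambda>q. p \<bullet> fst q - H p * snd q) (at_right 0)"
      using conjunct2[OF conjunct2[OF e1]] G viscosity_solution_affine[of H p] K by blast
    moreover have "uniform_limit {(0, 1)} G (\<lambda>q. p \<bullet> fst q - Hb c p * snd q) (at_right 0)"
      using conjunct2[OF conjunct2[OF e2]] G viscosity_solution_affine[of "Hb c" p] K by blast
    ultimately have "((\<lambda>\<epsilon>. G \<epsilon> (0, 1)) \<longlongrightarrow> p \<bullet> fst (0 :: real^2, 1 :: real) - H p * snd (0 :: real^2, 1 :: real)) (at_right 0)"
      "((\<lambda>\<epsilon>. G \<epsilon> (0, 1)) \<longlongrightarrow> p \<bullet> fst (0 :: real^2, 1 :: real) - Hb c p * snd (0 :: real^2, 1 :: real)) (at_right 0)"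
      by (auto dest: tendsto_uniform_limitI)
    from tendsto_unique[OF _ this] show ?case by simp
  qed
  then show ?thesis using eventually_happens'[OF ae_filter_bot] by simp
qed

section \<open>Effect of the strain on the mean roots\<close>

lemma clamp_id_continuous: "continuous_on UNIV (\<lambda>x :: real \<times> real. clamp (snd x))" "continuous_on UNIV (\<lambda>x :: real \<times> real. clamp (fst x))"
  by (intro continuous_intros)+

text \<open>The pathwise mean of v' is its expectation by the ergodic theorem, and it is 0 because v
  is a bounded primitive; means are unique.\<close>

lemma expectation_dv: "expectation (\<lambda>\<omega>. clamp (dv 0 \<omega>)) = 0"
proof -
  have "AE \<omega> in M. expectation (\<lambda>\<omega>. clamp (dv 0 \<omega>)) = 0"
    using pathwise_mean_functional[OF clamp_id_continuous(1) clamp_bounded] v_bounded dv_bounded AE_space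
  proof eventually_elim
    case (elim \<omega>)
    have "(\<lambda>y. clamp (snd (v y \<omega>, dv y \<omega>))) = (\<lambda>y. dv y \<omega>)" using elim(3) by (simp add: clamp_eq dv_def)
    then have "has_mean (\<lambda>y. dv y \<omega>) (expectation (\<lambda>\<omega>. clamp (dv 0 \<omega>)))" using elim(1) by simp
    moreover have "has_mean (\<lambda>y. dv y \<omega>) 0"
      by (rule has_mean_bounded_primitive[OF v_derivative[OF elim(4)]]) (use elim(2) in blast)
    ultimately show ?case by (rule has_mean_unique)
  qed
  then show ?thesis using eventually_happens'[OF ae_filter_bot] by simp
qed

text \<open>The added term has mean 0, so the expectation is the difference of the mean roots, while
  the integrand becomes nonnegative pointwise.\<close>

definition strain_gap :: "real \<Rightarrow> real \<Rightarrow> real \<Rightarrow> real \<times> real \<Rightarrow> real" where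
  "strain_gap c m l x = slope c m l x - slope 0 m l x + c * m * clamp (snd x)"

lemma strain_gap_nonneg: "lam m < l \<Longrightarrow> 0 \<le> strain_gap c m l x"
  unfolding strain_gap_def slope_def
  using cell_root_strain(1)[OF slope_args(1)[of m l x] slope_args(2)[of m l c x]] by simp

lemma expectation_strain_gap:
  assumes l: "lam m < l"
  shows "expectation (\<lambda>\<omega>. strain_gap c m l (v 0 \<omega>, dv 0 \<omega>)) = Pe c m l - Pe 0 m l"
proof -
  have int: "integrable M (\<lambda>\<omega>. clamp (dv 0 \<omega>))"
    using functional_integrable[OF clamp_id_continuous(1) clamp_bounded, of 0] by simp
  show ?thesis
    unfolding strain_gap_def Pe_def snd_conv
    using slope_integrable[OF l, of c 0] slope_integrable[OF l, of 0 0] int expectation_dv by simp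
qed

lemma Pe_strain: "lam m < l \<Longrightarrow> Pe 0 m l \<le> Pe c m l"
proof -
  assume l: "lam m < l"
  have "0 \<le> expectation (\<lambda>\<omega>. strain_gap c m l (v 0 \<omega>, dv 0 \<omega>))"
    by (intro integral_nonneg_AE AE_I2 strain_gap_nonneg[OF l])
  then show ?thesis using expectation_strain_gap[OF l] by simp
qed

text \<open>Equality of the means makes the nonnegative gap vanish along almost every path; the
  equality case of \<open>cell_root_strain\<close> then gives c m v' = 0.\<close>

lemma Pe_strain_eq:
  assumes l: "lam m < l" and le: "Pe c m l \<le> Pe 0 m l" and cm: "c \<noteq> 0" "m \<noteq> 0"
  shows "AE \<omega> in M. \<forall>y. dv y \<omega> = 0"
proof -
  have "expectation (\<lambda>\<omega>. strain_gap c m l (v 0 \<omega>, dv 0 \<omega>)) = 0"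
    using expectation_strain_gap[OF l, of c] Pe_strain[OF l, of c] le by simp
  then have "AE \<omega> in M. \<forall>y. strain_gap c m l (v y \<omega>, dv y \<omega>) = 0"
  proof (rule functional_zero_AE[rotated 3])
    show "continuous_on UNIV (strain_gap c m l)"
      unfolding strain_gap_def[abs_def] by (intro continuous_intros slope_continuous[OF l])
    show "\<bar>strain_gap c m l x\<bar> \<le> slope_bound c m l + slope_bound 0 m l + \<bar>c * m\<bar> * B" for x
      unfolding strain_gap_def
      using slope_bounded[OF l, of c x] slope_bounded[OF l, of 0 x] mult_clamp_bounded[of "c * m" "snd x"] by linarith
  qed (simp add: strain_gap_nonneg[OF l])
  then show ?thesis
    using dv_bounded
  proof eventually_elim
    case (elim \<omega>)
    show ?case
    proof
      fix y
      have "c * m * clamp (dv y \<omega>) = 0"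
        using cell_root_strain(2)[OF slope_args(1)[OF l, of "(v y \<omega>, dv y \<omega>)"] slope_args(2)[of m l c "(v y \<omega>, dv y \<omega>)", OF l] cm(2)]
          elim(1) unfolding strain_gap_def slope_def by simp
      then show "dv y \<omega> = 0" using cm elim(2) by (simp add: clamp_eq dv_def)
    qed
  qed
qed

text \<open>At distance \<kappa> above the flat level the root is Lipschitz in the level with a
  constant independent of the path, so the bound passes to the mean.\<close>

lemma Pe_lipschitz:
  assumes \<kappa>: "\<kappa> > 0"
  shows "\<exists>K. \<forall>l l'. lam m + \<kappa> \<le> l \<longrightarrow> l \<le> U \<longrightarrow> lam m + \<kappa> \<le> l' \<longrightarrow> l' \<le> U \<longrightarrow> \<bar>Pe c m l - Pe c m l'\<bar> \<le> K * \<bar>l - l'\<bar>"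
proof -
  define S where "S = max (\<bar>m\<bar> + (U - lam m)) (\<bar>U\<bar> + \<bar>m\<bar> * B)"
  define K where "K = 2 * (S + 2 * (\<bar>c * m\<bar> * B)) / \<kappa>"
  have pt: "\<bar>slope c m l x - slope c m l' x\<bar> \<le> K * \<bar>l - l'\<bar>"
    if l: "lam m + \<kappa> \<le> l" "l \<le> U" "lam m + \<kappa> \<le> l'" "l' \<le> U" for l l' x
  proof -
    define s where "s l = max (\<bar>m\<bar> + (l - lam m)) (l - m * clamp (fst x))" for l
    have sS: "s l \<le> S" if "l \<le> U" for l
      unfolding s_def S_def using that mult_clamp_bounded[of m "fst x"] by (intro max.mono) auto
    have sl: "\<bar>m\<bar> + \<kappa> \<le> s l" if "lam m + \<kappa> \<le> l" for l unfolding s_def using that by auto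
    let ?b = "c * m * clamp (snd x)"
    have "\<bar>cell_root m ?b (s l) - cell_root m ?b (s l')\<bar> \<le> K * (\<bar>s l - s l'\<bar> + \<bar>?b - ?b\<bar>)"
      unfolding K_def by (rule cell_root_lipschitz[OF \<kappa>]) (use l in \<open>auto simp: sS sl mult_clamp_bounded\<close>)
    also have "\<dots> = K * \<bar>l - l'\<bar>"
    proof -
      have "\<bar>s l - s l'\<bar> = \<bar>l - l'\<bar>" unfolding s_def by (auto simp: max_def)
      then show ?thesis by simp
    qed
    finally show ?thesis unfolding slope_def s_def .
  qed
  have "\<bar>Pe c m l - Pe c m l'\<bar> \<le> K * \<bar>l - l'\<bar>"
    if l: "lam m + \<kappa> \<le> l" "l \<le> U" "lam m + \<kappa> \<le> l'" "l' \<le> U" for l l'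
  proof -
    have i: "integrable M (\<lambda>\<omega>. slope c m l (v 0 \<omega>, dv 0 \<omega>))" "integrable M (\<lambda>\<omega>. slope c m l' (v 0 \<omega>, dv 0 \<omega>))"
      using l \<kappa> by (auto intro!: slope_integrable)
    have eq: "Pe c m l - Pe c m l' = expectation (\<lambda>\<omega>. slope c m l (v 0 \<omega>, dv 0 \<omega>) - slope c m l' (v 0 \<omega>, dv 0 \<omega>))"
      using i by (simp add: Pe_def)
    have "\<bar>Pe c m l - Pe c m l'\<bar> \<le> expectation (\<lambda>\<omega>. \<bar>slope c m l (v 0 \<omega>, dv 0 \<omega>) - slope c m l' (v 0 \<omega>, dv 0 \<omega>)\<bar>)"
      unfolding eq by (rule integral_abs_bound)
    also have "\<dots> \<le> expectation (\<lambda>\<omega>. K * \<bar>l - l'\<bar>)"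
    proof (rule integral_mono)
      show "integrable M (\<lambda>\<omega>. \<bar>slope c m l (v 0 \<omega>, dv 0 \<omega>) - slope c m l' (v 0 \<omega>, dv 0 \<omega>)\<bar>)"
        by (intro integrable_abs Bochner_Integration.integrable_diff i)
    qed (simp, rule pt[OF l])
    finally show ?thesis by (simp add: prob_space)
  qed
  then show ?thesis by (intro exI[of _ K]) blast
qed

lemma Pe_continuous:
  assumes l: "lam m < l"
  shows "(Pe c m \<longlongrightarrow> Pe c m l) (at l)"
proof -
  define \<kappa> where "\<kappa> = (l - lam m) / 2"
  have \<kappa>: "\<kappa> > 0" using l by (simp add: \<kappa>_def)
  obtain K where K: "\<And>l1 l2. lam m + \<kappa> \<le> l1 \<Longrightarrow> l1 \<le> l + 1 \<Longrightarrow> lam m + \<kappa> \<le> l2 \<Longrightarrow> l2 \<le> l + 1 \<Longrightarrow>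
      \<bar>Pe c m l1 - Pe c m l2\<bar> \<le> K * \<bar>l1 - l2\<bar>"
    using Pe_lipschitz[OF \<kappa>, of m "l + 1" c] by blast
  have "\<forall>\<^sub>F l1 in at l. l1 \<in> {lam m + \<kappa><..<l + 1}"
    using \<kappa> by (intro eventually_at_in_open') (auto simp: \<kappa>_def field_simps)
  then have ev: "\<forall>\<^sub>F l1 in at l. norm (Pe c m l1 - Pe c m l) \<le> K * \<bar>l1 - l\<bar>"
  proof eventually_elim
    case (elim l1)
    have "lam m + \<kappa> \<le> l" using l by (simp add: \<kappa>_def field_simps)
    then show ?case using K[of l1 l] elim by simp
  qed
  have "((\<lambda>l1. K * \<bar>l1 - l\<bar>) \<longlongrightarrow> K * \<bar>l - l\<bar>) (at l)" by (intro tendsto_intros)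
  then have "((\<lambda>l1. K * \<bar>l1 - l\<bar>) \<longlongrightarrow> 0) (at l)" by simp
  from Lim_null_comparison[OF ev this] show ?thesis by (simp add: LIM_zero_iff)
qed

text \<open>Strain raises the mean of the positive root for c and for -c, so it widens the interval
  between the two means, enlarges the set of levels and lowers the infimum.\<close>

lemma hb_strain_le: "hb c m n \<le> hb 0 m n"
  unfolding hb_def
proof (rule cInf_superset_mono[OF levels_nonempty levels_bdd_below])
  show "levels 0 m n \<subseteq> levels c m n"
  proof
    fix l assume l: "l \<in> levels 0 m n"
    then have "lam m < l" by (simp add: levels_def)
    from Pe_strain[OF this, of c] Pe_strain[OF this, of "- c"] l
    show "l \<in> levels c m n" by (auto simp: levels_def)
  qed
qed

text \<open>Just below \<open>hb\<close> the slope n lies outside the interval of means. Since this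
  interval contains 0, the sign of n tells on which side, and continuity carries the inequality to
  the level itself. Together with \<open>hb_upper\<close> it gives equality: off the flat part the
  mean root inverts the effective Hamiltonian.\<close>

lemma hb_gt_lam:
  assumes gt: "lam m < hb c m n"
  shows "n \<noteq> 0" "n > 0 \<Longrightarrow> Pe c m (hb c m n) \<le> n" "n < 0 \<Longrightarrow> Pe (- c) m (hb c m n) \<le> - n"
proof -
  have out: "n < - Pe (- c) m l \<or> Pe c m l < n" if "lam m < l" "l < hb c m n" for l
    using below_hb[OF that(2)] that(1) by (auto simp: levels_def)
  have nonneg: "0 \<le> Pe c m l" "0 \<le> Pe (- c) m l" if "lam m < l" for l
    using that by (auto intro: Pe_nonneg)
  have ev: "\<forall>\<^sub>F l in at_left (hb c m n). l \<in> {lam m<..<hb c m n}"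
    using gt by (rule eventually_at_left_real)
  have lim: "(Pe k m \<longlongrightarrow> Pe k m (hb c m n)) (at_left (hb c m n))" for k
    using Pe_continuous[OF gt, of k] by (rule tendsto_within_subset) auto
  show "n \<noteq> 0" using out[of "(lam m + hb c m n) / 2"] nonneg[of "(lam m + hb c m n) / 2"] gt by auto
  show "Pe c m (hb c m n) \<le> n" if "n > 0"
  proof (rule tendsto_upperbound[OF lim])
    show "\<forall>\<^sub>F l in at_left (hb c m n). Pe c m l \<le> n" using ev
    proof eventually_elim
      case (elim l) then show ?case using out[of l] nonneg(2)[of l] that by auto
    qed
  qed simp
  show "Pe (- c) m (hb c m n) \<le> - n" if "n < 0"
  proof (rule tendsto_upperbound[OF lim])
    show "\<forall>\<^sub>F l in at_left (hb c m n). Pe (- c) m l \<le> - n" using ev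
    proof eventually_elim
      case (elim l) then show ?case using out[of l] nonneg(1)[of l] that by auto
    qed
  qed simp
qed

lemma hb_upper:
  assumes gt: "lam m < hb c m n"
  shows "n \<le> Pe c m (hb c m n)" "- n \<le> Pe (- c) m (hb c m n)"
proof -
  have lim: "(Pe k m \<longlongrightarrow> Pe k m (hb c m n)) (at_right (hb c m n))" for k
    using Pe_continuous[OF gt, of k] by (rule tendsto_within_subset) auto
  have "\<forall>\<^sub>F l in at_right (hb c m n). hb c m n < l" by (rule eventually_at_right_less)
  then have ev: "\<forall>\<^sub>F l in at_right (hb c m n). n \<le> Pe c m l \<and> - n \<le> Pe (- c) m l"
  proof eventually_elim
    case (elim l) then show ?case using above_hb[of c m n l] by (auto simp: levels_def)
  qed
  show "n \<le> Pe c m (hb c m n)"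
    by (rule tendsto_lowerbound[OF lim]) (use ev in \<open>auto elim: eventually_mono\<close>)
  show "- n \<le> Pe (- c) m (hb c m n)"
    by (rule tendsto_lowerbound[OF lim]) (use ev in \<open>auto elim: eventually_mono\<close>)
qed

text \<open>At the common level the mean roots with and without strain both equal |n|, so v' = 0
  along almost every path; the sign of n decides whether c or -c is used. A constant path equals its
  own mean, which is 0.\<close>

lemma hb_strain_eq:
  assumes gt: "lam m < hb 0 m n" and eq: "hb 0 m n = hb c m n" and c: "c \<noteq> 0"
    and mean: "expectation (v 0) = 0"
  shows "AE \<omega> in M. \<forall>y. m * v y \<omega> = 0"
proof (cases "m = 0")
  case False
  define l where "l = hb 0 m n"
  have l: "lam m < l" using gt by (simp add: l_def)
  have gtc: "lam m < hb c m n" using gt eq by simp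
  have "AE \<omega> in M. \<forall>y. dv y \<omega> = 0"
  proof (cases "n > 0")
    case True
    have "Pe c m l \<le> Pe 0 m l"
      using hb_gt_lam(2)[OF gtc True] hb_upper(1)[OF gt] eq unfolding l_def by simp
    then show ?thesis using c False by (intro Pe_strain_eq[OF l])
  next
    case False
    then have n: "n < 0" using hb_gt_lam(1)[OF gtc] by simp
    have "Pe (- c) m l \<le> Pe 0 m l"
      using hb_gt_lam(3)[OF gtc n] hb_upper(2)[OF gt] eq unfolding l_def by simp
    then show ?thesis using c \<open>m \<noteq> 0\<close> by (intro Pe_strain_eq[OF l, of "- c"]) auto
  qed
  then show ?thesis
    using pathwise_mean_functional[OF clamp_id_continuous(2) clamp_bounded] v_bounded AE_space
  proof eventually_elim
    case (elim \<omega>)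
    have "expectation (\<lambda>\<omega>. clamp (v 0 \<omega>)) = expectation (v 0)"
    proof (rule integral_cong_AE)
      show "AE \<omega> in M. clamp (v 0 \<omega>) = v 0 \<omega>" using v_bounded by eventually_elim (simp add: clamp_eq)
      show "(\<lambda>\<omega>. clamp (v 0 \<omega>)) \<in> borel_measurable M" unfolding clamp_def by measurable
    qed simp
    then have "has_mean (\<lambda>y. v y \<omega>) 0" using elim(2,3) mean by (simp add: clamp_eq)
    have "\<forall>x. DERIV (\<lambda>y. v y \<omega>) x :> 0" using v_derivative[OF elim(4)] elim(1) by metis
    then have const: "v y \<omega> = v 0 \<omega>" for y using DERIV_isconst_all by blast
    have "has_mean (\<lambda>y. v 0 \<omega>) (v 0 \<omega>)"
      unfolding has_mean_def
    proof (intro exI[of _ "\<lambda>y. v 0 \<omega> * y"] conjI allI impI)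
      show "((\<lambda>y. v 0 \<omega> * y) has_real_derivative v 0 \<omega>) (at y)" for y by (auto intro!: derivative_eq_intros)
      show "\<exists>D. \<forall>y. \<bar>v 0 \<omega> * y - v 0 \<omega> * y\<bar> \<le> \<kappa> * \<bar>y\<bar> + D" if "\<kappa> > 0" for \<kappa> :: real
        using that by (intro exI[of _ 0]) simp
    qed
    moreover have "(\<lambda>y. v y \<omega>) = (\<lambda>y. v 0 \<omega>)" using const by blast
    ultimately have "v 0 \<omega> = 0" using \<open>has_mean (\<lambda>y. v y \<omega>) 0\<close> has_mean_unique by metis
    then show ?case using const by simp
  qed
qed simp

text \<open>If m v vanishes, so does m v'; the roots for c, -c and 0 then coincide almost surely,
  and with them the sets of levels.\<close>

lemma hb_no_shear:
  assumes "AE \<omega> in M. \<forall>y. m * v y \<omega> = 0"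
  shows "hb 0 m n = hb c m n"
proof -
  have "AE \<omega> in M. m * clamp (dv 0 \<omega>) = 0"
    using assms AE_space dv_bounded
  proof eventually_elim
    case (elim \<omega>)
    have "((\<lambda>y. m * v y \<omega>) has_real_derivative m * dv 0 \<omega>) (at 0)"
      by (rule DERIV_cmult[OF v_derivative[OF elim(2)]])
    then have "((\<lambda>y. 0) has_real_derivative m * dv 0 \<omega>) (at 0)" using elim(1) by simp
    then have "m * dv 0 \<omega> = 0" using DERIV_const DERIV_unique by blast
    then show ?case using elim(3) by (simp add: clamp_eq dv_def)
  qed
  then have Pe0: "Pe k m l = Pe 0 m l" if "lam m < l" for k l
    unfolding Pe_def
  proof (intro integral_cong_AE)
    show "(\<lambda>\<omega>. slope k m l (v 0 \<omega>, dv 0 \<omega>)) \<in> borel_measurable M" for k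
      using slope_integrable[OF that] by (rule borel_measurable_integrable)
    then show "(\<lambda>\<omega>. slope 0 m l (v 0 \<omega>, dv 0 \<omega>)) \<in> borel_measurable M" .
    assume "AE \<omega> in M. m * clamp (dv 0 \<omega>) = 0"
    then show "AE \<omega> in M. slope k m l (v 0 \<omega>, dv 0 \<omega>) = slope 0 m l (v 0 \<omega>, dv 0 \<omega>)"
      by eventually_elim (auto simp: slope_def)
  qed
  have "levels c m n = levels 0 m n"
    unfolding levels_def
  proof (rule Collect_cong)
    fix l
    show "lam m < l \<and> - Pe (- c) m l \<le> n \<and> n \<le> Pe c m l \<longleftrightarrow> lam m < l \<and> - Pe (- 0) m l \<le> n \<and> n \<le> Pe 0 m l"
      using Pe0[of l c] Pe0[of l "- c"] by (cases "lam m < l") simp_all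
  qed
  then show ?thesis by (simp add: hb_def)
qed

end

text \<open>Every effective Hamiltonian coincides with \<open>Hb\<close>, so the claims about
  arbitrary \<open>H0\<close> and \<open>Hc\<close> become claims about \<open>hb\<close>.\<close>

theorem theorem1p2:
  fixes M :: "'w measure"
    and \<tau> :: "real \<Rightarrow> 'w \<Rightarrow> 'w"
    and v :: "real \<Rightarrow> 'w \<Rightarrow> real"
  assumes "prob_space M"
    and "ergodic_group M \<tau>"
    and "stationary_field M \<tau> v"
    and "\<forall>\<omega>\<in>space M. C_infinity (\<lambda>y. v y \<omega>)"
    and "Linfty_field M v"
    and "Linfty_field M (\<lambda>y \<omega>. deriv (\<lambda>s. v s \<omega>) y)"
  shows "(\<forall>c\<ge>0. \<exists>Hbar. effective_hamiltonian M v c Hbar) \<and>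
    (\<forall>H0 Hc c p.
       effective_hamiltonian M v 0 H0 \<and> effective_hamiltonian M v c Hc \<and> c > 0 \<and> norm p = 1 \<longrightarrow>
         H0 p \<ge> Hc p \<and>
         ereal (Hc p) \<ge> ereal \<bar>p $ 1\<bar> + sup_field M (\<lambda>y \<omega>. p $ 1 * v y \<omega>)) \<and>
    (\<forall>H0 Hc c p.
       effective_hamiltonian M v 0 H0 \<and> effective_hamiltonian M v c Hc \<and> c > 0 \<and> norm p = 1 \<and>
       ereal (H0 p) > ereal \<bar>p $ 1\<bar> + sup_field M (\<lambda>y \<omega>. p $ 1 * v y \<omega>) \<and>
       (\<forall>y. prob_space.expectation M (v y) = 0) \<longrightarrow>
         (H0 p = Hc p \<longleftrightarrow> (AE \<omega> in M. \<forall>y. p $ 1 * v y \<omega> = 0)))"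
proof -
  obtain B1 where B1: "AE \<omega> in M. \<forall>y. \<bar>v y \<omega>\<bar> \<le> B1" using assms(5) unfolding Linfty_field_def by blast
  obtain B2 where B2: "AE \<omega> in M. \<forall>y. \<bar>deriv (\<lambda>s. v s \<omega>) y\<bar> \<le> B2" using assms(6) unfolding Linfty_field_def by blast
  interpret prob_space M by fact
  interpret random_shear M \<tau> v "max B1 B2"
  proof
    show "AE \<omega> in M. \<forall>y. \<bar>v y \<omega>\<bar> \<le> max B1 B2" using B1 by eventually_elim (simp add: le_max_iff_disj)
    show "AE \<omega> in M. \<forall>y. \<bar>deriv (\<lambda>s. v s \<omega>) y\<bar> \<le> max B1 B2" using B2 by eventually_elim (simp add: le_max_iff_disj)
  qed (use assms in auto)
  \<comment> \<open>The extended real threshold of the statement is the real number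
    \<open>lam m\<close>.\<close>
  have sup: "ereal \<bar>m\<bar> + sup_field M (\<lambda>y \<omega>. m * v y \<omega>) = ereal (lam m)" for m
    by (simp add: msup(1) lam_def)
  show ?thesis
  proof (intro conjI allI impI)
    show "\<exists>Hbar. effective_hamiltonian M v c Hbar" for c using effective_hamiltonian_Hb by blast
  next
    fix H0 Hc c and p :: "real^2"
    assume *: "effective_hamiltonian M v 0 H0 \<and> effective_hamiltonian M v c Hc \<and> c > 0 \<and> norm p = 1"
    then have eq: "H0 p = Hb 0 p" "Hc p = Hb c p" using effective_hamiltonian_eq_Hb by blast+
    show "Hc p \<le> H0 p" unfolding eq Hb_def by (rule hb_strain_le)
    show "ereal \<bar>p $ 1\<bar> + sup_field M (\<lambda>y \<omega>. p $ 1 * v y \<omega>) \<le> ereal (Hc p)"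
      unfolding sup eq Hb_def using lam_le_hb by simp
  next
    fix H0 Hc c and p :: "real^2"
    assume *: "effective_hamiltonian M v 0 H0 \<and> effective_hamiltonian M v c Hc \<and> c > 0 \<and> norm p = 1 \<and>
       ereal (H0 p) > ereal \<bar>p $ 1\<bar> + sup_field M (\<lambda>y \<omega>. p $ 1 * v y \<omega>) \<and> (\<forall>y. expectation (v y) = 0)"
    then have eq: "H0 p = Hb 0 p" "Hc p = Hb c p" using effective_hamiltonian_eq_Hb by blast+
    have gt: "lam (p $ 1) < hb 0 (p $ 1) (p $ 2)" using * unfolding sup eq Hb_def by simp
    show "H0 p = Hc p \<longleftrightarrow> (AE \<omega> in M. \<forall>y. p $ 1 * v y \<omega> = 0)"
      unfolding eq Hb_def
    proof
      assume "hb 0 (p $ 1) (p $ 2) = hb c (p $ 1) (p $ 2)"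
      then show "AE \<omega> in M. \<forall>y. p $ 1 * v y \<omega> = 0"
        using * by (intro hb_strain_eq[OF gt]) auto
    qed (rule hb_no_shear)
  qed
qed

end
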